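(* Let $\rho\in L^1(\Omega)$ be a weight with grading $\gamma_\rho\ge1$, let $h\in L^1(\Omega)$ be a mesh size function with grading $\gamma_h$, and let $p\in[1,\infty]$. With $\gamma_{\max}$ the worst grading for $Q$, assume that $$\gamma_\rho\,\gamma_h^{1+d\left|\frac12-\frac1p\right|}<\gamma_{\max}.$$ Then there exists a constant $c<\infty$, depending only on $\gamma_\rho,\gamma_h,d,p,K$ and the shape-regularity parameter $\chi_0$ of $\mathcal{T}$ (as well as on the equivalence constants of the mesh size function $h$ and the constants $C(\cdot)$ in the definition of $\gamma_{\max}$), such that $$\|\rho\,\nabla Qu\|_p\le c\,\|\rho\,\nabla u\|_p\qquad\text{for all }u\in W^{1,p}(\Omega).$$
   Context: Let $d,K\in\mathbb{N}$ (both $\geq 1$), $\Omega\subset\mathbb{R}^d$ a bounded polyhedral (connected) domain, $\mathcal{T}$ a regular triangulation of $\Omega$ into closed simplices with shape-regularity parameter $\chi_0$ (the maximal ratio of the diameter of $T\in\mathcal{T}$ to its inradius), $\mathcal{L}^1_K(\mathcal{T})$ the space of continuous functions on $\Omega$ that are polynomials of degree at most $K$ on each $T\in\mathcal{T}$, and $Q$ the $L^2$-projection onto $\mathcal{L}^1_K(\mathcal{T})$, defined by $\langle Qu,v\rangle=\langle u,v\rangle$ for all $v\in\mathcal{L}^1_K(\mathcal{T})$, where $\langle\cdot,\cdot\rangle$ is the $L^2(\Omega)$ pairing; it extends to $u\in L^1(\Omega)$ by the same formula. $\|\cdot\|_p$ is the norm of $L^p(\Omega)$. Distance $\delta$: there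 is a fixed symmetric neighbor relation on distinct simplices of $\mathcal{T}$ such that neighbors $T,T'$ satisfy $T\cap T'\ne\emptyset$, and such that any two simplices can be joined by a chain of consecutive neighbors; $\delta(T,T')$ is the smallest $N\in\mathbb{N}_0$ such that there are $T_0=T,\dots,T_N=T'$ in $\mathcal{T}$ with $T_{j-1},T_j$ neighbors for $j=1,\dots,N$. A positive function $\rho\in L^1(\Omega)$ is a weight with grading $\gamma_\rho\ge1$ (with respect to $\delta$) if for all $T,T'\in\mathcal{T}$: $\operatorname{ess\,sup}_T\rho\le\gamma_\rho\operatorname{ess\,inf}_T\rho$; and if $\delta(T,T')=1$, then $\operatorname{ess\,sup}_{T'}\rho\le\gamma_\rho\operatorname{ess\,sup}_T\rho$ and $\operatorname{ess\,inf}_{T'}\rho\le\gamma_\rho\operatorname{ess\,inf}_T\rho$. A mesh size function is a positive weight $h\in L^1(\Omega)$ such that $\operatorname{ess\,inf}_Th\eqsim\operatorname{diam}(T)\eqsim\operatorname{ess\,sup}_Th$ for all $T\in\mathcal{T}$ with equivalence constants independent of $T$. The worst grading $\gamma_{\max}$ (for $Q$) is the number such that for all weights $\rho\in L^1(\Omega)$ with grading $\gamma_\rho<\gamma_{\max}$ there is a constant $C(\gamma_\rho)<\infty$, depending on $\rho$ only through $\gamma_\rho$, with $\|\rho Qu\|_2\le C(\gamma_\rho)\|\rho u\|_2$ for all $u\in L^2(\Omega)$. *)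

theory Defs
  imports "HOL-Analysis.Analysis" "HOL-Probability.Essential_Supremum"
begin

section \<open>Lebesgue and Sobolev spaces on an open set\<close>

text \<open>For \<open>p < \<infinity>\<close> the norm is the \<open>p\<close>-th root of the integral of \<open>|f|\<^sup>p\<close>, and it is infinite
  if this integral is; \<open>enn2real\<close> alone would send infinity to \<open>0\<close>.\<close>

definition Lp_norm :: "'a::euclidean_space set \<Rightarrow> ennreal \<Rightarrow> ('a \<Rightarrow> 'b::real_normed_vector) \<Rightarrow> ennreal" where
  "Lp_norm \<Omega> p f =
     (if p = \<infinity> then esssup (lebesgue_on \<Omega>) (\<lambda>x. ennreal (norm (f x)))
      else let I = (\<integral>\<^sup>+ x. ennreal (norm (f x) powr enn2real p) \<partial>lebesgue_on \<Omega>)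
           in if I = \<infinity> then \<infinity> else ennreal (enn2real I powr (1 / enn2real p)))"

definition Lp_space :: "'a::euclidean_space set \<Rightarrow> ennreal \<Rightarrow> ('a \<Rightarrow> 'b::real_normed_vector) set" where
  "Lp_space \<Omega> p = {f. f \<in> borel_measurable (lebesgue_on \<Omega>) \<and> Lp_norm \<Omega> p f < \<infinity>}"

primrec Ck :: "nat \<Rightarrow> ('a::euclidean_space \<Rightarrow> real) \<Rightarrow> bool" where
  "Ck 0 f \<longleftrightarrow> continuous_on UNIV f"
| "Ck (Suc k) f \<longleftrightarrow> (\<forall>x. f differentiable (at x)) \<and>
     (\<forall>b\<in>Basis. Ck k (\<lambda>x. frechet_derivative f (at x) b))"

definition test_function :: "'a::euclidean_space set \<Rightarrow> ('a \<Rightarrow> real) \<Rightarrow> bool" where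
  "test_function \<Omega> \<phi> \<longleftrightarrow> (\<forall>k. Ck k \<phi>) \<and> (\<exists>S. compact S \<and> S \<subseteq> \<Omega> \<and> (\<forall>x. x \<notin> S \<longrightarrow> \<phi> x = 0))"

definition locally_integrable :: "'a::euclidean_space set \<Rightarrow> ('a \<Rightarrow> 'b::euclidean_space) \<Rightarrow> bool" where
  "locally_integrable \<Omega> f \<longleftrightarrow> (\<forall>S. compact S \<and> S \<subseteq> \<Omega> \<longrightarrow> integrable (lebesgue_on S) f)"

definition is_weak_gradient :: "'a::euclidean_space set \<Rightarrow> ('a \<Rightarrow> real) \<Rightarrow> ('a \<Rightarrow> 'a) \<Rightarrow> bool" where
  "is_weak_gradient \<Omega> u g \<longleftrightarrow> locally_integrable \<Omega> u \<and> locally_integrable \<Omega> g \<and>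
     (\<forall>\<phi>. test_function \<Omega> \<phi> \<longrightarrow> (\<forall>b\<in>Basis.
        (\<integral>x. u x * frechet_derivative \<phi> (at x) b \<partial>lebesgue_on \<Omega>) =
        - (\<integral>x. (g x \<bullet> b) * \<phi> x \<partial>lebesgue_on \<Omega>)))"

text \<open>Weak gradients on an open set are unique up to null sets, so the choice does not affect
  any norm.\<close>

definition weak_gradient :: "'a::euclidean_space set \<Rightarrow> ('a \<Rightarrow> real) \<Rightarrow> 'a \<Rightarrow> 'a" where
  "weak_gradient \<Omega> u = (SOME g. is_weak_gradient \<Omega> u g)"

definition W1p :: "'a::euclidean_space set \<Rightarrow> ennreal \<Rightarrow> ('a \<Rightarrow> real) set" where
  "W1p \<Omega> p = {u. u \<in> Lp_space \<Omega> p \<and> (\<exists>g \<in> Lp_space \<Omega> p. is_weak_gradient \<Omega> u g)}"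


section \<open>Polyhedral domains and triangulations\<close>

definition polyhedral_domain :: "'a::euclidean_space set \<Rightarrow> bool" where
  "polyhedral_domain \<Omega> \<longleftrightarrow> open \<Omega> \<and> connected \<Omega> \<and> bounded \<Omega> \<and> \<Omega> \<noteq> {} \<and>
     (\<exists>\<P>. finite \<P> \<and> (\<forall>P\<in>\<P>. polytope P) \<and> frontier \<Omega> = \<Union>\<P>)"

text \<open>The library's \<open>triangulation\<close> is a finite, face-to-face family of simplices of arbitrary
  dimensions. The last condition says that the mesh resolves the boundary. It follows from
  the other ones if \<open>\<Omega>\<close> is the interior of its closure; otherwise (slits) it prevents \<open>\<partial>\<Omega>\<close> from
  cutting through a simplex or through a part of a face.\<close>

definition triangulation_of :: "'a::euclidean_space set set \<Rightarrow> 'a set \<Rightarrow> bool" where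
  "triangulation_of \<T> \<Omega> \<longleftrightarrow> triangulation \<T> \<and> (\<forall>T\<in>\<T>. int DIM('a) simplex T) \<and>
     \<Union>\<T> = closure \<Omega> \<and>
     (\<exists>\<F>. (\<forall>F\<in>\<F>. \<exists>T\<in>\<T>. F face_of T) \<and> frontier \<Omega> = \<Union>\<F>)"

definition inradius :: "'a::euclidean_space set \<Rightarrow> real" where
  "inradius T = Sup {r. 0 \<le> r \<and> (\<exists>x. cball x r \<subseteq> T)}"

definition shape_regularity :: "'a::euclidean_space set set \<Rightarrow> real" where
  "shape_regularity \<T> = Max ((\<lambda>T. diameter T / inradius T) ` \<T>)"

definition neighbor_relation :: "'a set set \<Rightarrow> ('a set \<times> 'a set) set \<Rightarrow> bool" where
  "neighbor_relation \<T> R \<longleftrightarrow> R \<subseteq> \<T> \<times> \<T> \<and> sym R \<and>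
     (\<forall>(T, T')\<in>R. T \<noteq> T' \<and> T \<inter> T' \<noteq> {}) \<and> (\<forall>T\<in>\<T>. \<forall>T'\<in>\<T>. (T, T') \<in> R\<^sup>*)"

definition mesh_dist :: "('a set \<times> 'a set) set \<Rightarrow> 'a set \<Rightarrow> 'a set \<Rightarrow> nat" where
  "mesh_dist R T T' = (LEAST N. (T, T') \<in> R ^^ N)"


section \<open>Lagrange finite elements and the \<open>L\<^sup>2\<close>-projection\<close>

definition poly_deg_le :: "nat \<Rightarrow> ('a::euclidean_space \<Rightarrow> real) \<Rightarrow> bool" where
  "poly_deg_le K f \<longleftrightarrow> (\<exists>(A :: ('a \<Rightarrow> nat) set) a. finite A \<and> (\<forall>\<alpha>\<in>A. (\<Sum>b\<in>Basis. \<alpha> b) \<le> K) \<and>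
     (\<forall>x. f x = (\<Sum>\<alpha>\<in>A. a \<alpha> * (\<Prod>b\<in>Basis. (x \<bullet> b) ^ \<alpha> b))))"

text \<open>Elements are functions on the whole space, of which only the values on \<open>\<Omega>\<close> matter.\<close>

definition lagrange_space :: "'a::euclidean_space set \<Rightarrow> 'a set set \<Rightarrow> nat \<Rightarrow> ('a \<Rightarrow> real) set" where
  "lagrange_space \<Omega> \<T> K = {v. continuous_on \<Omega> v \<and>
     (\<forall>T\<in>\<T>. \<exists>q. poly_deg_le K q \<and> (\<forall>x \<in> \<Omega> \<inter> T. v x = q x))}"

text \<open>For integrable \<open>u\<close> the defining property determines \<open>Q u\<close> uniquely on \<open>\<Omega>\<close>; the choice only
  concerns the values outside \<open>\<Omega>\<close>.\<close>

definition L2_projection ::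
    "'a::euclidean_space set \<Rightarrow> 'a set set \<Rightarrow> nat \<Rightarrow> ('a \<Rightarrow> real) \<Rightarrow> 'a \<Rightarrow> real" where
  "L2_projection \<Omega> \<T> K u = (SOME w. w \<in> lagrange_space \<Omega> \<T> K \<and>
     (\<forall>v \<in> lagrange_space \<Omega> \<T> K.
        (\<integral>x. w x * v x \<partial>lebesgue_on \<Omega>) = (\<integral>x. u x * v x \<partial>lebesgue_on \<Omega>)))"


section \<open>Weights, mesh size functions and the worst grading\<close>

text \<open>The simplices are closed, while functions live on \<open>\<Omega>\<close>; \<open>T\<close> and \<open>\<Omega> \<inter> T\<close> differ by a null set.\<close>

definition ess_sup_on :: "'a::euclidean_space set \<Rightarrow> 'a set \<Rightarrow> ('a \<Rightarrow> real) \<Rightarrow> ereal" where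
  "ess_sup_on \<Omega> T f = esssup (lebesgue_on (\<Omega> \<inter> T)) (\<lambda>x. ereal (f x))"

definition ess_inf_on :: "'a::euclidean_space set \<Rightarrow> 'a set \<Rightarrow> ('a \<Rightarrow> real) \<Rightarrow> ereal" where
  "ess_inf_on \<Omega> T f = - esssup (lebesgue_on (\<Omega> \<inter> T)) (\<lambda>x. - ereal (f x))"

definition weight_with_grading ::
    "'a::euclidean_space set \<Rightarrow> 'a set set \<Rightarrow> ('a set \<times> 'a set) set \<Rightarrow> real \<Rightarrow> ('a \<Rightarrow> real) \<Rightarrow> bool" where
  "weight_with_grading \<Omega> \<T> R \<gamma> \<rho> \<longleftrightarrow>
     1 \<le> \<gamma> \<and> integrable (lebesgue_on \<Omega>) \<rho> \<and> (AE x in lebesgue_on \<Omega>. 0 < \<rho> x) \<and>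
     (\<forall>T\<in>\<T>. ess_sup_on \<Omega> T \<rho> \<le> ereal \<gamma> * ess_inf_on \<Omega> T \<rho>) \<and>
     (\<forall>T\<in>\<T>. \<forall>T'\<in>\<T>. mesh_dist R T T' = 1 \<longrightarrow>
        ess_sup_on \<Omega> T' \<rho> \<le> ereal \<gamma> * ess_sup_on \<Omega> T \<rho> \<and>
        ess_inf_on \<Omega> T' \<rho> \<le> ereal \<gamma> * ess_inf_on \<Omega> T \<rho>)"

text \<open>\<open>c\<^sub>1\<close> and \<open>c\<^sub>2\<close> are the equivalence constants of the mesh size function.\<close>

definition mesh_size_function ::
    "'a::euclidean_space set \<Rightarrow> 'a set set \<Rightarrow> ('a set \<times> 'a set) set \<Rightarrow> real \<Rightarrow> real \<Rightarrow> real \<Rightarrow>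
     ('a \<Rightarrow> real) \<Rightarrow> bool" where
  "mesh_size_function \<Omega> \<T> R c\<^sub>1 c\<^sub>2 \<gamma> h \<longleftrightarrow> weight_with_grading \<Omega> \<T> R \<gamma> h \<and>
     (\<forall>T\<in>\<T>. ereal (c\<^sub>1 * diameter T) \<le> ess_inf_on \<Omega> T h \<and>
             ess_inf_on \<Omega> T h \<le> ereal (c\<^sub>2 * diameter T) \<and>
             ereal (c\<^sub>1 * diameter T) \<le> ess_sup_on \<Omega> T h \<and>
             ess_sup_on \<Omega> T h \<le> ereal (c\<^sub>2 * diameter T))"

text \<open>The defining property of \<open>\<gamma>\<^sub>m\<^sub>a\<^sub>x\<close>, with \<open>C(\<cdot>)\<close> made explicit so that other constants can depend on it.
  Only the values of \<open>C\<close> on \<open>[1, \<gamma>\<^sub>m\<^sub>a\<^sub>x)\<close> matter. Maximality is not part of the property;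
  the value infinity is allowed.\<close>

definition worst_grading ::
    "'a::euclidean_space set \<Rightarrow> 'a set set \<Rightarrow> ('a set \<times> 'a set) set \<Rightarrow> nat \<Rightarrow> ereal \<Rightarrow>
     (real \<Rightarrow> real) \<Rightarrow> bool" where
  "worst_grading \<Omega> \<T> R K \<gamma>max C \<longleftrightarrow>
     (\<forall>\<gamma> \<rho>. ereal \<gamma> < \<gamma>max \<and> weight_with_grading \<Omega> \<T> R \<gamma> \<rho> \<longrightarrow>
        (\<forall>u \<in> Lp_space \<Omega> 2.
           Lp_norm \<Omega> 2 (\<lambda>x. \<rho> x * L2_projection \<Omega> \<T> K u x) \<le>
           ennreal (C \<gamma>) * Lp_norm \<Omega> 2 (\<lambda>x. \<rho> x * u x)))"

end

theory Submission
 imports Defs "HOL-Real_Asymp.Real_Asymp"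
begin

text \<open>The \<open>L\<^sup>2\<close> bound for graded weights yields \<open>\<ell>\<^sup>p\<close> bounds over the simplices: multiplying a weight
by suitable factors \<open>\<kappa>\<close> to the power \<open>dist(T, T')\<close> keeps it graded, and the volumes of the simplices, weighted by
these factors, are summable by the grading of \<open>h\<close>. This is applied to \<open>\<rho> / h\<close> and to \<open>Q\<close> of the remainder \<open>u - \<pi> u\<close>, where
\<open>\<pi> u\<close> interpolates averages of \<open>u\<close> at the vertices and the remainder may be replaced by its piecewise \<open>L\<^sup>2\<close> projection,
which a Poincare inequality bounds by \<open>\<nabla>u\<close> on patches. The inverse inequality then gives the gradient. Neighbors need not
include all intersecting simplices. That graded weights are nevertheless comparable on them follows from the \<open>L\<^sup>2\<close> bound,
applied to a function supported on \<open>T\<close> whose projection is \<open>1\<close> on \<open>T\<close>.\<close>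

text \<open>Origin of the exponent: dividing by \<open>h\<close> turns \<open>\<rho>\<close> into a
  weight of grading \<open>\<gamma> = \<gamma>\<^sub>\<rho> * \<gamma>\<^sub>h\<close>. A number
  \<open>\<gamma>'\<close> between \<open>\<gamma>\<close> and \<open>\<gamma>max\<close> leaves
  room for factors \<open>\<kappa>\<close> to the power of the distance with
  \<open>\<kappa> = (\<gamma> / \<gamma>')^2\<close>, squared because weights enter L2 sums squared.
  The simplices at distance N have volume at most polynomial in N times
  \<open>\<gamma>\<^sub>h ^ (d N)\<close>, and Young's inequality between 2 and p replaces
  \<open>\<kappa>\<close> by \<open>\<kappa> powr r\<close> with \<open>r = p / |p - 2|\<close>.
  Convergence needs \<open>\<kappa> powr r * \<gamma>\<^sub>h ^ d < 1\<close>, which is the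
  hypothesis because \<open>2 r |1/2 - 1/p| = 1\<close>. Two obstacles shape the rest. For p < 2 the
  remainder \<open>u - \<pi> u\<close> need not be square integrable, so only its moments against
  polynomials are estimated, by the L1 norm of the gradient. And \<open>Om\<close> may lie on both
  sides of its boundary, so one vertex can carry several independent values; adjacency and patches
  are therefore taken through points of \<open>Om\<close>. All constants are explicit, since they
  must be fixed before the mesh.\<close>

abbreviation ind :: "'a set => 'a => 'b::zero_neq_one" where "ind == indicator"

abbreviation vol :: "'a::euclidean_space set => real" where "vol == measure lborel"

section \<open>Smooth functions, bump functions and cutoffs\<close>

text \<open>The powers of \<open>inverse t\<close> are carried along because differentiating
  \<open>exp (- inverse t)\<close> produces them: each derivative is a combination of
  \<open>flat_exp (n + 2)\<close> and \<open>flat_exp (n + 1)\<close>.\<close>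

definition flat_exp :: "nat => real => real" where "flat_exp n t = (if t > 0 then exp (- inverse t) * inverse t ^ n else 0)"

lemma flat_exp_nonneg: "0 <= flat_exp n t" by (simp add: flat_exp_def)

lemma flat_exp_eq_0: "t <= 0 ==> flat_exp n t = 0" by (simp add: flat_exp_def)

lemma flat_exp_0_le_1: "flat_exp 0 t <= 1" by (simp add: flat_exp_def)

lemma flat_exp_has_derivative: "(flat_exp n has_real_derivative (flat_exp (n + 2) t - real n * flat_exp (n + 1) t)) (at t)"
proof -
 consider "t > 0" | "t < 0" | "t = 0" by linarith
 thus ?thesis
 proof cases
  case 1
  have "((%t. exp (- inverse t) * inverse t ^ n) has_real_derivative (flat_exp (n + 2) t - real n * flat_exp (n + 1) t)) (at t)"
   using 1 by (auto intro!: derivative_eq_intros simp: flat_exp_def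
      simp flip: power_add) (cases n; simp add: algebra_simps)
  thus ?thesis by (rule has_field_derivative_transform_within_open[of _ _ _ "{0<..}"]) (use 1 in \<open>auto simp: flat_exp_def\<close>)
 next
  case 2
  have "(flat_exp n has_real_derivative 0) (at t)" by (rule has_field_derivative_transform_within_open[of _ _ _ "{..<0}"])
    (use 2 in \<open>auto simp: flat_exp_def\<close>)
  with 2 show ?thesis by (simp add: flat_exp_def)
 next
  case 3
  \<comment> \<open>With \<open>x = 1 / h\<close> the right difference quotient at 0 is
    \<open>x ^ Suc n / exp x\<close>.\<close>
  have "((%x::real. x ^ Suc n / exp x) \<longlongrightarrow> 0) at_top" by (rule tendsto_power_div_exp_0)
  hence "((%h::real. inverse h ^ Suc n / exp (inverse h)) \<longlongrightarrow> 0) (at_right 0)"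
   by (rule filterlim_compose[OF _ filterlim_inverse_at_top_right])
  hence R: "((%h. (flat_exp n (0 + h) - flat_exp n 0) / h) \<longlongrightarrow> 0) (at_right 0)" by (rule Lim_transform_eventually)
    (auto simp: eventually_at_filter flat_exp_def exp_minus field_simps)
  have L: "((%h. (flat_exp n (0 + h) - flat_exp n 0) / h) \<longlongrightarrow> 0) (at_left 0)"
   by (rule tendsto_eventually) (auto simp: eventually_at_filter flat_exp_def)
  have "(flat_exp n has_real_derivative 0) (at 0)" unfolding DERIV_def using filterlim_split_at[OF L R] by simp
  with 3 show ?thesis by (simp add: flat_exp_def)
 qed
qed

text \<open>A generated stand-in for the smooth functions: it contains polynomials and cutoffs and
  is closed under partial derivatives, so \<open>Ck k\<close> for every k is an induction on
  k.\<close>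

inductive_set smooth_fun :: "('a::euclidean_space => real) set" where
 const: "(%x. c) \<in> smooth_fun"
| inner: "(%x. x \<bullet> a) \<in> smooth_fun"
| add: "f \<in> smooth_fun ==> g \<in> smooth_fun ==> (%x. f x + g x) \<in> smooth_fun"
| mult: "f \<in> smooth_fun ==> g \<in> smooth_fun ==> (%x. f x * g x) \<in> smooth_fun"
| flat: "f \<in> smooth_fun ==> (%x. flat_exp n (f x)) \<in> smooth_fun"

lemma smooth_fun_derivative: "f \<in> smooth_fun ==> \<exists>D. (\<forall>b. D b \<in> smooth_fun) \<and>
   (\<forall>x. (f has_derivative (%v. \<Sum>b\<in>Basis. (v \<bullet> b) * D b x)) (at x))" proof (induction rule: smooth_fun.induct)
 case (const c)
 show ?case by (rule exI[of _ "%b x. 0"]) (auto intro: smooth_fun.intros)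
next
 case (inner a)
 show ?case by (rule exI[of _ "%b x. a \<bullet> b"]) (auto intro!: smooth_fun.intros derivative_eq_intros simp: euclidean_inner[symmetric])
next
 case (add f g)
 then obtain D E where "\<forall>b. D b \<in> smooth_fun" "\<forall>b. E b \<in> smooth_fun"
  "!!x. (f has_derivative (%v. \<Sum>b\<in>Basis. (v \<bullet> b) * D b x)) (at x)"
  "!!x. (g has_derivative (%v. \<Sum>b\<in>Basis. (v \<bullet> b) * E b x)) (at x)" by blast
 thus ?case by (intro exI[of _ "%b x. D b x + E b x"]) (auto intro!: smooth_fun.intros
    simp: algebra_simps sum.distrib)
next
 case (mult f g)
 then obtain D E where "\<forall>b. D b \<in> smooth_fun" "\<forall>b. E b \<in> smooth_fun"
  "!!x. (f has_derivative (%v. \<Sum>b\<in>Basis. (v \<bullet> b) * D b x)) (at x)"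
  "!!x. (g has_derivative (%v. \<Sum>b\<in>Basis. (v \<bullet> b) * E b x)) (at x)" by blast
 with mult.hyps show ?case by (intro exI[of _ "%b x. f x * E b x + D b x * g x"])
   (auto intro!: smooth_fun.intros has_derivative_eq_rhs[OF has_derivative_mult]
    simp: algebra_simps sum.distrib sum_distrib_left)
next
 case (flat f n)
 then obtain D where D: "\<forall>b. D b \<in> smooth_fun"
  "!!x. (f has_derivative (%v. \<Sum>b\<in>Basis. (v \<bullet> b) * D b x)) (at x)" by blast
 have "((%x. flat_exp n (f x)) has_derivative (%v. \<Sum>b\<in>Basis. (v \<bullet> b) *
   ((flat_exp (n + 2) (f x) + (- real n) * flat_exp (n + 1) (f x)) * D b x))) (at x)" for x
  using has_derivative_compose[OF D(2), OF flat_exp_has_derivative[unfolded has_field_derivative_def]]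
  by (rule has_derivative_eq_rhs) (simp add: algebra_simps sum_distrib_left sum_subtractf)
 moreover have "(%x. (flat_exp (n + 2) (f x) + (- real n) * flat_exp (n + 1) (f x)) * D b x) \<in> smooth_fun" for b
  by (intro smooth_fun.intros flat.hyps D(1)[rule_format])
 ultimately show ?case by (intro exI[of _ "%b x. (flat_exp (n + 2) (f x) + (- real n) * flat_exp (n + 1) (f x)) * D b x"]) blast
qed

lemma
 assumes "f \<in> smooth_fun"
 shows smooth_fun_has_derivative: "(f has_derivative (%v. \<Sum>b\<in>Basis. (v \<bullet> b) * frechet_derivative f (at x) b)) (at x)"
  and smooth_fun_partial: "b \<in> Basis ==> (%x. frechet_derivative f (at x) b) \<in> smooth_fun"
proof -
 obtain D where D: "\<forall>b. D b \<in> smooth_fun" "!!x. (f has_derivative (%v. \<Sum>b\<in>Basis. (v \<bullet> b) * D b x)) (at x)"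
  using smooth_fun_derivative[OF assms] by blast
 have e: "frechet_derivative f (at x) b = D b x" if "b \<in> Basis" for b x using that by (subst frechet_derivative_at[OF D(2), symmetric])
   (simp add: inner_Basis if_distrib[of "%c. c * _"] cong: if_cong)
 thus "(f has_derivative (%v. \<Sum>b\<in>Basis. (v \<bullet> b) * frechet_derivative f (at x) b)) (at x)" using D(2)[of x] by simp
 show "b \<in> Basis ==> (%x. frechet_derivative f (at x) b) \<in> smooth_fun" using e D(1) by simp
qed

lemma smooth_fun_continuous: "f \<in> smooth_fun ==> continuous_on S f"
 by (rule has_derivative_continuous_on, rule has_derivative_at_withinI, rule smooth_fun_has_derivative)

lemma smooth_fun_Ck: "f \<in> smooth_fun ==> Ck k f"
proof (induction k arbitrary: f)
 case (Suc k)
 have "f differentiable (at x)" for x unfolding differentiable_def using smooth_fun_has_derivative[OF Suc.prems] by blast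
 thus ?case using Suc.IH smooth_fun_partial[OF Suc.prems] by simp
qed (simp add: smooth_fun_continuous)

lemma smooth_fun_affine: "f \<in> smooth_fun ==> (%x. f (c + k *\<^sub>R x)) \<in> smooth_fun"
proof (induction rule: smooth_fun.induct)
 case (inner a)
 have "(%x. (c + k *\<^sub>R x) \<bullet> a) = (%x. c \<bullet> a + k * (x \<bullet> a))" by (simp add: inner_add_left)
 thus ?case by (simp only:) (intro smooth_fun.intros)
qed (rule smooth_fun.intros; assumption?)+

lemma smooth_fun_sum: "(!!i. i \<in> I ==> f i \<in> smooth_fun) ==> (%x. \<Sum>i\<in>I. f i x) \<in> smooth_fun"
 by (induction I rule: infinite_finite_induct) (simp_all add: smooth_fun.const smooth_fun.add)

lemma smooth_fun_prod: "(!!i. i \<in> I ==> f i \<in> smooth_fun) ==> (%x. \<Prod>i\<in>I. f i x) \<in> smooth_fun"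
 by (induction I rule: infinite_finite_induct) (simp_all add: smooth_fun.const smooth_fun.mult)

lemma smooth_fun_power: "f \<in> smooth_fun ==> (%x. f x ^ n) \<in> smooth_fun"
 by (induction n) (simp_all add: smooth_fun.const smooth_fun.mult)

text \<open>Test functions taken from \<open>smooth_fun\<close>. Uniqueness of weak gradients and
  the Poincare inequality test only with these; products with smooth functions and partial
  derivatives stay in the class.\<close>

definition bump_on :: "'a::euclidean_space set => ('a => real) set" where
 "bump_on D = {f \<in> smooth_fun. \<exists>S. compact S \<and> S \<subseteq> D \<and> (\<forall>x. x \<notin> S --> f x = 0)}"

lemma bump_onI: "f \<in> smooth_fun ==> compact S ==> S \<subseteq> D ==> (!!x. x \<notin> S ==> f x = 0) ==> f \<in> bump_on D"
 unfolding bump_on_def by blast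

lemma bump_onE:
 assumes "f \<in> bump_on D"
 obtains S where "f \<in> smooth_fun" "compact S" "S \<subseteq> D" "\<forall>x. x \<notin> S --> f x = 0" using assms unfolding bump_on_def by blast

lemma bump_on_smooth: "f \<in> bump_on D ==> f \<in> smooth_fun" unfolding bump_on_def by simp

lemma bump_on_test_function:
 assumes "f \<in> bump_on D" "D \<subseteq> Om" shows "test_function Om f"
proof -
 obtain S where "f \<in> smooth_fun" "compact S" "S \<subseteq> D" "\<forall>x. x \<notin> S --> f x = 0" using assms(1) by (rule bump_onE)
 thus ?thesis unfolding test_function_def using smooth_fun_Ck[of f] assms(2) by (intro conjI exI[of _ S]) auto
qed

lemma bump_on_mult:
 assumes "f \<in> bump_on D" "g \<in> smooth_fun" shows "(%x. g x * f x) \<in> bump_on D"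
proof -
 obtain S where "f \<in> smooth_fun" "compact S" "S \<subseteq> D" "\<forall>x. x \<notin> S --> f x = 0" using assms(1) by (rule bump_onE)
 with assms(2) show ?thesis by (intro bump_onI[of _ S] smooth_fun.mult) simp_all
qed

lemma frechet_derivative_zero_open:
 fixes f :: "'a::euclidean_space => real"
 assumes "open U" "x \<in> U" "\<forall>y\<in>U. f y = 0"
 shows "frechet_derivative f (at x) v = 0"
proof -
 have "(f has_derivative (%v. 0)) (at x)" by (rule has_derivative_transform_within_open[OF has_derivative_const assms(1,2)])
   (simp add: assms(3))
 hence "(%v. 0) = frechet_derivative f (at x)" by (rule frechet_derivative_at)
 thus ?thesis by (simp add: fun_eq_iff)
qed

lemma bump_on_partial:
 assumes "f \<in> bump_on D" "b \<in> Basis"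
 shows "(%x. frechet_derivative f (at x) b) \<in> bump_on D"
proof -
 obtain S where S: "f \<in> smooth_fun" "compact S" "S \<subseteq> D" "\<forall>x. x \<notin> S --> f x = 0" using assms(1) by (rule bump_onE)
 have "frechet_derivative f (at x) b = 0" if "x \<notin> S" for x by (rule frechet_derivative_zero_open[of "- S"])
   (use S(3-) that compact_imp_closed[OF S(2)] in \<open>simp_all add: open_Compl\<close>)
 thus ?thesis using S assms(2) by (intro bump_onI[of _ S] smooth_fun_partial) simp_all
qed

lemma bump_on_bounded:
 assumes "f \<in> bump_on D" obtains B where "B > 0" "!!x. \<bar>f x\<bar> <= B"
proof -
 obtain S where S: "f \<in> smooth_fun" "compact S" "S \<subseteq> D" "\<forall>x. x \<notin> S --> f x = 0" using assms(1) by (rule bump_onE)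
 have "compact (f ` S)" using smooth_fun_continuous[OF S(1)] S(2) by (rule compact_continuous_image)
 then obtain B where B: "\<forall>y\<in>f ` S. norm y <= B" using compact_imp_bounded bounded_iff by metis
 have "\<bar>f x\<bar> <= \<bar>B\<bar> + 1" for x
 proof (cases "x \<in> S")
  case True
  hence "norm (f x) <= B" using B by blast
  thus ?thesis by simp
 qed (simp add: S(4))
 with that[of "\<bar>B\<bar> + 1"] show ?thesis by simp
qed

text \<open>The product of \<open>flat_exp 0 ((n + 1) f i - 1)\<close> vanishes unless every
  \<open>f i\<close> is at least \<open>1 / (n + 1)\<close>, which is a compact part of the set.
  Where all \<open>f i\<close> are positive the arguments tend to infinity and the factors to
  1.\<close>

lemma smooth_cutoff:
 fixes f :: "'i => 'a::euclidean_space => real"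
 assumes fin: "finite I" and sm: "!!i. i \<in> I ==> f i \<in> smooth_fun" and bd: "bounded {x. \<forall>i\<in>I. 0 < f i x}"
 obtains \<phi> :: "nat => 'a => real" where "!!n. \<phi> n \<in> bump_on {x. \<forall>i\<in>I. 0 < f i x}"
  "!!n x. 0 <= \<phi> n x" "!!n x. \<phi> n x <= 1"
  "!!x. (%n. \<phi> n x) \<longlonglongrightarrow> indicator {x. \<forall>i\<in>I. 0 < f i x} x"
proof -
 define D where "D = {x. \<forall>i\<in>I. 0 < f i x}"
 define \<phi> where "\<phi> n x = (\<Prod>i\<in>I. flat_exp 0 (real (Suc n) * f i x + (-1)))" for n x
 have 1: "\<phi> n \<in> bump_on D" for n
 proof (rule bump_onI)
  show "\<phi> n \<in> smooth_fun" unfolding \<phi>_def by (intro smooth_fun_prod smooth_fun.flat smooth_fun.add smooth_fun.mult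
     smooth_fun.const sm) auto
  define S where "S = (\<Inter>i\<in>I. {x. 1 / real (Suc n) <= f i x})"
  show SD: "S \<subseteq> D" unfolding S_def D_def by (force intro: order.strict_trans2[of 0 "1 / real (Suc n)"])
  have "closed S" unfolding S_def by (intro closed_INT ballI closed_Collect_le continuous_on_const
     smooth_fun_continuous sm) auto
  moreover have "bounded S" using SD bd D_def bounded_subset by metis
  ultimately show "compact S" by (simp add: compact_eq_bounded_closed)
  show "\<phi> n x = 0" if xS: "x \<notin> S" for x
  proof -
   obtain i where i: "i \<in> I" "f i x < 1 / real (Suc n)" using xS unfolding S_def by auto
   hence "real (Suc n) * f i x + (-1) <= 0" by (simp add: field_simps)
   thus ?thesis unfolding \<phi>_def using i(1) fin by (intro prod_zero bexI[of _ i]) (auto simp: flat_exp_eq_0)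
  qed
 qed
 have 2: "(%n. \<phi> n x) \<longlonglongrightarrow> ind D x" for x
 proof (cases "x \<in> D")
  case True
  have "(%n. flat_exp 0 (real (Suc n) * f i x + (-1))) \<longlonglongrightarrow> 1" if "i \<in> I" for i
  proof -
   have pos: "0 < f i x" using True that D_def by auto
   have lim: "filterlim (%n. real (Suc n) * f i x + (-1)) at_top sequentially" using pos by real_asymp
   have "((%t::real. exp (- inverse t)) \<longlongrightarrow> 1) at_top" by real_asymp
   hence "((%t. flat_exp 0 t) \<longlongrightarrow> 1) at_top" by (rule Lim_transform_eventually)
     (use eventually_gt_at_top[of 0] in \<open>eventually_elim, simp add: flat_exp_def\<close>)
   thus ?thesis using lim by (rule filterlim_compose)
  qed
  hence "(%n. \<phi> n x) \<longlonglongrightarrow> (\<Prod>i\<in>I. 1)" unfolding \<phi>_def by (intro tendsto_prod)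
  with True show ?thesis by simp
 next
  case False
  hence "\<phi> n x = 0" for n using 1[of n] bump_onE by (metis subsetD)
  with False show ?thesis by simp
 qed
 show ?thesis by (rule that[of \<phi>]) (use 1 2 in \<open>auto simp: D_def \<phi>_def prod_nonneg flat_exp_nonneg prod_le_1 flat_exp_0_le_1\<close>)
qed

definition has_cutoffs :: "'a::euclidean_space set => bool" where
 "has_cutoffs D \<longleftrightarrow> (\<exists>\<phi>::nat => 'a => real. (\<forall>n. \<phi> n \<in> bump_on D \<and> (\<forall>x. 0 <= \<phi> n x \<and> \<phi> n x <= 1)) \<and>
   (\<forall>x. (%n. \<phi> n x) \<longlonglongrightarrow> ind D x))"

lemma has_cutoffs_box: "has_cutoffs (box a b :: 'a::euclidean_space set)"
proof -
 \<comment> \<open>The product of the two distances is also positive between \<open>b\<close> and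
   \<open>a\<close> if \<open>b \<bullet> i < a \<bullet> i\<close>, so the empty box is treated
   separately by the value -1.\<close>
 define f :: "'a => 'a => real"
  where "f i x = (if box a b = {} then -1 else (x \<bullet> i + (- (a \<bullet> i))) * (b \<bullet> i + (-1) * (x \<bullet> i)))" for i x
 have eq: "{x. \<forall>i\<in>Basis. 0 < f i x} = box a b"
 proof (cases "box a b = {}")
  case True
  thus ?thesis by (auto simp: f_def)
 next
  case False
  hence ab: "!!i. i \<in> Basis ==> a \<bullet> i < b \<bullet> i" by (simp add: box_ne_empty)
  have "0 < f i x \<longleftrightarrow> a \<bullet> i < x \<bullet> i \<and> x \<bullet> i < b \<bullet> i" if "i \<in> Basis" for i x
   using ab[OF that] False by (auto simp: f_def zero_less_mult_iff)
  thus ?thesis by (auto simp: mem_box)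
 qed
 have sm: "f i \<in> smooth_fun" for i
 proof (cases "box a b = {}")
  case True
  hence "f i = (%x. -1)" by (simp add: f_def fun_eq_iff)
  thus ?thesis by (simp add: smooth_fun.const)
 next
  case False
  hence "f i = (%x. (x \<bullet> i + (- (a \<bullet> i))) * (b \<bullet> i + (-1) * (x \<bullet> i)))" by (simp add: f_def fun_eq_iff)
  thus ?thesis by (simp only:) (intro smooth_fun.intros)
 qed
 have bd: "bounded {x. \<forall>i\<in>Basis. 0 < f i x}" unfolding eq by simp
 show ?thesis by (rule smooth_cutoff[OF finite_Basis sm bd]) (unfold has_cutoffs_def eq, blast)
qed

lemma has_cutoffs_ball: "has_cutoffs (ball c r :: 'a::euclidean_space set)"
proof -
 \<comment> \<open>\<open>r^2\<close> forgets the sign of \<open>r\<close>, hence the value -1 for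
   an empty ball.\<close>
 define f :: "unit => 'a => real" where
  "f i x = (if r <= 0 then -1 else r^2 + (-1) * (\<Sum>i\<in>Basis. (x \<bullet> i + (- (c \<bullet> i))) ^ 2))" for i x
 have sq: "(\<Sum>i\<in>Basis. (x \<bullet> i + (- (c \<bullet> i))) ^ 2) = (dist c x)^2" for x
  unfolding dist_commute[of c] dist_norm power2_norm_eq_inner by (subst (3) euclidean_inner) (simp add: power2_eq_square algebra_simps)
 have "0 < f i x \<longleftrightarrow> dist c x < r" for i x
 proof (cases "r <= 0")
  case False
  hence "(dist c x)^2 < r^2 \<longleftrightarrow> dist c x < r"
   using power2_less_imp_less[of "dist c x" r] power_strict_mono[of "dist c x" r 2] by auto
  with False show ?thesis unfolding f_def sq by simp
 qed (simp add: f_def not_less, metis zero_le_dist order.trans)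
 hence eq: "{x. \<forall>i\<in>{()}. 0 < f i x} = ball c r" by force
 have sm: "f i \<in> smooth_fun" for i
 proof (cases "r <= 0")
  case True
  hence "f i = (%x. -1)" by (simp add: f_def fun_eq_iff)
  thus ?thesis by (simp add: smooth_fun.const)
 next
  case False
  hence "f i = (%x. r^2 + (-1) * (\<Sum>i\<in>Basis. (x \<bullet> i + (- (c \<bullet> i))) ^ 2))" by (simp add: f_def fun_eq_iff)
  thus ?thesis by (simp only:) (intro smooth_fun.intros smooth_fun_sum smooth_fun_power)
 qed
 have bd: "bounded {x. \<forall>i\<in>{()}. 0 < f i x}" unfolding eq by simp
 show ?thesis by (rule smooth_cutoff[of "{()}" f, OF _ sm bd]) (simp, unfold has_cutoffs_def eq, blast)
qed

section \<open>Test functions determine integrable functions; uniqueness of weak gradients\<close>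

text \<open>The positive and the negative part are densities of two measures that agree on the
  boxes, an intersection-stable generator of the Borel sets. Hence the measures and their densities
  agree.\<close>

lemma AE_zero_if_box_integrals_zero:
 fixes f :: "'a::euclidean_space => real"
 assumes int: "integrable lborel f" and zero: "!!a b. (LBINT x. ind (box a b) x * f x) = 0"
 shows "AE x in lborel. f x = 0"
proof -
 have f[measurable]: "f \<in> borel_measurable lborel" using int by (rule borel_measurable_integrable)
 have fin: "(\<integral>\<^sup>+x. ennreal (g x) \<partial>lborel) < \<infinity>" if "integrable lborel g" for g :: "'a => real"
  using integrableD(2)[OF that] nn_integral_mono[of lborel "%x. ennreal (g x)" "%x. ennreal (norm (g x))"]
  by (auto simp: ennreal_leI less_top top_unique)
 have "density lborel (%x. ennreal (f x)) = density lborel (%x. ennreal (- f x))" (is "?M = ?N")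
 proof (rule measure_eqI_generator_eq)
  let ?B = "range (%(a, b). box a b :: 'a set)"
  show "Int_stable ?B"
  proof (rule Int_stableI)
   fix X Y assume "X \<in> ?B" "Y \<in> ?B"
   then obtain a b c d where "X = box a b" "Y = box c d" by auto
   thus "X \<inter> Y \<in> ?B" using box_Int_box[of a b c d] by auto
  qed
  show "sets ?M = sigma_sets UNIV ?B" "sets ?N = sigma_sets UNIV ?B"
   unfolding sets_density sets_lborel borel_eq_box by (simp_all add: sets_measure_of)
  show "(\<Union>n::nat. box (- (real n *\<^sub>R One)) (real n *\<^sub>R One)) = (UNIV :: 'a set)" by (rule UN_box_eq_UNIV)
  show "emeasure ?M (box (- (real n *\<^sub>R One)) (real n *\<^sub>R One)) \<noteq> \<infinity>" for n
   using fin[OF int] emeasure_mono[of "box (- (real n *\<^sub>R One)) (real n *\<^sub>R One)" UNIV ?M] by (auto simp: emeasure_density top_unique)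
  show "emeasure ?M X = emeasure ?N X" if "X \<in> ?B" for X
  proof -
   from that obtain a b where X: "X = box a b" by auto
   have g: "integrable lborel (%x. ind X x * f x)" using integrable_mult_indicator[OF _ int, of X] X by simp
   have "emeasure ?M X = (\<integral>\<^sup>+x. ennreal (ind X x * f x) \<partial>lborel)"
    "emeasure ?N X = (\<integral>\<^sup>+x. ennreal (- (ind X x * f x)) \<partial>lborel)"
    using X by (auto simp: emeasure_density indicator_def intro!: nn_integral_cong)
   thus ?thesis using zero[of a b] fin[OF g] fin[OF integrable_minus[OF g]] unfolding X
    by (simp add: real_lebesgue_integral_def[OF g[unfolded X]] less_top) (metis ennreal_enn2real less_top)
  qed
 qed auto
 hence "AE x in lborel. ennreal (f x) = ennreal (- f x)" by (subst (asm) sigma_finite_measure.density_unique_iff[OF sigma_finite_lborel]) auto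
 thus ?thesis proof eventually_elim
  case (elim x)
  thus ?case by (cases "0 <= f x") (auto simp: ennreal_neg eq_commute[of 0])
 qed
qed

lemma has_cutoffsE:
 assumes "has_cutoffs D"
 obtains \<phi> :: "nat => 'a::euclidean_space => real" where "!!n. \<phi> n \<in> bump_on D"
  "!!n x. 0 <= \<phi> n x" "!!n x. \<phi> n x <= 1" "!!x. (%n. \<phi> n x) \<longlonglongrightarrow> ind D x"
 using assms unfolding has_cutoffs_def by blast

text \<open>Sobolev functions are given on \<open>lebesgue_on Om\<close>; a Borel version on
  \<open>lborel\<close> gives access to Fubini and to affine substitutions.\<close>

lemma borel_version_lebesgue_on:
 fixes f :: "'a::euclidean_space => 'b::euclidean_space"
 assumes A: "A \<in> sets lebesgue" and f: "integrable (lebesgue_on A) f"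
 obtains F where "integrable lborel F" "AE x in lborel. F x = ind A x *\<^sub>R f x"
proof -
 have int: "integrable lebesgue (%x. ind A x *\<^sub>R f x)" using f A by (simp add: integrable_restrict_space)
 have "\<exists>g\<in>borel_measurable lborel. AE x in lborel. ind A x *\<^sub>R f x \<bullet> b = g x" for b
  using int by (intro completion_ex_borel_measurable_real borel_measurable_inner) auto
 then obtain g where g: "!!b. g b \<in> borel_measurable lborel" "!!b. AE x in lborel. ind A x *\<^sub>R f x \<bullet> b = g b x"
  by metis
 define F where "F x = (\<Sum>b\<in>Basis. g b x *\<^sub>R b)" for x
 have F[measurable]: "F \<in> borel_measurable lborel" unfolding F_def using g(1) by measurable
 have "AE x in lborel. \<forall>b\<in>Basis. ind A x *\<^sub>R f x \<bullet> b = g b x" using g(2) by (intro AE_finite_allI) auto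
 hence ae: "AE x in lborel. F x = ind A x *\<^sub>R f x"
 proof eventually_elim
  case (elim x)
  have "F x = (\<Sum>b\<in>Basis. (ind A x *\<^sub>R f x \<bullet> b) *\<^sub>R b)" unfolding F_def using elim by (intro sum.cong) auto
  thus ?case by (simp only: euclidean_representation)
 qed
 have "integrable lebesgue F"
 proof (rule integrable_cong_AE_imp[OF int])
  show "F \<in> borel_measurable lebesgue" using F by (rule measurable_completion)
  show "AE x in lebesgue. ind A x *\<^sub>R f x = F x" unfolding AE_completion_iff using ae by eventually_elim simp
 qed
 hence "integrable lborel F" by (simp add: integrable_completion)
 with ae show ?thesis using that by blast
qed

lemma locally_integrable_times_bump:
 fixes f :: "'a::euclidean_space => 'b::euclidean_space"
 assumes "locally_integrable Om f" "\<phi> \<in> bump_on Om" "Om \<in> sets lebesgue"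
 shows "integrable (lebesgue_on Om) (%x. \<phi> x *\<^sub>R f x)"
proof -
 obtain S where S: "\<phi> \<in> smooth_fun" "compact S" "S \<subseteq> Om" "\<forall>x. x \<notin> S --> \<phi> x = 0"
  using assms(2) by (rule bump_onE)
 obtain B where B: "B > 0" "!!x. \<bar>\<phi> x\<bar> <= B" using assms(2) by (rule bump_on_bounded) blast
 have Sm: "S \<in> sets lebesgue" using S(2) by (simp add: lmeasurable_compact fmeasurableD)
 have "integrable (lebesgue_on S) f" using assms(1) S(2,3) unfolding locally_integrable_def by blast
 hence fS: "integrable lebesgue (%x. ind S x *\<^sub>R f x)" using Sm by (simp add: integrable_restrict_space)
 have \<phi>: "\<phi> \<in> borel_measurable lebesgue" using borel_measurable_continuous_onI[OF smooth_fun_continuous[OF S(1)]]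
  by (intro measurable_completion) simp
 have "integrable lebesgue (%x. B *\<^sub>R (ind S x *\<^sub>R f x))" using fS by (rule integrable_scaleR_right)
 hence "integrable lebesgue (%x. \<phi> x *\<^sub>R (ind S x *\<^sub>R f x))"
 proof (rule Bochner_Integration.integrable_bound)
  show "(%x. \<phi> x *\<^sub>R (ind S x *\<^sub>R f x)) \<in> borel_measurable lebesgue"
   by (rule borel_measurable_scaleR[OF \<phi> borel_measurable_integrable[OF fS]])
  show "AE x in lebesgue. norm (\<phi> x *\<^sub>R (ind S x *\<^sub>R f x)) <= norm (B *\<^sub>R (ind S x *\<^sub>R f x))"
   using B by (intro AE_I2) (auto simp: mult_right_mono indicator_def)
 qed
 moreover have "(%x. \<phi> x *\<^sub>R (ind S x *\<^sub>R f x)) = (%x. ind Om x *\<^sub>R (\<phi> x *\<^sub>R f x))"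
 proof
  fix x show "\<phi> x *\<^sub>R (ind S x *\<^sub>R f x) = ind Om x *\<^sub>R (\<phi> x *\<^sub>R f x)"
   using S(3,4) by (cases "x \<in> S") (auto)
 qed
 ultimately show ?thesis using assms(3) by (simp add: integrable_restrict_space)
qed

lemma integral_lebesgue_on_eq:
 fixes f F :: "'a::euclidean_space => real"
 assumes A: "A \<in> sets lebesgue" and F: "F \<in> borel_measurable borel" and ae: "AE x in lborel. ind A x * f x = F x"
 shows "(\<integral>x. f x \<partial>lebesgue_on A) = (LBINT x. F x)"
proof -
 have m: "F \<in> borel_measurable lebesgue" using F by (intro measurable_completion) simp
 have e: "AE x in lebesgue. F x = ind A x * f x" unfolding AE_completion_iff using ae by eventually_elim simp
 have "(\<integral>x. f x \<partial>lebesgue_on A) = (\<integral>x. ind A x * f x \<partial>lebesgue)" using A by (simp add: integral_restrict_space)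
 also have "... = (\<integral>x. F x \<partial>lebesgue)"
  by (rule integral_cong_AE[OF borel_measurable_AE[OF m e] m]) (use e in \<open>eventually_elim, simp\<close>)
 finally show ?thesis using F by (simp add: integral_completion)
qed

text \<open>Countably many closed boxes exhaust \<open>Om\<close>. On each one the function extends
  by zero to an integrable \<open>F\<close>, and cutoffs of its intersection with an arbitrary
  second box give, in the limit, that all box integrals of \<open>F\<close> vanish.\<close>

lemma AE_zero_if_bump_integrals_zero:
 fixes f :: "'a::euclidean_space => real"
 assumes op: "open Om" and li: "locally_integrable Om f"
  and zero: "!!\<phi>. \<phi> \<in> bump_on Om ==> (\<integral>x. \<phi> x * f x \<partial>lebesgue_on Om) = 0"
 shows "AE x in lebesgue_on Om. f x = 0"
proof -
 have Omm: "Om \<in> sets lebesgue" using op by simp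
 have box0: "AE x\<in>cbox a b in lborel. f x = 0" if ab: "cbox a b \<subseteq> Om" for a b
 proof -
  have "integrable (lebesgue_on (cbox a b)) f" using li ab compact_cbox unfolding locally_integrable_def by blast
  then obtain F where F: "integrable lborel F" "AE x in lborel. F x = ind (cbox a b) x *\<^sub>R f x"
   by (rule borel_version_lebesgue_on[rotated]) auto
  have fr: "AE x in lborel. x \<notin> cbox a b - box a b" using negligible_frontier_interval[of a b]
   by (intro AE_not_in) (simp add: negligible_iff_null_sets null_sets_completion_iff)
  have "AE x in lborel. F x = 0"
  proof (rule AE_zero_if_box_integrals_zero[OF F(1)])
   fix c d
   obtain p q where pq: "box c d \<inter> box a b = box p q" using box_Int_box by blast
   hence sub: "box p q \<subseteq> Om" "box p q \<subseteq> cbox a b" using box_subset_cbox[of a b] ab by blast+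
   obtain \<phi> where \<phi>: "!!n. \<phi> n \<in> bump_on (box p q)" "!!n x. 0 <= \<phi> n x" "!!n x. \<phi> n x <= 1"
    "!!x. (%n. \<phi> n x) \<longlonglongrightarrow> ind (box p q) x" using has_cutoffs_box[of p q] by (rule has_cutoffsE) blast
   have m: "(%x. \<phi> n x * F x) \<in> borel_measurable borel" for n
    using F(1) borel_measurable_continuous_onI[OF smooth_fun_continuous[OF bump_on_smooth[OF \<phi>(1)]]] by (intro borel_measurable_times) auto
   have z: "(LBINT x. \<phi> n x * F x) = 0" for n
   proof -
    have \<phi>0: "\<phi> n x = 0" if "x \<notin> box p q" for x using \<phi>(1)[of n] by (rule bump_onE) (use that in blast)
    have "\<phi> n \<in> bump_on Om" using \<phi>(1)[of n] sub(1) unfolding bump_on_def by blast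
    moreover have "AE x in lborel. ind Om x * (\<phi> n x * f x) = \<phi> n x * F x" using F(2)
    proof eventually_elim
     case (elim x)
     thus ?case using \<phi>0[of x] sub by (cases "x \<in> box p q") (auto simp: indicator_def)
    qed
    ultimately show ?thesis using zero integral_lebesgue_on_eq[OF Omm m] by metis
   qed
   have "(%n. LBINT x. \<phi> n x * F x) \<longlonglongrightarrow> (LBINT x. ind (box p q) x * F x)"
   proof (rule integral_dominated_convergence)
    show "integrable lborel (%x. norm (F x))" using F(1) by (rule integrable_norm)
    show "AE x in lborel. (%n. \<phi> n x * F x) \<longlonglongrightarrow> ind (box p q) x * F x"
     by (intro AE_I2 tendsto_mult_right \<phi>(4))
    show "AE x in lborel. norm (\<phi> n x * F x) <= norm (F x)" for n
     using \<phi>(2,3) by (intro AE_I2) (simp add: abs_mult mult_left_le_one_le)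
   qed (use F(1) m in \<open>auto intro!: borel_measurable_times borel_measurable_indicator\<close>)
   hence "(LBINT x. ind (box p q) x * F x) = 0" unfolding z by (simp add: LIMSEQ_const_iff)
   moreover have "(LBINT x. ind (box p q) x * F x) = (LBINT x. ind (box c d) x * F x)"
   proof (rule integral_cong_AE)
    show "AE x in lborel. ind (box p q) x * F x = ind (box c d) x * F x"
     using F(2) fr by eventually_elim (auto simp: indicator_def simp flip: pq)
   qed (use F(1) in \<open>auto intro!: borel_measurable_times borel_measurable_indicator\<close>)
   ultimately show "(LBINT x. ind (box c d) x * F x) = 0" by simp
  qed
  thus ?thesis using F(2) by eventually_elim auto
 qed
 obtain \<D> where \<D>: "countable \<D>" "\<D> \<subseteq> Pow Om" "!!X. X \<in> \<D> ==> \<exists>a b. X = cbox a b" "\<Union>\<D> = Om"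
  using open_countable_Union_open_cbox[OF op] by metis
 have "AE x in lborel. \<forall>X\<in>\<D>. x \<in> X --> f x = 0" unfolding AE_ball_countable[OF \<D>(1)] using \<D>(2,3) box0 by blast
 hence "AE x\<in>Om in lborel. f x = 0" by eventually_elim (use \<D>(4) in blast)
 thus ?thesis using Omm by (simp add: AE_restrict_space_iff AE_completion_iff)
qed

lemma locally_integrable_inner: "locally_integrable Om g ==> locally_integrable Om (%x. g x \<bullet> b)"
 unfolding locally_integrable_def by auto

text \<open>Makes the arbitrary choice in \<open>weak_gradient\<close> harmless: any weak gradient
  found by hand agrees with it almost everywhere.\<close>

lemma weak_gradient_AE_unique:
 fixes u :: "'a::euclidean_space => real"
 assumes op: "open Om" and g: "is_weak_gradient Om u g" and g': "is_weak_gradient Om u g'"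
 shows "AE x in lebesgue_on Om. g x = g' x"
proof -
 have Omm: "Om \<in> sets lebesgue" using op by simp
 have "AE x in lebesgue_on Om. g x \<bullet> b - g' x \<bullet> b = 0" if b: "b \<in> Basis" for b
 proof (rule AE_zero_if_bump_integrals_zero[OF op])
  have li: "locally_integrable Om (%x. g x \<bullet> b)" "locally_integrable Om (%x. g' x \<bullet> b)"
   using g g' unfolding is_weak_gradient_def by (auto intro: locally_integrable_inner)
  thus "locally_integrable Om (%x. g x \<bullet> b - g' x \<bullet> b)" unfolding locally_integrable_def by auto
  show "(\<integral>x. \<phi> x * (g x \<bullet> b - g' x \<bullet> b) \<partial>lebesgue_on Om) = 0" if \<phi>: "\<phi> \<in> bump_on Om" for \<phi>
  proof -
   have eq: "(\<integral>x. (g x \<bullet> b) * \<phi> x \<partial>lebesgue_on Om) = (\<integral>x. (g' x \<bullet> b) * \<phi> x \<partial>lebesgue_on Om)"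
    using g g' bump_on_test_function[OF \<phi> order_refl] b unfolding is_weak_gradient_def by fastforce
   have i: "integrable (lebesgue_on Om) (%x. (g x \<bullet> b) * \<phi> x)"
    "integrable (lebesgue_on Om) (%x. (g' x \<bullet> b) * \<phi> x)"
    using locally_integrable_times_bump[OF li(1) \<phi> Omm] locally_integrable_times_bump[OF li(2) \<phi> Omm]
    by (simp_all add: mult.commute)
   have "(\<integral>x. \<phi> x * (g x \<bullet> b - g' x \<bullet> b) \<partial>lebesgue_on Om) =
     (\<integral>x. (g x \<bullet> b) * \<phi> x - (g' x \<bullet> b) * \<phi> x \<partial>lebesgue_on Om)" by (simp add: algebra_simps)
   also have "... = 0" using i eq by simp
   finally show ?thesis .
  qed
 qed
 hence "AE x in lebesgue_on Om. \<forall>b\<in>Basis. g x \<bullet> b - g' x \<bullet> b = 0" by (intro AE_finite_allI) auto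
 thus ?thesis by eventually_elim (auto intro: euclidean_eqI)
qed

section \<open>A Poincare inequality for weak gradients\<close>

lemma frechet_derivative_eqI: "(f has_derivative D) (at x) ==> frechet_derivative f (at x) b = D b" by (metis frechet_derivative_at)

text \<open>Dominated convergence along sequences; by the mean value inequality the difference
  quotients of \<open>h\<close> are bounded by \<open>B\<close>, so
  \<open>B * \<bar>v z\<bar>\<close> dominates.\<close>

lemma DERIV_integral_parameter:
 fixes h :: "real => 'a => real"
 assumes v: "integrable M v" and S: "convex S" "k \<in> S"
  and hm: "!!k. k \<in> S ==> h k \<in> borel_measurable M"
  and hb: "!!k z. k \<in> S ==> \<bar>h k z\<bar> <= B"
  and hm': "h' k \<in> borel_measurable M"
  and der: "!!k z. k \<in> S ==> ((%k. h k z) has_real_derivative h' k z) (at k within S)"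
  and hb': "!!k z. k \<in> S ==> \<bar>h' k z\<bar> <= B"
 shows "((%k. \<integral>z. v z * h k z \<partial>M) has_real_derivative (\<integral>z. v z * h' k z \<partial>M)) (at k within S)"
 unfolding has_field_derivative_iff tendsto_at_iff_sequentially comp_def
proof (intro allI impI)
 fix X :: "nat => real" assume X: "\<forall>i. X i \<in> S - {k}" "X \<longlonglongrightarrow> k"
 have vm: "v \<in> borel_measurable M" using v by auto
 have int: "integrable M (%z. v z * h j z)" if "j \<in> S" for j
 proof (rule Bochner_Integration.integrable_bound)
  show "integrable M (%z. B * v z)" using v by simp
  show "(%z. v z * h j z) \<in> borel_measurable M" using vm hm[OF that] by simp
  have "\<bar>h j z\<bar> <= \<bar>B\<bar>" for z using hb[OF that, of z] by linarith
  thus "AE z in M. norm (v z * h j z) <= norm (B * v z)" by (intro AE_I2) (simp add: abs_mult mult.commute[of "\<bar>v _\<bar>"] mult_right_mono)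
 qed

 have "(%i. \<integral>z. (v z * h (X i) z - v z * h k z) / (X i - k) \<partial>M) \<longlonglongrightarrow> (\<integral>z. v z * h' k z \<partial>M)"
 proof (rule integral_dominated_convergence)
  show "(%z. v z * h' k z) \<in> borel_measurable M" using vm hm' by simp
  show "(%z. (v z * h (X i) z - v z * h k z) / (X i - k)) \<in> borel_measurable M" for i using vm hm[of "X i"] hm[OF S(2)] X(1) by simp
  show "integrable M (%z. B * \<bar>v z\<bar>)" using v by simp
  show "AE z in M. (%i. (v z * h (X i) z - v z * h k z) / (X i - k)) \<longlonglongrightarrow> v z * h' k z"
  proof (rule AE_I2)
   fix z
   have "(%i. (h (X i) z - h k z) / (X i - k)) \<longlonglongrightarrow> h' k z"
    using der[OF S(2), of z] X unfolding has_field_derivative_iff tendsto_at_iff_sequentially comp_def by blast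
   hence "(%i. v z * ((h (X i) z - h k z) / (X i - k))) \<longlonglongrightarrow> v z * h' k z" by (rule tendsto_mult_left)
   thus "(%i. (v z * h (X i) z - v z * h k z) / (X i - k)) \<longlonglongrightarrow> v z * h' k z" by (simp add: right_diff_distrib)
  qed
  show "AE z in M. norm ((v z * h (X i) z - v z * h k z) / (X i - k)) <= B * \<bar>v z\<bar>" for i
  proof (rule AE_I2)
   fix z
   have Xi: "X i \<in> S" "X i \<noteq> k" using X(1) by auto
   have "norm (h (X i) z - h k z) <= B * norm (X i - k)" by (rule field_differentiable_bound[OF S(1) der _ Xi(1) S(2)]) (use hb' in auto)
   hence "\<bar>h (X i) z - h k z\<bar> / \<bar>X i - k\<bar> <= B" using Xi(2) by (simp add: divide_le_eq)
   hence "\<bar>v z\<bar> * (\<bar>h (X i) z - h k z\<bar> / \<bar>X i - k\<bar>) <= \<bar>v z\<bar> * B" by (rule mult_left_mono) simp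
   thus "norm ((v z * h (X i) z - v z * h k z) / (X i - k)) <= B * \<bar>v z\<bar>"
    by (simp add: abs_mult mult.commute flip: right_diff_distrib)
  qed
 qed
 moreover have "(\<integral>z. (v z * h (X i) z - v z * h k z) / (X i - k) \<partial>M) =
   ((\<integral>z. v z * h (X i) z \<partial>M) - (\<integral>z. v z * h k z \<partial>M)) / (X i - k)" for i
  using Bochner_Integration.integral_diff[OF int[of "X i"] int[OF S(2)]] X(1) by simp
 ultimately show "(%i. ((\<integral>z. v z * h (X i) z \<partial>M) - (\<integral>z. v z * h k z \<partial>M)) / (X i - k))
   \<longlonglongrightarrow> (\<integral>z. v z * h' k z \<partial>M)" by (simp only:)
  qed

lemma partial_affine:
 assumes "q \<in> smooth_fun" "b \<in> Basis"
 shows "frechet_derivative (%z. q (c + k *\<^sub>R z)) (at z) b = k * frechet_derivative q (at (c + k *\<^sub>R z)) b"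
proof -
 have "((%z. c + k *\<^sub>R z) has_derivative (%h. k *\<^sub>R h)) (at z)" by (auto intro!: derivative_eq_intros)
 hence "((%z. q (c + k *\<^sub>R z)) has_derivative
   (%h. \<Sum>i\<in>Basis. ((k *\<^sub>R h) \<bullet> i) * frechet_derivative q (at (c + k *\<^sub>R z)) i)) (at z)"
  by (rule has_derivative_compose[OF _ smooth_fun_has_derivative[OF assms(1)]])
 hence "frechet_derivative (%z. q (c + k *\<^sub>R z)) (at z) b =
   (\<Sum>i\<in>Basis. ((k *\<^sub>R b) \<bullet> i) * frechet_derivative q (at (c + k *\<^sub>R z)) i)" by (rule frechet_derivative_eqI)
 also have "... = (\<Sum>i\<in>Basis. if i = b then k * frechet_derivative q (at (c + k *\<^sub>R z)) i else 0)"
  using assms(2) by (intro sum.cong) (auto simp: inner_Basis)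
 also have "... = k * frechet_derivative q (at (c + k *\<^sub>R z)) b" using assms(2) by simp
 finally show ?thesis .
qed

lemma partial_mult:
 assumes "f \<in> smooth_fun" "g \<in> smooth_fun"
 shows "frechet_derivative (%z. f z * g z) (at z) b = f z * frechet_derivative g (at z) b + frechet_derivative f (at z) b * g z"
proof -
 have "f differentiable (at z)" "g differentiable (at z)" using smooth_fun_has_derivative assms unfolding differentiable_def by blast+
 thus ?thesis by (intro frechet_derivative_eqI[OF has_derivative_mult]) (simp_all add: frechet_derivative_works)
qed

text \<open>\<open>v\<close> and \<open>g\<close> are integrable on the whole space, but the
  identity is tested only inside \<open>Om\<close>. So the property passes to every subset
  (\<open>has_wgrad_mono\<close>) without changing the functions.\<close>

definition has_wgrad :: "'a::euclidean_space set => ('a => real) => ('a => 'a) => bool" where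
 "has_wgrad Om v g \<longleftrightarrow> integrable lborel v \<and> integrable lborel g \<and>
   (\<forall>\<phi>\<in>bump_on Om. \<forall>b\<in>Basis. (LBINT x. v x * frechet_derivative \<phi> (at x) b) =
    - (LBINT x. (g x \<bullet> b) * \<phi> x))"

lemma bump_on_measurable: "\<phi> \<in> bump_on D ==> \<phi> \<in> borel_measurable borel"
 by (intro borel_measurable_continuous_onI smooth_fun_continuous bump_on_smooth)

lemma bump_on_mono: "\<phi> \<in> bump_on D ==> D \<subseteq> E ==> \<phi> \<in> bump_on E" unfolding bump_on_def by blast

lemma bump_on_outside: "\<phi> \<in> bump_on D ==> x \<notin> D ==> \<phi> x = 0" unfolding bump_on_def by blast

lemma integrable_times_bounded:
 fixes f :: "'a => real" and g :: "'a => 'b::{banach, second_countable_topology}"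
 assumes g: "integrable M g" and f: "f \<in> borel_measurable M" and B: "!!x. \<bar>f x\<bar> <= B"
 shows "integrable M (%x. f x *\<^sub>R g x)"
proof (rule Bochner_Integration.integrable_bound)
 show "integrable M (%x. B *\<^sub>R g x)" using g by simp
 show "(%x. f x *\<^sub>R g x) \<in> borel_measurable M" using f g by auto
 have "\<bar>f x\<bar> <= \<bar>B\<bar>" for x using B[of x] by linarith
 thus "AE x in M. norm (f x *\<^sub>R g x) <= norm (B *\<^sub>R g x)" by (intro AE_I2) (simp add: mult_right_mono)
qed

lemma abs_integral_le:
 fixes f g :: "'a => real"
 assumes g: "integrable M g" and le: "AE x in M. \<bar>f x\<bar> <= g x"
 shows "\<bar>\<integral>x. f x \<partial>M\<bar> <= (\<integral>x. g x \<partial>M)"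
proof (cases "integrable M f")
 case True
 have "\<bar>\<integral>x. f x \<partial>M\<bar> <= (\<integral>x. \<bar>f x\<bar> \<partial>M)" by simp
 also have "... <= (\<integral>x. g x \<partial>M)" using True g le by (intro integral_mono_AE) auto
 finally show ?thesis .
next
 case False
 have "0 <= (\<integral>x. g x \<partial>M)" using le by (intro integral_nonneg_AE) (auto)
 with False show ?thesis by (simp add: not_integrable_integral_eq)
qed

text \<open>Substituting \<open>w = (1 - k) y + k z\<close> shows that \<open>k ^ d * F k\<close> is
  the integral of \<open>v (y + (w - y) / k) * q w\<close>. It moves from the values of
  \<open>v\<close> at \<open>w\<close> (k = 1) to those at the midpoint of \<open>y\<close> and
  \<open>w\<close> (k = 2). Its derivative in k is an integral of the weak gradient, because
  \<open>d q + r\<close>, taken at \<open>A k z\<close>, is the divergence in z of the field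
  \<open>(z - y) q (A k z)\<close>. Stopping halfway avoids the singular kernel that a contraction
  down to \<open>y\<close> would produce.\<close>

lemma dilated_bump_integral_bound:
 fixes v :: "'a::euclidean_space => real"
 assumes wg: "has_wgrad D v g" and D: "convex D" "D \<in> sets lborel"
  and diam: "!!x x'. x \<in> D ==> x' \<in> D ==> norm (x - x') <= \<delta>"
  and q: "q \<in> bump_on D" and qB: "!!x. \<bar>q x\<bar> <= B" and y: "y \<in> D"
 shows "\<bar>2 ^ DIM('a) * (LBINT z. v z * q (2 *\<^sub>R z - y)) - (LBINT z. v z * q z)\<bar> <=
   2 ^ DIM('a) * \<delta> * B * (LBINT z. ind D z * norm (g z))" proof -
 have v: "integrable lborel v" and g: "integrable lborel g" using wg unfolding has_wgrad_def by auto
 have qs: "q \<in> smooth_fun" using q by (rule bump_on_smooth)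
 define d where "d = DIM('a)"
 have d1: "1 <= d" unfolding d_def by simp
 have B0: "0 <= B" using qB abs_ge_zero order.trans by metis
 have \<delta>0: "0 <= \<delta>" using diam[OF y y] by simp
 define A where "A k z = (1 - k) *\<^sub>R y + k *\<^sub>R z" for k z
 have Ay: "A k z - y = k *\<^sub>R (z - y)" for k z by (simp add: A_def algebra_simps)
 \<comment> \<open>At \<open>w = A k z\<close>, \<open>r w\<close> is k times the derivative of
   \<open>q (A k z)\<close> with respect to k, since
   \<open>w - y = k *\<^sub>R (z - y)\<close>.\<close>
 define r where "r w = (\<Sum>b\<in>Basis. (w \<bullet> b + - (y \<bullet> b)) * frechet_derivative q (at w) b)" for w
 obtain S where S: "compact S" "S \<subseteq> D" "\<forall>x. x \<notin> S --> q x = 0" using q by (rule bump_onE)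
 have rb: "r \<in> bump_on D"
 proof -
  have "r \<in> smooth_fun" unfolding r_def by (intro smooth_fun_sum smooth_fun.mult smooth_fun.add smooth_fun.inner
     smooth_fun.const smooth_fun_partial qs)
  moreover have "r x = 0" if "x \<notin> S" for x
  proof -
   have "frechet_derivative q (at x) b = 0" for b by (rule frechet_derivative_zero_open[of "- S"])
     (use S that compact_imp_closed[OF S(1)] in \<open>simp_all add: open_Compl\<close>)
   thus ?thesis by (simp add: r_def)
  qed
  ultimately show ?thesis using S(1,2) by (intro bump_onI[of _ S]) auto
 qed
 obtain B' where B': "B' > 0" "!!x. \<bar>r x\<bar> <= B'" using rb by (rule bump_on_bounded) blast
 have Am: "(%z. f (A k z)) \<in> borel_measurable lborel" if "f \<in> borel_measurable borel" for f :: "'a => real" and k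
 proof -
  have "A k \<in> borel_measurable lborel" unfolding A_def by measurable
  thus ?thesis using that by simp
 qed
 have der0: "((%k. q (A k z)) has_real_derivative r (A k z) / k) (at k within {1..2})"
  if "k \<in> {1..2}" for k z
 proof -
  have "((%k. A k z) has_derivative (%h. h *\<^sub>R (z - y))) (at k within {1..2})"
   unfolding A_def by (auto intro!: derivative_eq_intros simp: algebra_simps)
  hence "((%k. q (A k z)) has_derivative
    (%h. \<Sum>b\<in>Basis. ((h *\<^sub>R (z - y)) \<bullet> b) * frechet_derivative q (at (A k z)) b)) (at k within {1..2})"
   by (rule has_derivative_compose[OF _ smooth_fun_has_derivative[OF qs]])
  moreover have "(%h. \<Sum>b\<in>Basis. ((h *\<^sub>R (z - y)) \<bullet> b) * frechet_derivative q (at (A k z)) b) = (*) (r (A k z) / k)"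
  proof
   fix h :: real
   have "r (A k z) = (\<Sum>b\<in>Basis. k * ((z - y) \<bullet> b) * frechet_derivative q (at (A k z)) b)"
    unfolding r_def using Ay[of k z] by (intro sum.cong refl arg_cong2[where f = "(*)"])
     (metis inner_diff_left inner_scaleR_left uminus_add_conv_diff add.commute)
   also have "... = k * (\<Sum>b\<in>Basis. ((z - y) \<bullet> b) * frechet_derivative q (at (A k z)) b)"
    by (simp add: sum_distrib_left mult.assoc)
   finally have "r (A k z) = k * (\<Sum>b\<in>Basis. ((z - y) \<bullet> b) * frechet_derivative q (at (A k z)) b)" .
   thus "(\<Sum>b\<in>Basis. ((h *\<^sub>R (z - y)) \<bullet> b) * frechet_derivative q (at (A k z)) b) = r (A k z) / k * h"
    using that by (simp add: mult.assoc flip: sum_distrib_left)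
  qed
  ultimately show ?thesis by (simp add: has_field_derivative_def)
 qed
 define F where "F k = (LBINT z. v z * q (A k z))" for k
 define G where "G k = (LBINT z. v z * (r (A k z) / k))" for k
 have derF: "(F has_real_derivative G k) (at k within {1..2})" if k: "k \<in> {1..2}" for k unfolding F_def G_def
 proof (rule DERIV_integral_parameter[where B = "max B B'"])
  show "\<bar>r (A k z) / k\<bar> <= max B B'" if "k \<in> {1..2}" for k z
  proof -
   have "\<bar>r (A k z) / k\<bar> <= \<bar>r (A k z)\<bar>" using that by (simp add: divide_le_eq mult_le_cancel_left1)
   also have "... <= B'" by (rule B'(2))
   finally show ?thesis by simp
  qed
  show "(%z. q (A k z)) \<in> borel_measurable lborel" if "k \<in> {1..2}" for k by (rule Am[OF bump_on_measurable[OF q]])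
  show "(%z. r (A k z) / k) \<in> borel_measurable lborel"
   by (rule borel_measurable_divide[OF Am[OF bump_on_measurable[OF rb]] borel_measurable_const])
  show "\<bar>q (A k z)\<bar> <= max B B'" for k z using qB[of "A k z"] by simp
 qed (use v k der0 in simp_all)
 have G: "real d * k ^ (d - 1) * F k + k ^ d * G k = - (k ^ (d - 1) * (LBINT z. (g z \<bullet> (z - y)) * q (A k z)))" if k: "k \<in> {1..2}" for k
 proof -
  define \<Theta> where "\<Theta> b z = (z \<bullet> b + - (y \<bullet> b)) * q (A k z)" for b z
  have qA: "(%z. q (A k z)) \<in> smooth_fun" unfolding A_def by (rule smooth_fun_affine[OF qs])
  \<comment> \<open>The support of the dilated bump is that of \<open>q\<close> contracted towards
    \<open>y\<close> by the factor 1/k; convexity keeps it inside \<open>D\<close>.\<close>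
  have qAb: "(%z. q (A k z)) \<in> bump_on D"
  proof (rule bump_onI[OF qA])
   define S' where "S' = (%w. y + (1/k) *\<^sub>R (w - y)) ` S"
   show "compact S'" unfolding S'_def by (intro compact_continuous_image S(1) continuous_intros)
   show "S' \<subseteq> D"
   proof
    fix z assume "z \<in> S'"
    then obtain w where w: "w \<in> S" "z = y + (1/k) *\<^sub>R (w - y)" unfolding S'_def by blast
    hence "z = (1 - 1/k) *\<^sub>R y + (1/k) *\<^sub>R w" by (simp add: algebra_simps)
    thus "z \<in> D" using y w(1) S(2) k by (auto intro!: convexD_alt[OF D(1)])
   qed
   show "q (A k z) = 0" if "z \<notin> S'" for z
   proof -
    have "z = y + (1/k) *\<^sub>R (A k z - y)" using k unfolding Ay by simp
    hence "A k z \<notin> S" using that unfolding S'_def by blast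
    thus ?thesis using S(3) by blast
   qed
  qed
  have lin: "(%z. z \<bullet> b + - (y \<bullet> b)) \<in> smooth_fun" for b by (intro smooth_fun.add smooth_fun.inner smooth_fun.const)
  have \<Theta>b: "\<Theta> b \<in> bump_on D" for b unfolding \<Theta>_def by (rule bump_on_mult[OF qAb lin])
  have pd: "frechet_derivative (\<Theta> b) (at z) b =
    (z \<bullet> b + - (y \<bullet> b)) * (k * frechet_derivative q (at (A k z)) b) + q (A k z)" if b: "b \<in> Basis" for b z proof -
   have "((%z. z \<bullet> b + - (y \<bullet> b)) has_derivative (%h. h \<bullet> b)) (at z)"
    by (auto intro!: derivative_eq_intros)
   hence "frechet_derivative (%z. z \<bullet> b + - (y \<bullet> b)) (at z) b = 1" using b by (simp add: frechet_derivative_eqI)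
   thus ?thesis unfolding \<Theta>_def using partial_mult[OF lin qA, of b z b] partial_affine[OF qs b, of "(1 - k) *\<^sub>R y" k z]
    by (simp add: A_def)
  qed
  have pds: "(\<Sum>b\<in>Basis. frechet_derivative (\<Theta> b) (at z) b) = real d * q (A k z) + r (A k z)" for z
  proof -
   have "r (A k z) = (\<Sum>b\<in>Basis. (z \<bullet> b + - (y \<bullet> b)) * (k * frechet_derivative q (at (A k z)) b))" unfolding r_def
   proof (intro sum.cong refl)
    fix b :: 'a
    have "A k z \<bullet> b + - (y \<bullet> b) = (A k z - y) \<bullet> b" by (simp add: inner_diff_left)
    thus "(A k z \<bullet> b + - (y \<bullet> b)) * frechet_derivative q (at (A k z)) b =
      (z \<bullet> b + - (y \<bullet> b)) * (k * frechet_derivative q (at (A k z)) b)" unfolding Ay by (simp add: inner_diff_left)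
     qed
   thus ?thesis by (simp add: pd sum.distrib d_def)
  qed
  have vi: "integrable lborel (%z. v z * \<phi> z)" if \<phi>: "\<phi> \<in> bump_on D" for \<phi>
  proof -
   obtain C where "C > 0" "!!x. \<bar>\<phi> x\<bar> <= C" using \<phi> by (rule bump_on_bounded) blast
   thus ?thesis using integrable_times_bounded[OF v, of \<phi> C] bump_on_measurable[OF \<phi>] by (simp add: mult.commute)
  qed
  have gi: "integrable lborel (%z. (g z \<bullet> b) * \<phi> z)" if \<phi>: "\<phi> \<in> bump_on D" for \<phi> b
  proof -
   obtain C where "C > 0" "!!x. \<bar>\<phi> x\<bar> <= C" using \<phi> by (rule bump_on_bounded) blast
   thus ?thesis using integrable_times_bounded[OF integrable_inner_left, OF g, of \<phi> C b] bump_on_measurable[OF \<phi>]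
    by (simp add: mult.commute)
  qed
  have "real d * F k + k * G k = (LBINT z. v z * (real d * q (A k z) + r (A k z)))"
  proof -
   have rA: "integrable lborel (%z. v z * r (A k z))"
    using integrable_times_bounded[OF v Am[OF bump_on_measurable[OF rb]] B'(2)] by (simp add: mult.commute)
   have "G k = (LBINT z. v z * r (A k z)) / k" unfolding G_def by simp
   thus ?thesis unfolding F_def using k vi[OF qAb] rA by (simp add: distrib_left mult.left_commute)
  qed
  also have "... = (LBINT z. (\<Sum>b\<in>Basis. v z * frechet_derivative (\<Theta> b) (at z) b))" by (simp add: pds flip: sum_distrib_left)
  also have "... = (\<Sum>b\<in>Basis. LBINT z. v z * frechet_derivative (\<Theta> b) (at z) b)"
   by (rule Bochner_Integration.integral_sum) (rule vi, rule bump_on_partial[OF \<Theta>b])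
  also have "... = (\<Sum>b\<in>Basis. - (LBINT z. (g z \<bullet> b) * \<Theta> b z))"
   using wg \<Theta>b unfolding has_wgrad_def by (intro sum.cong) auto
  also have "... = - (LBINT z. (\<Sum>b\<in>Basis. (g z \<bullet> b) * \<Theta> b z))"
   unfolding sum_negf by (subst Bochner_Integration.integral_sum) (rule gi, rule \<Theta>b, simp)
  also have "(%z. \<Sum>b\<in>Basis. (g z \<bullet> b) * \<Theta> b z) = (%z. (g z \<bullet> (z - y)) * q (A k z))"
   by (simp add: \<Theta>_def euclidean_inner[of "g _" "_ - y"] inner_diff_left sum_distrib_right mult.assoc)
  finally have *: "real d * F k + k * G k = - (LBINT z. (g z \<bullet> (z - y)) * q (A k z))" .
  have "k ^ d = k ^ (d - 1) * k" using d1 by (simp flip: power_Suc2)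
  hence "real d * k ^ (d - 1) * F k + k ^ d * G k = k ^ (d - 1) * (real d * F k + k * G k)" by (simp add: algebra_simps)
  thus ?thesis unfolding * by simp
 qed
 have derf: "((%k. k ^ d * F k) has_real_derivative - (k ^ (d - 1) * (LBINT z. (g z \<bullet> (z - y)) * q (A k z)))) (at k within {1..2})"
  if "k \<in> {1..2}" for k unfolding G[OF that, symmetric] by (auto intro!: derivative_eq_intros derF that)
 have bound: "\<bar>- (k ^ (d - 1) * (LBINT z. (g z \<bullet> (z - y)) * q (A k z)))\<bar> <=
   2 ^ d * \<delta> * B * (LBINT z. ind D z * norm (g z))" if k: "k \<in> {1..2}" for k proof -
  have ng: "integrable lborel (%z. ind D z * norm (g z))" using integrable_mult_indicator[OF D(2) integrable_norm[OF g]] by simp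
  have "\<bar>LBINT z. (g z \<bullet> (z - y)) * q (A k z)\<bar> <= (LBINT z. (\<delta> * B) * (ind D z * norm (g z)))"
  proof (rule abs_integral_le, goal_cases)
   case 1 thus ?case using ng by simp
  next
   case 2
   have "\<bar>(g z \<bullet> (z - y)) * q (A k z)\<bar> <= (\<delta> * B) * (ind D z * norm (g z))" for z
   proof (cases "A k z \<in> D")
    case True
    have "z = (1 - 1/k) *\<^sub>R y + (1/k) *\<^sub>R A k z" using k by (simp add: A_def algebra_simps)
    hence zD: "z \<in> D" using k convexD_alt[OF D(1) y True, of "1/k"] by simp
    have "\<bar>g z \<bullet> (z - y)\<bar> * \<bar>q (A k z)\<bar> <= (norm (g z) * \<delta>) * B"
     using order.trans[OF Cauchy_Schwarz_ineq2[of "g z" "z - y"] mult_left_mono[OF diam[OF zD y] norm_ge_zero]]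
      qB[of "A k z"] \<delta>0 by (intro mult_mono) auto
    thus ?thesis using zD by (simp add: abs_mult mult_ac)
   next
    case False
    thus ?thesis using bump_on_outside[OF q False] \<delta>0 B0 by simp
   qed
   thus ?case by blast
  qed
  hence 1: "\<bar>LBINT z. (g z \<bullet> (z - y)) * q (A k z)\<bar> <= \<delta> * B * (LBINT z. ind D z * norm (g z))" by simp
  have "k ^ (d - 1) <= 2 ^ (d - 1)" using k by (intro power_mono) auto
  also have "... <= 2 ^ d" by simp
  finally have "k ^ (d - 1) <= 2 ^ d" .
  hence "k ^ (d - 1) * \<bar>LBINT z. (g z \<bullet> (z - y)) * q (A k z)\<bar> <=
    2 ^ d * (\<delta> * B * (LBINT z. ind D z * norm (g z)))" using 1 by (intro mult_mono) auto
  moreover have "\<bar>k ^ (d - 1)\<bar> = k ^ (d - 1)" using k by simp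
  ultimately show ?thesis by (simp only: abs_minus_cancel abs_mult)
 qed
 have "norm (2 ^ d * F 2 - 1 ^ d * F 1) <= 2 ^ d * \<delta> * B * (LBINT z. ind D z * norm (g z)) * norm (2 - (1::real))"
  by (rule field_differentiable_bound[of "{1..2}" "%k. k ^ d * F k"]) (use derf bound in auto)
 moreover have "A 2 z = 2 *\<^sub>R z - y" "A 1 z = z" for z by (simp_all add: A_def)
 ultimately show ?thesis by (simp add: F_def d_def)
qed

lemma lborel_integral_reflect:
 fixes f :: "'a::euclidean_space => real"
 assumes [measurable]: "f \<in> borel_measurable borel"
 shows "(LBINT y. f (c - y)) = (LBINT y. f y)"
proof -
 have "(LBINT y. f y) = (\<integral>y. f y \<partial>distr lborel borel (%x. c + (-1) *\<^sub>R x))"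
  using lborel_affine[of "-1" c] by (simp add: density_1)
 also have "... = (LBINT y. f (c + (-1) *\<^sub>R y))" by (rule integral_distr) auto
 finally show ?thesis by simp
qed

lemma bump_on_integrable:
 assumes "\<phi> \<in> bump_on D" shows "integrable lborel \<phi>"
proof -
 obtain S where S: "\<phi> \<in> smooth_fun" "compact S" "S \<subseteq> D" "\<forall>x. x \<notin> S --> \<phi> x = 0" using assms by (rule bump_onE)
 have "integrable lborel (%x. ind S x *\<^sub>R \<phi> x)" by (rule borel_integrable_compact[OF S(2) smooth_fun_continuous[OF S(1)]])
 moreover have "(%x. ind S x *\<^sub>R \<phi> x) = \<phi>" using S(4) by (auto simp: indicator_def fun_eq_iff)
 ultimately show ?thesis by simp
qed

text \<open>The dilation bound is integrated against \<open>\<psi> y\<close>. Up to the factor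
  \<open>2 ^ d\<close>, \<open>J q \<psi>\<close> is the double integral of \<open>v\<close> at the
  midpoint of \<open>y\<close> and \<open>w\<close>, weighted by \<open>q w\<close> and
  \<open>\<psi> y\<close>.\<close>

lemma weak_poincare_bump_half:
 fixes v :: "'a::euclidean_space => real"
 assumes wg: "has_wgrad D v g" and D: "convex D" "D \<in> sets lborel" "emeasure lborel D < \<infinity>"
  and diam: "!!x x'. x \<in> D ==> x' \<in> D ==> norm (x - x') <= \<delta>"
  and q: "q \<in> bump_on D" and \<psi>: "\<psi> \<in> bump_on D"
  and B1: "!!x. \<bar>q x\<bar> <= B1" and B2: "!!x. \<bar>\<psi> x\<bar> <= B2"
 defines "J == %q \<psi>. LBINT z. v z * (LBINT y. q (2 *\<^sub>R z - y) * \<psi> y)"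
 shows "\<bar>2 ^ DIM('a) * J q \<psi> - (LBINT y. \<psi> y) * (LBINT z. v z * q z)\<bar> <=
   2 ^ DIM('a) * \<delta> * B1 * B2 * vol D * (LBINT z. ind D z * norm (g z))" proof -
 have v: "integrable lborel v" and g: "integrable lborel g" using wg unfolding has_wgrad_def by auto
 have vm[measurable]: "v \<in> borel_measurable borel" using borel_measurable_integrable[OF v] by simp
 have qm[measurable]: "q \<in> borel_measurable borel" and \<psi>m[measurable]: "\<psi> \<in> borel_measurable borel"
  using q \<psi> bump_on_measurable by auto
 have \<psi>i: "integrable lborel \<psi>" using \<psi> by (rule bump_on_integrable)
 have B10: "0 <= B1" and B20: "0 <= B2" using B1 B2 abs_ge_zero order.trans by metis+
 define H where "H = (%(z, y). v z * (q (2 *\<^sub>R z - y) * \<psi> y))"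
 have qp: "integrable lborel (%y. q (2 *\<^sub>R z - y) * \<psi> y)" for z
  using integrable_times_bounded[OF \<psi>i, of "%y. q (2 *\<^sub>R z - y)" B1] B1 by simp
 have Hm: "H \<in> borel_measurable (lborel \<Otimes>\<^sub>M lborel)" unfolding H_def by measurable
 have H: "integrable (lborel \<Otimes>\<^sub>M lborel) H"
 proof (rule lborel_pair.Fubini_integrable[OF Hm])
  have le: "(LBINT y. norm (H (z, y))) <= \<bar>v z\<bar> * (B1 * (LBINT y. \<bar>\<psi> y\<bar>))" for z
  proof -
   have "(LBINT y. norm (H (z, y))) = \<bar>v z\<bar> * (LBINT y. \<bar>q (2 *\<^sub>R z - y) * \<psi> y\<bar>)" by (simp add: H_def abs_mult)
   also have "(LBINT y. \<bar>q (2 *\<^sub>R z - y) * \<psi> y\<bar>) <= (LBINT y. B1 * \<bar>\<psi> y\<bar>)"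
    proof (rule integral_mono[OF integrable_abs[OF qp]])
     show "integrable lborel (%y. B1 * \<bar>\<psi> y\<bar>)" using \<psi>i by simp
    qed (simp add: abs_mult mult_right_mono B1)
   finally show ?thesis by (simp add: mult_left_mono)
  qed
  show "integrable lborel (%z. LBINT y. norm (H (z, y)))"
  proof (rule Bochner_Integration.integrable_bound)
   show "integrable lborel (%z. \<bar>v z\<bar> * (B1 * (LBINT y. \<bar>\<psi> y\<bar>)))" using v by simp
   show "(%z. LBINT y. norm (H (z, y))) \<in> borel_measurable lborel" using Hm by measurable
   show "AE z in lborel. norm (LBINT y. norm (H (z, y))) <= norm (\<bar>v z\<bar> * (B1 * (LBINT y. \<bar>\<psi> y\<bar>)))"
    using le B10 by (intro AE_I2) (simp)
  qed
  show "AE z in lborel. integrable lborel (%y. H (z, y))" using qp by (intro AE_I2) (simp add: H_def)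
 qed
 have swap: "(LBINT y. \<psi> y * (LBINT z. v z * q (2 *\<^sub>R z - y))) = J q \<psi>"
 proof -
  have "(LBINT y. (LBINT z. v z * (q (2 *\<^sub>R z - y) * \<psi> y))) = (LBINT z. (LBINT y. v z * (q (2 *\<^sub>R z - y) * \<psi> y)))"
   by (rule lborel_pair.Fubini_integral) (use H in \<open>simp add: H_def\<close>)
  moreover have "(LBINT z. v z * (q (2 *\<^sub>R z - y) * \<psi> y)) = \<psi> y * (LBINT z. v z * q (2 *\<^sub>R z - y))" for y
   by (subst integral_mult_right_zero[symmetric]) (simp add: mult_ac)
  ultimately show ?thesis unfolding J_def by simp
 qed
 have yi: "integrable lborel (%y. \<psi> y * (LBINT z. v z * q (2 *\<^sub>R z - y)))"
 proof -
  have "integrable lborel (%y. LBINT z. H (z, y))" using lborel_pair.integrable_snd[of "%z y. H (z, y)"] H by simp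
  moreover have "(LBINT z. H (z, y)) = \<psi> y * (LBINT z. v z * q (2 *\<^sub>R z - y))" for y
   unfolding H_def by (subst integral_mult_right_zero[symmetric]) (simp add: mult_ac)
  ultimately show ?thesis by simp
 qed
 define R where "R = 2 ^ DIM('a) * \<delta> * B1 * (LBINT z. ind D z * norm (g z))"
 define I where "I = (LBINT z. v z * q z)"
 have "2 ^ DIM('a) * J q \<psi> - (LBINT y. \<psi> y) * I =
   (LBINT y. 2 ^ DIM('a) * (\<psi> y * (LBINT z. v z * q (2 *\<^sub>R z - y))) - \<psi> y * I)" using yi \<psi>i by (simp add: swap)
 also have "\<bar>...\<bar> <= (LBINT y. ind D y * (B2 * R))"
 proof (rule abs_integral_le)
  show "integrable lborel (%y. ind D y * (B2 * R))" using D(2,3) by (intro integrable_mult_left integrable_real_indicator) auto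
  show "AE y in lborel. \<bar>2 ^ DIM('a) * (\<psi> y * (LBINT z. v z * q (2 *\<^sub>R z - y))) - \<psi> y * I\<bar> <= ind D y * (B2 * R)"
  proof (rule AE_I2)
   fix y
   show "\<bar>2 ^ DIM('a) * (\<psi> y * (LBINT z. v z * q (2 *\<^sub>R z - y))) - \<psi> y * I\<bar> <= ind D y * (B2 * R)"
   proof (cases "y \<in> D")
    case True
    have "\<bar>2 ^ DIM('a) * (\<psi> y * (LBINT z. v z * q (2 *\<^sub>R z - y))) - \<psi> y * I\<bar> =
      \<bar>\<psi> y\<bar> * \<bar>2 ^ DIM('a) * (LBINT z. v z * q (2 *\<^sub>R z - y)) - I\<bar>" by (simp add: algebra_simps flip: abs_mult)
    also have "... <= B2 * R" unfolding R_def I_def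
     by (intro mult_mono B2 dilated_bump_integral_bound[OF wg D(1,2) diam q B1 True] B20) auto
    finally show ?thesis using True by simp
   next
    case False
    thus ?thesis using bump_on_outside[OF \<psi> False] by simp
   qed
  qed
 qed

 finally show ?thesis by (simp add: I_def R_def mult_ac)
qed

text \<open>The reflection of \<open>y\<close> at \<open>z\<close> shows that \<open>J\<close> is
  symmetric in \<open>q\<close> and \<open>\<psi>\<close>. The two half estimates thus compare both
  products with the same number, and the triangle inequality doubles the constant.\<close>

lemma weak_poincare_bump:
 fixes v :: "'a::euclidean_space => real"
 assumes wg: "has_wgrad D v g" and D: "convex D" "D \<in> sets lborel" "emeasure lborel D < \<infinity>"
  and diam: "!!x x'. x \<in> D ==> x' \<in> D ==> norm (x - x') <= \<delta>"
  and q: "q \<in> bump_on D" and \<psi>: "\<psi> \<in> bump_on D"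
  and B1: "!!x. \<bar>q x\<bar> <= B1" and B2: "!!x. \<bar>\<psi> x\<bar> <= B2"
 shows "\<bar>(LBINT z. v z * q z) * (LBINT z. \<psi> z) - (LBINT z. v z * \<psi> z) * (LBINT z. q z)\<bar> <=
   2 ^ (DIM('a) + 1) * \<delta> * B1 * B2 * vol D * (LBINT z. ind D z * norm (g z))" proof -
 have qm[measurable]: "q \<in> borel_measurable borel" and \<psi>m[measurable]: "\<psi> \<in> borel_measurable borel"
  using q \<psi> bump_on_measurable by auto
 have "(LBINT y. q (2 *\<^sub>R z - y) * \<psi> y) = (LBINT y. \<psi> (2 *\<^sub>R z - y) * q y)" for z
  using lborel_integral_reflect[of "%y. \<psi> (2 *\<^sub>R z - y) * q y" "2 *\<^sub>R z"] by (simp add: mult.commute)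
 thus ?thesis using weak_poincare_bump_half[OF wg D diam q \<psi> B1 B2] weak_poincare_bump_half[OF wg D diam \<psi> q B2 B1]
  by (simp add: mult_ac abs_le_iff)
qed

text \<open>Pointwise limits of uniformly bounded bump functions inherit the inequality; they include
 polynomials cut off to a simplex and indicators of balls.\<close>

definition bump_limit :: "'a::euclidean_space set => real => ('a => real) => bool" where
 "bump_limit D B q \<longleftrightarrow> (\<exists>\<phi>::nat => 'a => real. (\<forall>n. \<phi> n \<in> bump_on D \<and> (\<forall>x. \<bar>\<phi> n x\<bar> <= B)) \<and>
   (\<forall>x. (%n. \<phi> n x) \<longlonglongrightarrow> q x))"

lemma bump_limit_integral:
 assumes v: "integrable lborel v" and D: "D \<in> sets lborel" "emeasure lborel D < \<infinity>"
  and \<phi>: "!!n. \<phi> n \<in> bump_on D" "!!n x. \<bar>\<phi> n x\<bar> <= B" "!!x. (%n::nat. \<phi> n x) \<longlonglongrightarrow> q x"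
 shows "(%n. LBINT z. v z * \<phi> n z) \<longlonglongrightarrow> (LBINT z. v z * q z)"
  and "(%n. LBINT z. \<phi> n z) \<longlonglongrightarrow> (LBINT z. q z)"
proof -
 have m: "\<phi> n \<in> borel_measurable lborel" for n using bump_on_measurable[OF \<phi>(1)] by simp
 have qm: "q \<in> borel_measurable lborel" using m \<phi>(3) by (rule borel_measurable_LIMSEQ_metric)
 have vm: "v \<in> borel_measurable lborel" using v by auto
 show "(%n. LBINT z. v z * \<phi> n z) \<longlonglongrightarrow> (LBINT z. v z * q z)"
 proof (rule integral_dominated_convergence[where w = "%z. B * \<bar>v z\<bar>"])
  show "AE z in lborel. (%n. v z * \<phi> n z) \<longlonglongrightarrow> v z * q z" by (intro AE_I2 tendsto_mult_left \<phi>(3))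
  show "AE z in lborel. norm (v z * \<phi> n z) <= B * \<bar>v z\<bar>" for n
   using \<phi>(2)[of n] by (intro AE_I2) (simp add: abs_mult mult.commute[of "\<bar>v _\<bar>"] mult_right_mono)
 qed (use v m qm vm in auto)
 show "(%n. LBINT z. \<phi> n z) \<longlonglongrightarrow> (LBINT z. q z)"
 proof (rule integral_dominated_convergence[where w = "%z. B * ind D z"])
  show "integrable lborel (%z. B * ind D z)" using D by simp
  show "AE z in lborel. (%n. \<phi> n z) \<longlonglongrightarrow> q z" by (intro AE_I2 \<phi>(3))
  show "AE z in lborel. norm (\<phi> n z) <= B * ind D z" for n
  proof (rule AE_I2)
   fix z show "norm (\<phi> n z) <= B * ind D z"
    using \<phi>(2)[of n z] bump_on_outside[OF \<phi>(1)[of n], of z] by (cases "z \<in> D") auto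
  qed
 qed (use m qm in auto)
qed

text \<open>The product form, without division by the integrals, admits a \<open>q\<close> of
  integral zero; polynomial test functions may have one.\<close>

lemma weak_poincare:
 fixes v :: "'a::euclidean_space => real"
 assumes wg: "has_wgrad D v g" and D: "convex D" "D \<in> sets lborel" "emeasure lborel D < \<infinity>"
  and diam: "!!x x'. x \<in> D ==> x' \<in> D ==> norm (x - x') <= \<delta>"
  and q: "bump_limit D B1 q" and \<psi>: "bump_limit D B2 \<psi>"
 shows "\<bar>(LBINT z. v z * q z) * (LBINT z. \<psi> z) - (LBINT z. v z * \<psi> z) * (LBINT z. q z)\<bar> <=
   2 ^ (DIM('a) + 1) * \<delta> * B1 * B2 * vol D * (LBINT z. ind D z * norm (g z))" proof -
 have v: "integrable lborel v" using wg unfolding has_wgrad_def by auto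
 obtain \<phi>1 where 1: "!!n::nat. \<phi>1 n \<in> bump_on D" "!!n x. \<bar>\<phi>1 n x\<bar> <= B1" "!!x. (%n. \<phi>1 n x) \<longlonglongrightarrow> q x"
  using q unfolding bump_limit_def by blast
 obtain \<phi>2 where 2: "!!n::nat. \<phi>2 n \<in> bump_on D" "!!n x. \<bar>\<phi>2 n x\<bar> <= B2" "!!x. (%n. \<phi>2 n x) \<longlonglongrightarrow> \<psi> x"
  using \<psi> unfolding bump_limit_def by blast
 note lim1 = bump_limit_integral[OF v D(2,3) 1] and lim2 = bump_limit_integral[OF v D(2,3) 2]
 have "(%n. \<bar>(LBINT z. v z * \<phi>1 n z) * (LBINT z. \<phi>2 n z) - (LBINT z. v z * \<phi>2 n z) * (LBINT z. \<phi>1 n z)\<bar>)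
   \<longlonglongrightarrow> \<bar>(LBINT z. v z * q z) * (LBINT z. \<psi> z) - (LBINT z. v z * \<psi> z) * (LBINT z. q z)\<bar>"
  by (intro tendsto_intros lim1 lim2)
 thus ?thesis by (rule LIMSEQ_le_const2) (use weak_poincare_bump[OF wg D diam 1(1) 2(1) 1(2) 2(2)] in blast)
qed

lemma has_wgrad_mono: "has_wgrad Om v g ==> D \<subseteq> Om ==> has_wgrad D v g" unfolding has_wgrad_def using bump_on_mono by blast

lemma bump_limit_cutoff:
 assumes D: "has_cutoffs D" and E: "D \<subseteq> E" and p: "p \<in> smooth_fun" and B: "!!x. x \<in> D ==> \<bar>p x\<bar> <= B" "0 <= B"
 shows "bump_limit E B (%x. ind D x * p x)"
proof -
 obtain \<phi> where \<phi>: "!!n. \<phi> n \<in> bump_on D" "!!n x. 0 <= \<phi> n x" "!!n x. \<phi> n x <= 1"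
  "!!x. (%n. \<phi> n x) \<longlonglongrightarrow> ind D x" using D by (rule has_cutoffsE) blast
 show ?thesis unfolding bump_limit_def
 proof (intro exI[of _ "%n x. p x * \<phi> n x"] conjI allI)
  fix n x
  show "(%x. p x * \<phi> n x) \<in> bump_on E" using bump_on_mult[OF \<phi>(1) p] bump_on_mono E by blast
  show "\<bar>p x * \<phi> n x\<bar> <= B"
  proof (cases "x \<in> D")
   case True
   have "\<bar>p x\<bar> * \<bar>\<phi> n x\<bar> <= B * 1" using B True \<phi>(2,3)[of n x] by (intro mult_mono) auto
   thus ?thesis by (simp add: abs_mult)
  next
   case False
   thus ?thesis using bump_on_outside[OF \<phi>(1) False] B(2) by simp
  qed
  show "(%n. p x * \<phi> n x) \<longlonglongrightarrow> ind D x * p x"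
   using tendsto_mult_left[OF \<phi>(4), of "p x" x] by (simp add: mult.commute)
 qed
qed

section \<open>Weak gradients of piecewise Lipschitz functions\<close>

lemma lborel_integral_shift:
 fixes f :: "'a::euclidean_space => real"
 assumes [measurable]: "f \<in> borel_measurable borel"
 shows "(LBINT y. f (c + y)) = (LBINT y. f y)"
proof -
 have "(LBINT y. f y) = (\<integral>y. f y \<partial>distr lborel borel (%x. c + 1 *\<^sub>R x))"
  using lborel_affine[of 1 c] by (simp add: density_1)
 also have "... = (LBINT y. f (c + 1 *\<^sub>R y))" by (rule integral_distr) auto
 finally show ?thesis by simp
qed

lemma lborel_integrable_shift:
 fixes f :: "'a::euclidean_space => real"
 assumes "integrable lborel f" shows "integrable lborel (%y. f (y + c))"
proof -
 have "lborel = distr lborel borel (%x. c + 1 *\<^sub>R x)" using lborel_affine[of 1 c] by (simp add: density_1)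
 hence "integrable (distr lborel borel (%x. c + 1 *\<^sub>R x)) f" using assms by simp
 hence "integrable lborel (%y. f (c + 1 *\<^sub>R y))"
  by (subst (asm) integrable_distr_eq) (use assms in \<open>auto dest: borel_measurable_integrable\<close>)
 thus ?thesis by (simp add: add.commute)
qed

text \<open>In the parameter of the segment the simplices become finitely many closed sets covering
  [0, 1], on each of which the composition is Lipschitz. Continuity of \<open>w\<close> is a
  consequence, not an assumption.\<close>

lemma piecewise_lipschitz_segment:
 fixes w :: "'a::euclidean_space => real"
 assumes fin: "finite \<T>" and cl: "!!T. T \<in> \<T> ==> closed T" and cov: "Om \<subseteq> \<Union>\<T>"
  and lip: "!!T x y. T \<in> \<T> ==> x \<in> Om \<inter> T ==> y \<in> Om \<inter> T ==> \<bar>w x - w y\<bar> <= L * norm (x - y)"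
  and L: "0 <= L" and seg: "closed_segment x y \<subseteq> Om"
 shows "\<bar>w x - w y\<bar> <= L * norm (x - y)"
proof -
 define P where "P t = x + t *\<^sub>R (y - x)" for t :: real
 define U where "U T = {0..1} \<inter> P -` T" for T
 have POm: "P t \<in> Om" if "t \<in> {0..1}" for t
 proof -
  have "P t = (1 - t) *\<^sub>R x + t *\<^sub>R y" by (simp add: P_def algebra_simps)
  hence "P t \<in> closed_segment x y" unfolding closed_segment_def using that by auto
  thus ?thesis using seg by blast
 qed
 have "(L * norm (x - y))-lipschitz_on {0..1} (%t. w (P t))"
 proof (rule lipschitz_on_closed_Union[where U = U and I = \<T>])
  show "(L * norm (x - y))-lipschitz_on (U T) (%t. w (P t))" if T: "T \<in> \<T>" for T
  proof (rule lipschitz_onI)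
   fix s t assume st: "s \<in> U T" "t \<in> U T"
   hence "P s \<in> Om \<inter> T" "P t \<in> Om \<inter> T" using POm by (auto simp: U_def)
   hence "\<bar>w (P s) - w (P t)\<bar> <= L * norm (P s - P t)" by (rule lip[OF T])
   moreover have "P s - P t = (s - t) *\<^sub>R (y - x)" by (simp add: P_def algebra_simps)
   ultimately show "dist (w (P s)) (w (P t)) <= L * norm (x - y) * dist s t" by (simp add: dist_real_def norm_minus_commute mult_ac)
  qed (use L in simp)
  show "closed (U T)" if "T \<in> \<T>" for T unfolding U_def P_def by (intro continuous_closed_preimage continuous_intros cl that)
  show "{0..1} \<subseteq> (\<Union>T\<in>\<T>. U T)"
  proof
   fix t :: real assume t: "t \<in> {0..1}"
   then obtain T where "T \<in> \<T>" "P t \<in> T" using POm cov by blast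
   with t show "t \<in> (\<Union>T\<in>\<T>. U T)" by (auto simp: U_def)
  qed
 qed (use fin L in auto)
 from lipschitz_onD[OF this, of 0 1] show ?thesis by (simp add: P_def dist_real_def)
qed

lemma locally_integrableI:
 assumes "!!S. compact S ==> S \<subseteq> Om ==> integrable lborel (%x. ind S x *\<^sub>R f x)"
 shows "locally_integrable Om f" unfolding locally_integrable_def
proof (intro allI impI)
 fix S assume S: "compact S \<and> S \<subseteq> Om"
 hence i: "integrable lborel (%x. ind S x *\<^sub>R f x)" using assms by blast
 have "integrable lebesgue (%x. ind S x *\<^sub>R f x)" using i by (subst integrable_completion) auto
 thus "integrable (lebesgue_on S) f" using S lmeasurable_compact[of S] by (subst integrable_restrict_space) auto
qed

lemma is_weak_gradient_lipschitz:
 fixes w :: "'a::euclidean_space => real"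
 assumes op: "open Om" and cont: "continuous_on Om w"
  and lip: "!!x y. closed_segment x y \<subseteq> Om ==> \<bar>w x - w y\<bar> <= L * norm (x - y)" and L: "0 <= L"
  and Gm: "G \<in> borel_measurable borel" and Gb: "!!x. norm (G x) <= L'"
  and der: "AE x\<in>Om in lborel. (w has_derivative (%h. G x \<bullet> h)) (at x)"
 shows "is_weak_gradient Om w G" unfolding is_weak_gradient_def
proof (intro conjI allI impI ballI)
 show "locally_integrable Om w" using cont by (intro locally_integrableI borel_integrable_compact) (auto intro: continuous_on_subset)
 show "locally_integrable Om G"
 proof (rule locally_integrableI)
  fix S :: "'a set" assume S: "compact S"
  hence Sb: "S \<in> sets lborel" using compact_imp_closed[of S] by simp
  have "integrable lborel (%x. L' * ind S x)"
   using emeasure_compact_finite[of S] S Sb by (intro integrable_mult_right integrable_real_indicator) auto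
  thus "integrable lborel (%x. ind S x *\<^sub>R G x)"
  proof (rule Bochner_Integration.integrable_bound)
   show "(%x. ind S x *\<^sub>R G x) \<in> borel_measurable lborel"
    using Sb Gm by (intro borel_measurable_scaleR borel_measurable_indicator) auto
   have "norm (G x) <= \<bar>L'\<bar>" for x using Gb[of x] by linarith
   thus "AE x in lborel. norm (ind S x *\<^sub>R G x) <= norm (L' * ind S x)" by (intro AE_I2) (auto simp: indicator_def)
  qed
 qed
next
 fix \<phi> :: "'a => real" and b :: 'a assume tf: "test_function Om \<phi>" and b: "b \<in> Basis"
 obtain S where S: "compact S" "S \<subseteq> Om" "!!x. x \<notin> S ==> \<phi> x = 0" using tf unfolding test_function_def by blast
 have cS: "open (- S)" using compact_imp_closed[OF S(1)] by (simp add: open_Compl)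
 define D where "D x = frechet_derivative \<phi> (at x) b" for x
 have "Ck 1 \<phi>" using tf unfolding test_function_def by blast
 hence dif: "!!x. (\<phi> has_derivative frechet_derivative \<phi> (at x)) (at x)" and contD: "continuous_on UNIV D"
  and cont\<phi>: "continuous_on UNIV \<phi>"
  using b by (auto simp: D_def[abs_def] frechet_derivative_works[symmetric] differentiable_imp_continuous_within
    continuous_on_eq_continuous_within)
 have D0: "D x = 0" if "x \<notin> S" for x unfolding D_def by (rule frechet_derivative_zero_open[OF cS]) (use S(3) that in auto)
 have bounded: "\<exists>B. \<forall>x. \<bar>f x\<bar> <= B" if c: "continuous_on UNIV f" and 0: "!!x. x \<notin> S ==> f x = 0" for f :: "'a => real"
 proof -
  have "compact (f ` S)" using c S(1) by (intro compact_continuous_image) (auto intro: continuous_on_subset)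
  then obtain B where "\<forall>y\<in>f ` S. norm y <= B" using compact_imp_bounded bounded_iff by metis
  hence "\<bar>f x\<bar> <= \<bar>B\<bar>" for x using 0[of x] by (cases "x \<in> S") fastforce+
  thus ?thesis by blast
 qed
 obtain B where B: "!!x. \<bar>D x\<bar> <= B" using bounded[OF contD D0] by blast
 obtain C where C: "!!x. \<bar>\<phi> x\<bar> <= C" using bounded[OF cont\<phi> S(3)] by blast
 have line: "((%t. f (x + t *\<^sub>R b)) has_real_derivative f' b) (at t)"
  if "(f has_derivative f') (at (x + t *\<^sub>R b))" for f f' x t
 proof -
  have "((%t. x + t *\<^sub>R b) has_derivative (%h. h *\<^sub>R b)) (at t)" by (auto intro!: derivative_eq_intros)
  from has_derivative_compose[OF this that] show ?thesis unfolding has_field_derivative_def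
   by (rule has_derivative_eq_rhs) (simp add: fun_eq_iff linear_cmul[OF has_derivative_linear[OF that]])
 qed
 \<comment> \<open>For steps up to \<open>\<delta>\<close> a quotient can differ from 0 only if
   \<open>x\<close> or the shifted point lies in the support, hence only on the compact set
   \<open>S'\<close>; there the connecting segment stays in \<open>Om\<close>.\<close>
 obtain \<delta> where \<delta>: "\<delta> > 0" "(\<Union>x\<in>S. cball x \<delta>) \<subseteq> Om"
  using compact_subset_open_imp_cball_epsilon_subset[OF S(1) op S(2)] by blast
 define S' where "S' = {x + y |x y. x \<in> S \<and> y \<in> cball 0 \<delta>}"
 have S': "compact S'" unfolding S'_def using S(1) by (intro compact_sums) auto
 have S'Om: "S' \<subseteq> Om" using \<delta>(2) unfolding S'_def by (force simp: dist_norm)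
 have in_S': "x + c *\<^sub>R b \<in> S'" if "x \<in> S" "\<bar>c\<bar> <= \<delta>" for x c
  using that b unfolding S'_def by (intro CollectI exI[of _ x] exI[of _ "c *\<^sub>R b"]) simp
 obtain E where E: "!!x. x \<in> S' ==> \<bar>w x\<bar> <= E"
  using compact_imp_bounded[OF compact_continuous_image[OF continuous_on_subset[OF cont S'Om] S']] unfolding bounded_iff by auto
 define M where "M = B * E + C * L"
 define W where "W x = ind S x * w x" for x
 have Wi: "integrable lborel W" using borel_integrable_compact[OF S(1) continuous_on_subset[OF cont S(2)]] by (simp add: W_def[abs_def])
 have \<phi>m: "\<phi> \<in> borel_measurable borel" and Dm: "D \<in> borel_measurable borel"
  using cont\<phi> contD by (auto intro: borel_measurable_continuous_onI)
 define F where "F x = \<phi> x * w x" for x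
 have "F = (%x. \<phi> x * W x)" using S(3) by (auto simp: F_def W_def indicator_def fun_eq_iff)
 hence Fi: "integrable lborel F" using integrable_times_bounded[OF Wi _ C] \<phi>m by simp
 have WDi: "integrable lborel (%x. D x * W x)" using integrable_times_bounded[OF Wi _ B] Dm by simp
 have "integrable lborel (%x. ind S x *\<^sub>R \<phi> x)"
  using cont\<phi> by (intro borel_integrable_compact S(1)) (auto intro: continuous_on_subset)
 moreover have "(%x. ind S x *\<^sub>R \<phi> x) = \<phi>" using S(3) by (auto simp: indicator_def fun_eq_iff)
 ultimately have \<phi>i: "integrable lborel \<phi>" by simp
 have "\<bar>G x \<bullet> b\<bar> <= L'" for x using Gb[of x] Basis_le_norm[OF b, of "G x"] by linarith
 from integrable_times_bounded[OF \<phi>i _ this] have Gi: "integrable lborel (%x. (G x \<bullet> b) * \<phi> x)" using Gm by simp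
 define \<tau> where "\<tau> n = \<delta> / real (Suc n)" for n
 have \<tau>: "0 < \<tau> n" "\<tau> n <= \<delta>" for n using \<delta>(1) by (auto simp: \<tau>_def divide_le_eq)
 have \<tau>at: "filterlim \<tau> (at 0) sequentially" unfolding \<tau>_def using \<delta>(1) by real_asymp
 have lim: "(%n. LBINT x. (F (x + \<tau> n *\<^sub>R b) - F x) / \<tau> n) \<longlonglongrightarrow> (LBINT x. D x * W x + (G x \<bullet> b) * \<phi> x)"
 proof (rule integral_dominated_convergence[where w = "%x. M * ind S' x"])
  show "integrable lborel (%x. M * ind S' x)" using emeasure_compact_finite[OF S'] compact_imp_closed[OF S']
   by (intro integrable_mult_right integrable_real_indicator) auto
  show "(%x. D x * W x + (G x \<bullet> b) * \<phi> x) \<in> borel_measurable lborel" using WDi Gi by auto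
  show "(%x. (F (x + \<tau> n *\<^sub>R b) - F x) / \<tau> n) \<in> borel_measurable lborel" for n
   using lborel_integrable_shift[OF Fi] Fi by (intro borel_measurable_divide borel_measurable_diff) auto
  show "AE x in lborel. (%n. (F (x + \<tau> n *\<^sub>R b) - F x) / \<tau> n) \<longlonglongrightarrow> D x * W x + (G x \<bullet> b) * \<phi> x"
   using der
  proof eventually_elim
   case (elim x)
   have "\<exists>F'. (F has_derivative F') (at x) \<and> F' b = D x * W x + (G x \<bullet> b) * \<phi> x"
   proof (cases "x \<in> S")
    case True
    hence "(w has_derivative (%h. G x \<bullet> h)) (at x)" using elim S(2) by blast
    from has_derivative_mult[OF dif this]
    have "(F has_derivative (%h. \<phi> x * (G x \<bullet> h) + frechet_derivative \<phi> (at x) h * w x)) (at x)"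
     by (simp add: F_def[abs_def])
    thus ?thesis using True by (intro exI[of _ "%h. \<phi> x * (G x \<bullet> h) + frechet_derivative \<phi> (at x) h * w x"]) (simp add: D_def W_def)
   next
    case False
    have "(F has_derivative (%h. 0)) (at x)"
     by (rule has_derivative_transform_within_open[OF has_derivative_const cS]) (use S(3) False in \<open>auto simp: F_def\<close>)
    thus ?thesis using D0[OF False] S(3)[OF False] by auto
   qed
   then obtain F' where F': "(F has_derivative F') (at (x + 0 *\<^sub>R b))" "F' b = D x * W x + (G x \<bullet> b) * \<phi> x" by auto
   from filterlim_compose[OF line[OF F'(1), unfolded has_field_derivative_iff] \<tau>at] show ?case using F'(2) by simp
  qed
  show "AE x in lborel. norm ((F (x + \<tau> n *\<^sub>R b) - F x) / \<tau> n) <= M * ind S' x" for n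
  proof (rule AE_I2)
   fix x define y where "y = x + \<tau> n *\<^sub>R b"
   have M0: "0 <= M" if "x \<in> S'" using order.trans[OF abs_ge_zero B] order.trans[OF abs_ge_zero E[OF that]] order.trans[OF abs_ge_zero C] L
    by (simp add: M_def)
   show "norm ((F (x + \<tau> n *\<^sub>R b) - F x) / \<tau> n) <= M * ind S' x"
   proof (cases "x \<in> S \<or> y \<in> S")
    case True
    have on: "x + c *\<^sub>R b \<in> S'" if "0 <= c" "c <= \<tau> n" for c
     using True in_S'[of x c] in_S'[of y "c - \<tau> n"] that \<tau>[of n] by (auto simp: y_def algebra_simps)
    have xy: "x \<in> S'" "y \<in> S'" using on[of 0] on[of "\<tau> n"] \<tau>[of n] by (auto simp: y_def)
    have "closed_segment y x \<subseteq> Om"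
    proof
     fix z assume "z \<in> closed_segment y x"
     then obtain u where u: "0 <= u" "u <= 1" "z = (1 - u) *\<^sub>R y + u *\<^sub>R x" unfolding closed_segment_def by blast
     hence "z = x + ((1 - u) * \<tau> n) *\<^sub>R b" by (simp add: y_def algebra_simps)
     thus "z \<in> Om" using on[of "(1 - u) * \<tau> n"] u \<tau>[of n] mult_left_le_one_le[of "\<tau> n" "1 - u"] S'Om by auto
    qed
    from lip[OF this] have w: "\<bar>w y - w x\<bar> <= L * \<tau> n" using \<tau>(1)[of n] b by (simp add: y_def)
    have "norm (\<phi> (x + \<tau> n *\<^sub>R b) - \<phi> (x + 0 *\<^sub>R b)) <= B * norm (\<tau> n - 0)"
     by (rule field_differentiable_bound[of UNIV "%t. \<phi> (x + t *\<^sub>R b)"]) (use line[OF dif] B in \<open>auto simp: D_def\<close>)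
    hence \<phi>: "\<bar>\<phi> y - \<phi> x\<bar> <= B * \<tau> n" using \<tau>(1)[of n] by (simp add: y_def)
    have "\<bar>F y - F x\<bar> = \<bar>(\<phi> y - \<phi> x) * w y + \<phi> x * (w y - w x)\<bar>" by (simp add: F_def algebra_simps)
    also have "... <= (B * \<tau> n) * E + C * (L * \<tau> n)" unfolding abs_mult[symmetric]
     by (rule order.trans[OF abs_triangle_ineq], unfold abs_mult, intro add_mono mult_mono \<phi> w C E xy)
       (use \<tau>(1)[of n] order.trans[OF abs_ge_zero B] order.trans[OF abs_ge_zero C] in auto)
    finally have "\<bar>F y - F x\<bar> <= M * \<tau> n" by (simp add: M_def algebra_simps)
    thus ?thesis using \<tau>(1)[of n] xy by (simp add: y_def divide_le_eq)
   qed (use M0 S(3) in \<open>auto simp: F_def y_def indicator_def\<close>)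
  qed
 qed
 have "(LBINT x. (F (x + \<tau> n *\<^sub>R b) - F x) / \<tau> n) = 0" for n
  using lborel_integral_shift[of F "\<tau> n *\<^sub>R b"] Fi lborel_integrable_shift[OF Fi, of "\<tau> n *\<^sub>R b"] by (simp add: add.commute)
 from lim[unfolded this] have eq: "(LBINT x. D x * W x) = - (LBINT x. (G x \<bullet> b) * \<phi> x)"
  using WDi Gi by (simp add: LIMSEQ_const_iff eq_neg_iff_add_eq_0)
 have Omm: "Om \<in> sets lebesgue" using op by simp
 have "(\<integral>x. w x * frechet_derivative \<phi> (at x) b \<partial>lebesgue_on Om) = (LBINT x. D x * W x)"
  using WDi D0 S(2) by (intro integral_lebesgue_on_eq[OF Omm] AE_I2) (auto simp: W_def indicator_def simp flip: D_def)
 moreover have "(\<integral>x. (G x \<bullet> b) * \<phi> x \<partial>lebesgue_on Om) = (LBINT x. (G x \<bullet> b) * \<phi> x)"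
  using Gi S(2,3) by (intro integral_lebesgue_on_eq[OF Omm] AE_I2) (auto simp: indicator_def)
 ultimately show "(\<integral>x. w x * frechet_derivative \<phi> (at x) b \<partial>lebesgue_on Om) =
   - (\<integral>x. (G x \<bullet> b) * \<phi> x \<partial>lebesgue_on Om)" using eq by simp
  qed

section \<open>Finite spans of functions and Bernstein forms\<close>

text \<open>The dual (Lagrange) basis of a span exists without any linear independence of the \<open>f a\<close>.\<close>

definition dual_points :: "'x set => ('i => 'x => real) => 'i set => 'x set => ('x => 'i => real) => bool" where
 "dual_points S f A X g \<longleftrightarrow> finite X \<and> X \<subseteq> S \<and>
   (\<forall>x\<in>X. \<forall>y\<in>X. (\<Sum>a\<in>A. g y a * f a x) = (if x = y then 1 else 0)) \<and>
   (\<forall>c. \<forall>x\<in>S. (\<Sum>a\<in>A. c a * f a x) = (\<Sum>y\<in>X. (\<Sum>a\<in>A. c a * f a y) * (\<Sum>a\<in>A. g y a * f a x)))"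

text \<open>A Gaussian elimination on function values. \<open>F\<close> is the new function minus
  its interpolation at the old points. If \<open>F\<close> vanishes on \<open>S\<close>, the span
  has not grown; otherwise a point where it does not vanish becomes a new interpolation
  point.\<close>

lemma finite_span_dual_points:
 assumes "finite A"
 shows "\<exists>X g. dual_points S f A X g" using assms
proof (induction A rule: finite_induct)
 case empty
 have "dual_points S f {} {} g" for g by (simp add: dual_points_def)
 thus ?case by blast
next
 case (insert e A)
 then obtain X g where XG: "dual_points S f A X g" by blast
 have X: "finite X" "X \<subseteq> S"
  and dual: "!!x y. x \<in> X ==> y \<in> X ==> (\<Sum>a\<in>A. g y a * f a x) = (if x = y then 1 else 0)"
  and g: "!!c x. x \<in> S ==> (\<Sum>a\<in>A. c a * f a x) = (\<Sum>y\<in>X. (\<Sum>a\<in>A. c a * f a y) * (\<Sum>a\<in>A. g y a * f a x))"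
  using XG unfolding dual_points_def by simp_all
 define G where "G y x = (\<Sum>a\<in>A. g y a * f a x)" for y x
 define F where "F x = f e x - (\<Sum>y\<in>X. f e y * G y x)" for x
 define w where "w c x = (\<Sum>a\<in>insert e A. c a * f a x)" for c x
 have w_ext: "w (%a. if a = e then k else c a) x = k * f e x + (\<Sum>a\<in>A. c a * f a x)" for k c x
 proof -
  have "(\<Sum>a\<in>A. (if a = e then k else c a) * f a x) = (\<Sum>a\<in>A. c a * f a x)" using insert.hyps by (intro sum.cong) auto
  thus ?thesis unfolding w_def using insert.hyps by simp
 qed
 have dualG: "G y x = (if x = y then 1 else 0)" if "x \<in> X" "y \<in> X" for x y using dual[OF that] by (simp add: G_def)
 have FX: "F x = 0" if "x \<in> X" for x
 proof -
  have "(\<Sum>y\<in>X. f e y * G y x) = (\<Sum>y\<in>X. if x = y then f e y else 0)" using that by (intro sum.cong) (auto simp: dualG)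
  thus ?thesis using that X(1) by (simp add: F_def)
 qed
 have w: "w c x = c e * F x + (\<Sum>y\<in>X. w c y * G y x)" if x: "x \<in> S" for c x
 proof -
  have "w c y = c e * f e y + (\<Sum>a\<in>A. c a * f a y)" for y unfolding w_def using insert.hyps by simp
  moreover have "f e x = F x + (\<Sum>y\<in>X. f e y * G y x)" by (simp add: F_def)
  moreover have "(\<Sum>a\<in>A. c a * f a x) = (\<Sum>y\<in>X. (\<Sum>a\<in>A. c a * f a y) * G y x)" unfolding G_def by (rule g[OF x])
  ultimately show ?thesis by (simp add: distrib_right distrib_left sum.distrib sum_distrib_left mult.assoc)
 qed
 have w_lin: "w (%a. k * c a + l * d a) x = k * w c x + l * w d x" for k l c d x
  by (simp add: w_def sum.distrib distrib_right sum_distrib_left mult.assoc)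
 show ?case
 proof (cases "\<forall>x\<in>S. F x = 0")
  case True
  define g' where "g' y = (%a. if a = e then 0 else g y a)" for y
  have g': "w (g' y) x = G y x" for y x unfolding g'_def w_ext by (simp add: G_def)
  have "(\<forall>x\<in>X. \<forall>y\<in>X. w (g' y) x = (if x = y then 1 else 0)) \<and>
    (\<forall>c. \<forall>x\<in>S. w c x = (\<Sum>y\<in>X. w c y * w (g' y) x))" unfolding g' proof (intro conjI ballI allI)
   fix c x assume x: "x \<in> S"
   hence "F x = 0" using True by blast
   with w[OF x, of c] show "w c x = (\<Sum>y\<in>X. w c y * G y x)" by simp
  qed (rule dualG)
  with X show ?thesis unfolding w_def dual_points_def by blast
 next
  case False
  then obtain z where z: "z \<in> S" "F z \<noteq> 0" by blast
  hence zX: "z \<notin> X" using FX by blast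
  define cF where "cF = (%a. if a = e then 1 else - (\<Sum>y\<in>X. f e y * g y a))"
  have cF: "w cF x = F x" for x
  proof -
   have "(\<Sum>a\<in>A. - (\<Sum>y\<in>X. f e y * g y a) * f a x) = - (\<Sum>a\<in>A. \<Sum>y\<in>X. f e y * g y a * f a x)"
    by (simp add: sum_negf sum_distrib_right)
   also have "... = - (\<Sum>y\<in>X. f e y * G y x)" unfolding G_def sum_distrib_left by (subst sum.swap) (simp add: mult.assoc)
   finally show ?thesis unfolding cF_def w_ext by (simp add: F_def)
  qed
  \<comment> \<open>The function dual to the new point is \<open>F / F z\<close>; the old ones are
    corrected by multiples of \<open>F\<close> so as to vanish at \<open>z\<close>. Duality at the
    old points survives because \<open>F\<close> vanishes there.\<close>
  define h where "h y = (if y = z then (%a. (1 / F z) * cF a + 0 * cF a)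
    else (%a. 1 * (if a = e then 0 else g y a) + - (G y z / F z) * cF a))" for y have hz: "w (h z) x = F x / F z" for x proof -
   have "w (h z) x = 1 / F z * w cF x + 0 * w cF x" unfolding h_def by (simp only: if_True refl w_lin)
   thus ?thesis by (simp add: cF)
  qed
  have hy: "w (h y) x = G y x - G y z / F z * F x" if "y \<noteq> z" for y x
  proof -
   have "w (h y) x = 1 * w (%a. if a = e then 0 else g y a) x + - (G y z / F z) * w cF x"
    using that unfolding h_def by (simp only: if_False w_lin)
   thus ?thesis unfolding w_ext cF by (simp add: G_def)
  qed
  have "(\<forall>x\<in>insert z X. \<forall>y\<in>insert z X. w (h y) x = (if x = y then 1 else 0)) \<and>
    (\<forall>c. \<forall>x\<in>S. w c x = (\<Sum>y\<in>insert z X. w c y * w (h y) x))" proof (intro conjI ballI allI)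
   fix x y assume "x \<in> insert z X" "y \<in> insert z X"
   thus "w (h y) x = (if x = y then 1 else 0)" using z FX dualG hz hy by (cases "y = z"; cases "x = z") auto
  next
   fix c x assume x: "x \<in> S"
   have "(\<Sum>y\<in>X. w c y * w (h y) x) = (\<Sum>y\<in>X. w c y * (G y x - G y z / F z * F x))"
   proof (intro sum.cong refl)
    fix y assume "y \<in> X"
    hence "y \<noteq> z" using zX by blast
    thus "w c y * w (h y) x = w c y * (G y x - G y z / F z * F x)" using hy[of y x] by simp
   qed
   also have "... = (\<Sum>y\<in>X. w c y * G y x) - (\<Sum>y\<in>X. w c y * G y z) / F z * F x"
    by (simp add: right_diff_distrib sum_subtractf sum_distrib_right sum_divide_distrib mult.assoc)
   finally have "(\<Sum>y\<in>insert z X. w c y * w (h y) x) =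
     w c z * (F x / F z) + (\<Sum>y\<in>X. w c y * G y x) - (\<Sum>y\<in>X. w c y * G y z) / F z * F x" using zX X(1) by (simp add: hz)
   also have "w c z = c e * F z + (\<Sum>y\<in>X. w c y * G y z)" by (rule w[OF z(1)])
   finally have "(\<Sum>y\<in>insert z X. w c y * w (h y) x) = c e * F x + (\<Sum>y\<in>X. w c y * G y x)"
    using z(2) by (simp add: distrib_right add_divide_distrib)
   thus "w c x = (\<Sum>y\<in>insert z X. w c y * w (h y) x)" using w[OF x, of c] by simp
  qed
  moreover have "finite (insert z X)" "insert z X \<subseteq> S" using X z by auto
  ultimately show ?thesis unfolding w_def dual_points_def by blast
 qed
qed

text \<open>Expanding in the dual functions yields coefficients that are fixed combinations of point
  values, hence bounded by the maximum. They may differ from \<open>c\<close>, since the spanning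
  family can be redundant. \<open>C + 1\<close> only ensures positivity.\<close>

lemma finite_span_stable_representation:
 fixes f :: "'i => 'x => real"
 assumes A: "finite A"
 shows "\<exists>C>0. \<forall>c. \<exists>c'. (\<forall>x\<in>S. (\<Sum>a\<in>A. c a * f a x) = (\<Sum>a\<in>A. c' a * f a x)) \<and>
   (\<forall>M. (\<forall>x\<in>S. \<bar>\<Sum>a\<in>A. c a * f a x\<bar> <= M) --> (\<Sum>a\<in>A. \<bar>c' a\<bar>) <= C * \<bar>M\<bar>)"
proof -
 obtain X g where XG: "dual_points S f A X g" using finite_span_dual_points[OF A, of S f] by blast
 have X: "finite X" "X \<subseteq> S"
  and g: "!!c x. x \<in> S ==> (\<Sum>a\<in>A. c a * f a x) = (\<Sum>y\<in>X. (\<Sum>a\<in>A. c a * f a y) * (\<Sum>a\<in>A. g y a * f a x))"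
  using XG unfolding dual_points_def by simp_all
 define C where "C = (\<Sum>y\<in>X. \<Sum>a\<in>A. \<bar>g y a\<bar>)"
 have C: "C >= 0" unfolding C_def by (intro sum_nonneg) auto
 show ?thesis
 proof (intro exI[of _ "C + 1"] conjI allI)
  fix c
  define c' where "c' a = (\<Sum>y\<in>X. (\<Sum>b\<in>A. c b * f b y) * g y a)" for a
  show "\<exists>c'. (\<forall>x\<in>S. (\<Sum>a\<in>A. c a * f a x) = (\<Sum>a\<in>A. c' a * f a x)) \<and>
   (\<forall>M. (\<forall>x\<in>S. \<bar>\<Sum>a\<in>A. c a * f a x\<bar> <= M) --> (\<Sum>a\<in>A. \<bar>c' a\<bar>) <= (C + 1) * \<bar>M\<bar>)"
  proof (intro exI[of _ c'] conjI ballI allI impI)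
   fix x assume "x \<in> S"
   show "(\<Sum>a\<in>A. c a * f a x) = (\<Sum>a\<in>A. c' a * f a x)"
    unfolding g[OF \<open>x \<in> S\<close>, of c] c'_def sum_distrib_right sum_distrib_left by (subst sum.swap) (simp add: mult_ac)
  next
   fix M assume M: "\<forall>x\<in>S. \<bar>\<Sum>a\<in>A. c a * f a x\<bar> <= M"
   have "(\<Sum>a\<in>A. \<bar>c' a\<bar>) <= (\<Sum>a\<in>A. \<Sum>y\<in>X. \<bar>M\<bar> * \<bar>g y a\<bar>)" unfolding c'_def
   proof (intro sum_mono order.trans[OF sum_abs])
    fix a y assume "y \<in> X"
    hence "\<bar>\<Sum>b\<in>A. c b * f b y\<bar> <= \<bar>M\<bar>" using M X(2) by (meson abs_ge_self order.trans subsetD)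
    thus "\<bar>(\<Sum>b\<in>A. c b * f b y) * g y a\<bar> <= \<bar>M\<bar> * \<bar>g y a\<bar>" by (simp add: abs_mult mult_right_mono)
   qed
   also have "... = C * \<bar>M\<bar>" unfolding C_def by (subst sum.swap) (simp add: sum_distrib_left mult.commute)
   finally show "(\<Sum>a\<in>A. \<bar>c' a\<bar>) <= (C + 1) * \<bar>M\<bar>" by (simp add: distrib_right)
  qed
 qed (use C in simp)
qed

text \<open>Homogeneous polynomials of degree \<open>n\<close> in the barycentric coordinates \<open>t 0, ..., t d\<close>,
 with monomials indexed (redundantly) by words of length \<open>n\<close>.\<close>

definition std_coords :: "nat => (nat => real) set" where "std_coords d = {t. (\<forall>i\<le>d. 0 <= t i) \<and> (\<Sum>i\<le>d. t i) = 1}"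

definition words :: "nat => nat => nat list set" where "words d n = {w. set w \<subseteq> {..d} \<and> length w = n}"

definition bern :: "nat => nat => (nat list => real) => (nat => real) => real" where
 "bern d n c t = (\<Sum>w\<in>words d n. c w * (\<Prod>i\<leftarrow>w. t i))"

definition bern_fun :: "nat => nat => ((nat => real) => real) => bool" where
 "bern_fun d n F \<longleftrightarrow> (\<exists>c. \<forall>t\<in>std_coords d. F t = bern d n c t)"

lemma finite_words: "finite (words d n)" unfolding words_def by (rule finite_lists_length_eq) simp

lemma words_Suc: "words d (Suc n) = (%(i, w). i # w) ` ({..d} \<times> words d n)" unfolding words_def by (auto simp: length_Suc_conv)

lemma bern_Suc: "bern d (Suc n) c t = (\<Sum>i\<le>d. t i * bern d n (%w. c (i # w)) t)"
proof -
 have "inj_on (%(i, w). i # w) ({..d} \<times> words d n)" by (auto simp: inj_on_def)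
 hence "bern d (Suc n) c t = (\<Sum>(i, w)\<in>{..d} \<times> words d n. c (i # w) * (\<Prod>i\<leftarrow>i # w. t i))"
  unfolding bern_def words_Suc by (subst sum.reindex) (auto intro: sum.cong)
 also have "... = (\<Sum>i\<le>d. \<Sum>w\<in>words d n. c (i # w) * (\<Prod>i\<leftarrow>i # w. t i))" by (subst sum.cartesian_product) simp
 finally show ?thesis by (simp add: bern_def sum_distrib_left mult_ac)
qed

lemma bern_0: "bern d 0 c t = c []"
proof -
 have "words d 0 = {[]}" by (auto simp: words_def)
 thus ?thesis by (simp add: bern_def)
qed

lemma bern_fun_cong: "(!!t. t \<in> std_coords d ==> F t = G t) ==> bern_fun d n F \<longleftrightarrow> bern_fun d n G"
 unfolding bern_fun_def by simp

lemma bern_fun_0: "bern_fun d 0 (%t. k)" unfolding bern_fun_def bern_0 by auto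

lemma bern_fun_add:
 assumes "bern_fun d n F" "bern_fun d n G" shows "bern_fun d n (%t. F t + G t)"
proof -
 obtain c c' where "\<forall>t\<in>std_coords d. F t = bern d n c t" "\<forall>t\<in>std_coords d. G t = bern d n c' t"
  using assms unfolding bern_fun_def by blast
 hence "\<forall>t\<in>std_coords d. F t + G t = bern d n (%w. c w + c' w) t" by (simp add: bern_def distrib_right sum.distrib)
 thus ?thesis unfolding bern_fun_def by blast
qed

lemma bern_fun_cmult:
 assumes "bern_fun d n F" shows "bern_fun d n (%t. k * F t)"
proof -
 obtain c where "\<forall>t\<in>std_coords d. F t = bern d n c t" using assms unfolding bern_fun_def by blast
 hence "\<forall>t\<in>std_coords d. k * F t = bern d n (%w. k * c w) t" by (simp add: bern_def sum_distrib_left mult.assoc)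
 thus ?thesis unfolding bern_fun_def by blast
qed

lemma bern_fun_sum: "(!!i. i \<in> I ==> bern_fun d n (F i)) ==> bern_fun d n (%t. \<Sum>i\<in>I. F i t)"
proof (induction I rule: infinite_finite_induct)
 case (insert x I)
 thus ?case by (simp add: bern_fun_add)
qed (use bern_fun_cmult[of d n "bern d n (%w. 0)" 0] in \<open>auto simp: bern_fun_def\<close>)

lemma bern_fun_coord_mult:
 assumes j: "j <= d" and F: "bern_fun d n F" shows "bern_fun d (Suc n) (%t. t j * F t)"
proof -
 obtain c where c: "\<forall>t\<in>std_coords d. F t = bern d n c t" using F unfolding bern_fun_def by blast
 define c' where "c' w = (case w of [] => 0 | i # w => if i = j then c w else 0)" for w
 have "t j * F t = bern d (Suc n) c' t" if t: "t \<in> std_coords d" for t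
 proof -
  have "bern d (Suc n) c' t = (\<Sum>i\<le>d. if i = j then t j * bern d n c t else 0)"
   unfolding bern_Suc by (intro sum.cong) (auto simp: c'_def bern_def)
  thus ?thesis using j c t by simp
 qed
 thus ?thesis unfolding bern_fun_def by blast
qed

text \<open>Multiplication by the sum of the coordinates, which is 1 on \<open>std_coords\<close>;
  this is why \<open>bern_fun\<close> asks for equality only there.\<close>

lemma bern_fun_Suc:
 assumes F: "bern_fun d n F" shows "bern_fun d (Suc n) F"
proof -
 have "bern_fun d (Suc n) (%t. \<Sum>i\<le>d. t i * F t)" by (intro bern_fun_sum bern_fun_coord_mult F) simp
 moreover have "F t = (\<Sum>i\<le>d. t i * F t)" if "t \<in> std_coords d" for t using that by (simp add: std_coords_def flip: sum_distrib_right)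
 ultimately show ?thesis using bern_fun_cong[of d F "%t. \<Sum>i\<le>d. t i * F t" "Suc n"] by simp
qed

lemma bern_fun_le: "bern_fun d m F ==> m <= n ==> bern_fun d n F"
 by (rotate_tac, induction n rule: nat_induct_at_least) (simp_all add: bern_fun_Suc)

lemma bern_fun_mult:
 assumes "bern_fun d m F" "bern_fun d n G" shows "bern_fun d (m + n) (%t. F t * G t)" using assms(1)
proof (induction m arbitrary: F)
 case 0
 then obtain c where "\<forall>t\<in>std_coords d. F t = bern d 0 c t" unfolding bern_fun_def by blast
 hence "!!t. t \<in> std_coords d ==> F t * G t = c [] * G t" by (simp add: bern_0)
 hence "bern_fun d n (%t. F t * G t) \<longleftrightarrow> bern_fun d n (%t. c [] * G t)" by (rule bern_fun_cong)
 thus ?case using bern_fun_cmult[OF assms(2), of "c []"] by simp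
next
 case (Suc m)
 then obtain c where c: "\<forall>t\<in>std_coords d. F t = bern d (Suc m) c t" unfolding bern_fun_def by blast
 have "bern_fun d m (bern d m (%w. c (i # w)))" for i unfolding bern_fun_def by blast
 hence "bern_fun d (Suc (m + n)) (%t. \<Sum>i\<le>d. t i * (bern d m (%w. c (i # w)) t * G t))"
  by (intro bern_fun_sum bern_fun_coord_mult Suc.IH) auto
 moreover have "F t * G t = (\<Sum>i\<le>d. t i * (bern d m (%w. c (i # w)) t * G t))" if "t \<in> std_coords d" for t
  using c that by (simp add: bern_Suc sum_distrib_right mult.assoc)
 hence "bern_fun d (Suc (m + n)) (%t. F t * G t) \<longleftrightarrow>
   bern_fun d (Suc (m + n)) (%t. \<Sum>i\<le>d. t i * (bern d m (%w. c (i # w)) t * G t))" by (rule bern_fun_cong)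
 ultimately show ?case by simp
qed

section \<open>Simplices and barycentric coordinates\<close>

definition full_simplex :: "'a::euclidean_space set => bool" where "full_simplex T \<longleftrightarrow> int DIM('a) simplex T"

definition verts :: "'a::euclidean_space set => 'a set" where "verts T = {z. z extreme_point_of T}"

lemma
 assumes "full_simplex (T :: 'a::euclidean_space set)"
 shows verts_independent: "\<not> affine_dependent (verts T)" and card_verts: "card (verts T) = Suc DIM('a)"
  and finite_verts: "finite (verts T)" and verts_hull: "T = convex hull (verts T)"
proof -
 obtain C where C: "\<not> affine_dependent C" "int (card C) = int DIM('a) + 1" "T = convex hull C"
  using assms unfolding full_simplex_def simplex_def by blast
 have "verts T = C" using extreme_point_of_convex_hull_affine_independent[OF C(1)] by (simp add: verts_def C(3))
 with C show "\<not> affine_dependent (verts T)" "card (verts T) = Suc DIM('a)" "finite (verts T)" "T = convex hull (verts T)"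
  by (auto intro: aff_independent_finite)
qed

lemma full_simplex_compact: "full_simplex T ==> compact T" unfolding full_simplex_def by (rule compact_simplex)

lemma full_simplex_closed: "full_simplex T ==> closed T" by (simp add: full_simplex_compact compact_imp_closed)

lemma full_simplex_convex: "full_simplex T ==> convex T" unfolding full_simplex_def by (rule convex_simplex)

lemma full_simplex_interior: "full_simplex T ==> interior T \<noteq> {}" using full_simplex_convex[of T] aff_dim_simplex[of _ T]
 by (metis full_simplex_def
   interior_rel_interior of_nat_0_le_iff rel_interior_eq_empty aff_dim_negative_iff linorder_not_le)

definition bary_rep :: "'a::euclidean_space set => 'a => ('a => real) => bool" where
 "bary_rep T x u \<longleftrightarrow> sum u (verts T) = 1 \<and> (\<Sum>z\<in>verts T. u z *\<^sub>R z) = x"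

text \<open>The value 0 at non-vertices allows the coordinates of two different simplices to be
  compared for every \<open>z\<close>, as in \<open>common_face\<close>.\<close>

definition bary :: "'a::euclidean_space set => 'a => 'a => real" where "bary T z x = (if z \<in> verts T then (SOME u. bary_rep T x u) z else 0)"

lemma bary_rep_exists:
 assumes "full_simplex T" shows "\<exists>u. bary_rep T x u"
proof -
 have "x \<in> affine hull (verts T)" using affine_independent_span_eq[OF verts_independent[OF assms] card_verts[OF assms]] by simp
 thus ?thesis unfolding affine_hull_finite[OF finite_verts[OF assms]] bary_rep_def by simp
qed

lemma bary_rep_unique:
 assumes T: "full_simplex T" and u: "bary_rep T x u" "bary_rep T x u'" and z: "z \<in> verts T"
 shows "u z = u' z"
proof (rule ccontr)
 assume ne: "u z \<noteq> u' z"
 have "sum (%z. u z - u' z) (verts T) = 0" "(\<Sum>z\<in>verts T. (u z - u' z) *\<^sub>R z) = 0"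
  using u unfolding bary_rep_def by (simp_all add: sum_subtractf scaleR_left_diff_distrib)
 moreover have "\<exists>z\<in>verts T. u z - u' z \<noteq> 0" using ne z by auto
 ultimately have "affine_dependent (verts T)" unfolding affine_dependent_explicit_finite[OF finite_verts[OF T]] by blast
 thus False using verts_independent[OF T] by simp
qed

lemma bary_rep_bary: assumes T: "full_simplex T" shows "bary_rep T x (%z. bary T z x)"
proof -
 have r: "bary_rep T x (SOME u. bary_rep T x u)" using bary_rep_exists[OF T] by (rule someI_ex)
 have "sum (%z. bary T z x) (verts T) = sum (SOME u. bary_rep T x u) (verts T)"
  "(\<Sum>z\<in>verts T. bary T z x *\<^sub>R z) = (\<Sum>z\<in>verts T. (SOME u. bary_rep T x u) z *\<^sub>R z)"
  by (intro sum.cong; simp add: bary_def)+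
 with r show ?thesis unfolding bary_rep_def by simp
qed

lemma bary_sum: "full_simplex T ==> (\<Sum>z\<in>verts T. bary T z x) = 1"
 and bary_combination: "full_simplex T ==> (\<Sum>z\<in>verts T. bary T z x *\<^sub>R z) = x"
 using bary_rep_bary[of T x] unfolding bary_rep_def by auto

lemma bary_eqI: "full_simplex T ==> sum u (verts T) = 1 ==> (\<Sum>z\<in>verts T. u z *\<^sub>R z) = x ==> z \<in> verts T ==> bary T z x = u z"
 using bary_rep_unique[of T x "%z. bary T z x" u z] bary_rep_bary[of T x] by (simp add: bary_rep_def)

lemma bary_notin: "z \<notin> verts T ==> bary T z x = 0" by (simp add: bary_def)

lemma bary_affine:
 assumes T: "full_simplex T"
 shows "bary T z ((1 - s) *\<^sub>R x + s *\<^sub>R y) = (1 - s) * bary T z x + s * bary T z y"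
proof (cases "z \<in> verts T")
 case True
 show ?thesis
 proof (rule bary_eqI[OF T _ _ True])
  show "(\<Sum>z\<in>verts T. (1 - s) * bary T z x + s * bary T z y) = 1" by (simp add: sum.distrib bary_sum[OF T] flip: sum_distrib_left)
  have "(\<Sum>z\<in>verts T. ((1 - s) * bary T z x + s * bary T z y) *\<^sub>R z) =
    (1 - s) *\<^sub>R (\<Sum>z\<in>verts T. bary T z x *\<^sub>R z) + s *\<^sub>R (\<Sum>z\<in>verts T. bary T z y *\<^sub>R z)"
   by (simp add: scaleR_left_distrib sum.distrib scaleR_sum_right)
  thus "(\<Sum>z\<in>verts T. ((1 - s) * bary T z x + s * bary T z y) *\<^sub>R z) = (1 - s) *\<^sub>R x + s *\<^sub>R y"
   by (simp only: bary_combination[OF T])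
 qed
qed (simp add: bary_notin)

lemma bary_linear:
 assumes T: "full_simplex T"
 obtains a where "!!x. bary T z x = x \<bullet> a + bary T z 0"
proof -
 define g where "g x = bary T z x - bary T z 0" for x
 have scale: "g (c *\<^sub>R x) = c * g x" for c x using bary_affine[OF T, of z c 0 x] by (simp add: g_def algebra_simps)
 have add: "g (x + y) = g x + g y" for x y
 proof -
  have "g ((1 - 1/2) *\<^sub>R (2 *\<^sub>R x) + (1/2) *\<^sub>R (2 *\<^sub>R y)) = (1/2) * g (2 *\<^sub>R x) + (1/2) * g (2 *\<^sub>R y)"
   unfolding g_def bary_affine[OF T] by (simp add: field_simps)
  thus ?thesis by (simp add: scale)
 qed
 have lin: "linear g" by (rule linearI) (simp_all add: add scale)
 define a where "a = (\<Sum>b\<in>Basis. g b *\<^sub>R b)"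
 have gx: "g x = x \<bullet> a" for x
 proof -
  have "g x = g (\<Sum>b\<in>Basis. (x \<bullet> b) *\<^sub>R b)" by (simp only: euclidean_representation)
  also have "... = (\<Sum>b\<in>Basis. (x \<bullet> b) * g b)" by (simp add: linear_sum[OF lin] linear_scale[OF lin])
  also have "... = x \<bullet> a" by (simp add: a_def inner_sum_right mult.commute)
  finally show ?thesis .
 qed
 have "bary T z x = x \<bullet> a + bary T z 0" for x using gx[of x] by (simp add: g_def)
 thus ?thesis using that by blast
qed

lemma bary_smooth: assumes "full_simplex T" shows "bary T z \<in> smooth_fun"
proof -
 obtain a where "!!x. bary T z x = x \<bullet> a + bary T z 0" using bary_linear[OF assms] by blast
 hence "bary T z = (%x. x \<bullet> a + bary T z 0)" by blast
 thus ?thesis using smooth_fun.add[OF smooth_fun.inner smooth_fun.const] by metis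
qed

lemma bary_continuous: "full_simplex T ==> continuous_on S (bary T z)" by (rule smooth_fun_continuous) (rule bary_smooth)

lemma simplex_iff_bary:
 assumes T: "full_simplex T" shows "x \<in> T \<longleftrightarrow> (\<forall>z. 0 <= bary T z x)"
proof
 assume "x \<in> T"
 then obtain u where u: "\<forall>z\<in>verts T. 0 <= u z" "sum u (verts T) = 1" "(\<Sum>z\<in>verts T. u z *\<^sub>R z) = x" using verts_hull[OF T]
  unfolding convex_hull_finite[OF finite_verts[OF T]] by blast
 show "\<forall>z. 0 <= bary T z x"
 proof
  fix z show "0 <= bary T z x" using u bary_eqI[OF T u(2,3), of z] bary_notin[of z T x] by (cases "z \<in> verts T") auto
 qed
next
 assume "\<forall>z. 0 <= bary T z x"
 hence "x \<in> convex hull (verts T)" unfolding convex_hull_finite[OF finite_verts[OF T]]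
  using bary_sum[OF T, of x] bary_combination[OF T, of x] by (intro CollectI exI[of _ "%z. bary T z x"]) auto
 thus "x \<in> T" using verts_hull[OF T] by simp
qed

lemma bary_nonneg: "full_simplex T ==> x \<in> T ==> 0 <= bary T z x" using simplex_iff_bary by blast

lemma bary_le_1:
 assumes T: "full_simplex T" and x: "x \<in> T" shows "bary T z x <= 1"
proof (cases "z \<in> verts T")
 case True
 have "bary T z x <= (\<Sum>z\<in>verts T. bary T z x)" by (rule member_le_sum[OF True]) (use finite_verts[OF T] bary_nonneg[OF T x] in auto)
 thus ?thesis using bary_sum[OF T] by simp
qed (simp add: bary_notin)

lemma verts_subset: assumes "full_simplex T" shows "verts T \<subseteq> T" using verts_hull[OF assms] hull_subset by metis

lemma bary_vertex:
 assumes T: "full_simplex T" and z: "z \<in> verts T" shows "bary T w z = (if w = z then 1 else 0)"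
proof (cases "w \<in> verts T")
 case True
 show ?thesis
 proof (rule bary_eqI[OF T _ _ True])
  show "(\<Sum>w\<in>verts T. if w = z then 1 else 0) = (1::real)" using finite_verts[OF T] z by simp
  have "(\<Sum>w\<in>verts T. (if w = z then 1 else 0 :: real) *\<^sub>R w) = (\<Sum>w\<in>verts T. if w = z then w else 0)"
   by (intro sum.cong) auto
  thus "(\<Sum>w\<in>verts T. (if w = z then 1 else 0 :: real) *\<^sub>R w) = z" using finite_verts[OF T] z by simp
 qed
next
 case False
 thus ?thesis using z by (auto simp: bary_notin)
qed

lemma simplex_interior_iff_bary:
 assumes T: "full_simplex T" shows "x \<in> interior T \<longleftrightarrow> (\<forall>z\<in>verts T. 0 < bary T z x)"
proof
 assume x: "x \<in> interior T"
 show "\<forall>z\<in>verts T. 0 < bary T z x"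
 proof
  fix z assume z: "z \<in> verts T"
  have xT: "x \<in> T" using x interior_subset by blast
  show "0 < bary T z x"
  proof (rule ccontr)
   assume "\<not> 0 < bary T z x"
   hence b0: "bary T z x = 0" using bary_nonneg[OF T xT, of z] by linarith
   obtain e where e: "e > 0" "ball x e \<subseteq> T" using x mem_interior by blast
   \<comment> \<open>A negative \<open>s\<close> moves from \<open>x\<close> away from the vertex
     \<open>z\<close> by less than \<open>e\<close>. The point stays in \<open>T\<close>, but its
     coordinate at \<open>z\<close>, zero at \<open>x\<close>, becomes \<open>s < 0\<close>.\<close>
   define s where "s = - e / (2 * (norm (z - x) + 1))"
   define n where "n = norm (z - x)"
   have n0: "0 <= n" by (simp add: n_def)
   hence np: "0 < norm (z - x) + 1" by (simp add: add_nonneg_pos)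
   have "n < 2 * (n + 1)" using n0 by argo

   hence s: "s < 0" "\<bar>s\<bar> * norm (z - x) < e" using e(1) np by (simp_all add: s_def divide_less_eq)
   have "dist x ((1 - s) *\<^sub>R x + s *\<^sub>R z) = \<bar>s\<bar> * norm (z - x)"
   proof -
    have "x - ((1 - s) *\<^sub>R x + s *\<^sub>R z) = (- s) *\<^sub>R (z - x)" by (simp add: algebra_simps)
    thus ?thesis by (simp add: dist_norm)
   qed
   hence "(1 - s) *\<^sub>R x + s *\<^sub>R z \<in> T" using s e(2) by auto
   hence "0 <= bary T z ((1 - s) *\<^sub>R x + s *\<^sub>R z)" by (rule bary_nonneg[OF T])
   thus False unfolding bary_affine[OF T] using s b0 bary_vertex[OF T z, of z] by simp
  qed
 qed
next
 assume pos: "\<forall>z\<in>verts T. 0 < bary T z x"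
 define U where "U = (\<Inter>z\<in>verts T. {x. 0 < bary T z x})"
 have "open U" unfolding U_def by (intro open_INT finite_verts[OF T] ballI open_Collect_less continuous_on_const bary_continuous[OF T])
 moreover have "U \<subseteq> T"
 proof
  fix x assume x: "x \<in> U"
  have "0 <= bary T z x" for z using x bary_notin[of z T x] by (cases "z \<in> verts T") (auto simp: U_def)
  thus "x \<in> T" using simplex_iff_bary[OF T] by blast
 qed
 moreover have "x \<in> U" using pos by (simp add: U_def)
 ultimately show "x \<in> interior T" using interior_maximal by blast
qed

text \<open>The coordinate is affine with values in [0, 1] on the ball. From the centre to the
  boundary in the direction of its gradient it grows by \<open>r\<close> times the norm of the
  gradient, so this norm is at most \<open>1 / r\<close>.\<close>

lemma bary_lipschitz:
 assumes T: "full_simplex T" and r: "0 < r" "cball b r \<subseteq> T"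
 shows "\<bar>bary T z x - bary T z y\<bar> <= norm (x - y) / r"
proof -
 obtain a where a: "!!x. bary T z x = x \<bullet> a + bary T z 0" using bary_linear[OF T] by blast
 have "norm a <= 1 / r"
 proof (cases "a = 0")
  case False
  define p where "p = b + (r / norm a) *\<^sub>R a"
  have "dist b p = r" using False r(1) by (simp add: p_def dist_norm)
  hence "p \<in> T" "b \<in> T" using r by auto
  hence "bary T z p - bary T z b <= 1" using bary_le_1[OF T, of p z] bary_nonneg[OF T, of b z] by linarith
  moreover have "bary T z p - bary T z b = (p - b) \<bullet> a" using a[of p] a[of b] by (simp add: inner_diff_left)
  moreover have "(p - b) \<bullet> a = r * norm a" by (simp add: p_def power2_norm_eq_inner[symmetric] power2_eq_square)
  ultimately show ?thesis using r(1) by (simp add: field_simps)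
 qed (use r in simp)
 moreover have "\<bar>bary T z x - bary T z y\<bar> <= norm (x - y) * norm a"
  using a[of x] a[of y] Cauchy_Schwarz_ineq2[of "x - y" a] by (simp add: inner_diff_left)
 ultimately have "\<bar>bary T z x - bary T z y\<bar> <= norm (x - y) * (1 / r)" by (meson mult_left_mono norm_ge_zero order.trans)
 thus ?thesis by simp
qed

lemma full_simplex_face:
 assumes T: "full_simplex T" and F: "F face_of T"
 shows "verts F \<subseteq> verts T" "F = convex hull (verts F)"
  "x \<in> F \<longleftrightarrow> x \<in> T \<and> (\<forall>z. z \<notin> verts F --> bary T z x = 0)"
proof -
 have ind: "\<not> affine_dependent (verts T)" by (rule verts_independent[OF T])
 have "F face_of convex hull (verts T)" using F verts_hull[OF T] by simp
 then obtain c where c: "c \<subseteq> verts T" "F = convex hull c" using face_of_convex_hull_affine_independent[OF ind] by blast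
 have vF: "verts F = c" using extreme_point_of_convex_hull_affine_independent[OF affine_independent_subset[OF ind c(1)]]
  by (simp add: verts_def c(2))
 show V: "verts F \<subseteq> verts T" "F = convex hull (verts F)" using vF c by auto
 have fin: "finite (verts T)" "finite (verts F)" using finite_verts[OF T] V(1) finite_subset by blast+
 show "x \<in> F \<longleftrightarrow> x \<in> T \<and> (\<forall>z. z \<notin> verts F --> bary T z x = 0)"
 proof
  assume x: "x \<in> F"
  then obtain u where u: "sum u (verts F) = 1" "(\<Sum>z\<in>verts F. u z *\<^sub>R z) = x" using V unfolding convex_hull_finite[OF fin(2)] by blast
  define u' where "u' z = (if z \<in> verts F then u z else 0)" for z
  have u': "sum u' (verts T) = 1" "(\<Sum>z\<in>verts T. u' z *\<^sub>R z) = x"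
  proof -
   have "sum u' (verts T) = sum u (verts F)" by (rule sum.mono_neutral_cong_right[OF fin(1) V(1)]) (auto simp: u'_def)
   moreover have "(\<Sum>z\<in>verts T. u' z *\<^sub>R z) = (\<Sum>z\<in>verts F. u z *\<^sub>R z)"
    by (rule sum.mono_neutral_cong_right[OF fin(1) V(1)]) (auto simp: u'_def)
   ultimately show "sum u' (verts T) = 1" "(\<Sum>z\<in>verts T. u' z *\<^sub>R z) = x" using u by simp_all
  qed
  have "bary T z x = 0" if "z \<notin> verts F" for z
   using that bary_eqI[OF T u', of z] bary_notin[of z T x] by (cases "z \<in> verts T") (auto simp: u'_def)
  moreover have "x \<in> T" using x face_of_imp_subset[OF F] by blast
  ultimately show "x \<in> T \<and> (\<forall>z. z \<notin> verts F --> bary T z x = 0)" by blast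
 next
  assume x: "x \<in> T \<and> (\<forall>z. z \<notin> verts F --> bary T z x = 0)"
  have "(\<Sum>z\<in>verts F. bary T z x) = 1"
   using bary_sum[OF T, of x] sum.mono_neutral_right[OF fin(1) V(1), of "%z. bary T z x"] x by auto
  moreover have "(\<Sum>z\<in>verts F. bary T z x *\<^sub>R z) = x"
   using bary_combination[OF T, of x] sum.mono_neutral_right[OF fin(1) V(1), of "%z. bary T z x *\<^sub>R z"] x by auto
  ultimately have "x \<in> convex hull (verts F)" unfolding convex_hull_finite[OF fin(2)] using bary_nonneg[OF T] x
   by (intro CollectI exI[of _ "%z. bary T z x"]) auto
  thus "x \<in> F" using V by simp
 qed
qed

text \<open>On the common face only common vertices carry weight, so a representation in one simplex
  is one in the other and uniqueness applies. This is the source of continuity for all functions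
  assembled simplex by simplex.\<close>

lemma common_face:
 assumes T: "full_simplex T" "full_simplex T'" and F: "T \<inter> T' face_of T" "T \<inter> T' face_of T'"
 shows "verts (T \<inter> T') = verts T \<inter> verts T'" "x \<in> T \<inter> T' ==> bary T z x = bary T' z x"
  "x \<in> T ==> x \<in> T \<inter> T' \<longleftrightarrow> (\<forall>z. z \<notin> verts T' --> bary T z x = 0)"
proof -
 have "z \<in> verts (T \<inter> T')" if "z \<in> verts T" "z \<in> verts T'" for z
 proof -
  have "z \<in> T \<inter> T'" using that verts_subset T by blast
  thus ?thesis using that extreme_point_of_face[OF F(1)] by (simp add: verts_def)
 qed
 thus V: "verts (T \<inter> T') = verts T \<inter> verts T'" using full_simplex_face(1)[OF T(1) F(1)] full_simplex_face(1)[OF T(2) F(2)] by blast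
 note fin = finite_verts[OF T(1)] finite_verts[OF T(2)]
 show "x \<in> T \<inter> T' \<longleftrightarrow> (\<forall>z. z \<notin> verts T' --> bary T z x = 0)" if x: "x \<in> T"
 proof -
  have "x \<in> T \<inter> T' \<longleftrightarrow> (\<forall>z. z \<notin> verts (T \<inter> T') --> bary T z x = 0)"
   using full_simplex_face(3)[OF T(1) F(1), of x] x by blast
  also have "... \<longleftrightarrow> (\<forall>z. z \<notin> verts T' --> bary T z x = 0)" unfolding V using bary_notin[of _ T x] by blast
  finally show ?thesis .
 qed
 show "bary T z x = bary T' z x" if x: "x \<in> T \<inter> T'"
 proof -
  have z0: "bary T z x = 0" if "z \<notin> verts T'" for z using full_simplex_face(3)[OF T(1) F(1), of x] x that V by blast

  show ?thesis
  proof (cases "z \<in> verts T'")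
   case True
   have "bary T' z x = bary T z x"
   proof (rule bary_eqI[OF T(2) _ _ True])
    have "(\<Sum>z\<in>verts T'. bary T z x) = (\<Sum>z\<in>verts T. bary T z x)"
     by (rule sum.mono_neutral_cong[OF fin]) (auto simp: z0 bary_notin)
    thus "(\<Sum>z\<in>verts T'. bary T z x) = 1" using bary_sum[OF T(1)] by simp
    have "(\<Sum>z\<in>verts T'. bary T z x *\<^sub>R z) = (\<Sum>z\<in>verts T. bary T z x *\<^sub>R z)"
     by (rule sum.mono_neutral_cong[OF fin]) (auto simp: z0 bary_notin)
    thus "(\<Sum>z\<in>verts T'. bary T z x *\<^sub>R z) = x" using bary_combination[OF T(1)] by simp
   qed
   thus ?thesis by simp
  next
   case False
   thus ?thesis using z0 bary_notin by metis
  qed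
 qed
qed

section \<open>Polynomials on a simplex: Lipschitz and inverse estimates\<close>

text \<open>The constant lives on the reference coordinates, so the polynomial estimates below
  depend on a simplex only through its barycentric coordinates.\<close>

definition bern_const :: "nat => nat => real" where
 "bern_const d n = (SOME C. C > 0 \<and> (\<forall>c. \<exists>c'. (\<forall>t\<in>std_coords d. bern d n c t = bern d n c' t) \<and>
   (\<forall>M. (\<forall>t\<in>std_coords d. \<bar>bern d n c t\<bar> <= M) --> (\<Sum>w\<in>words d n. \<bar>c' w\<bar>) <= C * \<bar>M\<bar>)))"

lemma
 shows bern_const_pos: "0 < bern_const d n"
  and bern_const: "\<exists>c'. (\<forall>t\<in>std_coords d. bern d n c t = bern d n c' t) \<and>
   (\<forall>M. (\<forall>t\<in>std_coords d. \<bar>bern d n c t\<bar> <= M) --> (\<Sum>w\<in>words d n. \<bar>c' w\<bar>) <= bern_const d n * \<bar>M\<bar>)"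
proof -
 have "\<exists>C>0. \<forall>c. \<exists>c'. (\<forall>t\<in>std_coords d. bern d n c t = bern d n c' t) \<and>
   (\<forall>M. (\<forall>t\<in>std_coords d. \<bar>bern d n c t\<bar> <= M) --> (\<Sum>w\<in>words d n. \<bar>c' w\<bar>) <= C * \<bar>M\<bar>)"
  unfolding bern_def by (rule finite_span_stable_representation[OF finite_words])
 from someI_ex[OF this, folded bern_const_def]
 show "0 < bern_const d n" "\<exists>c'. (\<forall>t\<in>std_coords d. bern d n c t = bern d n c' t) \<and>
   (\<forall>M. (\<forall>t\<in>std_coords d. \<bar>bern d n c t\<bar> <= M) --> (\<Sum>w\<in>words d n. \<bar>c' w\<bar>) <= bern_const d n * \<bar>M\<bar>)"
  by blast+
qed

lemma bern_fun_power: "bern_fun d 1 F ==> bern_fun d n (%t. F t ^ n)"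
proof (induction n)
 case (Suc n)
 thus ?case using bern_fun_mult[of d 1 F n "%t. F t ^ n"] by simp
qed (simp add: bern_fun_0)

lemma bern_fun_prod: "(!!i. i \<in> I ==> bern_fun d (n i) (F i)) ==> bern_fun d (\<Sum>i\<in>I. n i) (%t. \<Prod>i\<in>I. F i t)"
proof (induction I rule: infinite_finite_induct)
 case (insert x I)
 thus ?case using bern_fun_mult[of d "n x" "F x" "\<Sum>i\<in>I. n i" "%t. \<Prod>i\<in>I. F i t"] by simp
qed (simp_all add: bern_fun_0)

lemma poly_deg_le_bern_fun:
 fixes q :: "'a::euclidean_space => real"
 assumes "poly_deg_le K q"
 shows "bern_fun d K (%t. q (\<Sum>i\<le>d. t i *\<^sub>R v i))"
proof -
 obtain A :: "('a => nat) set" and a where A: "finite A" "\<forall>\<alpha>\<in>A. (\<Sum>b\<in>Basis. \<alpha> b) <= K"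
  and q: "\<forall>x. q x = (\<Sum>\<alpha>\<in>A. a \<alpha> * (\<Prod>b\<in>Basis. (x \<bullet> b) ^ \<alpha> b))"
  using assms unfolding poly_deg_le_def by blast
 have lin: "bern_fun d 1 (%t. (\<Sum>i\<le>d. t i *\<^sub>R v i) \<bullet> b)" for b
 proof -
  have "bern_fun d (Suc 0) (%t. \<Sum>i\<le>d. t i * (v i \<bullet> b))" by (intro bern_fun_sum bern_fun_coord_mult bern_fun_0) simp
  thus ?thesis by (simp add: inner_sum_left)
 qed
 have "bern_fun d K (%t. \<Sum>\<alpha>\<in>A. a \<alpha> * (\<Prod>b\<in>Basis. ((\<Sum>i\<le>d. t i *\<^sub>R v i) \<bullet> b) ^ \<alpha> b))"
 proof (intro bern_fun_sum bern_fun_cmult)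
  fix \<alpha> assume "\<alpha> \<in> A"
  have "bern_fun d (\<Sum>b\<in>Basis. \<alpha> b) (%t. \<Prod>b\<in>Basis. ((\<Sum>i\<le>d. t i *\<^sub>R v i) \<bullet> b) ^ \<alpha> b)"
   by (intro bern_fun_prod bern_fun_power lin)
  thus "bern_fun d K (%t. \<Prod>b\<in>Basis. ((\<Sum>i\<le>d. t i *\<^sub>R v i) \<bullet> b) ^ \<alpha> b)"
   using A(2) \<open>\<alpha> \<in> A\<close> bern_fun_le by blast
 qed
 thus ?thesis using q by simp
qed

lemma prod_list_diff_le:
 fixes s t :: "nat => real"
 assumes "!!i. i \<in> set w ==> 0 <= t i \<and> t i <= 1 \<and> 0 <= s i \<and> s i <= 1 \<and> \<bar>t i - s i\<bar> <= e"
 shows "\<bar>(\<Prod>i\<leftarrow>w. t i) - (\<Prod>i\<leftarrow>w. s i)\<bar> <= real (length w) * e \<and> 0 <= (\<Prod>i\<leftarrow>w. t i) \<and> (\<Prod>i\<leftarrow>w. t i) <= 1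
   \<and> 0 <= (\<Prod>i\<leftarrow>w. s i) \<and> (\<Prod>i\<leftarrow>w. s i) <= 1" using assms proof (induction w) case (Cons a w)
 let ?T = "\<Prod>i\<leftarrow>w. t i" and ?S = "\<Prod>i\<leftarrow>w. s i"
 have IH: "\<bar>?T - ?S\<bar> <= real (length w) * e" "0 <= ?T" "?T <= 1" "0 <= ?S" "?S <= 1" using Cons.IH Cons.prems by auto
 have a: "0 <= t a" "t a <= 1" "0 <= s a" "s a <= 1" "\<bar>t a - s a\<bar> <= e" using Cons.prems[of a] by auto
 have "\<bar>t a * ?T - s a * ?S\<bar> = \<bar>t a * (?T - ?S) + (t a - s a) * ?S\<bar>" by (simp add: algebra_simps)
 also have "... <= \<bar>t a\<bar> * \<bar>?T - ?S\<bar> + \<bar>t a - s a\<bar> * \<bar>?S\<bar>"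
  by (rule order.trans[OF abs_triangle_ineq]) (simp add: abs_mult)
 also have "... <= 1 * (real (length w) * e) + e * 1" using a IH by (intro add_mono mult_mono) auto
 finally have "\<bar>t a * ?T - s a * ?S\<bar> <= real (length (a # w)) * e" by (simp add: algebra_simps)
 thus ?case using a IH by (simp add: mult_le_one)
qed simp

lemma bern_lipschitz:
 assumes "!!i. i <= d ==> 0 <= t i \<and> t i <= 1 \<and> 0 <= s i \<and> s i <= 1 \<and> \<bar>t i - s i\<bar> <= e"
 shows "\<bar>bern d n c t - bern d n c s\<bar> <= (\<Sum>w\<in>words d n. \<bar>c w\<bar>) * (real n * e)"
proof -
 have "\<bar>bern d n c t - bern d n c s\<bar> = \<bar>\<Sum>w\<in>words d n. c w * ((\<Prod>i\<leftarrow>w. t i) - (\<Prod>i\<leftarrow>w. s i))\<bar>"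
  by (simp add: bern_def sum_subtractf right_diff_distrib)
 also have "... <= (\<Sum>w\<in>words d n. \<bar>c w\<bar> * (real n * e))"
 proof (intro order.trans[OF sum_abs] sum_mono)
  fix w assume w: "w \<in> words d n"
  have "\<bar>(\<Prod>i\<leftarrow>w. t i) - (\<Prod>i\<leftarrow>w. s i)\<bar> <= real (length w) * e"
   using prod_list_diff_le[of w t s e] w assms by (auto simp: words_def)
  thus "\<bar>c w * ((\<Prod>i\<leftarrow>w. t i) - (\<Prod>i\<leftarrow>w. s i))\<bar> <= \<bar>c w\<bar> * (real n * e)"
   using w by (simp add: words_def abs_mult mult_left_mono)
 qed
 finally show ?thesis by (simp add: sum_distrib_right)
qed

lemma simplex_enumeration:
 assumes T: "full_simplex (T :: 'a::euclidean_space set)"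
 obtains v where "bij_betw v {..DIM('a)} (verts T)"
proof -
 show ?thesis using card_verts[OF T] using that finite_same_card_bij[of "{..DIM('a)}" "verts T"] finite_verts[OF T] by auto
qed

lemma bary_std_coords:
 assumes T: "full_simplex (T :: 'a::euclidean_space set)" and v: "bij_betw v {..DIM('a)} (verts T)" and x: "x \<in> T"
 shows "(%i. bary T (v i) x) \<in> std_coords DIM('a)" unfolding std_coords_def
 using bary_nonneg[OF T x] bary_sum[OF T, of x] sum.reindex_bij_betw[OF v, of "%z. bary T z x"] by auto

lemma simplex_point_of_coords:
 assumes T: "full_simplex (T :: 'a::euclidean_space set)" and v: "bij_betw v {..DIM('a)} (verts T)"
  and t: "t \<in> std_coords DIM('a)"
 shows "(\<Sum>i\<le>DIM('a). t i *\<^sub>R v i) \<in> T"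
proof -
 define u where "u z = t (inv_into {..DIM('a)} v z)" for z
 have inv: "inv_into {..DIM('a)} v (v i) = i" if "i <= DIM('a)" for i using that v by (intro inv_into_f_f) (auto simp: bij_betw_def)
 have "(\<Sum>z\<in>verts T. u z) = (\<Sum>i\<le>DIM('a). t i)" by (subst sum.reindex_bij_betw[OF v, symmetric]) (simp add: u_def inv)
 moreover have "(\<Sum>z\<in>verts T. u z *\<^sub>R z) = (\<Sum>i\<le>DIM('a). t i *\<^sub>R v i)"
  by (subst sum.reindex_bij_betw[OF v, symmetric]) (simp add: u_def inv)
 moreover have "0 <= u z" if "z \<in> verts T" for z
 proof -
  have "inv_into {..DIM('a)} v z \<in> {..DIM('a)}" using that v by (intro inv_into_into) (auto simp: bij_betw_def)
  thus ?thesis using t by (auto simp: u_def std_coords_def)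
 qed
 ultimately have "(\<Sum>i\<le>DIM('a). t i *\<^sub>R v i) \<in> convex hull (verts T)" unfolding convex_hull_finite[OF finite_verts[OF T]] using t
  by (intro CollectI exI[of _ u]) (auto simp: std_coords_def)
 thus ?thesis using verts_hull[OF T] by simp
qed

lemma poly_bary_representation:
 assumes T: "full_simplex (T :: 'a::euclidean_space set)" and v: "bij_betw v {..DIM('a)} (verts T)"
  and q: "poly_deg_le K q" and M: "!!x. x \<in> T ==> \<bar>q x\<bar> <= M"
 obtains c where "!!x. x \<in> T ==> q x = bern DIM('a) K c (%i. bary T (v i) x)"
  "(\<Sum>w\<in>words DIM('a) K. \<bar>c w\<bar>) <= bern_const DIM('a) K * \<bar>M\<bar>"
proof -
 let ?d = "DIM('a)"
 obtain c0 where c0: "\<forall>t\<in>std_coords ?d. q (\<Sum>i\<le>?d. t i *\<^sub>R v i) = bern ?d K c0 t"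
  using poly_deg_le_bern_fun[OF q, of ?d v] unfolding bern_fun_def by blast
 obtain c where c: "\<forall>t\<in>std_coords ?d. bern ?d K c0 t = bern ?d K c t"
  "\<forall>M. (\<forall>t\<in>std_coords ?d. \<bar>bern ?d K c0 t\<bar> <= M) --> (\<Sum>w\<in>words ?d K. \<bar>c w\<bar>) <= bern_const ?d K * \<bar>M\<bar>"
  using bern_const[of ?d K c0] by blast
 have "\<forall>t\<in>std_coords ?d. \<bar>bern ?d K c0 t\<bar> <= M" using c0 M simplex_point_of_coords[OF T v] by metis
 hence "(\<Sum>w\<in>words ?d K. \<bar>c w\<bar>) <= bern_const ?d K * \<bar>M\<bar>" using c(2) by blast
 moreover have "q x = bern ?d K c (%i. bary T (v i) x)" if x: "x \<in> T" for x
 proof -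
  show ?thesis using bary_combination[OF T, of x] sum.reindex_bij_betw[OF v, of "%z. bary T z x *\<^sub>R z"] using c0 c(1) bary_std_coords[OF T v x] by auto
 qed
 ultimately show ?thesis using that by blast
qed

lemma poly_bary_lipschitz:
 assumes T: "full_simplex (T :: 'a::euclidean_space set)" and q: "poly_deg_le K q"
  and M: "!!x. x \<in> T ==> \<bar>q x\<bar> <= M" and xy: "x \<in> T" "y \<in> T"
  and e: "!!z. \<bar>bary T z x - bary T z y\<bar> <= e"
 shows "\<bar>q x - q y\<bar> <= bern_const DIM('a) K * M * (real K * e)"
proof -
 obtain v where v: "bij_betw v {..DIM('a)} (verts T)" using simplex_enumeration[OF T] by blast
 have M0: "\<bar>M\<bar> = M" using M[OF xy(1)] by linarith
 have e0: "0 <= e" using e[of undefined] by linarith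
 obtain c where c: "!!x. x \<in> T ==> q x = bern DIM('a) K c (%i. bary T (v i) x)"
  "(\<Sum>w\<in>words DIM('a) K. \<bar>c w\<bar>) <= bern_const DIM('a) K * \<bar>M\<bar>" using poly_bary_representation[OF T v q M] by blast
 have "\<bar>q x - q y\<bar> <= (\<Sum>w\<in>words DIM('a) K. \<bar>c w\<bar>) * (real K * e)" unfolding c(1)[OF xy(1)] c(1)[OF xy(2)]
  using bary_nonneg[OF T xy(1)] bary_nonneg[OF T xy(2)] bary_le_1[OF T xy(1)] bary_le_1[OF T xy(2)] e by (intro bern_lipschitz) simp
 also have "... <= bern_const DIM('a) K * M * (real K * e)" using c(2) e0 M0 by (intro mult_right_mono) auto
 finally show ?thesis .
qed

text \<open>The inverse (Markov) inequality. The shape of \<open>T\<close> enters only through the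
  inscribed ball, which controls the barycentric coordinates.\<close>

lemma poly_lipschitz:
 assumes T: "full_simplex (T :: 'a::euclidean_space set)" and r: "0 < r" "cball b r \<subseteq> T"
  and q: "poly_deg_le K q" and M: "!!x. x \<in> T ==> \<bar>q x\<bar> <= M" and xy: "x \<in> T" "y \<in> T"
 shows "\<bar>q x - q y\<bar> <= (bern_const DIM('a) K * real K) * M / r * norm (x - y)"
 using poly_bary_lipschitz[OF T q M xy bary_lipschitz[OF T r]] by (simp add: mult_ac)

lemma poly_smooth:
 assumes "poly_deg_le K q" shows "q \<in> smooth_fun"
proof -
 obtain A a where "\<forall>x. q x = (\<Sum>\<alpha>\<in>A. a \<alpha> * (\<Prod>b\<in>Basis. (x \<bullet> b) ^ \<alpha> b))"
  using assms unfolding poly_deg_le_def by blast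
 hence "q = (%x. \<Sum>\<alpha>\<in>A. a \<alpha> * (\<Prod>b\<in>Basis. (x \<bullet> b) ^ \<alpha> b))" by blast
 moreover have "(%x. \<Sum>\<alpha>\<in>A. a \<alpha> * (\<Prod>b\<in>Basis. (x \<bullet> b) ^ \<alpha> b)) \<in> smooth_fun"
  by (intro smooth_fun_sum smooth_fun.mult smooth_fun.const smooth_fun_prod smooth_fun_power smooth_fun.inner)
 ultimately show ?thesis by simp
qed

text \<open>In \<open>poly_sup_le_L2\<close> the factor 4 compensates the value
  \<open>M / 2\<close>, and the bracket is the inverse of the contraction ratio
  \<open>e\<close>.\<close>

definition poly_mass :: "nat => nat => real" where "poly_mass d K = 4 * (2 * (bern_const d K + 1) * (real K + 1)) ^ d"

lemma poly_mass_pos: "0 < poly_mass d K" unfolding poly_mass_def using bern_const_pos[of d K] by simp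

lemma measure_lborel_contraction:
 assumes "compact (T :: 'a::euclidean_space set)" "0 <= e"
 shows "vol ((%x. a + e *\<^sub>R x) ` T) = e ^ DIM('a) * vol T"
proof -
 have c: "compact ((%x. a + e *\<^sub>R x) ` T)" by (intro compact_continuous_image continuous_intros assms(1))
 have "emeasure lborel ((%x. a + e *\<^sub>R x) ` T) = emeasure lebesgue ((%x. a + e *\<^sub>R x) ` T)"
  using compact_imp_closed[OF c] by simp
 also have "... = ennreal (\<bar>e\<bar> ^ DIM('a)) * emeasure lebesgue T" using emeasure_lebesgue_affine[of e a T] by (simp add: add.commute)
 also have "emeasure lebesgue T = emeasure lborel T" using compact_imp_closed[OF assms(1)] by simp
 finally show ?thesis using assms(2) by (simp add: measure_def enn2real_mult)
qed

text \<open>Contracting \<open>T\<close> towards a maximum point \<open>p\<close> by the ratio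
  \<open>e\<close> changes barycentric coordinates by at most \<open>e\<close>. For the chosen
  \<open>e\<close> the polynomial keeps at least half of its maximum on the contracted copy, whose
  volume is \<open>e ^ d\<close> times that of \<open>T\<close>.\<close>

lemma poly_sup_le_L2:
 assumes T: "full_simplex (T :: 'a::euclidean_space set)" and q: "poly_deg_le K q" and x: "x \<in> T"
 shows "(q x)^2 * vol T <= poly_mass DIM('a) K * (LBINT y. ind T y * (q y)^2)"
proof -
 let ?d = "DIM('a)"
 note comp = full_simplex_compact[OF T] and conv = full_simplex_convex[OF T]
 have qc: "continuous_on S q" for S using smooth_fun_continuous[OF poly_smooth[OF q]] .
 have "continuous_on T (%x. \<bar>q x\<bar>)" by (intro continuous_intros qc)
 then obtain p where p: "p \<in> T" "!!y. y \<in> T ==> \<bar>q y\<bar> <= \<bar>q p\<bar>" using continuous_attains_sup[OF comp] x by blast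
 define M where "M = \<bar>q p\<bar>"
 define W where "W = (bern_const ?d K + 1) * (real K + 1)"
 define e where "e = 1 / (2 * W)"
 have pm: "poly_mass ?d K = 4 * (2 * W) ^ ?d" by (simp only: poly_mass_def W_def mult.assoc)
 have bc: "0 < bern_const ?d K" by (rule bern_const_pos)
 have "1 * 1 <= (bern_const ?d K + 1) * (real K + 1)" using bc by (intro mult_mono) auto
 hence W1: "1 <= W" by (simp add: W_def)
 hence e: "0 < e" "e <= 1" by (auto simp: e_def)
 define E where "E = (%x. (1 - e) *\<^sub>R p + e *\<^sub>R x) ` T"
 have E: "E \<subseteq> T" unfolding E_def using convexD_alt[OF conv p(1), of _ e] e by auto
 have cE: "compact E" unfolding E_def by (intro compact_continuous_image continuous_intros comp)
 have large: "M / 2 <= \<bar>q y\<bar>" if y: "y \<in> E" for y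
 proof -
  obtain x where x: "x \<in> T" "y = (1 - e) *\<^sub>R p + e *\<^sub>R x" using y unfolding E_def by blast
  have "\<bar>bary T z y - bary T z p\<bar> <= e" for z
  proof -
   have "bary T z y - bary T z p = e * (bary T z x - bary T z p)" unfolding x(2) bary_affine[OF T] by (simp add: algebra_simps)
   moreover have "\<bar>bary T z x - bary T z p\<bar> <= 1"
    using bary_nonneg[OF T x(1), of z] bary_nonneg[OF T p(1), of z] bary_le_1[OF T x(1), of z]
     bary_le_1[OF T p(1), of z] by linarith
   ultimately show ?thesis using e by (simp add: abs_mult)
  qed
  hence "\<bar>q y - q p\<bar> <= bern_const ?d K * M * (real K * e)" using poly_bary_lipschitz[OF T q, of M y p e] p E y by (auto simp: M_def)
  also have "... = M * (bern_const ?d K * (real K * e))" by simp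
  also have "... <= M * (1 / 2)"
  proof (rule mult_left_mono)
   have "bern_const ?d K * real K <= W" unfolding W_def using bc by (intro mult_mono) auto
   thus "bern_const ?d K * (real K * e) <= 1 / 2" using W1 by (simp add: e_def)
  qed (simp add: M_def)
  finally show ?thesis unfolding M_def by linarith
 qed
 have qi: "integrable lborel (%y. ind S y * (q y)^2)" if "compact S" for S
  using borel_integrable_compact[OF that, of "%y. (q y)^2"] by (auto intro!: continuous_intros qc)
 have "(M / 2)^2 * vol E = (LBINT y. ind E y * (M / 2)^2)" by simp
 also have "... <= (LBINT y. ind T y * (q y)^2)"
 proof (rule integral_mono)
  show "integrable lborel (%y. ind E y * (M / 2)^2)" using compact_imp_closed[OF cE] emeasure_compact_finite[OF cE]
   by (intro integrable_mult_left integrable_real_indicator) (auto)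
  show "integrable lborel (%y. ind T y * (q y)^2)" by (rule qi[OF comp])
  fix y
  show "ind E y * (M / 2)^2 <= ind T y * (q y)^2"
  proof (cases "y \<in> E")
   case True
   have "(M / 2)^2 <= \<bar>q y\<bar>^2" using large[OF True] by (intro power_mono) (auto simp: M_def)
   thus ?thesis using True E by auto
  qed simp
 qed
 finally have 1: "(M / 2)^2 * (e ^ ?d * vol T) <= (LBINT y. ind T y * (q y)^2)"
  unfolding E_def measure_lborel_contraction[OF comp less_imp_le[OF e(1)]] .
 have "(q x)^2 <= M^2" using p(2)[OF x] by (simp add: M_def abs_le_square_iff)
 hence "(q x)^2 * vol T <= M^2 * vol T" by (intro mult_right_mono) auto
 also have "... = poly_mass ?d K * ((M / 2)^2 * (e ^ ?d * vol T))" using W1 by (simp add: pm e_def power_divide)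
 also have "... <= poly_mass ?d K * (LBINT y. ind T y * (q y)^2)"
  using 1 poly_mass_pos by (intro mult_left_mono) (auto intro: less_imp_le)
 finally show ?thesis .
qed

lemma gradient_le_lipschitz:
 fixes f :: "'a::euclidean_space => real"
 assumes U: "open U" "x \<in> U" and lip: "!!y. y \<in> U ==> \<bar>f y - f x\<bar> <= L * norm (y - x)"
  and der: "(f has_derivative (%h. G \<bullet> h)) (at x)"
 shows "norm G <= L"
proof (cases "G = 0")
 case False
 have "((%t. x + t *\<^sub>R G) has_derivative (%h. h *\<^sub>R G)) (at 0)" by (auto intro!: derivative_eq_intros)
 moreover have "(f has_derivative (%h. G \<bullet> h)) (at (x + 0 *\<^sub>R G))" using der by simp
 ultimately have "((%t. f (x + t *\<^sub>R G)) has_derivative (%h. G \<bullet> (h *\<^sub>R G))) (at 0)"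
  by (rule has_derivative_compose)
 hence "((%t. f (x + t *\<^sub>R G)) has_real_derivative (norm G)^2) (at 0)" unfolding has_field_derivative_def
  by (rule has_derivative_eq_rhs) (simp add: fun_eq_iff power2_norm_eq_inner)
 hence lim: "((%t. (f (x + t *\<^sub>R G) - f x) / t) \<longlongrightarrow> (norm G)^2) (at 0)" by (simp add: has_field_derivative_iff)
 obtain e where e: "e > 0" "ball x e \<subseteq> U" using U openE by blast
 have "\<forall>\<^sub>F t in at 0. (f (x + t *\<^sub>R G) - f x) / t <= L * norm G" unfolding eventually_at
 proof (intro exI[of _ "e / norm G"] conjI ballI impI)
  show "0 < e / norm G" using e False by simp
  fix t :: real assume t: "t \<noteq> 0 \<and> dist t 0 < e / norm G"
  hence "dist x (x + t *\<^sub>R G) < e" using False by (simp add: dist_norm field_simps)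
  hence "\<bar>f (x + t *\<^sub>R G) - f x\<bar> <= L * norm (t *\<^sub>R G)" using lip[of "x + t *\<^sub>R G"] e(2) by auto
  hence "\<bar>(f (x + t *\<^sub>R G) - f x) / t\<bar> <= L * norm G" using t by (simp add: divide_le_eq mult_ac)
  thus "(f (x + t *\<^sub>R G) - f x) / t <= L * norm G" by linarith
 qed
 hence "(norm G)^2 <= L * norm G" by (rule tendsto_upperbound[OF lim]) simp
 thus ?thesis using False by (simp add: power2_eq_square)
next
 case True
 \<comment> \<open>Only \<open>0 <= L\<close> remains, which follows from the hypothesis at any
   other point of \<open>U\<close>.\<close>
 obtain e where e: "e > 0" "ball x e \<subseteq> U" using U openE by blast
 obtain i :: 'a where i: "i \<in> Basis" by force
 have "x + (e / 2) *\<^sub>R i \<in> U" using e i by (intro subsetD[OF e(2)]) (simp add: dist_norm)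
 from order.trans[OF abs_ge_zero lip[OF this]] show ?thesis using True e i by (simp add: zero_le_mult_iff)
qed

section \<open>Riesz representation without a basis\<close>

text \<open>Induction on the set \<open>Z\<close> of points at which functions may be nonzero; a new
  point adds at most one dimension. The extra direction \<open>e\<close> is a function with value 1
  at the new point minus its projection \<open>p\<close>, and the representer is corrected along
  \<open>e\<close> by \<open>l e / B e e\<close>. Positivity of \<open>B\<close> is asked only for
  functions that are nonzero at some point of \<open>X\<close>; the others are invisible to
  \<open>B\<close> and \<open>l\<close>.\<close>

lemma riesz_finite_points:
 fixes V :: "('x => real) set" and B :: "('x => real) => ('x => real) => real"
 assumes X: "finite X" and ne: "V \<noteq> {}"
  and cl: "!!f g a b. f \<in> V ==> g \<in> V ==> (%x. a * f x + b * g x) \<in> V"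
  and lin: "!!f g h a b. f \<in> V ==> g \<in> V ==> h \<in> V ==> B (%x. a * f x + b * g x) h = a * B f h + b * B g h"
  and sym: "!!f g. f \<in> V ==> g \<in> V ==> B f g = B g f"
  and llin: "!!f g a b. f \<in> V ==> g \<in> V ==> l (%x. a * f x + b * g x) = a * l f + b * (l g :: real)"
  and lz: "!!f. f \<in> V ==> \<forall>x\<in>X. f x = 0 ==> l f = 0"
  and Bz: "!!f h. f \<in> V ==> h \<in> V ==> \<forall>x\<in>X. f x = 0 ==> B f h = 0"
  and pos: "!!f x. f \<in> V ==> x \<in> X ==> f x \<noteq> 0 ==> 0 < B f f"
 shows "\<exists>w\<in>V. \<forall>h\<in>V. B w h = l h"
proof -
 define W where "W Z = {f \<in> V. \<forall>x\<in>X. x \<notin> Z --> f x = 0}" for Z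
 have WV: "f \<in> V" if "f \<in> W Z" for f Z using that by (simp add: W_def)
 have lin2: "B h (%x. a * f x + b * g x) = a * B h f + b * B h g" if "f \<in> V" "g \<in> V" "h \<in> V" for f g h a b
  using lin[OF that, of a b] sym[OF that(3) cl[OF that(1,2)], of a b] sym[OF that(3,1)] sym[OF that(3,2)] by simp
 have main: "\<exists>w\<in>W Z. \<forall>h\<in>W Z. B w h = l h"
  if "finite Z" "Z \<subseteq> X" and "!!f g a b. f \<in> V ==> g \<in> V ==> l (%x. a * f x + b * g x) = a * l f + b * l g"
   "!!f. f \<in> V ==> \<forall>x\<in>X. f x = 0 ==> l f = 0" for Z and l :: "('x => real) => real" using that
 proof (induction Z arbitrary: l)
  case empty
  obtain f where "f \<in> V" using ne by blast
  from cl[OF this this, of 0 0] have w: "(%x. 0) \<in> V" by simp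
  hence "B (%x. 0) h = l h" if "h \<in> W {}" for h using Bz[OF w, of h] empty.prems(3)[of h] that by (simp add: W_def)
  with w show ?case by (intro bexI[of _ "%x. 0"]) (auto simp: W_def)
 next
  case (insert x0 Z l)
  let ?W = "W (insert x0 Z)"
  have W0: "f \<in> W Z \<longleftrightarrow> f \<in> ?W \<and> f x0 = 0" for f using insert.hyps insert.prems(1) by (auto simp: W_def)
  have clW: "(%x. a * f x + b * g x) \<in> ?W" if "f \<in> ?W" "g \<in> ?W" for f g a b using that cl by (simp add: W_def)
  have ZX: "Z \<subseteq> X" using insert.prems(1) by simp
  have "\<exists>w\<in>W Z. \<forall>h\<in>W Z. B w h = l h" by (rule insert.IH[OF ZX]) (fact insert.prems)+
  then obtain w0 where w0: "w0 \<in> W Z" "!!h. h \<in> W Z ==> B w0 h = l h" by blast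
  show ?case
  proof (cases "\<forall>f\<in>?W. f x0 = 0")
   case True
   thus ?thesis using w0 W0 by blast
  next
   case False
   then obtain f1 where f1: "f1 \<in> ?W" "f1 x0 \<noteq> 0" by blast
   define v1 where "v1 = (%x. (1 / f1 x0) * f1 x + 0 * f1 x)"
   have v1: "v1 \<in> ?W" "v1 x0 = 1" using clW[OF f1(1) f1(1), of "1 / f1 x0" 0] f1(2) by (simp_all add: v1_def)
   \<comment> \<open>The induction hypothesis is applied to the functional \<open>B v1\<close>, so
     its representer \<open>p\<close> is the projection of \<open>v1\<close>. For this purpose the
     induction is over all \<open>l\<close>.\<close>
   have "\<exists>w\<in>W Z. \<forall>h\<in>W Z. B w h = B v1 h"
   proof (rule insert.IH[OF ZX])
    show "B v1 f = 0" if "f \<in> V" "\<forall>x\<in>X. f x = 0" for f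
     using Bz[OF that(1) WV[OF v1(1)] that(2)] sym[OF that(1) WV[OF v1(1)]] by simp
   qed (rule lin2[OF _ _ WV[OF v1(1)]])
   then obtain p where p: "p \<in> W Z" "!!h. h \<in> W Z ==> B p h = B v1 h" by blast
   define e where "e = (%x. 1 * v1 x + (-1) * p x)"
   have eW: "e \<in> ?W" unfolding e_def using p(1) W0 by (intro clW[OF v1(1)]) simp
   have ex0: "e x0 = 1" using v1(2) p(1) W0 by (simp add: e_def)
   note V = WV[OF eW] WV[OF w0(1)]
   have e0: "B e h = 0" if "h \<in> W Z" for h using lin[OF WV[OF v1(1)] WV[OF p(1)] WV[OF that], of 1 "-1"] p(2)[OF that] by (simp add: e_def)
   have Be: "0 < B e e" using insert.prems(1) ex0 by (intro pos[OF V(1), of x0]) auto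
   define k where "k = l e / B e e"
   define w where "w = (%x. 1 * w0 x + k * e x)"
   have wW: "w \<in> ?W" unfolding w_def using w0(1) W0 eW by (intro clW) auto
   have Bw: "B w h = B w0 h + k * B e h" if "h \<in> V" for h unfolding w_def using lin[OF V(2,1) that, of 1 k] by simp
   have "B w h = l h" if h: "h \<in> ?W" for h
   proof -
    define h' where "h' = (%x. 1 * h x + (- h x0) * e x)"
    have h': "h' \<in> W Z" unfolding W0 h'_def using clW[OF h eW, of 1 "- h x0"] ex0 by simp
    have hh: "h = (%x. 1 * h' x + h x0 * e x)" by (simp add: h'_def)
    have "B w h = B w h' + h x0 * B w e" by (subst hh) (use lin2[OF WV[OF h'] V(1) WV[OF wW], of 1 "h x0"] in simp)
    also have "... = l h' + h x0 * l e"
     using Bw[OF WV[OF h']] Bw[OF V(1)] e0[OF h'] w0(2)[OF h'] sym[OF V(2,1)] e0[OF w0(1)] Be by (simp add: k_def)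
    also have "... = l h" by (subst (2) hh) (use insert.prems(2)[OF WV[OF h'] V(1), of 1 "h x0"] in simp)
    finally show ?thesis .
   qed
   with wW show ?thesis by blast
  qed
 qed
 have "\<exists>w\<in>W X. \<forall>h\<in>W X. B w h = l h" by (rule main[OF X order_refl]) (fact llin lz)+
 thus ?thesis by (simp add: W_def)
qed

section \<open>The triangulation of the domain\<close>

locale mesh =
 fixes Om :: "'a::euclidean_space set" and \<T> :: "'a set set"
 assumes domain: "polyhedral_domain Om" and tri: "triangulation_of \<T> Om"
context mesh
begin

lemma open_Om: "open Om" and bounded_Om: "bounded Om" and nonempty_Om: "Om \<noteq> {}"
 and connected_Om: "connected Om" using domain unfolding polyhedral_domain_def by blast+

lemma finite_\<T>: "finite \<T>" and simplex_\<T>: "T \<in> \<T> ==> full_simplex T"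
 and face_\<T>: "T \<in> \<T> ==> T' \<in> \<T> ==> T \<inter> T' face_of T" "T \<in> \<T> ==> T' \<in> \<T> ==> T \<inter> T' face_of T'"
 and union_\<T>: "\<Union>\<T> = closure Om"
 and boundary_faces: "\<exists>\<F>. (\<forall>F\<in>\<F>. \<exists>T\<in>\<T>. F face_of T) \<and> frontier Om = \<Union>\<F>"
proof -
 have t: "triangulation \<T>" "\<forall>T\<in>\<T>. int DIM('a) simplex T" "\<Union>\<T> = closure Om"
  "\<exists>\<F>. (\<forall>F\<in>\<F>. \<exists>T\<in>\<T>. F face_of T) \<and> frontier Om = \<Union>\<F>"
  using tri unfolding triangulation_of_def by blast+
 hence f: "!!T T'. T \<in> \<T> ==> T' \<in> \<T> ==> T \<inter> T' face_of T" unfolding triangulation_def by blast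
 show "finite \<T>" using t(1) unfolding triangulation_def by blast
 show "T \<in> \<T> ==> full_simplex T" using t(2) by (simp add: full_simplex_def)
 show "T \<in> \<T> ==> T' \<in> \<T> ==> T \<inter> T' face_of T" by (rule f)
 show "T \<in> \<T> ==> T' \<in> \<T> ==> T \<inter> T' face_of T'" using f[of T' T] by (simp add: Int_commute)
 show "\<Union>\<T> = closure Om" "\<exists>\<F>. (\<forall>F\<in>\<F>. \<exists>T\<in>\<T>. F face_of T) \<and> frontier Om = \<Union>\<F>" by (fact t)+
qed

lemma cover: "Om \<subseteq> \<Union>\<T>" using union_\<T> closure_subset by blast

lemma simplex_subset_closure: "T \<in> \<T> ==> T \<subseteq> closure Om" using union_\<T> by blast

text \<open>A face that meets the interior is the whole simplex. This is applied to
  \<open>T \<inter> T'\<close> twice: as a face of \<open>T\<close>, which gives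
  \<open>T \<subseteq> T'\<close>, and then as a face of \<open>T'\<close>.\<close>

lemma interior_meets_imp_eq:
 assumes T: "T \<in> \<T>" "T' \<in> \<T>" and x: "x \<in> interior T" "x \<in> T'"
 shows "T = T'"
proof -
 have xT: "x \<in> T" using x(1) interior_subset by blast
 have sub: "T \<subseteq> T'" using face_of_disjoint_interior[OF face_\<T>(1)[OF T]] x xT by blast
 hence "T \<inter> T' = T'" using x(1) interior_mono using face_of_disjoint_interior[OF face_\<T>(2)[OF T]] x xT by blast
 with sub show ?thesis by blast
qed

text \<open>A boundary point inside \<open>T\<close> would lie on a face contained in the frontier.
  That face meets the interior, so it is all of \<open>T\<close>; but the frontier of an open set
  has empty interior.\<close>

lemma interior_simplex_subset:
 assumes T: "T \<in> \<T>" shows "interior T \<subseteq> Om"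
proof
 fix x assume x: "x \<in> interior T"
 show "x \<in> Om"
 proof (rule ccontr)
  assume "x \<notin> Om"
  moreover have "x \<in> closure Om" using x interior_subset simplex_subset_closure[OF T] by blast
  ultimately have "x \<in> frontier Om" using open_Om by (simp add: frontier_def interior_open)
  moreover obtain \<F> where \<F>: "\<forall>F\<in>\<F>. \<exists>T\<in>\<T>. F face_of T" "frontier Om = \<Union>\<F>"
   using boundary_faces by blast
  ultimately obtain F where F0: "F \<in> \<F>" "x \<in> F" by auto
  then obtain T'' where "T'' \<in> \<T>" "F face_of T''" using \<F>(1) by blast
  moreover have "F \<subseteq> frontier Om" unfolding \<F>(2) using F0(1) by (rule Union_upper)
  ultimately have F: "T'' \<in> \<T>" "F face_of T''" "x \<in> F" "F \<subseteq> frontier Om" using F0(2) by simp_all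
  have eq: "T = T''" using interior_meets_imp_eq[OF T F(1) x] face_of_imp_subset[OF F(2)] F(3) by blast
  hence "interior T \<subseteq> interior (frontier Om)" using face_of_disjoint_interior[OF F(2)] x F(3) using F(4) interior_mono by blast
  also have "... = {}"
  proof -
   have fr: "interior (frontier Om) \<subseteq> frontier Om" by (rule interior_subset)
   hence "interior (frontier Om) \<inter> Om = {}" using open_Om by (auto simp: frontier_def interior_open)
   hence "interior (frontier Om) \<inter> closure Om = {}" by (simp add: open_Int_closure_eq_empty)
   thus ?thesis using fr by (auto simp: frontier_def)
  qed
  finally show False using x by blast
 qed
qed

lemma simplex_measurable: "T \<in> \<T> ==> T \<in> sets lborel" using full_simplex_closed[OF simplex_\<T>] by simp

lemma Om_measurable: "Om \<in> sets lborel" using open_Om by simp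

text \<open>Frontiers of convex sets are null sets, so almost everywhere statements can be checked
  on the disjoint interiors. The ambiguity of piecewise definitions on shared faces then
  disappears.\<close>

lemma skeleton_null: "AE x in lborel. \<forall>T\<in>\<T>. x \<in> T --> x \<in> interior T"
proof -
 have "AE x\<in>T in lborel. x \<in> interior T" if T: "T \<in> \<T>" for T
 proof -
  have "negligible (frontier T)" by (rule negligible_convex_frontier) (rule full_simplex_convex[OF simplex_\<T>[OF T]])
  hence "frontier T \<in> null_sets lborel" using null_sets_completion_iff[of "frontier T" lborel] by (simp add: negligible_iff_null_sets)
  hence "AE x in lborel. x \<notin> frontier T" by (rule AE_not_in)
  thus ?thesis by eventually_elim (use closure_subset in \<open>auto simp: frontier_def\<close>)
 qed
 thus ?thesis using finite_\<T> by (intro AE_finite_allI) auto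
qed

lemma AE_simplexI:
 assumes T: "T \<in> \<T>" and "!!x. x \<in> interior T ==> x \<in> T ==> x \<in> Om ==> P x" "!!x. x \<notin> T ==> P x"
 shows "AE x in lborel. P x" using skeleton_null by eventually_elim (use assms interior_simplex_subset[OF T] in blast)

lemma sum_interior:
 fixes f :: "'a set => 'b::real_vector"
 assumes T: "T \<in> \<T>" "x \<in> interior T"
 shows "(\<Sum>S\<in>\<T>. ind (interior S) x *\<^sub>R f S) = f T"
proof -
 have "(\<Sum>S\<in>\<T>. ind (interior S) x *\<^sub>R f S) = (\<Sum>S\<in>\<T>. if S = T then f T else 0)"
 proof (intro sum.cong refl)
  fix S assume "S \<in> \<T>"
  thus "ind (interior S) x *\<^sub>R f S = (if S = T then f T else 0)"
   using interior_meets_imp_eq[OF T(1) _ T(2), of S] T interior_subset[of S] by (auto simp: indicator_def)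
 qed
 thus ?thesis using T finite_\<T> by simp
qed

lemma indicator_decomposition: "AE x in lborel. (ind Om x :: real) = (\<Sum>T\<in>\<T>. ind T x)" using skeleton_null
proof eventually_elim
 case (elim x)
 show ?case
 proof (cases "x \<in> Om")
  case True
  then obtain T where T: "T \<in> \<T>" "x \<in> T" using cover by blast
  hence "x \<in> interior T" using elim by blast
  hence "ind T' x = (if T' = T then 1 else 0 :: real)" if "T' \<in> \<T>" for T'
   using interior_meets_imp_eq[OF T(1) that] T(2) by (auto simp: indicator_def)
  thus ?thesis using T(1) True finite_\<T> by simp
 next
  case False
  hence "x \<notin> T" if "T \<in> \<T>" for T using elim that interior_simplex_subset by blast
  thus ?thesis using False by simp
 qed
qed

lemma integral_decomposition:
 fixes f :: "'a => real"
 assumes "!!T. T \<in> \<T> ==> integrable lborel (%x. ind T x * f x)" and m: "(%x. ind Om x * f x) \<in> borel_measurable borel"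
 shows "integrable lborel (%x. ind Om x * f x)"
  "(LBINT x. ind Om x * f x) = (\<Sum>T\<in>\<T>. LBINT x. ind T x * f x)"
proof -
 have i: "integrable lborel (%x. \<Sum>T\<in>\<T>. ind T x * f x)" by (rule Bochner_Integration.integrable_sum) (rule assms)
 have ae: "AE x in lborel. (\<Sum>T\<in>\<T>. ind T x * f x) = ind Om x * f x"
  using indicator_decomposition by eventually_elim (simp flip: sum_distrib_right)
 show "integrable lborel (%x. ind Om x * f x)" by (rule integrable_cong_AE_imp[OF i _ ae]) (use m in simp)
 have "(LBINT x. ind Om x * f x) = (LBINT x. (\<Sum>T\<in>\<T>. ind T x * f x))"
  by (rule integral_cong_AE) (use m i ae in \<open>auto elim: AE_mp\<close>)
 also have "... = (\<Sum>T\<in>\<T>. LBINT x. ind T x * f x)" by (rule Bochner_Integration.integral_sum) (rule assms)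
 finally show "(LBINT x. ind Om x * f x) = (\<Sum>T\<in>\<T>. LBINT x. ind T x * f x)" .
qed

end

section \<open>Polynomial spaces, Lagrange space and projection\<close>

lemma poly_deg_leI:
 fixes f :: "'a::euclidean_space => real"
 assumes "finite A" "!!\<alpha>. \<alpha> \<in> A ==> (\<Sum>b\<in>Basis. \<alpha> b) <= K"
  "!!x. f x = (\<Sum>\<alpha>\<in>A. a \<alpha> * (\<Prod>b\<in>Basis. (x \<bullet> b) ^ \<alpha> b))"
 shows "poly_deg_le K f" unfolding poly_deg_le_def using assms by (intro exI[of _ A] exI[of _ a]) simp

lemma poly_deg_leE:
 fixes f :: "'a::euclidean_space => real"
 assumes "poly_deg_le K f"
 obtains A :: "('a => nat) set" and a where "finite A" "\<forall>\<alpha>\<in>A. (\<Sum>b\<in>Basis. \<alpha> b) <= K"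
  "\<forall>x. f x = (\<Sum>\<alpha>\<in>A. a \<alpha> * (\<Prod>b\<in>Basis. (x \<bullet> b) ^ \<alpha> b))"
 using assms unfolding poly_deg_le_def by (elim exE conjE) (rule that)

lemma poly_add:
 fixes f g :: "'a::euclidean_space => real"
 assumes "poly_deg_le K f" "poly_deg_le K g" shows "poly_deg_le K (%x. f x + g x)"
proof -
 obtain A :: "('a => nat) set" and a where A: "finite A" "\<forall>\<alpha>\<in>A. (\<Sum>b\<in>Basis. \<alpha> b) <= K"
  and f: "\<forall>x. f x = (\<Sum>\<alpha>\<in>A. a \<alpha> * (\<Prod>b\<in>Basis. (x \<bullet> b) ^ \<alpha> b))"
  using assms(1) by (rule poly_deg_leE)
 obtain B :: "('a => nat) set" and b where B: "finite B" "\<forall>\<alpha>\<in>B. (\<Sum>b\<in>Basis. \<alpha> b) <= K"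
  and g: "\<forall>x. g x = (\<Sum>\<alpha>\<in>B. b \<alpha> * (\<Prod>b\<in>Basis. (x \<bullet> b) ^ \<alpha> b))"
  using assms(2) by (rule poly_deg_leE)
 show ?thesis
 proof (rule poly_deg_leI[of "A \<union> B" _ _ "%\<alpha>. (if \<alpha> \<in> A then a \<alpha> else 0) + (if \<alpha> \<in> B then b \<alpha> else 0)"])
  fix x :: 'a
  let ?m = "%\<alpha>. (\<Prod>b\<in>Basis. (x \<bullet> b) ^ \<alpha> b)"
  have "(\<Sum>\<alpha>\<in>A \<union> B. ((if \<alpha> \<in> A then a \<alpha> else 0) + (if \<alpha> \<in> B then b \<alpha> else 0)) * ?m \<alpha>) =
    (\<Sum>\<alpha>\<in>A \<union> B. (if \<alpha> \<in> A then a \<alpha> else 0) * ?m \<alpha>) + (\<Sum>\<alpha>\<in>A \<union> B. (if \<alpha> \<in> B then b \<alpha> else 0) * ?m \<alpha>)"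
   by (simp add: distrib_right sum.distrib)
  also have "(\<Sum>\<alpha>\<in>A \<union> B. (if \<alpha> \<in> A then a \<alpha> else 0) * ?m \<alpha>) = f x"
   unfolding f[rule_format] by (rule sum.mono_neutral_cong_right) (use A(1) B(1) in auto)
  also have "(\<Sum>\<alpha>\<in>A \<union> B. (if \<alpha> \<in> B then b \<alpha> else 0) * ?m \<alpha>) = g x"
   unfolding g[rule_format] by (rule sum.mono_neutral_cong_right) (use A(1) B(1) in auto)
  finally show "f x + g x = (\<Sum>\<alpha>\<in>A \<union> B. ((if \<alpha> \<in> A then a \<alpha> else 0) + (if \<alpha> \<in> B then b \<alpha> else 0)) * ?m \<alpha>)"
   by simp
 qed (use A B in auto)
qed

lemma poly_monomial_mult:
 fixes g :: "'a::euclidean_space => real" and \<alpha> :: "'a => nat"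
 assumes "(\<Sum>b\<in>Basis. \<alpha> b) <= m" "poly_deg_le n g"
 shows "poly_deg_le (m + n) (%x. k * (\<Prod>b\<in>Basis. (x \<bullet> b) ^ \<alpha> b) * g x)"
proof -
 obtain B :: "('a => nat) set" and b where B: "finite B" "\<forall>\<alpha>\<in>B. (\<Sum>b\<in>Basis. \<alpha> b) <= n"
  and g: "\<forall>x. g x = (\<Sum>\<alpha>\<in>B. b \<alpha> * (\<Prod>b\<in>Basis. (x \<bullet> b) ^ \<alpha> b))"
  using assms(2) by (rule poly_deg_leE)
 define sh where "sh \<beta> = (%b. \<alpha> b + \<beta> b)" for \<beta> :: "'a => nat"
 have inj: "inj_on sh B" by (auto simp: inj_on_def sh_def fun_eq_iff)
 show ?thesis
 proof (rule poly_deg_leI[of "sh ` B" _ _ "%\<gamma>. k * b (%b. \<gamma> b - \<alpha> b)"])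
  show "(\<Sum>b\<in>Basis. \<gamma> b) <= m + n" if "\<gamma> \<in> sh ` B" for \<gamma>
  proof -
   obtain \<beta> where \<beta>: "\<beta> \<in> B" "\<gamma> = sh \<beta>" using \<open>\<gamma> \<in> sh ` B\<close> by blast
   have "(\<Sum>b\<in>Basis. \<gamma> b) = (\<Sum>b\<in>Basis. \<alpha> b) + (\<Sum>b\<in>Basis. \<beta> b)" by (simp add: \<beta>(2) sh_def sum.distrib)
   thus ?thesis using assms(1) B(2) \<beta>(1) by fastforce
  qed
  fix x :: 'a
  show "k * (\<Prod>b\<in>Basis. (x \<bullet> b) ^ \<alpha> b) * g x =
    (\<Sum>\<gamma>\<in>sh ` B. k * b (%b. \<gamma> b - \<alpha> b) * (\<Prod>b\<in>Basis. (x \<bullet> b) ^ \<gamma> b))"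
   unfolding sum.reindex[OF inj] g[rule_format] by (simp add: sh_def power_add prod.distrib sum_distrib_left mult_ac)
 qed (use B(1) in auto)
qed

lemma poly_zero: "poly_deg_le K (%x. 0)" by (rule poly_deg_leI[of "{}"]) auto

lemma poly_sum: "(!!i. i \<in> I ==> poly_deg_le K (f i)) ==> poly_deg_le K (%x. \<Sum>i\<in>I. f i x)"
proof (induction I rule: infinite_finite_induct)
 case (insert i I)
 hence "poly_deg_le K (%x. f i x + (\<Sum>i\<in>I. f i x))" by (intro poly_add) auto
 thus ?case using insert.hyps by simp
qed (simp_all add: poly_zero)

lemma poly_const: "poly_deg_le K (%x. c)" by (rule poly_deg_leI[of "{%b. 0}" _ _ "%\<alpha>. c"]) auto

lemma poly_mult:
 fixes f g :: "'a::euclidean_space => real"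
 assumes "poly_deg_le m f" "poly_deg_le n g" shows "poly_deg_le (m + n) (%x. f x * g x)"
proof -
 obtain A :: "('a => nat) set" and a where A: "finite A" "\<forall>\<alpha>\<in>A. (\<Sum>b\<in>Basis. \<alpha> b) <= m"
  and f: "\<forall>x. f x = (\<Sum>\<alpha>\<in>A. a \<alpha> * (\<Prod>b\<in>Basis. (x \<bullet> b) ^ \<alpha> b))"
  using assms(1) by (rule poly_deg_leE)
 have "poly_deg_le (m + n) (%x. \<Sum>\<alpha>\<in>A. a \<alpha> * (\<Prod>b\<in>Basis. (x \<bullet> b) ^ \<alpha> b) * g x)"
  by (intro poly_sum poly_monomial_mult A(2)[rule_format] assms(2))
 thus ?thesis unfolding f[rule_format] sum_distrib_right .
qed

lemma poly_cmult: assumes "poly_deg_le K f" shows "poly_deg_le K (%x. c * f x)" using poly_mult[OF poly_const[of 0 c] assms] by simp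

lemma poly_lincomb: "poly_deg_le K f ==> poly_deg_le K g ==> poly_deg_le K (%x. a * f x + b * g x)"
 by (rule poly_add[OF poly_cmult poly_cmult])

lemma poly_inner: "poly_deg_le 1 (%x::'a::euclidean_space. x \<bullet> a)"
proof -
 have "poly_deg_le 1 (%x::'a. x \<bullet> b)" if b: "b \<in> Basis" for b
 proof (rule poly_deg_leI[of "{%i. if i = b then 1 else 0}" _ _ "%\<alpha>. 1"])
  fix x :: 'a
  have "(\<Prod>i\<in>Basis. (x \<bullet> i) ^ (if i = b then 1 else 0)) = (\<Prod>i\<in>Basis. if i = b then x \<bullet> i else 1)"
   by (intro prod.cong) auto
  thus "x \<bullet> b = (\<Sum>\<alpha>\<in>{%i. if i = b then 1 else 0}. 1 * (\<Prod>i\<in>Basis. (x \<bullet> i) ^ \<alpha> i))"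
   using b by simp
 qed (use b in auto)
 hence "poly_deg_le 1 (%x::'a. \<Sum>b\<in>Basis. (a \<bullet> b) * (x \<bullet> b))" by (intro poly_sum poly_cmult)
 thus ?thesis by (simp add: euclidean_inner[of _ a] mult.commute)
qed

lemma poly_bary:
 assumes T: "full_simplex T" shows "poly_deg_le 1 (bary T z)"
proof -
 obtain a where "!!x. bary T z x = x \<bullet> a + bary T z 0" using bary_linear[OF T] by blast
 hence "bary T z = (%x. x \<bullet> a + bary T z 0)" by blast
 thus ?thesis using poly_add[OF poly_inner[of a] poly_const[of 1 "bary T z 0"]] by metis
qed

lemma poly_mono: "poly_deg_le m f ==> m <= n ==> poly_deg_le n f" unfolding poly_deg_le_def by (meson order.trans)

lemma poly_measurable: "poly_deg_le K q ==> q \<in> borel_measurable borel"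
 by (intro borel_measurable_continuous_onI smooth_fun_continuous poly_smooth)

text \<open>The points are the dual points of the Bernstein monomials restricted to
  \<open>S \<inter> T\<close>. They are the finite point sets on which
  \<open>riesz_finite_points\<close> is run.\<close>

lemma poly_determined_by_points:
 assumes T: "full_simplex (T :: 'a::euclidean_space set)"
 obtains X where "finite X" "X \<subseteq> S \<inter> T" "!!q x. poly_deg_le K q ==> \<forall>x\<in>X. q x = 0 ==> x \<in> S \<inter> T ==> q x = 0"
proof -
 obtain v where v: "bij_betw v {..DIM('a)} (verts T)" using simplex_enumeration[OF T] by blast
 define f where "f w x = (\<Prod>i\<leftarrow>w. bary T (v i) x)" for w x
 obtain X g where Xg: "dual_points (S \<inter> T) f (words DIM('a) K) X g" using finite_span_dual_points[OF finite_words] by blast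
 have X: "finite X" "X \<subseteq> S \<inter> T" using Xg unfolding dual_points_def by simp_all
 have "q x = 0" if q: "poly_deg_le K q" and z: "\<forall>x\<in>X. q x = 0" and x: "x \<in> S \<inter> T" for q x
 proof -
  have "compact (q ` T)" by (rule compact_continuous_image[OF smooth_fun_continuous[OF poly_smooth[OF q]] full_simplex_compact[OF T]])
  then obtain M where "\<forall>y\<in>q ` T. norm y <= M" using compact_imp_bounded bounded_iff by metis
  hence M: "!!x. x \<in> T ==> \<bar>q x\<bar> <= M" by simp
  obtain c where c: "!!x. x \<in> T ==> q x = bern DIM('a) K c (%i. bary T (v i) x)" using poly_bary_representation[OF T v q M] by metis
  have qf: "q x = (\<Sum>w\<in>words DIM('a) K. c w * f w x)" if "x \<in> T" for x using c[OF that] by (simp add: bern_def f_def)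
  have "(\<Sum>w\<in>words DIM('a) K. c w * f w x) =
    (\<Sum>y\<in>X. (\<Sum>w\<in>words DIM('a) K. c w * f w y) * (\<Sum>w\<in>words DIM('a) K. g y w * f w x))"
   using Xg x unfolding dual_points_def by blast
  also have "... = 0"
  proof (rule sum.neutral, rule ballI)
   fix y assume "y \<in> X"
   thus "(\<Sum>w\<in>words DIM('a) K. c w * f w y) * (\<Sum>w\<in>words DIM('a) K. g y w * f w x) = 0" using qf[of y] z X(2) by auto
  qed
  finally show ?thesis using qf x by simp
 qed
 thus ?thesis using that[OF X] by blast
qed

locale mesh_poly = mesh +
 fixes K :: nat

context mesh_poly
begin

abbreviation "V == lagrange_space Om \<T> K"

lemma V_poly:
 assumes "v \<in> V" "T \<in> \<T>"
 obtains q where "poly_deg_le K q" "!!x. x \<in> Om \<inter> T ==> v x = q x" using assms unfolding lagrange_space_def by blast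

lemma V_lincomb:
 assumes f: "f \<in> V" and g: "g \<in> V" shows "(%x. a * f x + b * g x) \<in> V" unfolding lagrange_space_def
proof (intro CollectI conjI ballI)
 show "continuous_on Om (%x. a * f x + b * g x)" using f g unfolding lagrange_space_def by (intro continuous_intros) auto
 fix T assume T: "T \<in> \<T>"
 obtain p where p: "poly_deg_le K p" "!!x. x \<in> Om \<inter> T ==> f x = p x" using V_poly[OF f T] by blast
 obtain q where q: "poly_deg_le K q" "!!x. x \<in> Om \<inter> T ==> g x = q x" using V_poly[OF g T] by blast
 show "\<exists>q. poly_deg_le K q \<and> (\<forall>x\<in>Om \<inter> T. a * f x + b * g x = q x)"
  using p q by (intro exI[of _ "%x. a * p x + b * q x"]) (simp add: poly_lincomb)
qed

lemma V_zero: "(%x. 0) \<in> V" unfolding lagrange_space_def using poly_zero by auto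

lemma V_bounded:
 assumes f: "f \<in> V" obtains B where "0 <= B" "!!x. x \<in> Om ==> \<bar>f x\<bar> <= B"
proof -
 have "\<exists>B\<ge>0. \<forall>x\<in>Om \<inter> T. \<bar>f x\<bar> <= B" if T: "T \<in> \<T>" for T
 proof -
  obtain q where q: "poly_deg_le K q" "!!x. x \<in> Om \<inter> T ==> f x = q x" using V_poly[OF f T] by blast
  have "compact (q ` T)"
   by (rule compact_continuous_image[OF smooth_fun_continuous[OF poly_smooth[OF q(1)]] full_simplex_compact[OF simplex_\<T>[OF T]]])
  then obtain M where "\<forall>y\<in>q ` T. norm y <= M" using compact_imp_bounded bounded_iff by metis
  thus ?thesis using q(2) by (intro exI[of _ "\<bar>M\<bar>"]) (auto)
 qed
 then obtain B where B: "!!T. T \<in> \<T> ==> 0 <= B T \<and> (\<forall>x\<in>Om \<inter> T. \<bar>f x\<bar> <= B T)" by metis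
 show ?thesis
 proof (rule that[of "\<Sum>T\<in>\<T>. B T"])
  show "0 <= (\<Sum>T\<in>\<T>. B T)" using B by (intro sum_nonneg) blast
  fix x assume x: "x \<in> Om"
  then obtain T where T: "T \<in> \<T>" "x \<in> T" using cover by blast
  have "\<bar>f x\<bar> <= B T" using B T x by blast
  also have "... <= (\<Sum>T\<in>\<T>. B T)" by (rule member_le_sum[OF T(1)]) (use B finite_\<T> in auto)
  finally show "\<bar>f x\<bar> <= (\<Sum>T\<in>\<T>. B T)" .
 qed
qed

lemma V_measurable: assumes "f \<in> V" shows "(%x. ind Om x * f x) \<in> borel_measurable borel"
proof -
 have "continuous_on Om f" using assms unfolding lagrange_space_def by blast
 thus ?thesis using borel_measurable_continuous_on_indicator[of Om f] open_Om by simp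
qed

end

context mesh
begin

lemma Om_finite_measure: "emeasure lborel Om < \<infinity>" using bounded_Om emeasure_bounded_finite by blast

end

context mesh_poly
begin

lemma V_times_integrable:
 assumes v: "v \<in> V" and f: "integrable lborel (%x. ind Om x * f x)"
 shows "integrable lborel (%x. ind Om x * (f x * v x))"
proof -
 obtain B where B: "0 <= B" "!!x. x \<in> Om ==> \<bar>v x\<bar> <= B" using V_bounded[OF v] by blast
 have "integrable lborel (%x. (ind Om x * v x) *\<^sub>R (ind Om x * f x))"
  by (rule integrable_times_bounded[OF f, of _ B]) (use B V_measurable[OF v] in \<open>auto simp: indicator_def\<close>)
 thus ?thesis by (rule back_subst[of "integrable lborel"]) (auto simp: indicator_def)
qed

lemma V_integrable: "v \<in> V ==> integrable lborel (%x. ind Om x * v x)"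
 using V_times_integrable[of v "%x. 1"] Om_finite_measure Om_measurable by simp

definition inner_V :: "('a => real) => ('a => real) => real" where "inner_V f g = (LBINT x. ind Om x * (f x * g x))"

lemma inner_V_commute: "inner_V f g = inner_V g f" by (simp add: inner_V_def mult.commute)

lemma inner_V_lincomb:
 assumes v: "v \<in> V" and f: "integrable lborel (%x. ind Om x * f x)" and g: "integrable lborel (%x. ind Om x * g x)"
 shows "inner_V (%x. a * f x + b * g x) v = a * inner_V f v + b * inner_V g v"
proof -
 have "inner_V (%x. a * f x + b * g x) v = (LBINT x. a * (ind Om x * (f x * v x)) + b * (ind Om x * (g x * v x)))"
  unfolding inner_V_def by (simp add: algebra_simps)
 thus ?thesis using V_times_integrable[OF v f] V_times_integrable[OF v g] by (simp add: inner_V_def)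
qed

lemma inner_V_lincomb_right:
 assumes v: "v \<in> V" "w \<in> V" and f: "integrable lborel (%x. ind Om x * f x)"
 shows "inner_V f (%x. a * v x + b * w x) = a * inner_V f v + b * inner_V f w"
proof -
 have "inner_V f (%x. a * v x + b * w x) = (LBINT x. a * (ind Om x * (f x * v x)) + b * (ind Om x * (f x * w x)))"
  unfolding inner_V_def by (simp add: algebra_simps)
 thus ?thesis using V_times_integrable[OF v(1) f] V_times_integrable[OF v(2) f] by (simp add: inner_V_def)
qed

lemma inner_V_pos:
 assumes f: "f \<in> V" and x: "x \<in> Om" "f x \<noteq> 0" shows "0 < inner_V f f"
proof -
 have c: "continuous_on Om f" using f unfolding lagrange_space_def by blast
 hence "isCont f x" using open_Om x(1) by (simp add: continuous_on_eq_continuous_at)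
 moreover have "0 < \<bar>f x\<bar> / 2" using x(2) by simp
 ultimately obtain d where d: "d > 0" "!!y. dist y x < d ==> dist (f y) (f x) < \<bar>f x\<bar> / 2" using continuous_at_eps_delta by metis
 obtain e where e: "e > 0" "ball x e \<subseteq> Om" using open_Om x(1) openE by blast
 define r where "r = min d e"
 have r: "r > 0" using d e by (simp add: r_def)
 have fi: "integrable lborel (%x. ind Om x * (f x * f x))" by (rule V_times_integrable[OF f V_integrable[OF f]])
 have "0 < (\<bar>f x\<bar> / 2)^2 * vol (ball x r)" using x(2) content_ball_pos[OF r, of x] by simp
 also have "... = (LBINT y. ind (ball x r) y * (\<bar>f x\<bar> / 2)^2)" by simp
 also have "... <= inner_V f f" unfolding inner_V_def
 proof (rule integral_mono[OF _ fi])
  show "integrable lborel (%y. ind (ball x r) y * (\<bar>f x\<bar> / 2)^2)"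
   using emeasure_bounded_finite[OF bounded_ball, of x r] by (intro integrable_mult_left integrable_real_indicator) auto
  fix y
  show "ind (ball x r) y * (\<bar>f x\<bar> / 2)^2 <= ind Om y * (f y * f y)"
  proof (cases "y \<in> ball x r")
   case True
   hence "y \<in> Om" "dist y x < d" using e by (auto simp: r_def dist_commute)
   hence "\<bar>f y - f x\<bar> < \<bar>f x\<bar> / 2" using d(2)[of y] by (simp only: dist_real_def)
   hence "\<bar>f x\<bar> / 2 <= \<bar>f y\<bar>" by linarith
   hence "(\<bar>f x\<bar> / 2)^2 <= \<bar>f y\<bar>^2" by (intro power_mono) auto
   thus ?thesis using \<open>y \<in> Om\<close> True by (simp add: power2_eq_square)
  qed (simp add: indicator_def)
 qed
 finally show ?thesis .
qed

lemma V_determined_by_points: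
 obtains X where "finite X" "X \<subseteq> Om" "!!v x. v \<in> V ==> \<forall>x\<in>X. v x = 0 ==> x \<in> Om ==> v x = 0"
proof -
 have "\<exists>X. finite X \<and> X \<subseteq> Om \<inter> T \<and> (\<forall>q x. poly_deg_le K q --> (\<forall>x\<in>X. q x = 0) --> x \<in> Om \<inter> T --> q x = 0)"
  if T: "T \<in> \<T>" for T using poly_determined_by_points[OF simplex_\<T>[OF T], where S = Om and K = K] by metis
 then obtain X where X: "!!T. T \<in> \<T> ==> finite (X T) \<and> X T \<subseteq> Om \<inter> T \<and>
   (\<forall>q x. poly_deg_le K q --> (\<forall>x\<in>X T. q x = 0) --> x \<in> Om \<inter> T --> q x = 0)" by metis show ?thesis
 proof (rule that[of "\<Union>T\<in>\<T>. X T"])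
  show "finite (\<Union>T\<in>\<T>. X T)" using X finite_\<T> by blast
  show "(\<Union>T\<in>\<T>. X T) \<subseteq> Om" using X by blast
  fix v x assume v: "v \<in> V" "\<forall>x\<in>\<Union>T\<in>\<T>. X T. v x = 0" and x: "x \<in> Om"
  obtain T where T: "T \<in> \<T>" "x \<in> T" using cover x by blast
  obtain q where q: "poly_deg_le K q" "!!x. x \<in> Om \<inter> T ==> v x = q x" using V_poly[OF v(1) T(1)] by blast
  have "q y = 0" if "y \<in> X T" for y using that v(2) q(2) X[OF T(1)] T(1) by fastforce
  hence "q x = 0" using X[OF T(1)] q(1) x T(2) by blast
  thus "v x = 0" using q(2) x T(2) by simp
 qed
qed

definition is_proj :: "('a => real) => ('a => real) => bool" where
 "is_proj f w \<longleftrightarrow> w \<in> V \<and> (\<forall>v\<in>V. inner_V w v = inner_V f v)"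

lemma is_proj_exists:
 assumes f: "integrable lborel (%x. ind Om x * f x)" shows "\<exists>w. is_proj f w"
proof -
 obtain X where X: "finite X" "X \<subseteq> Om" "!!v x. v \<in> V ==> \<forall>x\<in>X. v x = 0 ==> x \<in> Om ==> v x = 0"
  using V_determined_by_points by blast
 have z: "inner_V g v = 0" if "v \<in> V" "\<forall>x\<in>X. v x = 0" for v g
 proof -
  have "ind Om x * (g x * v x) = 0" for x using X(3)[OF that] by (cases "x \<in> Om") auto
  thus ?thesis unfolding inner_V_def by (simp only: Bochner_Integration.integral_zero)
 qed
 have "\<exists>w\<in>V. \<forall>h\<in>V. inner_V w h = inner_V f h"
 proof (rule riesz_finite_points[OF X(1)])
  show "V \<noteq> {}" using V_zero by blast
  show "inner_V g h = inner_V h g" for g h by (rule inner_V_commute)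
  show "inner_V g h = 0" if "g \<in> V" "h \<in> V" "\<forall>x\<in>X. g x = 0" for g h
   using z[OF that(1,3), of h] inner_V_commute[of g h] by (rule trans[rotated])
  show "0 < inner_V g g" if "g \<in> V" "x \<in> X" "g x \<noteq> 0" for g x using inner_V_pos[OF that(1) _ that(3)] that(2) X(2) by blast
  show "inner_V (%x. a * g x + b * h x) k = a * inner_V g k + b * inner_V h k"
   if "g \<in> V" "h \<in> V" "k \<in> V" for g h k a b by (rule inner_V_lincomb[OF that(3) V_integrable[OF that(1)] V_integrable[OF that(2)]])
  show "inner_V f (%x. a * g x + b * h x) = a * inner_V f g + b * inner_V f h"
   if "g \<in> V" "h \<in> V" for g h a b by (rule inner_V_lincomb_right[OF that f])
 qed (use V_lincomb z in auto)
 thus ?thesis unfolding is_proj_def by blast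
qed

lemma is_proj_unique:
 assumes "is_proj f w" "is_proj f w'" "x \<in> Om" shows "w x = w' x"
proof (rule ccontr)
 assume ne: "w x \<noteq> w' x"
 have w: "w \<in> V" "w' \<in> V" "!!v. v \<in> V ==> inner_V w v = inner_V w' v" using assms unfolding is_proj_def by auto
 define e where "e = (%x. 1 * w x + (-1) * w' x)"
 have e: "e \<in> V" unfolding e_def by (rule V_lincomb[OF w(1,2)])
 have "inner_V e e = 1 * inner_V w e + (-1) * inner_V w' e"
  unfolding e_def[of] by (rule inner_V_lincomb[OF e[unfolded e_def] V_integrable[OF w(1)] V_integrable[OF w(2)]])
 hence "inner_V e e = 0" using w(3)[OF e] by simp
 moreover have "0 < inner_V e e" by (rule inner_V_pos[OF e assms(3)]) (use ne in \<open>simp add: e_def\<close>)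
 ultimately show False by simp
qed

text \<open>Passing to a Borel version changes no pairing, so the choice in
  \<open>L2_projection\<close> ranges over the predicate \<open>is_proj f\<close>, which is
  satisfiable for integrable \<open>f\<close>.\<close>

lemma L2_projection_is_proj:
 assumes u: "integrable (lebesgue_on Om) u" and f: "f \<in> borel_measurable borel" "AE x\<in>Om in lborel. f x = u x"
 shows "is_proj f (L2_projection Om \<T> K u)"
proof -
 have Omm: "Om \<in> sets lebesgue" using Om_measurable by simp
 obtain F where F: "integrable lborel F" "AE x in lborel. F x = ind Om x *\<^sub>R u x"
  by (rule borel_version_lebesgue_on[OF Omm u])
 have fi: "integrable lborel (%x. ind Om x * f x)"
 proof (rule integrable_cong_AE_imp[OF F(1)])
  show "(%x. ind Om x * f x) \<in> borel_measurable lborel"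
   using f(1) Om_measurable by (intro borel_measurable_times borel_measurable_indicator) auto
  show "AE x in lborel. F x = ind Om x * f x" using F(2) f(2) by eventually_elim auto
 qed
 have eq: "(\<integral>x. g x * v x \<partial>lebesgue_on Om) = inner_V h v"
  if "v \<in> V" "integrable lborel (%x. ind Om x * h x)" "AE x\<in>Om in lborel. h x = g x" for g h v
  unfolding inner_V_def by (rule integral_lebesgue_on_eq[OF Omm])
   (use that(3) borel_measurable_integrable[OF V_times_integrable[OF that(1,2)]] in \<open>auto elim!: eventually_mono simp: indicator_def\<close>)
 have "L2_projection Om \<T> K u = (SOME w. is_proj f w)" unfolding L2_projection_def is_proj_def
  using eq[OF _ fi f(2)] eq[OF _ V_integrable, of _ w w for w] by (intro arg_cong[where f = Eps] ext) auto
 thus ?thesis using someI_ex[OF is_proj_exists[OF fi]] by simp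
qed

end

section \<open>Shape-regular meshes: local finiteness and comparable sizes\<close>

text \<open>\<open>cs\<close> and \<open>cr\<close> are parameters, so that every later constant is
  a function of them, the dimension and the degree. \<open>cr\<close> bounds size jumps between
  related simplices; it enters on the line, where intervals meeting at a vertex share no
  edge.\<close>

locale mesh_shape = mesh Om \<T> for Om :: "'a::euclidean_space set" and \<T> +
 fixes R :: "('a set \<times> 'a set) set" and cs cr :: real
 assumes neighbors: "neighbor_relation \<T> R"
  and shape: "T \<in> \<T> ==> \<exists>b r. 0 < r \<and> cball b r \<subseteq> T \<and> diameter T <= cs * r"
  and size_R: "(T, T') \<in> R ==> diameter T' <= cr * diameter T"
  and cs1: "1 <= cs" and cr1: "1 <= cr"

context mesh_shape
begin

definition rad :: "'a set => real" where "rad T = (SOME r. \<exists>b. 0 < r \<and> cball b r \<subseteq> T \<and> diameter T <= cs * r)"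

definition ctr :: "'a set => 'a" where "ctr T = (SOME b. cball b (rad T) \<subseteq> T)"

lemma rad:
 assumes "T \<in> \<T>" shows rad_pos: "0 < rad T" and ball_ctr: "cball (ctr T) (rad T) \<subseteq> T"
  and diameter_le_rad: "diameter T <= cs * rad T"
proof -
 have "\<exists>r. \<exists>b. 0 < r \<and> cball b r \<subseteq> T \<and> diameter T <= cs * r" using shape[OF assms] by blast
 from someI_ex[OF this, folded rad_def]
 have r: "0 < rad T" "diameter T <= cs * rad T" "\<exists>b. cball b (rad T) \<subseteq> T" by blast+
 thus "0 < rad T" "diameter T <= cs * rad T" by blast+
 show "cball (ctr T) (rad T) \<subseteq> T" unfolding ctr_def by (rule someI_ex[OF r(3)])
qed

end

context mesh
begin

lemma dist_le_diameter: "T \<in> \<T> ==> x \<in> T ==> y \<in> T ==> norm (x - y) <= diameter T"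
 using diameter_bounded_bound[of T x y] compact_imp_bounded[OF full_simplex_compact[OF simplex_\<T>]] by (simp add: dist_norm)

end

context mesh_shape
begin

lemma diameter_pos: assumes T: "T \<in> \<T>" shows "0 < diameter T"
proof -
 have "diameter (cball (ctr T) (rad T)) <= diameter T"
  by (rule diameter_subset[OF ball_ctr[OF T] compact_imp_bounded[OF full_simplex_compact[OF simplex_\<T>[OF T]]]])
 thus ?thesis using rad_pos[OF T] by simp
qed

lemma ctr_in: "T \<in> \<T> ==> ctr T \<in> T" using ball_ctr[of T] rad_pos[of T] by auto

definition \<omega> :: real where "\<omega> = unit_ball_vol (real DIM('a))"

lemma \<omega>_pos: "0 < \<omega>" by (simp add: \<omega>_def)

lemma measure_cball: "0 <= r ==> vol (cball (x::'a) r) = \<omega> * r ^ DIM('a)" by (simp add: \<omega>_def content_cball)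

end

lemma measure_mono_compact: "A \<subseteq> B ==> compact A ==> compact (B :: 'a::euclidean_space set) ==> vol A <= vol B"
 by (intro measure_mono_fmeasurable fmeasurableI) (simp_all add: compact_imp_closed emeasure_compact_finite[unfolded infinity_ennreal_def])

context mesh_shape
begin

lemma measure_simplex:
 assumes T: "T \<in> \<T>"
 shows measure_simplex_le: "vol T <= \<omega> * diameter T ^ DIM('a)"
  and measure_simplex_ge: "\<omega> * diameter T ^ DIM('a) <= cs ^ DIM('a) * vol T"
  and measure_simplex_pos: "0 < vol T"
proof -
 note c = full_simplex_compact[OF simplex_\<T>[OF T]]
 have "T \<subseteq> cball (ctr T) (diameter T)" using dist_le_diameter[OF T ctr_in[OF T]] by (auto simp: dist_norm)
 hence "vol T <= vol (cball (ctr T) (diameter T))" by (rule measure_mono_compact[OF _ c compact_cball])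
 thus "vol T <= \<omega> * diameter T ^ DIM('a)" using measure_cball[of "diameter T" "ctr T"] diameter_pos[OF T] by simp
 have "\<omega> * rad T ^ DIM('a) = vol (cball (ctr T) (rad T))" using measure_cball[of "rad T" "ctr T"] rad_pos[OF T] by simp
 also have "... <= vol T" by (rule measure_mono_compact[OF ball_ctr[OF T] compact_cball c])
 finally have 1: "\<omega> * rad T ^ DIM('a) <= vol T" .
 have "\<omega> * diameter T ^ DIM('a) <= \<omega> * (cs * rad T) ^ DIM('a)" using diameter_le_rad[OF T] diameter_pos[OF T] using \<omega>_pos by simp
 also have "... = cs ^ DIM('a) * (\<omega> * rad T ^ DIM('a))" by (simp add: power_mult_distrib)
 also have "... <= cs ^ DIM('a) * vol T" using 1 cs1 by (intro mult_left_mono) auto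
 finally show "\<omega> * diameter T ^ DIM('a) <= cs ^ DIM('a) * vol T" .
 show "0 < vol T" using order.strict_trans2[OF mult_pos_pos[OF \<omega>_pos zero_less_power[OF rad_pos[OF T]]] 1] .
qed

end

context mesh
begin

lemma packing:
 assumes S: "S \<subseteq> \<T>" and A: "!!T. T \<in> S ==> A T \<subseteq> T \<inter> B" "!!T. T \<in> S ==> A T \<in> sets lborel"
  and B: "B \<in> sets lborel" "emeasure lborel B < \<infinity>"
 shows "(\<Sum>T\<in>S. vol (A T)) <= vol B"
proof -
 have fin: "finite S" using S finite_\<T> finite_subset by blast
 have i: "integrable lborel (ind (A T) :: 'a => real)" if "T \<in> S" for T
  using A[OF that] emeasure_mono[of "A T" B lborel] B by (intro integrable_real_indicator) (auto)
 have "(\<Sum>T\<in>S. vol (A T)) = (\<Sum>T\<in>S. LBINT x. ind (A T) x)" by simp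
 also have "... = (LBINT x. (\<Sum>T\<in>S. ind (A T) x))" by (rule Bochner_Integration.integral_sum[symmetric]) (rule i)
 also have "... <= (LBINT x. ind B x)"
 proof (rule integral_mono_AE)
  show "integrable lborel (%x. \<Sum>T\<in>S. ind (A T) x :: real)" by (rule Bochner_Integration.integrable_sum) (rule i)
  show "integrable lborel (ind B :: 'a => real)" using B by (intro integrable_real_indicator)
  show "AE x in lborel. (\<Sum>T\<in>S. ind (A T) x :: real) <= ind B x" using skeleton_null
  proof eventually_elim
   case (elim x)
   show ?case
   proof (cases "\<exists>T\<in>S. x \<in> A T")
    case True
    then obtain T where T: "T \<in> S" "x \<in> A T" by blast
    have "ind (A T') x = (0::real)" if "T' \<in> S - {T}" for T'
    proof -
     have "x \<in> interior T" using elim T A(1) S by blast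
     thus ?thesis using interior_meets_imp_eq[of T T' x] T(1) S that using A(1)[of T'] that by (auto simp: indicator_def)
    qed
    hence "(\<Sum>T\<in>S. ind (A T) x :: real) = ind (A T) x" using fin T(1) by (subst sum.remove[of _ T]) (auto)
    thus ?thesis using A(1)[OF T(1)] by (auto simp: indicator_def)
   qed (simp add: indicator_def)
  qed
 qed
 also have "... = vol B" by simp
 finally show ?thesis .
qed

end

lemma simplex_contraction:
 assumes T: "full_simplex T" and x: "x \<in> T" and c: "cball b r \<subseteq> T" and s: "0 < s" "s <= 1"
  and diam: "!!y. y \<in> T ==> norm (y - x) <= \<delta>"
 shows "cball ((1 - s) *\<^sub>R x + s *\<^sub>R b) (s * r) \<subseteq> T \<inter> cball x (s * \<delta>)"
proof
 fix y assume y: "y \<in> cball ((1 - s) *\<^sub>R x + s *\<^sub>R b) (s * r)"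
 define w where "w = b + (1 / s) *\<^sub>R (y - ((1 - s) *\<^sub>R x + s *\<^sub>R b))"
 have "norm (y - ((1 - s) *\<^sub>R x + s *\<^sub>R b)) <= s * r" using y by (simp add: dist_norm norm_minus_commute)
 hence "dist b w <= r" using s by (simp add: w_def dist_norm divide_le_eq mult.commute)
 hence w: "w \<in> T" using c by auto
 have yw: "y = (1 - s) *\<^sub>R x + s *\<^sub>R w" using s by (simp add: w_def algebra_simps)
 have "y \<in> T" unfolding yw using convexD_alt[OF full_simplex_convex[OF T] x w, of s] s by simp
 moreover have "y - x = s *\<^sub>R (w - x)" unfolding yw by (simp add: algebra_simps)
 hence "norm (y - x) <= s * \<delta>" using diam[OF w] s by simp
 ultimately show "y \<in> T \<inter> cball x (s * \<delta>)" by (simp add: dist_norm norm_minus_commute)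
qed

context mesh_shape
begin

text \<open>Every simplex of the star is contracted towards \<open>z\<close> to the smallest
  diameter \<open>\<epsilon>\<close> of the star. Each copy contains a ball of radius at least
  \<open>\<epsilon> / cs\<close>, and the copies fit without overlap into the ball of radius
  \<open>\<epsilon>\<close> around \<open>z\<close>.\<close>

lemma card_star_le: "real (card {T \<in> \<T>. z \<in> T}) <= cs ^ DIM('a)"
proof (cases "{T \<in> \<T>. z \<in> T} = {}")
 case False
 define S where "S = {T \<in> \<T>. z \<in> T}"
 have fin: "finite S" and ne: "S \<noteq> {}" using finite_\<T> False by (auto simp: S_def)
 define \<epsilon> where "\<epsilon> = Min (diameter ` S)"
 have \<epsilon>: "0 < \<epsilon>" "!!T. T \<in> S ==> \<epsilon> <= diameter T"
  using fin ne diameter_pos unfolding \<epsilon>_def by (auto simp: S_def)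
 define s where "s T = \<epsilon> / diameter T" for T :: "'a set"
 define A where "A T = cball ((1 - s T) *\<^sub>R z + s T *\<^sub>R ctr T) (s T * rad T)" for T
 have A: "A T \<subseteq> T \<inter> cball z \<epsilon>" "\<omega> * (\<epsilon> / cs) ^ DIM('a) <= vol (A T)" if T: "T \<in> S" for T
 proof -
  have T\<T>: "T \<in> \<T>" "z \<in> T" using T by (auto simp: S_def)
  have dp: "0 < diameter T" by (rule diameter_pos[OF T\<T>(1)])
  have s: "0 < s T" "s T <= 1" using \<epsilon> T dp by (auto simp: s_def)
  have "A T \<subseteq> T \<inter> cball z (s T * diameter T)" unfolding A_def using dist_le_diameter[OF T\<T>(1) _ T\<T>(2)]
   by (intro simplex_contraction[OF simplex_\<T>[OF T\<T>(1)] T\<T>(2) ball_ctr[OF T\<T>(1)] s])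
  thus "A T \<subseteq> T \<inter> cball z \<epsilon>" using dp by (simp add: s_def)
  have "\<epsilon> / cs <= s T * rad T" using diameter_le_rad[OF T\<T>(1)] dp \<epsilon>(1) cs1 by (simp add: s_def field_simps)
  hence "(\<epsilon> / cs) ^ DIM('a) <= (s T * rad T) ^ DIM('a)" using \<epsilon>(1) cs1 by (intro power_mono) auto
  moreover have "vol (A T) = \<omega> * (s T * rad T) ^ DIM('a)" unfolding A_def using s(1) rad_pos[OF T\<T>(1)] by (intro measure_cball) simp
  ultimately show "\<omega> * (\<epsilon> / cs) ^ DIM('a) <= vol (A T)" using \<omega>_pos by simp
 qed
 have "real (card S) * (\<omega> * (\<epsilon> / cs) ^ DIM('a)) = (\<Sum>T\<in>S. \<omega> * (\<epsilon> / cs) ^ DIM('a))" by simp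
 also have "... <= (\<Sum>T\<in>S. vol (A T))" by (intro sum_mono A(2))
 also have "... <= vol (cball z \<epsilon>)"
  by (rule packing) (use A(1) emeasure_compact_finite[of "cball z \<epsilon>"] in \<open>auto simp: S_def A_def\<close>)
 also have "... = \<omega> * \<epsilon> ^ DIM('a)" using \<epsilon>(1) by (intro measure_cball) simp
 finally show ?thesis using \<omega>_pos using \<epsilon>(1) cs1 by (simp add: power_divide S_def divide_le_eq)
next
 case True
 thus ?thesis using cs1 by (simp only: card.empty) simp
qed

text \<open>Between the ends of the edge a barycentric coordinate of \<open>T'\<close> drops from 1
  to 0, so the edge is at least as long as the radius of the ball inside \<open>T'\<close>; and it
  is at most as long as \<open>T\<close> is wide.\<close>

lemma shared_edge_size:
 assumes T: "T \<in> \<T>" "T' \<in> \<T>" and zw: "z \<noteq> w" "z \<in> verts T \<inter> verts T'" "w \<in> verts T \<inter> verts T'"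
 shows "diameter T' <= cs * diameter T"
proof -
 note S = simplex_\<T>[OF T(1)] simplex_\<T>[OF T(2)]
 have "\<bar>bary T' z z - bary T' z w\<bar> <= norm (z - w) / rad T'" by (rule bary_lipschitz[OF S(2) rad_pos[OF T(2)] ball_ctr[OF T(2)]])
 hence "rad T' <= norm (z - w)" using bary_vertex[OF S(2)] zw using rad_pos[OF T(2)] by simp
 also have "... <= diameter T" using dist_le_diameter[OF T(1)] verts_subset[OF S(1)] zw by blast
 finally have "cs * rad T' <= cs * diameter T" using cs1 by simp
 thus ?thesis using diameter_le_rad[OF T(2)] by linarith
qed

end

context mesh
begin

lemma common_vertex:
 assumes T: "T \<in> \<T>" "T' \<in> \<T>" and x: "x \<in> T \<inter> T'"
 shows "\<exists>z. z \<in> verts T \<inter> verts T'" and "T \<inter> T' = convex hull (verts T \<inter> verts T')"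
proof -
 note S = simplex_\<T>[OF T(1)] simplex_\<T>[OF T(2)] and F = face_\<T>[OF T]
 show h: "T \<inter> T' = convex hull (verts T \<inter> verts T')" using full_simplex_face(2)[OF S(1) F(1)] common_face(1)[OF S F] by simp
 thus "\<exists>z. z \<in> verts T \<inter> verts T'" using x by (metis convex_hull_eq_empty ex_in_conv)
qed

lemma avoid_other_simplices:
 assumes "y \<in> Om"
 obtains e where "0 < e" "ball y e \<subseteq> Om" "!!T. T \<in> \<T> ==> y \<notin> T ==> ball y e \<inter> T = {}"
proof -
 define C where "C = \<Union>{T \<in> \<T>. y \<notin> T}"
 have "closed C" unfolding C_def using finite_\<T> full_simplex_closed simplex_\<T> by (intro closed_Union) auto
 hence "open (Om - C)" using open_Om by (rule open_Diff[rotated])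
 moreover have "y \<in> Om - C" using assms by (auto simp: C_def)
 ultimately obtain e where e: "0 < e" "ball y e \<subseteq> Om - C" by (rule openE)
 thus ?thesis using that[of e] by (auto simp: C_def)
qed

end

context mesh_shape
begin

lemma card_star_nat: "card {T \<in> \<T>. z \<in> T} <= nat \<lfloor>cs ^ DIM('a)\<rfloor>" using card_star_le[of z] by (simp add: le_nat_floor)

text \<open>In dimension at least 2 a small punctured ball around \<open>z\<close> is connected. The
  simplices reachable from \<open>T\<close> and the unreachable ones cover it by two closed sets,
  disjoint there since a further common point would be a link; so one of the sets must miss the
  ball.\<close>

lemma vertex_star_chain:
 assumes z: "z \<in> Om" and d: "2 <= DIM('a)" and T: "T \<in> \<T>" "z \<in> T" and T': "T' \<in> \<T>" "z \<in> T'"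
 shows "(T, T') \<in> {(A, B). A \<in> \<T> \<and> B \<in> \<T> \<and> z \<in> A \<and> z \<in> B \<and> A \<inter> B \<noteq> {z}}\<^sup>*"
proof (rule ccontr)
 define E where "E = {(A, B). A \<in> \<T> \<and> B \<in> \<T> \<and> z \<in> A \<and> z \<in> B \<and> A \<inter> B \<noteq> {z}}"
 assume "(T, T') \<notin> {(A, B). A \<in> \<T> \<and> B \<in> \<T> \<and> z \<in> A \<and> z \<in> B \<and> A \<inter> B \<noteq> {z}}\<^sup>*"
 hence ns: "(T, T') \<notin> E\<^sup>*" by (simp add: E_def)
 define S1 where "S1 = {A \<in> \<T>. z \<in> A \<and> (T, A) \<in> E\<^sup>*}"
 define S2 where "S2 = {A \<in> \<T>. z \<in> A \<and> (T, A) \<notin> E\<^sup>*}"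
 obtain e where e: "0 < e" "ball z e \<subseteq> Om" "!!A. A \<in> \<T> ==> z \<notin> A ==> ball z e \<inter> A = {}"
  using avoid_other_simplices[OF z] by blast
 define P where "P = ball z e - {z}"
 have conn: "connected P" unfolding P_def by (rule connected_punctured_ball) (rule d)
 have closed: "closed (\<Union>S1)" "closed (\<Union>S2)"
  unfolding S1_def S2_def using finite_\<T> full_simplex_closed simplex_\<T> by (intro closed_Union; auto)+
 have cov: "P \<subseteq> \<Union>S1 \<union> \<Union>S2"
 proof
  fix y assume y: "y \<in> P"
  then obtain A where A: "A \<in> \<T>" "y \<in> A" using e(2) cover unfolding P_def by blast
  hence "z \<in> A" using e(3)[of A] y unfolding P_def by blast
  thus "y \<in> \<Union>S1 \<union> \<Union>S2" using A unfolding S1_def S2_def by blast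
 qed
 have disj: "\<Union>S1 \<inter> \<Union>S2 \<inter> P = {}"
 proof (rule ccontr)
  assume "\<Union>S1 \<inter> \<Union>S2 \<inter> P \<noteq> {}"
  then obtain y A B where y: "y \<in> P" "A \<in> S1" "B \<in> S2" "y \<in> A" "y \<in> B" by blast
  hence "A \<inter> B \<noteq> {z}" by (auto simp: P_def)
  hence "(A, B) \<in> E" using y by (auto simp: E_def S1_def S2_def)
  hence "(T, B) \<in> E\<^sup>*" using y(2) unfolding S1_def by auto
  thus False using y(3) by (simp add: S2_def)
 qed
 have meets: "\<exists>y. y \<in> A \<inter> P" if A: "A \<in> \<T>" "z \<in> A" for A
 proof -
  obtain w where w: "w \<in> A" "w \<noteq> z"
  proof -
   obtain i :: 'a where i: "i \<in> Basis" using nonempty_Basis by blast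
   define w1 where "w1 = ctr A + rad A *\<^sub>R i"
   have "w1 \<in> cball (ctr A) (rad A)" using rad_pos[OF A(1)] i by (simp add: w1_def dist_norm)
   hence "w1 \<in> A" "w1 \<noteq> ctr A" using ball_ctr[OF A(1)] rad_pos[OF A(1)] nonzero_Basis[OF i] by (auto simp: w1_def)
   thus ?thesis using ctr_in[OF A(1)] that by metis
  qed
  define s where "s = min 1 (e / (2 * norm (w - z)))"
  have s: "0 < s" "s <= 1" "s * norm (w - z) < e"
  proof -
   have n: "0 < norm (w - z)" using w by simp
   thus "0 < s" "s <= 1" using e(1) by (auto simp: s_def)
   have "s * norm (w - z) <= e / (2 * norm (w - z)) * norm (w - z)" by (intro mult_right_mono) (auto simp: s_def)
   also have "... < e" using e(1) by simp
   finally show "s * norm (w - z) < e" .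
  qed
  define y where "y = (1 - s) *\<^sub>R z + s *\<^sub>R w"
  have yz: "y - z = s *\<^sub>R (w - z)" by (simp add: y_def algebra_simps)
  have "y \<in> A" unfolding y_def using convexD_alt[OF full_simplex_convex[OF simplex_\<T>[OF A(1)]] A(2) w(1)] s by simp
  moreover have "dist z y < e" using yz s by (simp add: dist_norm norm_minus_commute)
  moreover have "y \<noteq> z" using yz s w by auto
  ultimately show ?thesis by (auto simp: P_def)
 qed
 have "T \<in> S1" "T' \<in> S2" using T T' ns by (auto simp: S1_def S2_def)
 thus False using meets[OF T] meets[OF T'] using conn cov disj closed unfolding connected_closed by blast
qed

end

context mesh
begin

text \<open>The common point has to lie in \<open>Om\<close>: simplices on the two sides of a slit
  share only boundary points, where functions on \<open>Om\<close> are unrelated.\<close>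

definition meets :: "'a set => 'a set => bool" where
 "meets T T' \<longleftrightarrow> T \<in> \<T> \<and> T' \<in> \<T> \<and> T \<inter> T' \<inter> Om \<noteq> {}"

end

text \<open>A path needs at most as many steps as there are pairs, at most \<open>n * n\<close>. The
  exponent \<open>nstar * nstar\<close> of later constants comes from here.\<close>

lemma rtrancl_bounded_relpow:
 assumes "finite F" "card F <= n" "E \<subseteq> F \<times> F" "(x, y) \<in> E\<^sup>*"
 obtains k where "k <= n * n" "(x, y) \<in> E ^^ k"
proof -
 have fE: "finite E" using assms(1,3) finite_subset by blast
 obtain k where k: "k <= card E" "(x, y) \<in> E ^^ k" using assms(4) unfolding rtrancl_finite_eq_relpow[OF fE] by blast
 have "card E <= card (F \<times> F)" using assms(1,3) by (intro card_mono) auto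
 also have "... <= n * n" unfolding card_cartesian_product using assms(2) by (intro mult_le_mono)
 finally show ?thesis using that k by (meson order.trans)
qed

lemma chain_bound:
 fixes f :: "'b => real"
 assumes step: "!!A B. (A, B) \<in> E ==> f B <= c * f A" and c: "1 <= c" and k: "(x, y) \<in> E ^^ k" "k <= m"
  and x: "0 <= f x"
 shows "f y <= c ^ m * f x"
proof -
 have "f y <= c ^ k * f x" using k(1)
 proof (induction k arbitrary: y)
  case (Suc k)
  then obtain A where A: "(x, A) \<in> E ^^ k" "(A, y) \<in> E" by auto
  have "f y <= c * f A" by (rule step[OF A(2)])
  also have "... <= c * (c ^ k * f x)" using Suc.IH[OF A(1)] c by (intro mult_left_mono) auto
  finally show ?case by simp
 qed simp
 also have "... <= c ^ m * f x" using c k(2) x by (intro mult_right_mono power_increasing) auto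
 finally show ?thesis .
qed

context mesh_shape
begin

text \<open>On the line a vertex separates the mesh, so neighboring intervals must be related by \<open>R\<close>.\<close>

lemma neighbors_1d:
 assumes d: "DIM('a) = 1" and T: "T \<in> \<T>" "T' \<in> \<T>" and TT: "T \<inter> T' = {z}"
 shows "(T, T') \<in> R"
proof -
 obtain b :: 'a where B: "Basis = {b}" using d card_1_singletonE by blast
 have bB: "b \<in> Basis" unfolding B by simp
 have b1: "norm b = 1" "b \<bullet> b = 1" "b \<noteq> 0" using bB by (simp_all add: nonzero_Basis)
 have eq: "x = y" if "x \<bullet> b = y \<bullet> b" for x y :: 'a by (rule euclidean_eqI) (use B that in auto)
 have nb: "norm x = \<bar>x \<bullet> b\<bar>" for x :: 'a unfolding norm_eq_sqrt_inner euclidean_inner[of x x] B by simp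
 have int: "y \<in> interior A" if A: "A \<in> \<T>" "p \<in> A" "q \<in> A" "p \<bullet> b < y \<bullet> b" "y \<bullet> b < q \<bullet> b" for A p q y
 proof -
  have "ball y (min (y \<bullet> b - p \<bullet> b) (q \<bullet> b - y \<bullet> b)) \<subseteq> A"
  proof
   fix x assume "x \<in> ball y (min (y \<bullet> b - p \<bullet> b) (q \<bullet> b - y \<bullet> b))"
   hence "\<bar>y \<bullet> b - x \<bullet> b\<bar> < min (y \<bullet> b - p \<bullet> b) (q \<bullet> b - y \<bullet> b)" by (simp add: dist_norm nb inner_diff_left)
   hence x: "p \<bullet> b < x \<bullet> b" "x \<bullet> b < q \<bullet> b" by auto
   define s where "s = (x \<bullet> b - p \<bullet> b) / (q \<bullet> b - p \<bullet> b)"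
   have s: "0 <= s" "s <= 1" using x by (auto simp: s_def)
   have "s * (q \<bullet> b - p \<bullet> b) = x \<bullet> b - p \<bullet> b" using x by (simp add: s_def)
   hence "x = (1 - s) *\<^sub>R p + s *\<^sub>R q" by (intro eq) (simp add: algebra_simps)
   thus "x \<in> A" using convexD_alt[OF full_simplex_convex[OF simplex_\<T>[OF A(1)]] A(2,3), of s] s by simp
  qed
  moreover have "0 < min (y \<bullet> b - p \<bullet> b) (q \<bullet> b - y \<bullet> b)" using that by simp
  ultimately show ?thesis by (meson centre_in_ball interior_maximal open_ball subsetD)
 qed
 have zT: "z \<in> T" "z \<in> T'" using TT by auto
 have other: "\<exists>w\<in>A. w \<bullet> b \<noteq> z \<bullet> b" if A: "A \<in> \<T>" for A
 proof -
  define w1 where "w1 = ctr A + rad A *\<^sub>R b"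
  have "w1 \<in> cball (ctr A) (rad A)" using rad_pos[OF A] b1 by (simp add: w1_def dist_norm)
  hence "w1 \<in> A" using ball_ctr[OF A] by blast
  moreover have "w1 \<bullet> b \<noteq> ctr A \<bullet> b" using rad_pos[OF A] b1 by (simp add: w1_def inner_add_left)
  ultimately show ?thesis using ctr_in[OF A] by metis
 qed
 have TneT: "T \<noteq> T'" using other[OF T(1)] TT by (metis Int_absorb singletonD)
 \<comment> \<open>The sign \<open>\<sigma>\<close> selects the side: 1 for intervals to the left of
   \<open>z\<close>, -1 for those to the right.\<close>
 define L where "L \<sigma> A \<longleftrightarrow> (\<forall>x\<in>A. \<sigma> * (x \<bullet> b) <= \<sigma> * (z \<bullet> b))" for \<sigma> :: real and A
 have LR: "L 1 A \<or> L (-1) A" if A: "A \<in> \<T>" for A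
 proof (rule ccontr)
  assume "\<not> (L 1 A \<or> L (-1) A)"
  then obtain p q where "p \<in> A" "q \<in> A" "p \<bullet> b < z \<bullet> b" "z \<bullet> b < q \<bullet> b" unfolding L_def by (auto simp: not_le)
  hence "A = T" "A = T'" using int[OF A] using interior_meets_imp_eq A T zT by blast+
  thus False using TneT by simp
 qed
 have same: "A = A'"
  if A: "A \<in> \<T>" "A' \<in> \<T>" "z \<in> A" "z \<in> A'" "L \<sigma> A" "L \<sigma> A'" and \<sigma>: "\<sigma> = 1 \<or> \<sigma> = -1" for A A' \<sigma>
 proof -
  obtain p where p: "p \<in> A" "\<sigma> * (p \<bullet> b) < \<sigma> * (z \<bullet> b)" using other[OF A(1)] A(5) \<sigma> unfolding L_def by force
  obtain p' where p': "p' \<in> A'" "\<sigma> * (p' \<bullet> b) < \<sigma> * (z \<bullet> b)" using other[OF A(2)] A(6) \<sigma> unfolding L_def by force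
  define t where "t = \<sigma> * ((max (\<sigma> * (p \<bullet> b)) (\<sigma> * (p' \<bullet> b)) + \<sigma> * (z \<bullet> b)) / 2)"
  have "\<sigma> * ((t *\<^sub>R b) \<bullet> b) = (max (\<sigma> * (p \<bullet> b)) (\<sigma> * (p' \<bullet> b)) + \<sigma> * (z \<bullet> b)) / 2"
   using \<sigma> b1 by (auto simp: t_def)
  hence t: "\<sigma> * (p \<bullet> b) < \<sigma> * ((t *\<^sub>R b) \<bullet> b)" "\<sigma> * (p' \<bullet> b) < \<sigma> * ((t *\<^sub>R b) \<bullet> b)"
   "\<sigma> * ((t *\<^sub>R b) \<bullet> b) < \<sigma> * (z \<bullet> b)" using p p' by auto
  have "t *\<^sub>R b \<in> interior A" "t *\<^sub>R b \<in> interior A'"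
   using \<sigma> t int[OF A(1) p(1) A(3)] int[OF A(1) A(3) p(1)] int[OF A(2) p'(1) A(4)] int[OF A(2) A(4) p'(1)] by auto
  thus ?thesis using interior_meets_imp_eq[OF A(1,2)] interior_subset by blast
 qed
 \<comment> \<open>A chain of neighbors from left to right must at some step pass between two
   intervals meeting at \<open>z\<close>. Since \<open>z\<close> has only one interval on each side,
   that step is the pair \<open>(U, U')\<close> itself.\<close>
 have main: "(U, U') \<in> R"
  if U: "U \<in> \<T>" "U' \<in> \<T>" "z \<in> U" "z \<in> U'" "L 1 U" "L (-1) U'" and ch: "(U, U') \<in> R\<^sup>*" for U U'
 proof (rule ccontr)
  assume nR: "(U, U') \<notin> R"
  have nrel: "R \<subseteq> \<T> \<times> \<T>" "!!A B. (A, B) \<in> R ==> A \<inter> B \<noteq> {}"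
   using neighbors unfolding neighbor_relation_def by auto
  have "A \<in> \<T> \<and> L 1 A" if "(U, A) \<in> R\<^sup>*" for A using that
  proof (induction rule: rtrancl_induct)
   case (step A B)
   have B: "B \<in> \<T>" using step.hyps(2) nrel(1) by blast
   show ?case
   proof (rule ccontr)
    assume "\<not> (B \<in> \<T> \<and> L 1 B)"
    hence RB: "L (-1) B" using LR B by blast
    obtain x where x: "x \<in> A" "x \<in> B" using nrel(2)[OF step.hyps(2)] by blast
    hence "x \<bullet> b = z \<bullet> b" using step.IH RB unfolding L_def by fastforce
    hence "x = z" by (rule eq)
    thus False using same[of A U 1] same[of B U' "-1"] x step.IH B RB U using step.hyps(2) nR by simp
   qed
  qed (use U in auto)
  hence "w \<bullet> b = z \<bullet> b" if "w \<in> U'" for w using ch using U(6) that unfolding L_def by fastforce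
  thus False using other[OF U(2)] by blast
 qed
 have chain: "(A, B) \<in> R\<^sup>*" if "A \<in> \<T>" "B \<in> \<T>" for A B using neighbors that unfolding neighbor_relation_def by blast
 have symR: "sym R" using neighbors unfolding neighbor_relation_def by blast
 show ?thesis using LR[OF T(1)] LR[OF T(2)] main[OF T zT] main[OF T(2,1) zT(2,1)] chain T symD[OF symR]
   same[OF T zT _ _ disjI1[OF refl]] same[OF T zT _ _ disjI2[OF refl]] TneT by blast
qed

definition nstar :: nat where "nstar = nat \<lfloor>cs ^ DIM('a)\<rfloor>"

text \<open>Dominates the three factors in \<open>meets_size\<close>: \<open>cs\<close> for a shared
  edge, a power of \<open>cs\<close> for a chain in the star, and \<open>cr\<close> on the
  line.\<close>

definition csize :: real where "csize = cr * cs ^ (nstar * nstar + 1)"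

lemma csize_ge: "cs <= csize" "cr <= csize" "cs ^ (nstar * nstar) <= csize" "1 <= csize"
proof -
 have "cs ^ 1 <= cs ^ (nstar * nstar + 1)" by (rule power_increasing) (use cs1 in auto)
 hence a: "cs <= cs ^ (nstar * nstar + 1)" by simp
 have b: "cs ^ (nstar * nstar) <= cs ^ (nstar * nstar + 1)" by (rule power_increasing) (use cs1 in auto)
 have c: "1 <= cs ^ (nstar * nstar + 1)" using a cs1 by linarith
 have d: "1 * cs ^ (nstar * nstar + 1) <= csize" unfolding csize_def using cr1 c by (intro mult_right_mono) auto
 have "cr * 1 <= csize" unfolding csize_def using cr1 c by (intro mult_left_mono) auto
 thus "cs <= csize" "cr <= csize" "cs ^ (nstar * nstar) <= csize" "1 <= csize" using a b d cr1 by linarith+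
qed

text \<open>Simplices with more than one common point share an edge. If they share only a point,
  they are linked within its star through simplices that share edges; in dimension one they are
  related by \<open>R\<close>.\<close>

lemma meets_size:
 assumes "meets T T'" shows "diameter T' <= csize * diameter T"
proof -
 have T: "T \<in> \<T>" "T' \<in> \<T>" using assms by (auto simp: meets_def)
 obtain x where x: "x \<in> T \<inter> T'" "x \<in> Om" using assms unfolding meets_def by blast
 have dp: "0 < diameter T" by (rule diameter_pos[OF T(1)])
 have edge: "diameter B <= cs * diameter A"
  if A: "A \<in> \<T>" "B \<in> \<T>" "z \<in> A" "z \<in> B" "A \<inter> B \<noteq> {z}" for A B z
 proof -
  obtain w where w: "w \<in> verts A \<inter> verts B" using common_vertex(1)[OF A(1,2), of z] A(3,4) by blast
  have "\<exists>w'. w' \<in> verts A \<inter> verts B \<and> w' \<noteq> w"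
  proof (rule ccontr)
   assume "\<nexists>w'. w' \<in> verts A \<inter> verts B \<and> w' \<noteq> w"
   hence "verts A \<inter> verts B = {w}" using w by blast
   thus False using common_vertex(2)[OF A(1,2), of z] A(3,4) using A(3-5) by auto
  qed
  thus ?thesis using shared_edge_size[OF A(1,2)] w by blast
 qed
 have big: "c * diameter T <= csize * diameter T" if "c <= csize" for c using that dp by simp
 show ?thesis
 proof (cases "T \<inter> T' = {x}")
  case False
  hence "diameter T' <= cs * diameter T" using edge[OF T, of x] x by blast
  thus ?thesis using big[OF csize_ge(1)] by linarith
 next
  case True
  show ?thesis
  proof (cases "2 <= DIM('a)")
   case d: True
   define E where "E = {(A, B). A \<in> \<T> \<and> B \<in> \<T> \<and> x \<in> A \<and> x \<in> B \<and> A \<inter> B \<noteq> {x}}"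
   have ch: "(T, T') \<in> E\<^sup>*" unfolding E_def by (rule vertex_star_chain[OF x(2) d]) (use T x in auto)
   obtain k where k: "k <= nstar * nstar" "(T, T') \<in> E ^^ k"
   proof (rule rtrancl_bounded_relpow[OF _ _ _ ch])
    show "finite {A \<in> \<T>. x \<in> A}" using finite_\<T> by simp
    show "card {A \<in> \<T>. x \<in> A} <= nstar" unfolding nstar_def by (rule card_star_nat)
   qed (auto simp: E_def)
   have "diameter T' <= cs ^ (nstar * nstar) * diameter T"
    by (rule chain_bound[OF _ cs1 k(2,1)]) (use edge dp in \<open>auto simp: E_def\<close>)
   thus ?thesis using big[OF csize_ge(3)] by linarith
  next
   case d: False
   hence "DIM('a) = 1" using DIM_positive[where 'a='a] by linarith
   hence "(T, T') \<in> R" using neighbors_1d T True by blast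
   hence "diameter T' <= cr * diameter T" by (rule size_R)
   thus ?thesis using big[OF csize_ge(2)] by linarith
  qed
 qed
qed

text \<open>The factor \<open>d + 1\<close> bounds the number of common vertices, so each of them
  has coordinate at least \<open>1 / (d + 1)\<close> at their barycentre; \<open>csize * cs\<close>
  compares \<open>diameter T\<close> with the radii in the star.\<close>

definition cball_const :: real where "cball_const = 1 / (csize * cs * (real DIM('a) + 1))"

lemma cball_const: "0 < cball_const" "cball_const <= 1"
proof -
 have "1 * 1 * 1 <= csize * cs * (real DIM('a) + 1)" using csize_ge(4) cs1 by (intro mult_mono) auto
 thus "0 < cball_const" "cball_const <= 1" by (auto simp: cball_const_def)
qed

end

section \<open>A ball of controlled size around a common face\<close>

context mesh
begin

text \<open>A boundary point lies on a mesh face \<open>F\<close> inside the frontier.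
  \<open>F \<inter> T\<close> is a face of \<open>T\<close>, and a face that contains
  \<open>x\<close> contains every vertex at which \<open>x\<close> has positive weight.\<close>

lemma face_in_boundary:
 assumes T: "T \<in> \<T>" and x: "x \<in> T" "x \<notin> Om" and W: "W \<subseteq> verts T" "!!z. z \<in> W ==> 0 < bary T z x"
 shows "convex hull W \<subseteq> frontier Om"
proof -
 have "x \<in> frontier Om" using x simplex_subset_closure[OF T] open_Om by (auto simp: frontier_def interior_open)
 moreover obtain \<F> where \<F>: "\<forall>F\<in>\<F>. \<exists>T\<in>\<T>. F face_of T" "frontier Om = \<Union>\<F>"
  using boundary_faces by blast
 ultimately obtain F where F: "F \<in> \<F>" "x \<in> F" by auto
 then obtain T' where T': "T' \<in> \<T>" "F face_of T'" using \<F>(1) by blast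
 have sub: "F \<subseteq> frontier Om" unfolding \<F>(2) using F(1) by (rule Union_upper)
 define G where "G = F \<inter> T"
 have "G face_of (T' \<inter> T)" unfolding G_def by (rule face_of_slice[OF T'(2) full_simplex_convex[OF simplex_\<T>[OF T]]])
 hence G: "G face_of T" using face_\<T>(2)[OF T'(1) T] by (rule face_of_trans)
 have xG: "x \<in> G" using F(2) x(1) by (simp add: G_def)
 have "W \<subseteq> verts G"
 proof
  fix z assume "z \<in> W"
  hence "bary T z x \<noteq> 0" using W(2)[of z] by simp
  thus "z \<in> verts G" using full_simplex_face(3)[OF simplex_\<T>[OF T] G, of x] xG by blast
 qed
 hence "convex hull W \<subseteq> convex hull (verts G)" by (rule hull_mono)
 also have "... = G" using full_simplex_face(2)[OF simplex_\<T>[OF T] G] by simp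
 also have "... \<subseteq> frontier Om" using sub by (auto simp: G_def)
 finally show ?thesis .
qed

end

context mesh_shape
begin

text \<open>The averages over two meeting simplices will be compared through this ball. It has to
  avoid the boundary, including slits, and to meet only simplices that have all common vertices of
  \<open>T\<close> and \<open>T'\<close>.\<close>

lemma star_ball:
 assumes TT: "meets T T'"
 obtains x where "x \<in> T \<inter> T'" "x \<in> Om" "ball x (cball_const * diameter T) \<subseteq> Om"
  "ball x (cball_const * diameter T) \<subseteq> \<Union>{S \<in> \<T>. x \<in> S}"
  "!!S z. S \<in> \<T> ==> x \<in> S ==> z \<in> verts T \<inter> verts T' ==> z \<in> verts S"
proof -
 have T: "T \<in> \<T>" "T' \<in> \<T>" and ne: "T \<inter> T' \<inter> Om \<noteq> {}" using TT by (auto simp: meets_def)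
 define W where "W = verts T \<inter> verts T'"
 have hull: "T \<inter> T' = convex hull W" using ne common_vertex(2)[OF T] unfolding W_def by blast
 have finW: "finite W" using finite_verts[OF simplex_\<T>[OF T(1)]] by (simp add: W_def)
 have neW: "W \<noteq> {}" using ne hull by auto
 define m where "m = real (card W)"
 have m: "1 <= m" "m <= real DIM('a) + 1"
 proof -
  have "card W <= card (verts T)" using finite_verts[OF simplex_\<T>[OF T(1)]] by (intro card_mono) (auto simp: W_def)
  thus "m <= real DIM('a) + 1" using card_verts[OF simplex_\<T>[OF T(1)]] by (simp add: m_def)
  show "1 <= m" using finW neW by (simp add: m_def card_gt_0_iff Suc_leI)
 qed
 \<comment> \<open>The barycentre of the common vertices. All of their coordinates equal
   \<open>1 / m\<close> there, which leaves room to move without any of them vanishing.\<close>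
 define x where "x = (\<Sum>z\<in>W. (1 / m) *\<^sub>R z)"
 have xW: "x \<in> convex hull W"
  unfolding convex_hull_finite[OF finW] x_def using m by (auto simp: m_def intro!: exI[of _ "%z. 1 / real (card W)"])
 have xTT: "x \<in> T \<inter> T'" using xW hull by simp
 have subverts: "W \<subseteq> verts S" "z \<in> W ==> bary S z x = 1 / m" if S: "S \<in> \<T>" "x \<in> S" for S z
 proof -
  have bT: "bary T z x = 1 / m" if "z \<in> W" for z
  proof -
   have WT: "W \<subseteq> verts T" by (simp add: W_def)
   have fT: "finite (verts T)" by (rule finite_verts[OF simplex_\<T>[OF T(1)]])
   have "bary T z x = (if z \<in> W then 1 / m else 0)"
   proof (rule bary_eqI[OF simplex_\<T>[OF T(1)]])
    have "(\<Sum>z\<in>verts T. if z \<in> W then 1 / m else 0) = (\<Sum>z\<in>W. 1 / m)" by (rule sum.mono_neutral_cong_right[OF fT WT]) auto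
    thus "(\<Sum>z\<in>verts T. if z \<in> W then 1 / m else 0) = 1" using m by (simp add: m_def)
    have "(\<Sum>z\<in>verts T. (if z \<in> W then 1 / m else 0) *\<^sub>R z) = (\<Sum>z\<in>W. (1 / m) *\<^sub>R z)"
     by (rule sum.mono_neutral_cong_right[OF fT WT]) auto
    thus "(\<Sum>z\<in>verts T. (if z \<in> W then 1 / m else 0) *\<^sub>R z) = x" by (simp add: x_def)
    show "z \<in> verts T" using that WT by blast
   qed
   thus ?thesis using that by simp
  qed
  have eq: "bary T z x = bary S z x" for z
   using common_face(2)[OF simplex_\<T>[OF T(1)] simplex_\<T>[OF S(1)] face_\<T>[OF T(1) S(1)]] xTT S(2) by blast
  show "W \<subseteq> verts S"
  proof
   fix z assume z: "z \<in> W"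
   hence "bary S z x \<noteq> 0" using bT[OF z] eq[of z] m by simp
   thus "z \<in> verts S" using bary_notin by blast
  qed
  show "z \<in> W ==> bary S z x = 1 / m" using bT eq by simp
 qed
 have front: "convex hull W \<inter> Om \<noteq> {}" using ne hull by simp
 have disj: "frontier Om \<inter> Om = {}" using open_Om by (auto simp: frontier_def interior_open)
 have xOm: "x \<in> Om"
 proof (rule ccontr)
  assume "x \<notin> Om"
  hence "convex hull W \<subseteq> frontier Om" using face_in_boundary[OF T(1), of x W] xTT subverts[OF T(1)] m by auto
  thus False using front disj by blast
 qed
 define r0 where "r0 = cball_const * diameter T"
 have dT: "0 < diameter T" by (rule diameter_pos[OF T(1)])
 have r0: "0 < r0" using cball_const dT by (simp add: r0_def)
 have star_rad: "r0 / rad S <= 1 / m" if S: "S \<in> \<T>" "x \<in> S" for S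
 proof -
  have "meets S T" using S T(1) xTT xOm by (auto simp: meets_def)
  hence "diameter T <= csize * diameter S" by (rule meets_size)
  also have "... <= csize * (cs * rad S)" using diameter_le_rad[OF S(1)] csize_ge(4) by (intro mult_left_mono) auto
  finally have "r0 <= cball_const * (csize * (cs * rad S))" using cball_const by (simp add: r0_def)
  also have "... = rad S / (real DIM('a) + 1)" using csize_ge(4) cs1 by (simp add: cball_const_def)
  also have "... <= rad S / m" using m rad_pos[OF S(1)] by (intro divide_left_mono) auto
  finally show ?thesis using rad_pos[OF S(1)] by (simp add: field_simps)
 qed
 have pos: "0 < bary S z y" if S: "S \<in> \<T>" "x \<in> S" and y: "y \<in> ball x r0" and z: "z \<in> W" for S y z
 proof -
  have "\<bar>bary S z x - bary S z y\<bar> <= norm (x - y) / rad S"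
   by (rule bary_lipschitz[OF simplex_\<T>[OF S(1)] rad_pos[OF S(1)] ball_ctr[OF S(1)]])
  also have "... < r0 / rad S" using y rad_pos[OF S(1)] by (intro divide_strict_right_mono) (auto simp: dist_norm)
  finally show ?thesis using star_rad[OF S] subverts(2)[OF S z] by linarith
 qed
 define A where "A = \<Union>{S \<in> \<T>. x \<in> S}"
 \<comment> \<open>In the star of \<open>x\<close> the coordinates at the common vertices are still
   positive at \<open>y\<close>. So every simplex through \<open>y\<close> has these vertices, and
   \<open>y \<notin> Om\<close> would put the whole common face into the frontier.\<close>
 have local: "y \<in> Om" "!!S. S \<in> \<T> ==> y \<in> S ==> x \<in> S" if y: "y \<in> ball x r0" "y \<in> A" for y
 proof -
  obtain S0 where S0: "S0 \<in> \<T>" "x \<in> S0" "y \<in> S0" using y(2) by (auto simp: A_def)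
  have bp: "0 < bary S z y" if S: "S \<in> \<T>" "y \<in> S" and z: "z \<in> W" for S z
  proof -
   show ?thesis using common_face(2)[OF simplex_\<T>[OF S0(1)] simplex_\<T>[OF S(1)] face_\<T>[OF S0(1) S(1)]] S0(3) S(2) using pos[OF S0(1,2) y(1) z] by simp
  qed
  show "x \<in> S" if S: "S \<in> \<T>" "y \<in> S" for S
  proof -
   have "W \<subseteq> verts S" using bp[OF S] bary_notin by fastforce
   hence "convex hull W \<subseteq> convex hull (verts S)" by (rule hull_mono)
   thus ?thesis using xW verts_hull[OF simplex_\<T>[OF S(1)]] by blast
  qed
  show "y \<in> Om"
  proof (rule ccontr)
   assume "y \<notin> Om"
   thus False using face_in_boundary[OF S0(1,3), of W] bp[OF S0(1,3)] subverts(1)[OF S0(1,2)] using front disj by blast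
  qed
 qed
 \<comment> \<open>The star of \<open>x\<close> is closed, and by \<open>local\<close> it is open
   relative to the ball. As the ball is connected, the star covers it.\<close>
 have sub: "ball x r0 \<subseteq> A"
 proof (rule ccontr)
  assume "\<not> ball x r0 \<subseteq> A"
  have "openin (top_of_set (ball x r0)) (ball x r0 \<inter> A)" unfolding openin_contains_ball
  proof (intro conjI ballI)
   fix y assume "y \<in> ball x r0 \<inter> A"
   hence y: "y \<in> ball x r0" "y \<in> A" by auto
   obtain e where e: "0 < e" "ball y e \<subseteq> Om" "!!S. S \<in> \<T> ==> y \<notin> S ==> ball y e \<inter> S = {}"
    using avoid_other_simplices[OF local(1)[OF y]] by blast
   have "ball y e \<subseteq> A"
   proof
    fix w assume w: "w \<in> ball y e"
    then obtain S where S: "S \<in> \<T>" "w \<in> S" using e(2) cover by blast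
    hence "y \<in> S" using e(3) w by blast
    hence "x \<in> S" by (rule local(2)[OF y S(1)])
    thus "w \<in> A" using S by (auto simp: A_def)
   qed
   thus "\<exists>e>0. ball y e \<inter> ball x r0 \<subseteq> ball x r0 \<inter> A" using e(1) by blast
  qed simp
  moreover have "closed A" unfolding A_def using finite_\<T> full_simplex_closed simplex_\<T> by (intro closed_Union) auto
  hence "closedin (top_of_set (ball x r0)) (ball x r0 \<inter> A)" by (rule closedin_closed_Int)
  moreover have "connected (ball x r0)" by simp
  ultimately have "ball x r0 \<inter> A = {} \<or> ball x r0 \<inter> A = ball x r0" unfolding connected_clopen by blast
  moreover have "x \<in> ball x r0 \<inter> A" using r0 T xTT by (auto simp: A_def)
  ultimately show False using \<open>\<not> ball x r0 \<subseteq> A\<close> by blast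
 qed
 show ?thesis
 proof (rule that[OF xTT xOm])
  show "ball x (cball_const * diameter T) \<subseteq> Om" using sub local(1) unfolding r0_def by blast
  show "ball x (cball_const * diameter T) \<subseteq> \<Union>{S \<in> \<T>. x \<in> S}" using sub unfolding r0_def A_def .
  show "z \<in> verts S" if "S \<in> \<T>" "x \<in> S" "z \<in> verts T \<inter> verts T'" for S z
   using subverts(1)[OF that(1,2)] that(3) by (auto simp: W_def)
 qed
qed

end

section \<open>Piecewise polynomials as elements of the Lagrange space\<close>

locale mesh_fem = mesh_shape Om \<T> R cs cr for Om :: "'a::euclidean_space set" and \<T> R cs cr +
 fixes K :: nat
 assumes K1: "1 <= K"

sublocale mesh_fem \<subseteq> mesh_poly Om \<T> K ..

context mesh_shape
begin

lemma piecewise_poly_lipschitz: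
 assumes pw: "!!T. T \<in> \<T> ==> \<exists>q. poly_deg_le n q \<and> (\<forall>x \<in> Om \<inter> T. w x = q x)"
 obtains L where "0 <= L" "!!T x y. T \<in> \<T> ==> x \<in> Om \<inter> T ==> y \<in> Om \<inter> T ==> \<bar>w x - w y\<bar> <= L * norm (x - y)"
proof -
 have "\<exists>L\<ge>0. \<forall>x\<in>Om \<inter> T. \<forall>y\<in>Om \<inter> T. \<bar>w x - w y\<bar> <= L * norm (x - y)" if T: "T \<in> \<T>" for T
 proof -
  obtain q where q: "poly_deg_le n q" "\<forall>x \<in> Om \<inter> T. w x = q x" using pw[OF T] by blast
  have "compact (q ` T)"
   by (rule compact_continuous_image[OF smooth_fun_continuous[OF poly_smooth[OF q(1)]] full_simplex_compact[OF simplex_\<T>[OF T]]])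
  then obtain M where "\<forall>y\<in>q ` T. norm y <= M" using compact_imp_bounded bounded_iff by metis
  hence M: "!!x. x \<in> T ==> \<bar>q x\<bar> <= M" by simp
  define L where "L = bern_const DIM('a) n * real n * M / rad T"
  have "0 <= M" using M[OF ctr_in[OF T]] by linarith
  hence "0 <= L" using bern_const_pos[of "DIM('a)" n] rad_pos[OF T] by (simp add: L_def)
  moreover have "\<bar>w x - w y\<bar> <= L * norm (x - y)" if "x \<in> Om \<inter> T" "y \<in> Om \<inter> T" for x y
   using poly_lipschitz[OF simplex_\<T>[OF T] rad_pos[OF T] ball_ctr[OF T] q(1) M, of x y] that q(2) by (simp add: L_def)
  ultimately show ?thesis by blast
 qed
 then obtain L where L: "!!T. T \<in> \<T> ==> 0 <= L T \<and> (\<forall>x\<in>Om \<inter> T. \<forall>y\<in>Om \<inter> T. \<bar>w x - w y\<bar> <= L T * norm (x - y))"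
  by metis
 show ?thesis
 proof (rule that[of "\<Sum>T\<in>\<T>. L T"])
  show "0 <= (\<Sum>T\<in>\<T>. L T)" using L by (intro sum_nonneg) blast
  fix T x y assume T: "T \<in> \<T>" and xy: "x \<in> Om \<inter> T" "y \<in> Om \<inter> T"
  have "\<bar>w x - w y\<bar> <= L T * norm (x - y)" using L[OF T] xy by blast
  also have "... <= (\<Sum>T\<in>\<T>. L T) * norm (x - y)" by (intro mult_right_mono member_le_sum[OF T]) (use L finite_\<T> in auto)
  finally show "\<bar>w x - w y\<bar> <= (\<Sum>T\<in>\<T>. L T) * norm (x - y)" .
 qed
qed

lemma piecewise_poly_segment:
 assumes pw: "!!T. T \<in> \<T> ==> \<exists>q. poly_deg_le n q \<and> (\<forall>x \<in> Om \<inter> T. w x = q x)"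
 obtains L where "0 <= L" "!!x y. closed_segment x y \<subseteq> Om ==> \<bar>w x - w y\<bar> <= L * norm (x - y)"
proof -
 obtain L where L: "0 <= L" "!!T x y. T \<in> \<T> ==> x \<in> Om \<inter> T ==> y \<in> Om \<inter> T ==> \<bar>w x - w y\<bar> <= L * norm (x - y)"
  using piecewise_poly_lipschitz[OF pw] by blast
 show ?thesis
 proof (rule that[OF L(1)])
  show "\<bar>w x - w y\<bar> <= L * norm (x - y)" if "closed_segment x y \<subseteq> Om" for x y
   by (rule piecewise_lipschitz_segment[OF finite_\<T> _ cover L(2,1) that]) (use full_simplex_closed simplex_\<T> in blast)+
 qed
qed

text \<open>One function that is polynomial on each closed piece \<open>Om \<inter> T\<close> is
  Lipschitz along segments in \<open>Om\<close>, hence continuous. Membership therefore reduces to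
  the local polynomials.\<close>

lemma lagrange_spaceI:
 assumes pw: "!!T. T \<in> \<T> ==> \<exists>q. poly_deg_le n q \<and> (\<forall>x \<in> Om \<inter> T. w x = q x)"
 shows "w \<in> lagrange_space Om \<T> n" unfolding lagrange_space_def
proof (intro CollectI conjI ballI)
 obtain L where L: "0 <= L" "!!x y. closed_segment x y \<subseteq> Om ==> \<bar>w x - w y\<bar> <= L * norm (x - y)"
  using piecewise_poly_segment[OF pw] by blast
 show "continuous_on Om w" unfolding continuous_on_iff
 proof (intro ballI allI impI)
  fix x and e :: real assume x: "x \<in> Om" and e: "0 < e"
  obtain r where r: "0 < r" "ball x r \<subseteq> Om" using open_Om x openE by blast
  show "\<exists>d>0. \<forall>y\<in>Om. dist y x < d --> dist (w y) (w x) < e"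
  proof (intro exI[of _ "min r (e / (L + 1))"] conjI ballI impI)
   show "0 < min r (e / (L + 1))" using r e L(1) by simp
   fix y assume y: "dist y x < min r (e / (L + 1))"
   hence "y \<in> ball x r" "x \<in> ball x r" using r(1) by (auto simp: dist_commute)
   hence "closed_segment y x \<subseteq> Om" using closed_segment_subset[OF _ _ convex_ball] r(2) by blast
   hence "\<bar>w y - w x\<bar> <= L * dist y x" using L(2) by (simp add: dist_norm)
   also have "... <= L * (e / (L + 1))" using y L(1) by (intro mult_left_mono) auto
   also have "... < e" using e L(1) by (simp add: field_simps)
   finally show "dist (w y) (w x) < e" by (simp add: dist_real_def)
  qed
 qed
qed (use pw in blast)

end

section \<open>Vertex classes, patches and local extension\<close>

context mesh
begin

text \<open>A vertex on a slit can be touched by simplices that are not linked through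
  \<open>Om\<close>. The classes \<open>reach z T\<close>, and not the vertices, are the degrees of
  freedom of continuous piecewise linear functions on \<open>Om\<close>.\<close>

definition vertex_link :: "'a => ('a set \<times> 'a set) set" where
 "vertex_link z = {(T, T'). meets T T' \<and> z \<in> verts T \<and> z \<in> verts T'}"

definition reach :: "'a => 'a set => 'a set set" where "reach z T = {T'. (T, T') \<in> (vertex_link z)\<^sup>*}"

definition patch :: "'a set => 'a set set" where "patch T = (\<Union>z\<in>verts T. reach z T)"

lemma sym_vertex_link: "sym (vertex_link z)" unfolding sym_def vertex_link_def meets_def by blast

lemma reach_refl: "T \<in> reach z T" by (simp add: reach_def)

lemma reach_sym: "T' \<in> reach z T ==> T \<in> reach z T'" unfolding reach_def using sym_rtrancl[OF sym_vertex_link] by (auto dest: symD)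

lemma reach_eq: "T' \<in> reach z T ==> reach z T' = reach z T" using reach_sym unfolding reach_def by (blast intro: rtrancl_trans)

lemma reach_step: "meets T T' ==> z \<in> verts T ==> z \<in> verts T' ==> T' \<in> reach z T" unfolding reach_def vertex_link_def by blast

lemma reach_in:
 assumes "T' \<in> reach z T" "T \<in> \<T>" "z \<in> verts T" shows "T' \<in> \<T>" "z \<in> verts T'"
proof -
 have "(T, T') \<in> (vertex_link z)\<^sup>*" using assms(1) by (simp add: reach_def)
 thus "T' \<in> \<T>" "z \<in> verts T'" by (induction rule: rtrancl_induct) (use assms in \<open>auto simp: vertex_link_def meets_def\<close>)
qed

lemma patch_in: "T' \<in> patch T ==> T \<in> \<T> ==> T' \<in> \<T>" unfolding patch_def using reach_in(1) by blast

lemma patch_refl: assumes "T \<in> \<T>" shows "T \<in> patch T"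
proof -
 have "verts T \<noteq> {}" using card_verts[OF simplex_\<T>[OF assms]] by (metis card.empty Zero_not_Suc)
 thus ?thesis unfolding patch_def using reach_refl by blast
qed

lemma patch_sym:
 assumes "T' \<in> patch T" "T \<in> \<T>" shows "T \<in> patch T'"
proof -
 obtain z where z: "z \<in> verts T" "T' \<in> reach z T" using assms(1) unfolding patch_def by blast
 thus ?thesis unfolding patch_def using reach_in(2)[OF z(2) assms(2) z(1)] reach_sym[OF z(2)] by blast
qed

end

context mesh_shape
begin

definition npatch :: nat where "npatch = Suc DIM('a) * nstar"

lemma card_patch:
 assumes T: "T \<in> \<T>" shows "finite (patch T)" "card (patch T) <= npatch"
proof -
 have sub: "reach z T \<subseteq> {S \<in> \<T>. z \<in> S}" if "z \<in> verts T" for z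
  using reach_in[OF _ T that] verts_subset[OF simplex_\<T>] by blast
 have f: "finite {S \<in> \<T>. z \<in> S}" for z using finite_\<T> by simp
 have c: "card (reach z T) <= nstar" if "z \<in> verts T" for z using card_mono[OF f sub[OF that]] card_star_nat[of z] by (simp add: nstar_def)
 note fv = finite_verts[OF simplex_\<T>[OF T]]
 show "finite (patch T)" unfolding patch_def using fv sub f finite_subset by (intro finite_UN_I) blast+
 have "card (patch T) <= (\<Sum>z\<in>verts T. card (reach z T))" unfolding patch_def by (rule card_UN_le[OF fv])
 also have "... <= (\<Sum>z\<in>verts T. nstar)" by (intro sum_mono c)
 finally show "card (patch T) <= npatch" using card_verts[OF simplex_\<T>[OF T]] by (simp add: npatch_def)
qed

text \<open>Any quantity that changes by a bounded factor between meeting simplices changes by a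
  bounded factor on patches. It serves for diameters and, later, for graded weights.\<close>

lemma patch_bound:
 assumes step: "!!A B. meets A B ==> f B <= c * f A" and c: "1 <= c" and f0: "0 <= (f T :: real)"
  and T: "T \<in> \<T>" and T': "T' \<in> patch T"
 shows "f T' <= c ^ (nstar * nstar) * f T"
proof -
 obtain z where z: "z \<in> verts T" "(T, T') \<in> (vertex_link z)\<^sup>*" using T' by (auto simp: patch_def reach_def)
 have sub: "vertex_link z \<subseteq> {S \<in> \<T>. z \<in> S} \<times> {S \<in> \<T>. z \<in> S}"
  unfolding vertex_link_def meets_def using verts_subset[OF simplex_\<T>] by blast
 obtain k where k: "k <= nstar * nstar" "(T, T') \<in> vertex_link z ^^ k"
  by (rule rtrancl_bounded_relpow[OF _ _ sub z(2)]) (use finite_\<T> card_star_nat[of z] in \<open>auto simp: nstar_def\<close>)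
 show ?thesis by (rule chain_bound[where f = f, OF _ c k(2,1) f0]) (use step in \<open>auto simp: vertex_link_def\<close>)
qed

lemma patch_size:
 assumes "T \<in> \<T>" "T' \<in> patch T" shows "diameter T' <= csize ^ (nstar * nstar) * diameter T"
 using meets_size csize_ge(4) diameter_pos[OF assms(1)] assms by (intro patch_bound) auto

end

context mesh
begin

text \<open>Vertex values may depend on the simplex; \<open>compatible\<close> makes them depend
  only on the vertex class, and then the simplex chosen by \<open>SOME\<close> does not matter
  (\<open>glue_eq\<close>).\<close>

definition glue :: "('a => 'a set => real) => 'a => real" where
 "glue A x = (let T = (SOME T. T \<in> \<T> \<and> x \<in> T) in \<Sum>z\<in>verts T. A z T * bary T z x)"

definition compatible :: "('a => 'a set => real) => bool" where
 "compatible A \<longleftrightarrow> (\<forall>T T' z. meets T T' --> z \<in> verts T --> z \<in> verts T' --> A z T = A z T')"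

lemma glue_eq:
 assumes A: "compatible A" and T: "T \<in> \<T>" and x: "x \<in> Om \<inter> T"
 shows "glue A x = (\<Sum>z\<in>verts T. A z T * bary T z x)"
proof -
 define S where "S = (SOME T. T \<in> \<T> \<and> x \<in> T)"
 have S: "S \<in> \<T>" "x \<in> S" using someI[of "%T. T \<in> \<T> \<and> x \<in> T" T] T x by (auto simp: S_def)
 note cf = common_face[OF simplex_\<T>[OF S(1)] simplex_\<T>[OF T] face_\<T>[OF S(1) T]]
 have "meets S T" using S T x by (auto simp: meets_def)
 have eq: "bary S z x = bary T z x" for z using cf(2) S(2) x by blast
 have "(\<Sum>z\<in>verts S. A z S * bary S z x) = (\<Sum>z\<in>verts T. A z T * bary T z x)"
 proof (rule sum.mono_neutral_cong[OF finite_verts[OF simplex_\<T>[OF T]] finite_verts[OF simplex_\<T>[OF S(1)]]])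
  show "A z S * bary S z x = 0" if "z \<in> verts S - verts T" for z using that eq[of z] bary_notin[of z T x] by simp
  show "A z T * bary T z x = 0" if "z \<in> verts T - verts S" for z using that eq[of z] bary_notin[of z S x] by simp
  show "A z S * bary S z x = A z T * bary T z x" if "z \<in> verts S \<inter> verts T" for z
   using A \<open>meets S T\<close> that eq unfolding compatible_def by auto
 qed
 thus ?thesis by (simp add: glue_def S_def)
qed

end

context mesh_shape
begin

lemma glue_poly:
 assumes A: "compatible A" and T: "T \<in> \<T>"
 shows "poly_deg_le 1 (%x. \<Sum>z\<in>verts T. A z T * bary T z x)" "\<forall>x\<in>Om \<inter> T. glue A x = (\<Sum>z\<in>verts T. A z T * bary T z x)"
 by (intro poly_sum poly_cmult poly_bary simplex_\<T>[OF T]) (use glue_eq[OF A T] in blast)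

end

context mesh_fem
begin

lemma glue_in_V: "compatible A ==> glue A \<in> V" using glue_poly poly_mono[OF _ K1] by (intro lagrange_spaceI) blast

end

context mesh
begin

text \<open>The nodal function of a single vertex class: it equals 1 at \<open>z0\<close> as seen
  from \<open>T0\<close> and vanishes on simplices at \<open>z0\<close> that are not linked to
  \<open>T0\<close>.\<close>

definition hat :: "'a set => 'a => 'a => real" where "hat T0 z0 = glue (%z T. if z = z0 \<and> T \<in> reach z0 T0 then 1 else 0)"

lemma hat_compatible: "compatible (%z T. if z = z0 \<and> T \<in> reach z0 T0 then 1 else 0)" unfolding compatible_def
proof (intro allI impI)
 fix T T' z assume m: "meets T T'" and z: "z \<in> verts T" "z \<in> verts T'"
 have "T \<in> reach z T0 \<longleftrightarrow> T' \<in> reach z T0" using reach_eq reach_step[OF m z] reach_sym by blast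
 thus "(if z = z0 \<and> T \<in> reach z0 T0 then 1 else 0) = (if z = z0 \<and> T' \<in> reach z0 T0 then 1 else 0 :: real)" by auto
qed

lemma hat_eq:
 assumes T: "T \<in> \<T>" "x \<in> Om \<inter> T"
 shows "hat T0 z0 x = (if T \<in> reach z0 T0 then bary T z0 x else 0)"
proof -
 have "hat T0 z0 x = (\<Sum>z\<in>verts T. (if z = z0 \<and> T \<in> reach z0 T0 then 1 else 0) * bary T z x)"
  unfolding hat_def by (rule glue_eq[OF hat_compatible T])
 also have "... = (\<Sum>z\<in>verts T. if z = z0 then (if T \<in> reach z0 T0 then bary T z0 x else 0) else 0)" by (intro sum.cong) auto
 also have "... = (if T \<in> reach z0 T0 then bary T z0 x else 0)" using finite_verts[OF simplex_\<T>[OF T(1)]] bary_notin[of z0 T x] by auto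
 finally show ?thesis .
qed

end

lemma poly_prod_list: "(!!i. i \<in> set w ==> poly_deg_le 1 (f i)) ==> poly_deg_le (length w) (%x. \<Prod>i\<leftarrow>w. f i x)"
proof (induction w)
 case (Cons a w)
 have "poly_deg_le (1 + length w) (%x. f a x * (\<Prod>i\<leftarrow>w. f i x))" by (rule poly_mult) (use Cons in auto)
 thus ?case by simp
qed (simp add: poly_const)

context mesh_fem
begin

text \<open>In the Bernstein form on \<open>T0\<close> each barycentric coordinate is replaced by
  the global function \<open>hat\<close>. Since the degree is at least 1, every monomial has such a
  factor, so the extension vanishes outside the patch. All factors lie in [0, 1], which keeps the
  coefficient bound.\<close>

lemma poly_extension:
 assumes T0: "T0 \<in> \<T>" and p: "poly_deg_le K p" and M: "!!x. x \<in> T0 ==> \<bar>p x\<bar> <= M"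
 obtains E where "E \<in> V" "!!x. x \<in> Om \<inter> T0 ==> E x = p x"
  "!!T x. T \<in> \<T> - patch T0 ==> x \<in> Om \<inter> T ==> E x = 0" "!!x. x \<in> Om ==> \<bar>E x\<bar> <= bern_const DIM('a) K * M"
proof -
 let ?d = "DIM('a)"
 note S0 = simplex_\<T>[OF T0]
 obtain v where v: "bij_betw v {..?d} (verts T0)" using simplex_enumeration[OF S0] by blast
 have vin: "v i \<in> verts T0" if "i <= ?d" for i using v that by (auto simp: bij_betw_def)
 have "0 <= M" using M[OF ctr_in[OF T0]] by linarith
 obtain c where c: "!!x. x \<in> T0 ==> p x = bern ?d K c (%i. bary T0 (v i) x)"
  "(\<Sum>w\<in>words ?d K. \<bar>c w\<bar>) <= bern_const ?d K * \<bar>M\<bar>" using poly_bary_representation[OF S0 v p M] by blast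
 define E where "E x = bern ?d K c (%i. hat T0 (v i) x)" for x
 have hat01: "0 <= hat T0 z x" "hat T0 z x <= 1" if x: "x \<in> Om" for z x
 proof -
  obtain T where T: "T \<in> \<T>" "x \<in> T" using cover x by blast
  show "0 <= hat T0 z x" "hat T0 z x <= 1" using hat_eq[OF T(1), of x T0 z] bary_nonneg[OF simplex_\<T>[OF T(1)] T(2), of z]
    bary_le_1[OF simplex_\<T>[OF T(1)] T(2), of z] T x by auto
 qed
 show ?thesis
 proof (rule that)
  show "E \<in> V"
  proof (rule lagrange_spaceI)
   fix T assume T: "T \<in> \<T>"
   define f where "f i x = (if T \<in> reach (v i) T0 then bary T (v i) x else 0)" for i x
   have f1: "poly_deg_le 1 (f i)" for i unfolding f_def using poly_bary[OF simplex_\<T>[OF T]] poly_zero[of 1]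
    by (cases "T \<in> reach (v i) T0") simp_all
   have "poly_deg_le K (%x. bern ?d K c (%i. f i x))" unfolding bern_def
   proof (intro poly_sum poly_cmult)
    fix w assume "w \<in> words ?d K"
    thus "poly_deg_le K (%x. \<Prod>i\<leftarrow>w. f i x)" using poly_prod_list[of w f] f1 by (simp add: words_def)
   qed
   moreover have "\<forall>x\<in>Om \<inter> T. E x = bern ?d K c (%i. f i x)" using hat_eq[OF T] by (simp add: E_def f_def)
   ultimately show "\<exists>q. poly_deg_le K q \<and> (\<forall>x\<in>Om \<inter> T. E x = q x)" by blast
  qed
  show "E x = p x" if "x \<in> Om \<inter> T0" for x using that hat_eq[OF T0 that] reach_refl c(1) by (simp add: E_def)
  show "E x = 0" if T: "T \<in> \<T> - patch T0" and x: "x \<in> Om \<inter> T" for T x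
  proof -
   have h0: "hat T0 (v i) x = 0" if "i <= ?d" for i using hat_eq[of T x T0 "v i"] T x vin[OF that] unfolding patch_def by auto
   have "(\<Prod>i\<leftarrow>w. hat T0 (v i) x) = 0" if w: "w \<in> words ?d K" for w
   proof -
    obtain i w' where "w = i # w'" using w K1 by (cases w) (auto simp: words_def)
    thus ?thesis using w h0[of i] by (auto simp: words_def)
   qed
   thus ?thesis by (simp add: E_def bern_def)
  qed
  show "\<bar>E x\<bar> <= bern_const ?d K * M" if x: "x \<in> Om" for x
  proof -
   have "\<bar>E x\<bar> <= (\<Sum>w\<in>words ?d K. \<bar>c w\<bar>)" unfolding E_def bern_def
   proof (intro order.trans[OF sum_abs] sum_mono)
    fix w
    show "\<bar>c w * (\<Prod>i\<leftarrow>w. hat T0 (v i) x)\<bar> <= \<bar>c w\<bar>" using prod_list_diff_le[of w "%i. hat T0 (v i) x" "%i. hat T0 (v i) x" 0] hat01[OF x] by (simp add: abs_mult mult_left_le)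
   qed
   also have "... <= bern_const ?d K * M" using c(2) \<open>0 <= M\<close> by simp
   finally show ?thesis .
  qed
 qed
qed

end

section \<open>Interpolation of simplex averages\<close>

context mesh
begin

text \<open>A quasi-interpolant of Clement type. All simplices of a vertex class have the same set
  \<open>reach z T\<close>, so \<open>SOME\<close> picks the same representative for all of them and
  the vertex values are compatible.\<close>

definition clement :: "('a set => real) => 'a => real" where "clement a = glue (%z T. a (SOME T'. T' \<in> reach z T))"

lemma clement_compatible: "compatible (%z T. a (SOME T'. T' \<in> reach z T))" unfolding compatible_def using reach_eq[OF reach_step] by simp

lemma clement_eq:
 assumes T: "T \<in> \<T>"
 obtains b where "!!x. x \<in> Om \<inter> T ==> clement a x - a T = (\<Sum>z\<in>verts T. (a (b z) - a T) * bary T z x)"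
  "!!z. z \<in> verts T ==> b z \<in> patch T"
proof (rule that)
 define b where "b z = (SOME T'. T' \<in> reach z T)" for z
 show "b z \<in> patch T" if "z \<in> verts T" for z
  using someI[of "%T'. T' \<in> reach z T" T] reach_refl that by (auto simp: patch_def b_def)
 show "clement a x - a T = (\<Sum>z\<in>verts T. (a (b z) - a T) * bary T z x)" if "x \<in> Om \<inter> T" for x
 proof -
  have "clement a x = (\<Sum>z\<in>verts T. a (b z) * bary T z x)" unfolding clement_def b_def by (rule glue_eq[OF clement_compatible T that])
  moreover have "(\<Sum>z\<in>verts T. a T * bary T z x) = a T" using bary_sum[OF simplex_\<T>[OF T], of x] by (simp flip: sum_distrib_left)
  ultimately show ?thesis by (simp add: left_diff_distrib sum_subtractf)
 qed
qed

lemma has_cutoffs_interior: assumes T: "T \<in> \<T>" shows "has_cutoffs (interior T)"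
proof -
 note S = simplex_\<T>[OF T]
 have eq: "{x. \<forall>z\<in>verts T. 0 < bary T z x} = interior T" using simplex_interior_iff_bary[OF S] by blast
 have bd: "bounded {x. \<forall>z\<in>verts T. 0 < bary T z x}"
  unfolding eq using compact_imp_bounded[OF full_simplex_compact[OF S]] interior_subset bounded_subset by metis
 show ?thesis by (rule smooth_cutoff[OF finite_verts[OF S] bary_smooth[OF S] bd]) (unfold has_cutoffs_def eq, blast)
qed

lemma integral_interior:
 fixes f :: "'a => real"
 assumes T: "T \<in> \<T>" and f: "f \<in> borel_measurable borel"
 shows "(LBINT x. ind (interior T) x * f x) = (LBINT x. ind T x * f x)"
proof (rule integral_cong_AE)
 show "AE x in lborel. ind (interior T) x * f x = ind T x * f x"
  by (rule AE_simplexI[OF T]) (use interior_subset in \<open>auto simp: indicator_def\<close>)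
qed (use f simplex_measurable[OF T] in \<open>auto intro!: borel_measurable_times borel_measurable_indicator\<close>)

lemma measure_interior_eq: "T \<in> \<T> ==> vol (interior T) = vol T" using integral_interior[of T "%x. 1"] by simp

lemma finite_measure_simplex: "T \<in> \<T> ==> emeasure lborel T < \<infinity>"
 using emeasure_compact_finite full_simplex_compact[OF simplex_\<T>] by blast

end

definition avg :: "('a::euclidean_space => real) => 'a set => real" where "avg v T = (LBINT x. ind T x * v x) / vol T"

definition mass :: "('a::euclidean_space => 'b::real_normed_vector) => 'a set => real" where "mass g T = (LBINT x. ind T x * norm (g x))"

lemma mass_nonneg: "0 <= mass g T" unfolding mass_def by simp

section \<open>Poincare estimates on patches\<close>

locale mesh_sobolev = mesh_fem Om \<T> R cs cr K
 for Om :: "'a::euclidean_space set" and \<T> R cs cr K +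
 fixes v :: "'a => real" and g :: "'a => 'a"
 assumes wgrad: "has_wgrad Om v g"

context mesh_sobolev
begin

lemma v_integrable: "integrable lborel v" and g_integrable: "integrable lborel g" using wgrad unfolding has_wgrad_def by auto

lemma v_measurable: "v \<in> borel_measurable borel" and g_measurable: "g \<in> borel_measurable borel"
 using borel_measurable_integrable[OF v_integrable] borel_measurable_integrable[OF g_integrable] by simp_all

lemma mass_interior: "T \<in> \<T> ==> mass g (interior T) = mass g T" unfolding mass_def by (rule integral_interior) (use g_measurable in simp_all)

text \<open>The second test function is the indicator of the simplex, so the comparison is with
  \<open>avg\<close>; its volume cancels against the volume in the constant.\<close>

lemma poincare_simplex:
 assumes T: "T \<in> \<T>" and q: "bump_limit (interior T) B q"
 shows "\<bar>(LBINT x. v x * q x) - avg v T * (LBINT x. q x)\<bar> <= 2 ^ (DIM('a) + 1) * diameter T * B * mass g T"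
proof -
 note S = simplex_\<T>[OF T]
 have one: "bump_limit (interior T) 1 (%x. ind (interior T) x * 1)"
  by (rule bump_limit_cutoff[OF has_cutoffs_interior[OF T] order_refl smooth_fun.const]) auto
 have m: "0 < vol T" by (rule measure_simplex_pos[OF T])
 have fm: "emeasure lborel (interior T) < \<infinity>"
  using finite_measure_simplex[OF T] emeasure_mono[OF interior_subset, of T lborel] simplex_measurable[OF T] by auto
 have "\<bar>(LBINT x. v x * q x) * (LBINT x. ind (interior T) x * 1) -
   (LBINT x. v x * (ind (interior T) x * 1)) * (LBINT x. q x)\<bar> <=
   2 ^ (DIM('a) + 1) * diameter T * B * 1 * vol (interior T) * (LBINT z. ind (interior T) z * norm (g z))"
 proof (rule weak_poincare[OF _ _ _ fm _ q one])
  show "has_wgrad (interior T) v g" by (rule has_wgrad_mono[OF wgrad interior_simplex_subset[OF T]])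
  show "convex (interior T)" by (rule convex_interior[OF full_simplex_convex[OF S]])
  show "norm (x - x') <= diameter T" if "x \<in> interior T" "x' \<in> interior T" for x x'
   by (rule dist_le_diameter[OF T]) (use that interior_subset in blast)+
 qed simp
 hence "\<bar>(LBINT x. v x * q x) * vol T - (avg v T * vol T) * (LBINT x. q x)\<bar> <= (2 ^ (DIM('a) + 1) * diameter T * B * mass g T) * vol T"
  using integral_interior[OF T v_measurable] measure_interior_eq[OF T] mass_interior[OF T] by (simp add: avg_def mass_def mult_ac)
 moreover have "(LBINT x. v x * q x) * vol T - (avg v T * vol T) * (LBINT x. q x) =
   ((LBINT x. v x * q x) - avg v T * (LBINT x. q x)) * vol T" by (simp add: algebra_simps) ultimately show ?thesis using m by (simp add: abs_mult)
qed

text \<open>Only moments of \<open>v\<close> are compared with those of its mean, at the price of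
  the L1 norm of the gradient. No higher integrability of \<open>v\<close> enters.\<close>

lemma moment_estimate:
 assumes T: "T \<in> \<T>" and q: "poly_deg_le n q" and B: "!!x. x \<in> T ==> \<bar>q x\<bar> <= B"
 shows "\<bar>(LBINT x. ind T x * (v x * q x)) - avg v T * (LBINT x. ind T x * q x)\<bar> <=
   2 ^ (DIM('a) + 1) * diameter T * B * mass g T" proof - have "0 <= B" using B[OF ctr_in[OF T]] by linarith
 have "bump_limit (interior T) B (%x. ind (interior T) x * q x)"
  by (rule bump_limit_cutoff[OF has_cutoffs_interior[OF T] order_refl poly_smooth[OF q]]) (use B interior_subset \<open>0 <= B\<close> in auto)
 from poincare_simplex[OF T this] show ?thesis
  using integral_interior[OF T, of "%x. v x * q x"] integral_interior[OF T poly_measurable[OF q]]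
   v_measurable poly_measurable[OF q] by (simp add: mult.left_commute)
qed

lemma ball_average_simplex:
 assumes T: "T \<in> \<T>" and b: "ball c r \<subseteq> T" and m: "0 < m" "m <= vol (ball c r)"
 shows "\<bar>avg v (ball c r) - avg v T\<bar> <= 2 ^ (DIM('a) + 1) * diameter T * mass g T / m"
proof -
 have "ball c r \<subseteq> interior T" using b by (simp add: interior_maximal)
 hence "bump_limit (interior T) 1 (%x. ind (ball c r) x * 1)" by (intro bump_limit_cutoff[OF has_cutoffs_ball _ smooth_fun.const]) auto
 from poincare_simplex[OF T this]
 have 1: "\<bar>(LBINT x. ind (ball c r) x * v x) - avg v T * vol (ball c r)\<bar> <= 2 ^ (DIM('a) + 1) * diameter T * mass g T"
  by (simp add: mult.commute)
 define mb where "mb = vol (ball c r)"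
 have mb: "0 < mb" "m <= mb" unfolding mb_def using m by linarith+
 have a: "avg v (ball c r) = (LBINT x. ind (ball c r) x * v x) / mb" by (simp add: avg_def mb_def)
 have "\<bar>avg v (ball c r) - avg v T\<bar> = \<bar>((LBINT x. ind (ball c r) x * v x) - avg v T * mb) / mb\<bar>"
  unfolding a using mb(1) by (simp add: diff_divide_distrib)
 also have "... = \<bar>(LBINT x. ind (ball c r) x * v x) - avg v T * mb\<bar> / mb" using mb(1) by simp
 also have "... <= 2 ^ (DIM('a) + 1) * diameter T * mass g T / m" by (rule frac_le[OF _ 1[folded mb_def] m(1) mb(2)])
   (use diameter_pos[OF T] mass_nonneg[of g T] in simp)
 finally show ?thesis .
qed

lemma ball_average_ball:
 assumes x: "ball x r0 \<subseteq> Om" "0 < r0" and b: "ball c r \<subseteq> ball x r0" "ball c' r' \<subseteq> ball x r0"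
  and m: "0 < m" "m <= vol (ball c r)" "m <= vol (ball c' r')"
 shows "\<bar>avg v (ball c r) - avg v (ball c' r')\<bar> <= 2 ^ (DIM('a) + 2) * r0 * (\<omega> * r0 ^ DIM('a)) * mass g (ball x r0) / (m * m)"
proof -
 have lim: "bump_limit (ball x r0) 1 (%x. ind (ball c r) x * 1)" if "ball c r \<subseteq> ball x r0" for c r
  by (intro bump_limit_cutoff[OF has_cutoffs_ball that smooth_fun.const]) auto
 have mb: "vol (ball x r0) = \<omega> * r0 ^ DIM('a)" using measure_cball[of r0 x] x(2) content_cball_conv_ball[of x r0] by simp
 let ?I = "LBINT z. ind (ball c r) z * v z" and ?I' = "LBINT z. ind (ball c' r') z * v z"
 define n n' where "n = vol (ball c r)" and "n' = vol (ball c' r')"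
 have n: "0 < n" "0 < n'" "m <= n" "m <= n'" unfolding n_def n'_def using m by linarith+
 have "\<bar>(LBINT z. v z * (ind (ball c r) z * 1)) * (LBINT z. ind (ball c' r') z * 1) -
   (LBINT z. v z * (ind (ball c' r') z * 1)) * (LBINT z. ind (ball c r) z * 1)\<bar> <=
   2 ^ (DIM('a) + 1) * (2 * r0) * 1 * 1 * vol (ball x r0) * (LBINT z. ind (ball x r0) z * norm (g z))"
 proof (rule weak_poincare[OF has_wgrad_mono[OF wgrad x(1)] _ _ _ _ lim[OF b(1)] lim[OF b(2)]])
  show "norm (y - y') <= 2 * r0" if "y \<in> ball x r0" "y' \<in> ball x r0" for y y'
   using that dist_triangle[of y y' x] by (simp add: dist_norm norm_minus_commute)
  show "emeasure lborel (ball x r0) < \<infinity>" using emeasure_bounded_finite[OF bounded_ball] .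
 qed auto
 hence 1: "\<bar>?I * n' - ?I' * n\<bar> <= 2 ^ (DIM('a) + 2) * r0 * (\<omega> * r0 ^ DIM('a)) * mass g (ball x r0)"
  by (simp add: mb mass_def mult_ac n_def n'_def)
 have "avg v (ball c r) - avg v (ball c' r') = ?I / n - ?I' / n'" by (simp add: avg_def n_def n'_def)
 also have "... = (?I * n' - ?I' * n) / (n * n')" using n by (simp add: field_simps)
 finally have "\<bar>avg v (ball c r) - avg v (ball c' r')\<bar> = \<bar>?I * n' - ?I' * n\<bar> / (n * n')" using n by simp
 also have "... <= 2 ^ (DIM('a) + 2) * r0 * (\<omega> * r0 ^ DIM('a)) * mass g (ball x r0) / (m * m)"
  by (rule frac_le[OF _ 1]) (use m n x(2) \<omega>_pos mass_nonneg[of g "ball x r0"] in \<open>auto intro!: mult_mono\<close>)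
 finally show ?thesis .
qed

end

context mesh_shape
begin

text \<open>A lower bound for the radii of the small balls in \<open>average_step\<close>, relative
  to \<open>diameter T\<close>: the factor \<open>cball_const / (2 * csize)\<close> is the
  contraction \<open>s\<close>, and \<open>1 / (cs * csize)\<close> bounds the radius of the ball
  inside the simplex.\<close>

definition cshrink :: real where "cshrink = cball_const / (2 * csize * cs * csize)"

lemma cshrink: "0 < cshrink" "cshrink <= 1"
proof -
 define W where "W = 2 * csize * cs * csize"
 have "1 * 1 * 1 * 1 <= W" unfolding W_def using csize_ge(4) cs1 by (intro mult_mono) auto
 thus "0 < cshrink" "cshrink <= 1" unfolding cshrink_def W_def[symmetric] using cball_const by (simp_all)
qed

definition cstep :: real where "cstep = 2 ^ (DIM('a) + 2) * (1 + csize + 1) / cshrink ^ (2 * DIM('a))"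

end

context mesh_sobolev
begin

lemma mass_union:
 assumes "S \<subseteq> \<T>" "A \<subseteq> \<Union>S" "A \<in> sets borel" shows "mass g A <= (\<Sum>T\<in>S. mass g T)"
proof -
 have fS: "finite S" using assms(1) finite_\<T> finite_subset by blast
 have i: "integrable lborel (%x. ind B x * norm (g x))" if "B \<in> sets borel" for B
  using integrable_mult_indicator[OF _ integrable_norm[OF g_integrable], of B] that by simp
 have iT: "integrable lborel (%x. ind T x * norm (g x))" if "T \<in> S" for T using i simplex_measurable[of T] that assms(1) by auto
 have "mass g A <= (LBINT x. (\<Sum>T\<in>S. ind T x * norm (g x)))" unfolding mass_def
 proof (rule integral_mono[OF i[OF assms(3)]])
  show "integrable lborel (%x. \<Sum>T\<in>S. ind T x * norm (g x))" by (rule Bochner_Integration.integrable_sum) (rule iT)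
  fix x
  show "ind A x * norm (g x) <= (\<Sum>T\<in>S. ind T x * norm (g x))"
  proof (cases "x \<in> A")
   case True
   then obtain T where T: "T \<in> S" "x \<in> T" using assms(2) by blast
   have "ind T x * norm (g x) <= (\<Sum>T\<in>S. ind T x * norm (g x))" by (rule member_le_sum[OF T(1)]) (use fS in auto)
   thus ?thesis using True T by simp
  qed (simp add: sum_nonneg)
 qed
 also have "... = (\<Sum>T\<in>S. mass g T)" unfolding mass_def by (rule Bochner_Integration.integral_sum) (rule iT)
 finally show ?thesis .
qed

text \<open>The average over \<open>T\<close> is compared with that over a small ball in
  \<open>T\<close>, this one with a small ball in \<open>T'\<close>, and that one with the average
  over \<open>T'\<close>. The middle comparison takes place in the convex ball of
  \<open>star_ball\<close>, which is covered by simplices of \<open>reach z T\<close>. These are the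
  three summands in \<open>cstep\<close>.\<close>

lemma average_step:
 assumes TT: "meets T T'" and z: "z \<in> verts T" "z \<in> verts T'"
 shows "\<bar>avg v T - avg v T'\<bar> <= cstep * diameter T / (\<omega> * diameter T ^ DIM('a)) * (\<Sum>S\<in>reach z T. mass g S)"
proof -
 have T: "T \<in> \<T>" "T' \<in> \<T>" using TT by (auto simp: meets_def)
 have T'T: "meets T' T" using TT by (auto simp: meets_def)
 define D where "D = diameter T"
 define r0 where "r0 = cball_const * D"
 define G where "G = (\<Sum>S\<in>reach z T. mass g S)"
 have D: "0 < D" "0 < diameter T'" using diameter_pos T by (auto simp: D_def)
 have r0: "0 < r0" "r0 <= D" using cball_const D by (auto simp: r0_def)
 have DD: "D <= csize * diameter T'" "diameter T' <= csize * D" using meets_size[OF TT] meets_size[OF T'T] by (auto simp: D_def)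
 obtain x where x: "x \<in> T \<inter> T'" "x \<in> Om" "ball x r0 \<subseteq> Om" "ball x r0 \<subseteq> \<Union>{S \<in> \<T>. x \<in> S}"
  "!!S z. S \<in> \<T> ==> x \<in> S ==> z \<in> verts T \<inter> verts T' ==> z \<in> verts S"
  using star_ball[OF TT] unfolding r0_def D_def by blast
 have sub\<T>: "reach z T \<subseteq> \<T>" using reach_in(1)[OF _ T(1) z(1)] by blast
 have finr: "finite (reach z T)" using sub\<T> finite_\<T> finite_subset by blast
 have le_G: "mass g S <= G" if "S \<in> reach z T" for S unfolding G_def by (rule member_le_sum[OF that]) (use finr mass_nonneg in auto)
 have star_reach: "{S \<in> \<T>. x \<in> S} \<subseteq> reach z T"
 proof
  fix S assume S: "S \<in> {S \<in> \<T>. x \<in> S}"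
  hence "meets T S" using x T by (auto simp: meets_def)
  moreover have "z \<in> verts S" using x(5)[of S z] S z by blast
  ultimately show "S \<in> reach z T" using reach_step z(1) by blast
 qed
 have ball_G: "mass g (ball x r0) <= G" unfolding G_def by (rule mass_union[OF sub\<T>]) (use x(4) star_reach in auto)
 \<comment> \<open>With this contraction even a simplex \<open>csize\<close> times as large as
   \<open>T\<close> shrinks to half of the radius \<open>r0\<close>.\<close>
 define s where "s = cball_const / (2 * csize)"
 have s: "0 < s" "s <= 1" using cball_const csize_ge(4) by (auto simp: s_def)
 define m where "m = \<omega> * (cshrink * D) ^ DIM('a)"
 have m: "0 < m" using \<omega>_pos cshrink D by (simp add: m_def)
 have small: "ball ((1 - s) *\<^sub>R x + s *\<^sub>R ctr U) (s * rad U) \<subseteq> U"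
  "ball ((1 - s) *\<^sub>R x + s *\<^sub>R ctr U) (s * rad U) \<subseteq> ball x r0"
  "m <= vol (ball ((1 - s) *\<^sub>R x + s *\<^sub>R ctr U) (s * rad U))"
  if U: "U \<in> \<T>" "x \<in> U" "diameter U <= csize * D" "D <= csize * diameter U" for U
 proof -
  have c: "cball ((1 - s) *\<^sub>R x + s *\<^sub>R ctr U) (s * rad U) \<subseteq> U \<inter> cball x (s * diameter U)"
   using dist_le_diameter[OF U(1) _ U(2)] by (intro simplex_contraction[OF simplex_\<T>[OF U(1)] U(2) ball_ctr[OF U(1)] s])
  have sub: "ball ((1 - s) *\<^sub>R x + s *\<^sub>R ctr U) (s * rad U) \<subseteq> cball ((1 - s) *\<^sub>R x + s *\<^sub>R ctr U) (s * rad U)"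
   by simp
  thus "ball ((1 - s) *\<^sub>R x + s *\<^sub>R ctr U) (s * rad U) \<subseteq> U" using c by blast
  have "s * diameter U <= s * (csize * D)" using U(3) s by (intro mult_left_mono) auto
  also have "... = r0 / 2" using csize_ge(4) by (simp add: s_def r0_def)
  finally have "cball x (s * diameter U) \<subseteq> ball x r0" using r0 by auto
  thus "ball ((1 - s) *\<^sub>R x + s *\<^sub>R ctr U) (s * rad U) \<subseteq> ball x r0" using c sub by blast
  have "D <= csize * (cs * rad U)" using U(4) diameter_le_rad[OF U(1)] csize_ge(4) by (meson mult_left_mono order.trans zero_le_one)
  hence "cshrink * D <= cshrink * (csize * (cs * rad U))" using cshrink by (intro mult_left_mono) auto
  also have "... = s * rad U" using cs1 by (simp add: cshrink_def s_def)
  finally have "(cshrink * D) ^ DIM('a) <= (s * rad U) ^ DIM('a)" using cshrink D by (intro power_mono) auto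
  hence "m <= \<omega> * (s * rad U) ^ DIM('a)" using \<omega>_pos by (simp add: m_def)
  also have "... = vol (ball ((1 - s) *\<^sub>R x + s *\<^sub>R ctr U) (s * rad U))"
   using measure_cball[of "s * rad U" "(1 - s) *\<^sub>R x + s *\<^sub>R ctr U"] s rad_pos[OF U(1)] by (simp add: content_cball_conv_ball)
  finally show "m <= vol (ball ((1 - s) *\<^sub>R x + s *\<^sub>R ctr U) (s * rad U))" .
 qed
 have D1: "D <= csize * D" using D csize_ge(4) by simp
 note sT = small[OF T(1), folded D_def, OF _ D1 D1] and sT' = small[OF T(2) _ DD(2,1)]
 have xT: "x \<in> T" "x \<in> T'" using x(1) by auto
 let ?b = "ball ((1 - s) *\<^sub>R x + s *\<^sub>R ctr T) (s * rad T)" and ?b' = "ball ((1 - s) *\<^sub>R x + s *\<^sub>R ctr T') (s * rad T')"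
 define c where "c = (2::real) ^ (DIM('a) + 2)"
 have c: "2 ^ (DIM('a) + 1) <= c" "0 < c" by (auto simp: c_def)
 have G0: "0 <= G" unfolding G_def by (intro sum_nonneg mass_nonneg)
 have mw: "m <= \<omega> * D ^ DIM('a)" unfolding m_def using \<omega>_pos cshrink D by (intro mult_left_mono power_mono) (auto)
 have e1: "\<bar>avg v ?b - avg v T\<bar> <= c * D * G / m"
 proof -
  have "\<bar>avg v ?b - avg v T\<bar> <= 2 ^ (DIM('a) + 1) * diameter T * mass g T / m"
   by (rule ball_average_simplex[OF T(1) sT(1)[OF xT(1)] m sT(3)[OF xT(1)]])
  also have "... <= c * D * G / m" using c D m le_G[OF reach_refl] mass_nonneg[of g T] unfolding D_def[symmetric]
   by (intro divide_right_mono mult_mono) auto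
  finally show ?thesis .
 qed
 have e2: "\<bar>avg v ?b' - avg v T'\<bar> <= c * (csize * D) * G / m"
 proof -
  have "\<bar>avg v ?b' - avg v T'\<bar> <= 2 ^ (DIM('a) + 1) * diameter T' * mass g T' / m"
   by (rule ball_average_simplex[OF T(2) sT'(1)[OF xT(2)] m sT'(3)[OF xT(2)]])
  also have "... <= c * (csize * D) * G / m" using c D m le_G[OF reach_step[OF TT z]] mass_nonneg[of g T'] DD(2)
   by (intro divide_right_mono mult_mono) auto
  finally show ?thesis .
 qed
 have e3: "\<bar>avg v ?b - avg v ?b'\<bar> <= c * D * (\<omega> * D ^ DIM('a)) * G / (m * m)"
 proof -
  have "\<bar>avg v ?b - avg v ?b'\<bar> <= 2 ^ (DIM('a) + 2) * r0 * (\<omega> * r0 ^ DIM('a)) * mass g (ball x r0) / (m * m)"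
   by (rule ball_average_ball[OF x(3) r0(1) sT(2)[OF xT(1)] sT'(2)[OF xT(2)] m sT(3)[OF xT(1)] sT'(3)[OF xT(2)]])
  also have "... <= c * D * (\<omega> * D ^ DIM('a)) * G / (m * m)"
   unfolding c_def[symmetric] using c r0 \<omega>_pos ball_G mass_nonneg[of g "ball x r0"] by (intro divide_right_mono mult_mono power_mono) auto
  finally show ?thesis .
 qed
 have "\<bar>avg v T - avg v T'\<bar> <= c * D * G / m + c * (csize * D) * G / m + c * D * (\<omega> * D ^ DIM('a)) * G / (m * m)"
  using e1 e2 e3 by linarith
 also have "c * D * G / m <= c * D * (\<omega> * D ^ DIM('a)) * G / (m * m)" using mw c D G0 m by (simp add: field_simps mult_left_mono)
 also have "c * (csize * D) * G / m <= c * (csize * D) * (\<omega> * D ^ DIM('a)) * G / (m * m)"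
  using mw c D G0 m csize_ge(4) by (simp add: field_simps mult_left_mono)
 also have "c * D * (\<omega> * D ^ DIM('a)) * G / (m * m) + c * (csize * D) * (\<omega> * D ^ DIM('a)) * G / (m * m) + c * D * (\<omega> * D ^ DIM('a)) * G / (m * m)
   = (c * (1 + csize + 1)) * D * G * ((\<omega> * D ^ DIM('a)) / (m * m))" by (simp add: algebra_simps)
 also have "(\<omega> * D ^ DIM('a)) / (m * m) = 1 / (\<omega> * D ^ DIM('a)) * (1 / cshrink ^ (2 * DIM('a)))"
 proof -
  have "cshrink ^ (2 * DIM('a)) = cshrink ^ DIM('a) * cshrink ^ DIM('a)" by (simp only: mult_2 power_add)
  thus ?thesis by (simp add: m_def field_simps)
 qed
 finally show ?thesis by (simp add: cstep_def c_def D_def G_def mult_ac)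
qed

text \<open>Of the size of the diameter times the mean gradient on the patch: the amount by which
  \<open>v\<close> can deviate from its average according to Poincare.\<close>

definition osc :: "'a set => real" where "osc T = diameter T / vol T * (\<Sum>S\<in>patch T. mass g S)"

end

context mesh_shape
begin

text \<open>At most \<open>nstar * nstar\<close> applications of \<open>average_step\<close>.
  Passing from the sizes along the chain to those of \<open>T\<close> costs one factor for the
  diameter and \<open>d\<close> factors for the volume.\<close>

definition cavg :: real where "cavg = real (nstar * nstar) * (cstep * (csize ^ (nstar * nstar)) ^ (DIM('a) + 1))"

lemma cstep_pos: "0 < cstep" unfolding cstep_def using csize_ge(4) cshrink by (intro divide_pos_pos mult_pos_pos) auto

lemma cavg_nonneg: "0 <= cavg" unfolding cavg_def using csize_ge(4) cstep_pos by (intro mult_nonneg_nonneg zero_le_power) auto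

end

context mesh_sobolev
begin

lemma osc_nonneg: "T \<in> \<T> ==> 0 <= osc T" unfolding osc_def using diameter_pos measure_simplex_pos
 by (intro mult_nonneg_nonneg divide_nonneg_pos sum_nonneg mass_nonneg) (auto intro: less_imp_le)

lemma mass_le_osc:
 assumes T: "T \<in> \<T>" shows "diameter T * mass g T <= osc T * vol T"
proof -
 have "mass g T <= (\<Sum>S\<in>patch T. mass g S)" by (rule member_le_sum[OF patch_refl[OF T]]) (use card_patch(1)[OF T] mass_nonneg in auto)
 thus ?thesis using diameter_pos[OF T] measure_simplex_pos[OF T] by (simp add: osc_def)
qed

lemma average_patch:
 assumes T: "T \<in> \<T>" and T': "T' \<in> patch T"
 shows "\<bar>avg v T' - avg v T\<bar> <= cavg * osc T"
proof -
 define M where "M = csize ^ (nstar * nstar)"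
 have M: "1 <= M" unfolding M_def using csize_ge(4) by (rule one_le_power)
 define D where "D = diameter T"
 define G where "G = (\<Sum>S\<in>patch T. mass g S)"
 have D: "0 < D" unfolding D_def by (rule diameter_pos[OF T])
 have G: "0 <= G" unfolding G_def by (intro sum_nonneg mass_nonneg)
 obtain z where z: "z \<in> verts T" "(T, T') \<in> (vertex_link z)\<^sup>*" using T' by (auto simp: patch_def reach_def)
 have sub: "vertex_link z \<subseteq> {S \<in> \<T>. z \<in> S} \<times> {S \<in> \<T>. z \<in> S}"
  unfolding vertex_link_def meets_def using verts_subset[OF simplex_\<T>] by blast
 obtain k where k: "k <= nstar * nstar" "(T, T') \<in> vertex_link z ^^ k"
  by (rule rtrancl_bounded_relpow[OF _ _ sub z(2)]) (use finite_\<T> card_star_nat[of z] in \<open>auto simp: nstar_def\<close>)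
 define E where "E = cstep * M ^ (DIM('a) + 1) * osc T"
 have E: "0 <= E" unfolding E_def using cstep_pos M osc_nonneg[OF T] by (intro mult_nonneg_nonneg zero_le_power) auto
 have step: "\<bar>avg v A - avg v B\<bar> <= E" if A: "A \<in> reach z T" and AB: "(A, B) \<in> vertex_link z" for A B
 proof -
  have A\<T>: "A \<in> \<T>" "z \<in> verts A" using reach_in[OF A T z(1)] by auto
  have m: "meets A B" "z \<in> verts B" using AB by (auto simp: vertex_link_def)
  have Ap: "A \<in> patch T" "T \<in> patch A" using A z(1) patch_sym[OF _ T] by (auto simp: patch_def)
  have sz: "diameter A <= M * D" "D <= M * diameter A"
   using patch_size[OF T Ap(1)] patch_size[OF A\<T>(1) Ap(2)] by (simp_all add: M_def D_def)
  have dA: "0 < diameter A" by (rule diameter_pos[OF A\<T>(1)])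
  have "reach z A = reach z T" by (rule reach_eq[OF A])
  hence "reach z A \<subseteq> patch T" using z(1) by (auto simp: patch_def)
  hence GA: "(\<Sum>S\<in>reach z A. mass g S) <= G" unfolding G_def using card_patch(1)[OF T] mass_nonneg by (intro sum_mono2) auto
  have mT: "0 < vol T" "vol T <= \<omega> * D ^ DIM('a)" using measure_simplex_pos[OF T] measure_simplex_le[OF T] by (simp_all add: D_def)
  have "D ^ DIM('a) <= (M * diameter A) ^ DIM('a)" using sz(2) D by (intro power_mono) auto
  hence "vol T <= \<omega> * (M * diameter A) ^ DIM('a)" using mT(2) \<omega>_pos by (meson mult_left_mono order.trans less_imp_le)
  hence mA: "vol T <= M ^ DIM('a) * (\<omega> * diameter A ^ DIM('a))" by (simp add: power_mult_distrib mult_ac)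
  have wA: "0 < \<omega> * diameter A ^ DIM('a)" using \<omega>_pos dA by simp
  have "\<bar>avg v A - avg v B\<bar> <= cstep * diameter A / (\<omega> * diameter A ^ DIM('a)) * (\<Sum>S\<in>reach z A. mass g S)"
   by (rule average_step[OF m(1) A\<T>(2) m(2)])
  also have "... <= cstep * (M * D) / (\<omega> * diameter A ^ DIM('a)) * G"
   using GA sz(1) wA cstep_pos M D by (intro mult_mono divide_right_mono mult_left_mono sum_nonneg mass_nonneg) auto
  also have "... = cstep * M * D * G * (1 / (\<omega> * diameter A ^ DIM('a)))" by simp
  also have "... <= cstep * M * D * G * (M ^ DIM('a) / vol T)"
   using cstep_pos M D G mT(1) mA wA by (intro mult_left_mono mult_nonneg_nonneg) (auto simp: field_simps)
  also have "... = E" by (simp add: E_def osc_def D_def G_def)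
  finally show ?thesis .
 qed
 have "\<bar>avg v B - avg v T\<bar> <= real k * E" if "(T, B) \<in> vertex_link z ^^ k" for B k using that
 proof (induction k arbitrary: B)
  case (Suc k)
  then obtain A where A: "(T, A) \<in> vertex_link z ^^ k" "(A, B) \<in> vertex_link z" by auto
  hence "A \<in> reach z T" unfolding reach_def by (auto dest: relpow_imp_rtrancl)
  thus ?case using step[OF _ A(2)] Suc.IH[OF A(1)] by (simp add: algebra_simps)
 qed simp
 hence "\<bar>avg v T' - avg v T\<bar> <= real k * E" using k(2) .
 also have "... <= real (nstar * nstar) * E" using k(1) E by (intro mult_right_mono) (simp_all only: of_nat_le_iff)
 finally show ?thesis by (simp add: cavg_def E_def M_def)
qed

text \<open>The barycentric coordinates sum to 1, so after subtracting \<open>avg v T\<close> the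
  interpolant is a combination of differences of averages on the patch. Its Lipschitz bound has one
  term for each of the \<open>d + 1\<close> vertices.\<close>

lemma clement_bound:
 assumes T: "T \<in> \<T>"
 obtains q where "poly_deg_le 1 q" "!!x. x \<in> Om \<inter> T ==> clement (avg v) x = q x"
  "!!x. x \<in> T ==> \<bar>q x - avg v T\<bar> <= cavg * osc T"
  "!!x y. \<bar>q x - q y\<bar> <= real (DIM('a) + 1) * (cavg * osc T) / rad T * norm (x - y)"
proof -
 note S = simplex_\<T>[OF T]
 obtain b where b: "!!x. x \<in> Om \<inter> T ==> clement (avg v) x - avg v T = (\<Sum>z\<in>verts T. (avg v (b z) - avg v T) * bary T z x)"
  "!!z. z \<in> verts T ==> b z \<in> patch T" using clement_eq[OF T, of "avg v"] by blast
 define e where "e z = avg v (b z) - avg v T" for z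
 define q where "q x = (\<Sum>z\<in>verts T. e z * bary T z x) + avg v T" for x
 have e: "\<bar>e z\<bar> <= cavg * osc T" if "z \<in> verts T" for z unfolding e_def by (rule average_patch[OF T b(2)[OF that]])
 show ?thesis
 proof (rule that)
  show "poly_deg_le 1 q" unfolding q_def by (intro poly_add poly_sum poly_cmult poly_bary poly_const S)
  show "clement (avg v) x = q x" if "x \<in> Om \<inter> T" for x using b(1)[OF that] by (simp add: q_def e_def)
  show "\<bar>q x - avg v T\<bar> <= cavg * osc T" if x: "x \<in> T" for x
  proof -
   have "\<bar>q x - avg v T\<bar> <= (\<Sum>z\<in>verts T. cavg * osc T * bary T z x)" unfolding q_def add_diff_cancel_right'
    by (intro order.trans[OF sum_abs] sum_mono) (use e bary_nonneg[OF S x] in \<open>auto simp: abs_mult intro!: mult_right_mono\<close>)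
   thus ?thesis using bary_sum[OF S, of x] by (simp flip: sum_distrib_left)
  qed
  show "\<bar>q x - q y\<bar> <= real (DIM('a) + 1) * (cavg * osc T) / rad T * norm (x - y)" for x y
  proof -
   have "q x - q y = (\<Sum>z\<in>verts T. e z * (bary T z x - bary T z y))" by (simp add: q_def right_diff_distrib sum_subtractf)
   also have "\<bar>...\<bar> <= (\<Sum>z\<in>verts T. (cavg * osc T) * (norm (x - y) / rad T))"
    unfolding abs_mult using e bary_lipschitz[OF S rad_pos[OF T] ball_ctr[OF T]] cavg_nonneg osc_nonneg[OF T]
    by (intro order.trans[OF sum_abs] sum_mono) (simp only: abs_mult mult_mono mult_nonneg_nonneg)
   finally show ?thesis using card_verts[OF S] by simp
  qed
 qed
qed

end

section \<open>Replacing the remainder by a bounded piecewise polynomial\<close>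

context mesh
begin

lemma integrable_simplex:
 fixes f :: "'a => real"
 assumes "T \<in> \<T>" "continuous_on T f" shows "integrable lborel (%x. ind T x * f x)"
 using borel_integrable_compact[OF full_simplex_compact[OF simplex_\<T>] assms(2)] assms(1) by simp

lemma integrable_times_poly:
 fixes f :: "'a => real"
 assumes f: "integrable lborel f" and T: "T \<in> \<T>" and q: "poly_deg_le n q"
 shows "integrable lborel (%x. ind T x * (f x * q x))"
proof -
 have "compact (q ` T)"
  by (rule compact_continuous_image[OF smooth_fun_continuous[OF poly_smooth[OF q]] full_simplex_compact[OF simplex_\<T>[OF T]]])
 then obtain M where "\<forall>y\<in>q ` T. norm y <= M" using compact_imp_bounded bounded_iff by metis
 hence bd: "\<bar>ind T x * q x\<bar> <= \<bar>M\<bar>" for x by (cases "x \<in> T") fastforce+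
 have "(%x. ind T x * q x) \<in> borel_measurable lborel" using poly_measurable[OF q] simplex_measurable[OF T] by simp
 from integrable_times_bounded[OF f this bd] show ?thesis by (simp add: mult_ac)
qed

end

context mesh_fem
begin

text \<open>Testing the projection with itself bounds its squared L2 norm by \<open>A\<close> times
  its maximum times the volume. \<open>poly_sup_le_L2\<close> turns the left side into the squared
  maximum, and one factor cancels.\<close>

lemma local_projection:
 assumes T: "T \<in> \<T>" and f: "integrable lborel f"
  and bd: "!!q M. poly_deg_le K q ==> (!!x. x \<in> T ==> \<bar>q x\<bar> <= M) ==>
   \<bar>LBINT x. ind T x * (f x * q x)\<bar> <= A * M * vol T" shows "\<exists>p. poly_deg_le K p \<and> (\<forall>h. poly_deg_le K h -->
   (LBINT x. ind T x * (p x * h x)) = (LBINT x. ind T x * (f x * h x))) \<and>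
  (\<forall>x\<in>T. \<bar>p x\<bar> <= poly_mass DIM('a) K * A)" proof - note S = simplex_\<T>[OF T]
 define B where "B f h = (LBINT x. ind T x * (f x * h x))" for f h :: "'a => real"
 obtain X where X: "finite X" "X \<subseteq> UNIV \<inter> T" "!!q x. poly_deg_le K q ==> \<forall>x\<in>X. q x = 0 ==> x \<in> UNIV \<inter> T ==> q x = 0"
  using poly_determined_by_points[OF S, of UNIV K] by blast
 have cont: "continuous_on T q" if "poly_deg_le K q" for q by (rule smooth_fun_continuous[OF poly_smooth[OF that]])
 have int: "integrable lborel (%x. ind T x * (q x * h x))" if "poly_deg_le K q" "poly_deg_le K h" for q h
  by (intro integrable_simplex T continuous_on_mult cont that)
 have sup: "(q x)^2 * vol T <= poly_mass DIM('a) K * B q q" if "poly_deg_le K q" "x \<in> T" for q x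
  using poly_sup_le_L2[OF S that] by (simp add: B_def power2_eq_square)
 have lin: "B u (%x. a * q x + b * h x) = a * B u q + b * B u h"
  if "integrable lborel (%x. ind T x * (u x * q x))" "integrable lborel (%x. ind T x * (u x * h x))" for u q h a b
 proof -
  have "B u (%x. a * q x + b * h x) = (LBINT x. a * (ind T x * (u x * q x)) + b * (ind T x * (u x * h x)))"
   unfolding B_def by (simp add: algebra_simps)
  thus ?thesis using that by (simp add: B_def)
 qed
 have comm: "B u h = B h u" for u h by (simp add: B_def mult.commute)
 have zero: "B u q = 0" if "\<forall>x\<in>X. q x = 0" "poly_deg_le K q" for u q
 proof -
  have "ind T x * (u x * q x) = 0" for x using X(3)[OF that(2,1)] by (cases "x \<in> T") auto
  thus ?thesis unfolding B_def by (simp only: Bochner_Integration.integral_zero)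
 qed
 have "\<exists>w\<in>{q. poly_deg_le K q}. \<forall>h\<in>{q. poly_deg_le K q}. B w h = B f h"
 proof (rule riesz_finite_points[OF X(1)])
  show "{q :: 'a => real. poly_deg_le K q} \<noteq> {}" using poly_zero by blast
  show "0 < B q q" if "q \<in> {q. poly_deg_le K q}" "x \<in> X" "q x \<noteq> 0" for q x
  proof -
   have "0 < (q x)^2 * vol T" using that(3) measure_simplex_pos[OF T] by simp
   also have "... <= poly_mass DIM('a) K * B q q" using sup that X(2) by blast
   finally show ?thesis using poly_mass_pos[of "DIM('a)" K] by (simp add: zero_less_mult_iff)
  qed
  show "B (%x. a * q x + b * h x) k = a * B q k + b * B h k"
   if "q \<in> {q. poly_deg_le K q}" "h \<in> {q. poly_deg_le K q}" "k \<in> {q. poly_deg_le K q}" for q h k a b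
   unfolding comm[of _ k] by (rule lin) (use int that in auto)
  show "B f (%x. a * q x + b * h x) = a * B f q + b * B f h"
   if "q \<in> {q. poly_deg_le K q}" "h \<in> {q. poly_deg_le K q}" for q h a b by (rule lin) (use integrable_times_poly[OF f T] that in auto)
  show "B q h = 0" if "q \<in> {q. poly_deg_le K q}" "h \<in> {q. poly_deg_le K q}" "\<forall>x\<in>X. q x = 0" for q h
   using zero[OF that(3), of h] that(1) comm[of q h] by simp
 qed (use zero comm poly_lincomb in auto)
 then obtain p where p: "poly_deg_le K p" "!!h. poly_deg_le K h ==> B p h = B f h" by blast
 have "continuous_on T (%x. \<bar>p x\<bar>)" by (intro continuous_intros cont p(1))
 then obtain y where y: "y \<in> T" "!!x. x \<in> T ==> \<bar>p x\<bar> <= \<bar>p y\<bar>"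
  using continuous_attains_sup[OF full_simplex_compact[OF S]] ctr_in[OF T] by blast
 have m: "0 < vol T" by (rule measure_simplex_pos[OF T])
 have "(p y)^2 * vol T <= poly_mass DIM('a) K * B p p" by (rule sup[OF p(1) y(1)])
 also have "... <= poly_mass DIM('a) K * (A * \<bar>p y\<bar> * vol T)"
  unfolding p(2)[OF p(1)] using bd[OF p(1) y(2)] poly_mass_pos[of "DIM('a)" K] by (intro mult_left_mono) (auto simp: B_def)
 finally have "(\<bar>p y\<bar> * \<bar>p y\<bar>) * vol T <= (poly_mass DIM('a) K * A * \<bar>p y\<bar>) * vol T"
  by (simp add: power2_eq_square)
 hence "\<bar>p y\<bar> * \<bar>p y\<bar> <= (poly_mass DIM('a) K * A) * \<bar>p y\<bar>" using m by simp
 moreover have "0 <= A"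
 proof -
  have "0 <= A * 1 * vol T" by (rule order.trans[OF abs_ge_zero bd[OF poly_const[of K 0]]]) simp
  thus ?thesis using m by (simp only: zero_le_mult_iff) linarith
 qed
 ultimately have "\<bar>p y\<bar> <= poly_mass DIM('a) K * A"
  using poly_mass_pos[of "DIM('a)" K] by (cases "p y = 0") (auto intro: mult_right_le_imp_le[of _ "\<bar>p y\<bar>"])
 hence "\<forall>x\<in>T. \<bar>p x\<bar> <= poly_mass DIM('a) K * A" using y(2) by (meson order.trans)
 thus ?thesis using p unfolding B_def by (intro exI[of _ p]) simp
qed

lemma inner_V_sum:
 assumes f: "integrable lborel f" and h: "h \<in> V"
  and q: "!!T. T \<in> \<T> ==> poly_deg_le K (q T)" "!!T x. T \<in> \<T> ==> x \<in> Om \<inter> T ==> h x = q T x"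
 shows "inner_V f h = (\<Sum>T\<in>\<T>. LBINT x. ind T x * (f x * q T x))"
proof -
 have fm: "f \<in> borel_measurable borel" using borel_measurable_integrable[OF f] by simp
 have m: "(%x. f x * (ind Om x * h x)) \<in> borel_measurable borel" by (intro borel_measurable_times fm V_measurable[OF h])
 have ae: "AE x in lborel. ind T x * (f x * q T x) = ind T x * (f x * (ind Om x * h x))" if T: "T \<in> \<T>" for T
  by (rule AE_simplexI[OF T]) (use q(2)[OF T] in auto)
 have mT: "(%x. ind T x * (f x * (ind Om x * h x))) \<in> borel_measurable lborel" if "T \<in> \<T>" for T
  using m simplex_measurable[OF that] by simp
 have "inner_V f h = (LBINT x. ind Om x * (f x * (ind Om x * h x)))"
  unfolding inner_V_def by (intro Bochner_Integration.integral_cong) (auto simp: indicator_def)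
 also have "... = (\<Sum>T\<in>\<T>. LBINT x. ind T x * (f x * (ind Om x * h x)))"
  by (rule integral_decomposition(2)[OF integrable_cong_AE_imp[OF integrable_times_poly[OF f _ q(1)] mT ae]])
   (use m Om_measurable in simp_all)
 also have "... = (\<Sum>T\<in>\<T>. LBINT x. ind T x * (f x * q T x))"
  by (intro sum.cong refl integral_cong_AE[symmetric] mT ae borel_measurable_integrable[OF integrable_times_poly[OF f _ q(1)]])
 finally show ?thesis .
qed

text \<open>Elements of \<open>V\<close> are polynomials of degree at most \<open>K\<close> on each
  simplex, so local projections do not change pairings with \<open>V\<close>. The global projection
  therefore cannot distinguish \<open>F\<close> from \<open>f\<close>.\<close>

lemma piecewise_projection:
 assumes f: "integrable lborel f" and bd: "!!T q M. T \<in> \<T> ==> poly_deg_le K q ==> (!!x. x \<in> T ==> \<bar>q x\<bar> <= M) ==>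
   \<bar>LBINT x. ind T x * (f x * q x)\<bar> <= A T * M * vol T" obtains F where "F \<in> borel_measurable borel"
  "!!T x. T \<in> \<T> ==> x \<in> interior T ==> \<bar>F x\<bar> <= poly_mass DIM('a) K * A T" "!!h. h \<in> V ==> inner_V F h = inner_V f h"
proof -
 have "\<forall>T\<in>\<T>. \<exists>p. poly_deg_le K p \<and> (\<forall>h. poly_deg_le K h -->
   (LBINT x. ind T x * (p x * h x)) = (LBINT x. ind T x * (f x * h x))) \<and>
  (\<forall>x\<in>T. \<bar>p x\<bar> <= poly_mass DIM('a) K * A T)" by (intro ballI local_projection f bd)
 from bchoice[OF this] obtain P where P: "!!T. T \<in> \<T> ==> poly_deg_le K (P T)"
  "!!T h. T \<in> \<T> ==> poly_deg_le K h ==> (LBINT x. ind T x * (P T x * h x)) = (LBINT x. ind T x * (f x * h x))"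
  "!!T x. T \<in> \<T> ==> x \<in> T ==> \<bar>P T x\<bar> <= poly_mass DIM('a) K * A T" by auto
 define F where "F x = (\<Sum>T\<in>\<T>. ind (interior T) x *\<^sub>R P T x)" for x
 have Feq: "F x = P T x" if "T \<in> \<T>" "x \<in> interior T" for T x unfolding F_def by (rule sum_interior[OF that])
 have Fi: "integrable lborel F" unfolding F_def[abs_def]
 proof (rule Bochner_Integration.integrable_sum)
  fix T assume T: "T \<in> \<T>"
  have "integrable lborel (%x. ind (interior T) x *\<^sub>R (ind T x * P T x))"
   by (intro integrable_mult_indicator integrable_simplex T smooth_fun_continuous[OF poly_smooth[OF P(1)[OF T]]]) simp
  moreover have "(%x. ind (interior T) x *\<^sub>R (ind T x * P T x)) = (%x. ind (interior T) x *\<^sub>R P T x)"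
   using interior_subset by (auto simp: indicator_def fun_eq_iff)
  ultimately show "integrable lborel (%x. ind (interior T) x *\<^sub>R P T x)" by (simp only:)
 qed
 hence Fm: "F \<in> borel_measurable borel" by auto
 have "inner_V F h = inner_V f h" if h: "h \<in> V" for h
 proof -
  have "\<forall>T\<in>\<T>. \<exists>q. poly_deg_le K q \<and> (\<forall>x\<in>Om \<inter> T. h x = q x)" using h by (simp add: lagrange_space_def)
  from bchoice[OF this] obtain q where q: "!!T. T \<in> \<T> ==> poly_deg_le K (q T)" "!!T x. T \<in> \<T> ==> x \<in> Om \<inter> T ==> h x = q T x"
   by auto
  have "(LBINT x. ind T x * (F x * q T x)) = (LBINT x. ind T x * (P T x * q T x))" if T: "T \<in> \<T>" for T
  proof (rule integral_cong_AE)
   show "AE x in lborel. ind T x * (F x * q T x) = ind T x * (P T x * q T x)" by (rule AE_simplexI[OF T]) (use Feq[OF T] in auto)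
  qed (use Fm poly_measurable[OF q(1)[OF T]] poly_measurable[OF P(1)[OF T]] simplex_measurable[OF T] in simp_all)
  hence "(LBINT x. ind T x * (F x * q T x)) = (LBINT x. ind T x * (f x * q T x))" if "T \<in> \<T>" for T
   using that P(2)[OF that q(1)[OF that]] by simp
  moreover have "inner_V u h = (\<Sum>T\<in>\<T>. LBINT x. ind T x * (u x * q T x))" if "integrable lborel u" for u
   by (rule inner_V_sum[OF that h q])
  ultimately show ?thesis using f Fi by simp
 qed
 thus ?thesis using that[OF Fm _ ] Feq P(3) interior_subset by (metis subsetD)
qed

definition cloc :: real where "cloc = poly_mass DIM('a) K * (2 ^ (DIM('a) + 1) + cavg)"

end

context mesh_sobolev
begin

text \<open>The interpolant lies in \<open>V\<close>, so the projection of \<open>v\<close> minus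
  the interpolant is the projection of the remainder \<open>f\<close>, hence of \<open>F\<close>. In
  contrast to \<open>f\<close>, the function \<open>F\<close> is bounded on each simplex, so
  weighted L2 bounds apply to it for every p.\<close>

lemma piecewise_remainder:
 obtains F where "F \<in> borel_measurable borel" "!!T x. T \<in> \<T> ==> x \<in> interior T ==> \<bar>F x\<bar> <= cloc * osc T"
  "!!w. is_proj v w ==> is_proj F (%x. w x - clement (avg v) x)"
proof -
 let ?\<pi> = "clement (avg v)"
 have \<pi>V: "?\<pi> \<in> V" unfolding clement_def by (rule glue_in_V[OF clement_compatible])
 define f where "f x = v x - ind Om x * ?\<pi> x" for x
 have fi: "integrable lborel f" unfolding f_def using v_integrable V_integrable[OF \<pi>V] by simp
 have bd: "\<bar>LBINT x. ind T x * (f x * h x)\<bar> <= ((2 ^ (DIM('a) + 1) + cavg) * osc T) * M * vol T"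
  if T: "T \<in> \<T>" and h: "poly_deg_le K h" and M: "!!x. x \<in> T ==> \<bar>h x\<bar> <= M" for T h M
 proof -
  obtain q where q: "poly_deg_le 1 q" "!!x. x \<in> Om \<inter> T ==> ?\<pi> x = q x" "!!x. x \<in> T ==> \<bar>q x - avg v T\<bar> <= cavg * osc T"
   by (rule clement_bound[OF T]) (rule that)
  have M0: "0 <= M" using M[OF ctr_in[OF T]] by linarith
  have i1: "integrable lborel (%x. ind T x * (v x * h x))" by (rule integrable_times_poly[OF v_integrable T h])
  have i2: "integrable lborel (%x. ind T x * h x)" and i3: "integrable lborel (%x. ind T x * ((avg v T - q x) * h x))"
   by (intro integrable_simplex T continuous_intros smooth_fun_continuous[OF poly_smooth[OF q(1)]] smooth_fun_continuous[OF poly_smooth[OF h]])+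
  have "(LBINT x. ind T x * (f x * h x)) =
    (LBINT x. ind T x * (v x * h x) - avg v T * (ind T x * h x) + ind T x * ((avg v T - q x) * h x))"
  proof (rule integral_cong_AE)
   show "AE x in lborel. ind T x * (f x * h x) =
     ind T x * (v x * h x) - avg v T * (ind T x * h x) + ind T x * ((avg v T - q x) * h x)"
    by (rule AE_simplexI[OF T]) (use q(2) in \<open>auto simp: f_def algebra_simps\<close>)
   show "(%x. ind T x * (f x * h x)) \<in> borel_measurable lborel"
    using borel_measurable_integrable[OF integrable_times_poly[OF fi T h]] .
  qed (use i1 i2 i3 in auto)
  also have "... = ((LBINT x. ind T x * (v x * h x)) - avg v T * (LBINT x. ind T x * h x))
    + (LBINT x. ind T x * ((avg v T - q x) * h x))" using i1 i2 i3 by simp finally have "(LBINT x. ind T x * (f x * h x)) = ..." .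
  moreover have "\<bar>(LBINT x. ind T x * (v x * h x)) - avg v T * (LBINT x. ind T x * h x)\<bar>
    <= 2 ^ (DIM('a) + 1) * osc T * M * vol T" proof -
   have "2 ^ (DIM('a) + 1) * M * (diameter T * mass g T) <= 2 ^ (DIM('a) + 1) * M * (osc T * vol T)"
    by (rule mult_left_mono[OF mass_le_osc[OF T]]) (use M0 in simp)
   thus ?thesis using moment_estimate[OF T h M] by (simp add: mult_ac)
  qed
  moreover have "\<bar>LBINT x. ind T x * ((avg v T - q x) * h x)\<bar> <= cavg * osc T * M * vol T"
  proof -
   have "\<bar>LBINT x. ind T x * ((avg v T - q x) * h x)\<bar> <= (LBINT x. ind T x * (cavg * osc T * M))"
   proof (rule abs_integral_le[OF integrable_simplex[OF T continuous_on_const] AE_I2])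
    fix x
    show "\<bar>ind T x * ((avg v T - q x) * h x)\<bar> <= ind T x * (cavg * osc T * M)" using q(3)[of x] M[of x]
     by (auto simp: indicator_def abs_mult intro!: mult_mono)
   qed
   thus ?thesis by (simp add: mult_ac)
  qed
  ultimately show ?thesis by (simp add: algebra_simps)
 qed
 obtain F where F: "F \<in> borel_measurable borel" "!!T x. T \<in> \<T> ==> x \<in> interior T ==> \<bar>F x\<bar> <= poly_mass DIM('a) K * ((2 ^ (DIM('a) + 1) + cavg) * osc T)"
  "!!h. h \<in> V ==> inner_V F h = inner_V f h" by (rule piecewise_projection[OF fi bd]) (assumption, assumption, assumption, rule that)
 show ?thesis
 proof (rule that[OF F(1)])
  show "\<bar>F x\<bar> <= cloc * osc T" if "T \<in> \<T>" "x \<in> interior T" for T x using F(2)[OF that] by (simp add: cloc_def)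
  fix w assume w: "is_proj v w"
  have wV: "w \<in> V" "!!h. h \<in> V ==> inner_V w h = inner_V v h" using w by (auto simp: is_proj_def)
  have vi: "integrable lborel (%x. ind Om x * v x)" using integrable_mult_indicator[OF _ v_integrable, of Om] Om_measurable by simp
  have e: "(%x. w x - ?\<pi> x) = (%x. 1 * w x + (-1) * ?\<pi> x)" by simp
  have "inner_V (%x. w x - ?\<pi> x) h = inner_V F h" if h: "h \<in> V" for h
  proof -
   have "inner_V f h = inner_V (%x. 1 * v x + (-1) * ?\<pi> x) h"
    unfolding inner_V_def f_def by (intro Bochner_Integration.integral_cong) (auto simp: indicator_def)
   thus ?thesis unfolding e F(3)[OF h] inner_V_lincomb[OF h V_integrable[OF wV(1)] V_integrable[OF \<pi>V]]
    using inner_V_lincomb[OF h vi V_integrable[OF \<pi>V], of 1 "-1"] wV(2)[OF h] by simp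
  qed
  moreover have "(%x. w x - ?\<pi> x) \<in> V" unfolding e by (rule V_lincomb[OF wV(1) \<pi>V])
  ultimately show "is_proj F (%x. w x - ?\<pi> x)" by (simp only: is_proj_def) blast
 qed
qed

end

section \<open>Stability for simplexwise weights and comparability of graded weights\<close>

context mesh_shape
begin

text \<open>Weights reduced to one positive number per simplex. A one-sided inequality suffices
  because \<open>R\<close> is symmetric.\<close>

definition graded :: "real => ('a set => real) => bool" where
 "graded \<gamma> s \<longleftrightarrow> (\<forall>T\<in>\<T>. 0 < s T) \<and> (\<forall>(T, T')\<in>R. s T' <= \<gamma> * s T)"

end

context mesh
begin

definition sup_on :: "('a => real) => 'a set => real" where "sup_on w T = (SUP x\<in>Om \<inter> T. \<bar>w x\<bar>)"

end

context mesh_poly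
begin

lemma sup_on_upper: "w \<in> V ==> x \<in> Om \<inter> T ==> \<bar>w x\<bar> <= sup_on w T"
proof -
 assume w: "w \<in> V" and x: "x \<in> Om \<inter> T"
 obtain B where B: "!!x. x \<in> Om ==> \<bar>w x\<bar> <= B" using V_bounded[OF w] by blast
 have "bdd_above ((%x. \<bar>w x\<bar>) ` (Om \<inter> T))" by (rule bdd_aboveI2[of _ _ B]) (use B in blast)
 thus ?thesis unfolding sup_on_def by (rule cSUP_upper[OF x])
qed

end

context mesh_shape
begin

lemma simplex_meets_domain: "T \<in> \<T> ==> ctr T \<in> interior T" "T \<in> \<T> ==> ctr T \<in> Om \<inter> T"
proof -
 assume T: "T \<in> \<T>"
 have "ball (ctr T) (rad T) \<subseteq> T" using ball_ctr[OF T] ball_subset_cball by blast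
 thus i: "ctr T \<in> interior T" using rad_pos[OF T] by (meson centre_in_ball interior_maximal open_ball subsetD)
 thus "ctr T \<in> Om \<inter> T" using interior_simplex_subset[OF T] interior_subset by blast
qed

lemma sup_on_least: "T \<in> \<T> ==> (!!x. x \<in> Om \<inter> T ==> \<bar>w x\<bar> <= B) ==> sup_on w T <= B"
 unfolding sup_on_def by (rule cSUP_least) (use simplex_meets_domain(2) in blast)+

end

context mesh_fem
begin

lemma sup_on_nonneg: "w \<in> V ==> T \<in> \<T> ==> 0 <= sup_on w T"
 using sup_on_upper[OF _ simplex_meets_domain(2)] by (meson abs_ge_zero order.trans)

text \<open>The weighted L2 bound in discrete form: data are given by bounds on simplices and
  results by maxima. For the projection, which is piecewise polynomial, the maximum costs only the
  factor \<open>poly_mass\<close>.\<close>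

definition stable :: "real => real => bool" where
 "stable A \<gamma> \<longleftrightarrow> (\<forall>s F w a. graded \<gamma> s --> F \<in> borel_measurable borel --> is_proj F w -->
   (\<forall>T\<in>\<T>. \<forall>x\<in>interior T. \<bar>F x\<bar> <= a T) -->
   (\<Sum>T\<in>\<T>. (s T)^2 * vol T * (sup_on w T)^2) <= A * (\<Sum>T\<in>\<T>. (s T)^2 * vol T * (a T)^2))"

lemma inner_V_localized:
 assumes T: "T \<in> \<T>" and f: "poly_deg_le n f" and h: "h \<in> V" "poly_deg_le K q" "!!x. x \<in> Om \<inter> T ==> h x = q x"
 shows "inner_V (%x. ind T x * f x) h = (LBINT x. ind T x * (f x * q x))" unfolding inner_V_def
proof (rule integral_cong_AE)
 have "(%x. f x * (ind T x * (ind Om x * h x))) \<in> borel_measurable borel"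
  by (intro borel_measurable_times borel_measurable_indicator poly_measurable[OF f] V_measurable[OF h(1)]) (use simplex_measurable[OF T] in simp)
 thus "(%x. ind Om x * (ind T x * f x * h x)) \<in> borel_measurable lborel" by (simp add: mult_ac)
 show "(%x. ind T x * (f x * q x)) \<in> borel_measurable lborel"
  using poly_measurable[OF f] poly_measurable[OF h(2)] simplex_measurable[OF T] by simp
 show "AE x in lborel. ind Om x * (ind T x * f x * h x) = ind T x * (f x * q x)"
  by (rule AE_simplexI[OF T]) (use h(3) in auto)
qed

end

context mesh_shape
begin

definition cvol :: real where "cvol = (csize ^ (nstar * nstar) * cs) ^ DIM('a)"

lemma cvol: "1 <= cvol" unfolding cvol_def using csize_ge(4) cs1 mult_mono[of 1 "csize ^ (nstar * nstar)" 1 cs] by (intro one_le_power) simp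

lemma patch_measure:
 assumes T: "T \<in> \<T>" and S: "S \<in> patch T" shows "vol S <= cvol * vol T"
proof -
 define M where "M = csize ^ (nstar * nstar)"
 have M: "0 <= M" unfolding M_def using csize_ge(4) by (intro zero_le_power) linarith
 have "vol S <= \<omega> * diameter S ^ DIM('a)" by (rule measure_simplex_le[OF patch_in[OF S T]])
 also have "... <= \<omega> * (M * diameter T) ^ DIM('a)" using patch_size[OF T S] \<omega>_pos diameter_pos[OF patch_in[OF S T]]
  by (intro mult_left_mono power_mono) (simp_all add: M_def)
 also have "... = M ^ DIM('a) * (\<omega> * diameter T ^ DIM('a))" by (simp add: power_mult_distrib)
 also have "... <= M ^ DIM('a) * (cs ^ DIM('a) * vol T)" using measure_simplex_ge[OF T] M by (intro mult_left_mono) auto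
 finally show ?thesis by (simp add: cvol_def M_def power_mult_distrib)
qed

lemma npatch: "1 <= real npatch"
proof -
 obtain T where T: "T \<in> \<T>" using cover nonempty_Om by blast
 have "card (patch T) \<noteq> 0" using card_patch(1)[OF T] patch_refl[OF T] by auto
 thus ?thesis using card_patch(2)[OF T] by simp
qed

end

context mesh_fem
begin

definition cext :: real where "cext = (bern_const DIM('a) K)^2 * (real npatch * cvol)"

lemma cext_pos: "0 < cext" unfolding cext_def using bern_const_pos[of "DIM('a)" K] npatch cvol by (intro mult_pos_pos zero_less_power) auto

lemma patch_volume:
 assumes T: "T \<in> \<T>" shows "(\<Sum>S\<in>patch T. vol S) <= real npatch * cvol * vol T"
proof -
 have "(\<Sum>S\<in>patch T. vol S) <= (\<Sum>S\<in>patch T. cvol * vol T)" by (intro sum_mono patch_measure[OF T])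
 also have "... = real (card (patch T)) * (cvol * vol T)" by simp
 also have "... <= real npatch * (cvol * vol T)" using card_patch(2)[OF T] cvol by (intro mult_right_mono mult_nonneg_nonneg) auto
 finally show ?thesis by simp
qed

text \<open>Combines the maximum bound of \<open>poly_extension\<close> with the volume of the patch
  outside which the extension vanishes; these are the factors of \<open>cext\<close>.\<close>

lemma extension_energy:
 assumes T: "T \<in> \<T>" and p: "poly_deg_le K p" and M: "!!x. x \<in> T ==> \<bar>p x\<bar> <= M"
 obtains E where "E \<in> V" "!!x. x \<in> Om \<inter> T ==> E x = p x" "inner_V E E <= cext * M^2 * vol T"
proof -
 obtain E where E: "E \<in> V" "!!x. x \<in> Om \<inter> T ==> E x = p x"
  "!!S x. S \<in> \<T> - patch T ==> x \<in> Om \<inter> S ==> E x = 0" "!!x. x \<in> Om ==> \<bar>E x\<bar> <= bern_const DIM('a) K * M"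
  by (rule poly_extension[OF T p M]) (assumption, rule that)
 define b where "b = bern_const DIM('a) K"

 have ip: "integrable lborel (%x. (b * M)^2 * (\<Sum>S\<in>patch T. ind S x))"
  using simplex_measurable finite_measure_simplex patch_in[OF _ T]
  by (intro integrable_mult_right Bochner_Integration.integrable_sum integrable_real_indicator) auto
 have "inner_V E E <= (LBINT x. (b * M)^2 * (\<Sum>S\<in>patch T. ind S x))" unfolding inner_V_def
 proof (rule integral_mono[OF V_times_integrable[OF E(1) V_integrable[OF E(1)]] ip])
  fix x
  have nn: "0 <= (b * M)^2 * (\<Sum>S\<in>patch T. ind S x :: real)" by (intro mult_nonneg_nonneg sum_nonneg) auto
  show "ind Om x * (E x * E x) <= (b * M)^2 * (\<Sum>S\<in>patch T. ind S x)"
  proof (cases "x \<in> Om \<and> E x \<noteq> 0")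
   case True
   then obtain S where S: "S \<in> \<T>" "x \<in> S" using cover by blast
   hence Sp: "S \<in> patch T" using E(3)[of S x] True by blast
   have "(1::real) = ind S x" using S by simp
   also have "... <= (\<Sum>S\<in>patch T. ind S x)" by (rule member_le_sum[OF Sp]) (use card_patch(1)[OF T] in auto)
   finally have "(b * M)^2 * 1 <= (b * M)^2 * (\<Sum>S\<in>patch T. ind S x)" by (intro mult_left_mono) auto
   moreover have "E x * E x <= (b * M)^2" using power_mono[OF E(4)[of x] abs_ge_zero, of 2] True by (simp add: b_def power2_eq_square)
   ultimately show ?thesis using True by simp
  qed (use nn in auto)
 qed
 also have "... = (b * M)^2 * (\<Sum>S\<in>patch T. vol S)"
 proof -
  show ?thesis using simplex_measurable finite_measure_simplex patch_in[OF _ T] by simp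
 qed
 also have "... <= (b * M)^2 * (real npatch * cvol * vol T)" by (intro mult_left_mono patch_volume[OF T]) auto
 finally have "inner_V E E <= cext * M^2 * vol T" by (simp add: cext_def b_def power_mult_distrib mult_ac)
 thus ?thesis using that[OF E(1,2)] by blast
qed

text \<open>On polynomials over \<open>T\<close>, \<open>B f g\<close> pairs the projections of the
  cut-off functions. It is positive definite, since pairing the projection of \<open>f\<close> with
  an extension of \<open>f\<close> gives the L2 norm of \<open>f\<close> on \<open>T\<close>.
  Representing the integral over \<open>T\<close> in this inner product gives \<open>p\<close>. If
  \<open>q\<close> is its projection on \<open>T\<close>, then \<open>h q\<close> and
  \<open>h\<close> have the same integral over \<open>T\<close> for every \<open>h\<close>; the
  choice \<open>h = q - 1\<close> forces \<open>q = 1\<close>.\<close>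

lemma unit_projection:
 assumes T: "T \<in> \<T>"
 obtains p where "poly_deg_le K p" "!!x. x \<in> T ==> \<bar>p x\<bar> <= (poly_mass DIM('a) K)^2 * cext"
  "!!w x. is_proj (%x. ind T x * p x) w ==> x \<in> Om \<inter> T ==> w x = 1"
proof -
 note S = simplex_\<T>[OF T]
 define m where "m = vol T"
 have m: "0 < m" unfolding m_def by (rule measure_simplex_pos[OF T])
 define Cm where "Cm = poly_mass DIM('a) K"
 have Cm: "0 < Cm" unfolding Cm_def by (rule poly_mass_pos)
 define I where "I f = (%x. ind T x * f x :: real)" for f
 define PQ where "PQ f = (SOME w. is_proj (I f) w)" for f
 have cont: "continuous_on A f" if "poly_deg_le n f" for f :: "'a => real" and A n by (rule smooth_fun_continuous[OF poly_smooth[OF that]])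
 have intT: "integrable lborel (%x. ind T x * f x)" if "continuous_on T f" for f :: "'a => real"
  using borel_integrable_compact[OF full_simplex_compact[OF S] that] by simp
 have Ii: "integrable lborel (%x. ind Om x * I f x)" if "poly_deg_le K f" for f
  using integrable_mult_indicator[OF _ intT[OF cont[OF that]], of Om] Om_measurable by (simp add: I_def)
 have proj: "is_proj (I f) (PQ f)" if "poly_deg_le K f" for f unfolding PQ_def by (rule someI_ex[OF is_proj_exists[OF Ii[OF that]]])
 have PV: "PQ f \<in> V" "!!h. h \<in> V ==> inner_V (PQ f) h = inner_V (I f) h" if "poly_deg_le K f" for f
  using proj[OF that] by (auto simp: is_proj_def)
 have sup: "(f x)^2 * m <= Cm * (LBINT x. ind T x * (f x * f x))" if "poly_deg_le K f" "x \<in> T" for f x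
  using poly_sup_le_L2[OF S that] by (simp add: m_def Cm_def power2_eq_square)
 define B where "B f g = inner_V (PQ f) (PQ g)" for f g
 have B: "B f g = inner_V (I f) (PQ g)" if "poly_deg_le K f" "poly_deg_le K g" for f g unfolding B_def by (rule PV(2)[OF that(1) PV(1)[OF that(2)]])
 obtain X where X: "finite X" "X \<subseteq> UNIV \<inter> T" "!!q x. poly_deg_le K q ==> \<forall>x\<in>X. q x = 0 ==> x \<in> UNIV \<inter> T ==> q x = 0"
  using poly_determined_by_points[OF S, of UNIV K] by blast
 have I0: "I f = (%x. 0)" if "\<forall>x\<in>X. f x = 0" "poly_deg_le K f" for f using X(3)[OF that(2,1)] by (auto simp: I_def indicator_def)
 have "\<exists>w\<in>{f. poly_deg_le K f}. \<forall>h\<in>{f. poly_deg_le K f}. B w h = (LBINT x. I h x)"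
 proof (rule riesz_finite_points[OF X(1)])
  show "{f :: 'a => real. poly_deg_le K f} \<noteq> {}" using poly_zero by blast
  show "B f h = B h f" for f h unfolding B_def by (rule inner_V_commute)
  show "B f h = 0" if "f \<in> {f. poly_deg_le K f}" "h \<in> {f. poly_deg_le K f}" "\<forall>x\<in>X. f x = 0" for f h
   using B[of f h] I0[OF that(3)] that(1,2) by (simp add: inner_V_def)
  show "(LBINT x. I f x) = 0" if "f \<in> {f. poly_deg_le K f}" "\<forall>x\<in>X. f x = 0" for f using I0[OF that(2)] that(1) by simp
  show "0 < B f f" if "f \<in> {f. poly_deg_le K f}" "x \<in> X" "f x \<noteq> 0" for f x
  proof -
   have f: "poly_deg_le K f" and x: "x \<in> T" using that X(2) by auto
   have "compact (f ` T)" by (rule compact_continuous_image[OF cont[OF f] full_simplex_compact[OF S]])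
   then obtain M where "\<forall>y\<in>f ` T. norm y <= M" using compact_imp_bounded bounded_iff by metis
   hence M: "!!x. x \<in> T ==> \<bar>f x\<bar> <= M" by simp
   obtain E where E: "E \<in> V" "!!x. x \<in> Om \<inter> T ==> E x = f x" by (rule extension_energy[OF T f M]) (assumption, rule that)
   have "0 < (f x)^2 * m" using that(3) m by simp
   also have "... <= Cm * (LBINT x. ind T x * (f x * f x))" by (rule sup[OF f x])
   also have "(LBINT x. ind T x * (f x * f x)) = inner_V (PQ f) E"
    unfolding PV(2)[OF f E(1)] I_def by (rule inner_V_localized[OF T f E(1) f E(2), symmetric])
   finally have "inner_V (PQ f) E \<noteq> 0" by auto
   have "\<exists>y\<in>Om. PQ f y \<noteq> 0"
   proof (rule ccontr)
    assume "\<not> (\<exists>y\<in>Om. PQ f y \<noteq> 0)"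
    hence "ind Om y * (PQ f y * E y) = 0" for y by auto
    hence "inner_V (PQ f) E = 0" unfolding inner_V_def by (simp only: Bochner_Integration.integral_zero)
    with \<open>inner_V (PQ f) E \<noteq> 0\<close> show False by blast
   qed
   thus ?thesis unfolding B_def using inner_V_pos[OF PV(1)[OF f]] by blast
  qed
  show "B (%x. a * f x + b * h x) k = a * B f k + b * B h k"
   if "f \<in> {f. poly_deg_le K f}" "h \<in> {f. poly_deg_le K f}" "k \<in> {f. poly_deg_le K f}" for f h k a b
  proof -
   have fh: "poly_deg_le K f" "poly_deg_le K h" "poly_deg_le K k" using that by auto
   have "B (%x. a * f x + b * h x) k = inner_V (I (%x. a * f x + b * h x)) (PQ k)" by (rule B[OF poly_lincomb[OF fh(1,2)] fh(3)])
   also have "I (%x. a * f x + b * h x) = (%x. a * I f x + b * I h x)" by (simp add: I_def algebra_simps)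
   also have "inner_V ... (PQ k) = a * inner_V (I f) (PQ k) + b * inner_V (I h) (PQ k)"
    by (rule inner_V_lincomb[OF PV(1)[OF fh(3)] Ii[OF fh(1)] Ii[OF fh(2)]])
   finally show ?thesis by (simp only: B[OF fh(1,3)] B[OF fh(2,3)])
  qed
  show "(LBINT x. I (%x. a * f x + b * h x) x) = a * (LBINT x. I f x) + b * (LBINT x. I h x)"
   if "f \<in> {f. poly_deg_le K f}" "h \<in> {f. poly_deg_le K f}" for f h a b
  proof -
   have "I (%x. a * f x + b * h x) = (%x. a * I f x + b * I h x)" by (simp add: I_def algebra_simps)
   thus ?thesis using intT[of f] intT[of h] cont that by (simp add: I_def)
  qed
 qed (use poly_lincomb in auto)
 then obtain p where p: "poly_deg_le K p" "!!h. poly_deg_le K h ==> B p h = (LBINT x. ind T x * h x)" unfolding I_def by blast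
 have unit: "w x = 1" if w: "is_proj (%x. ind T x * p x) w" and x: "x \<in> Om \<inter> T" for w x
 proof -
  have wV: "w \<in> V" using w by (simp add: is_proj_def)
  obtain q where q: "poly_deg_le K q" "!!x. x \<in> Om \<inter> T ==> w x = q x" using V_poly[OF wV T] by blast
  have wP: "PQ p y = q y" if "y \<in> Om \<inter> T" for y using is_proj_unique[OF proj[OF p(1), unfolded I_def] w] q(2)[OF that] that by simp
  define h where "h = (%x. 1 * q x + (-1) * 1)"
  have h: "poly_deg_le K h" unfolding h_def by (intro poly_lincomb q(1) poly_const)
  have "(LBINT x. ind T x * (h x * q x)) = inner_V (I h) (PQ p)"
   unfolding I_def by (rule inner_V_localized[OF T h PV(1)[OF p(1)] q(1) wP, symmetric])
  also have "... = B p h" unfolding B[OF h p(1), symmetric] B_def by (rule inner_V_commute)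
  also have "... = (LBINT x. ind T x * h x)" by (rule p(2)[OF h])
  finally
  moreover have "integrable lborel (%x. ind T x * (h x * q x))" "integrable lborel (%x. ind T x * h x)"
   by (intro intT continuous_intros cont[OF h] cont[OF q(1)])+
  ultimately have "(LBINT x. ind T x * (h x * q x) - ind T x * h x) = 0" by simp
  moreover have "(%x. ind T x * (h x * q x) - ind T x * h x) = (%x. ind T x * (h x * h x) :: real)"
   by (simp add: h_def algebra_simps)
  ultimately have "h x = 0" using sup[OF h, of x] x using m by (simp add: mult_le_0_iff)
  thus ?thesis using q(2)[OF x] by (simp add: h_def)
 qed
 have "continuous_on T (%x. \<bar>p x\<bar>)" by (intro continuous_intros cont[OF p(1)])
 then obtain y where y: "y \<in> T" "!!x. x \<in> T ==> \<bar>p x\<bar> <= \<bar>p y\<bar>"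
  using continuous_attains_sup[OF full_simplex_compact[OF S]] ctr_in[OF T] by blast
 define M where "M = \<bar>p y\<bar>"
 have M0: "0 <= M" by (simp add: M_def)
 obtain E where E: "E \<in> V" "!!x. x \<in> Om \<inter> T ==> E x = p x" "inner_V E E <= cext * M^2 * m"
  by (rule extension_energy[OF T p(1) y(2), folded M_def m_def]) (assumption, rule that)
 define J where "J = inner_V (PQ p) E"
 have "J = (LBINT x. ind T x * (p x * p x))" unfolding J_def PV(2)[OF p(1) E(1)] I_def by (rule inner_V_localized[OF T p(1) E(1) p(1) E(2)])
 hence J: "M^2 * m <= Cm * J" using sup[OF p(1) y(1)] by (simp add: M_def)
 have Bpp: "inner_V (PQ p) (PQ p) <= M * m"
 proof -
  have "inner_V (PQ p) (PQ p) = (LBINT x. ind T x * p x)" using p(2)[OF p(1)] by (simp add: B_def)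
  also have "... <= (LBINT x. ind T x * M)"
   by (rule integral_mono) (use intT[OF cont[OF p(1)]] intT[of "%x. M"] y(2) in \<open>auto simp: indicator_def M_def intro: order.trans[OF abs_ge_self]\<close>)
  also have "... = M * m" by (simp add: m_def)
  finally show ?thesis .
 qed
 \<comment> \<open>The size of \<open>p\<close> follows from the nonnegativity of the energy of
   \<open>t E - PQ p\<close>. This \<open>t\<close> makes the quadratic term use up exactly half of
   the left side.\<close>
 define t where "t = 1 / (Cm * cext)"
 have t: "0 < t" using Cm cext_pos by (simp add: t_def)
 define e where "e = (%x. t * E x + (-1) * PQ p x)"
 note i = V_integrable[OF E(1)] V_integrable[OF PV(1)[OF p(1)]]
 have eV: "e \<in> V" unfolding e_def by (rule V_lincomb[OF E(1) PV(1)[OF p(1)]])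
 have "0 <= inner_V e e" unfolding inner_V_def by simp
 also have "inner_V e e = t * inner_V E e + (-1) * inner_V (PQ p) e" by (subst (1) e_def) (rule inner_V_lincomb[OF eV i])
 also have "inner_V E e = t * inner_V E E + (-1) * inner_V E (PQ p)" unfolding e_def by (rule inner_V_lincomb_right[OF E(1) PV(1)[OF p(1)] i(1)])
 also have "inner_V (PQ p) e = t * inner_V (PQ p) E + (-1) * inner_V (PQ p) (PQ p)"
  unfolding e_def by (rule inner_V_lincomb_right[OF E(1) PV(1)[OF p(1)] i(2)])
 finally have "2 * t * J <= t * t * inner_V E E + inner_V (PQ p) (PQ p)" using inner_V_commute[of E "PQ p"] by (simp add: J_def algebra_simps)
 also have "... <= t * t * (cext * M^2 * m) + M * m" using E(3) Bpp by (intro add_mono mult_left_mono) auto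
 finally have 1: "2 * t * J <= t * t * (cext * M^2 * m) + M * m" .
 have "2 * t * (M^2 * m) <= 2 * t * (Cm * J)" using J t by (intro mult_left_mono) auto
 also have "... = Cm * (2 * t * J)" by simp
 also have "... <= Cm * (t * t * (cext * M^2 * m) + M * m)" using 1 Cm by (intro mult_left_mono) auto
 also have "... = (Cm * t * cext) * (t * (M^2 * m)) + Cm * M * m" by (simp add: algebra_simps)
 also have "Cm * t * cext = 1" using Cm cext_pos by (simp add: t_def)
 finally have "t * M^2 <= Cm * M" using m by simp
 hence "M * M <= (Cm^2 * cext) * M" using Cm cext_pos by (simp add: t_def field_simps power2_eq_square)
 hence "M <= Cm^2 * cext" using M0 cext_pos by (cases "M = 0") (auto)
 hence bd: "\<bar>p x\<bar> <= (poly_mass DIM('a) K)^2 * cext" if "x \<in> T" for x using y(2)[OF that] by (simp add: M_def Cm_def)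
 show ?thesis by (rule that[of p]) (rule p(1), erule bd, erule unit)
qed

definition ccomp :: "real => real" where "ccomp A = sqrt (A * ((poly_mass DIM('a) K)^2 * cext)^2 * (csize * cs) ^ DIM('a))"

text \<open>The projection from \<open>unit_projection\<close> equals 1 at a common point in
  \<open>Om\<close>, so its maximum over \<open>T'\<close> is at least 1, whereas the data live on
  \<open>T\<close> alone. Stability then compares \<open>s T'\<close> with \<open>s T\<close> even
  if no short chain in \<open>R\<close> joins the simplices.\<close>

lemma graded_comparable:
 assumes st: "stable A \<gamma>" and A: "0 <= A" and s: "graded \<gamma> s" and TT': "meets T T'"
 shows "s T' <= ccomp A * s T"
proof -
 have T: "T \<in> \<T>" "T' \<in> \<T>" using TT' by (auto simp: meets_def)
 obtain x where x: "x \<in> Om \<inter> T" "x \<in> Om \<inter> T'" using TT' by (auto simp: meets_def)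
 define M where "M = (poly_mass DIM('a) K)^2 * cext"
 obtain p where p: "poly_deg_le K p" "!!x. x \<in> T ==> \<bar>p x\<bar> <= M"
  "!!w x. is_proj (%x. ind T x * p x) w ==> x \<in> Om \<inter> T ==> w x = 1"
  by (rule unit_projection[OF T(1), folded M_def]) (rule that)
 define F where "F = (%x. ind T x * p x)"
 have Fm: "F \<in> borel_measurable borel" unfolding F_def using poly_measurable[OF p(1)] simplex_measurable[OF T(1)] by simp
 have "integrable lborel F"
  using borel_integrable_compact[OF full_simplex_compact[OF simplex_\<T>[OF T(1)]] smooth_fun_continuous[OF poly_smooth[OF p(1)]]]
  by (simp add: F_def)
 hence "integrable lborel (%x. ind Om x * F x)" using integrable_mult_indicator[of Om lborel F] Om_measurable by simp
 then obtain w where w: "is_proj F w" using is_proj_exists by blast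
 have wV: "w \<in> V" using w by (simp add: is_proj_def)
 have s0: "0 < s T" "0 < s T'" using s T by (auto simp: graded_def)
 define a where "a S = (if S = T then M else 0)" for S
 have "0 <= M" using p(2)[OF ctr_in[OF T(1)]] by linarith
 hence Fa: "\<bar>F x\<bar> <= a S" if "S \<in> \<T>" "x \<in> interior S" for S x
  using p(2) interior_meets_imp_eq[OF that(1) T(1) that(2)] by (auto simp: F_def a_def indicator_def)
 have b: "1 <= sup_on w T'" using sup_on_upper[OF wV x(2)] p(3)[OF w[unfolded F_def] x(1)] by simp
 define m m' where "m = vol T" and "m' = vol T'"
 have m: "0 < m" "0 < m'" unfolding m_def m'_def by (intro measure_simplex_pos T)+
 have mm: "m <= (csize * cs) ^ DIM('a) * m'"
 proof -
  have "m <= \<omega> * diameter T ^ DIM('a)" unfolding m_def by (rule measure_simplex_le[OF T(1)])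
  also have "... <= \<omega> * (csize * diameter T') ^ DIM('a)"
   using meets_size[of T' T] TT' \<omega>_pos diameter_pos[OF T(1)] by (intro mult_left_mono power_mono) (auto simp: meets_def)
  also have "... = csize ^ DIM('a) * (\<omega> * diameter T' ^ DIM('a))" by (simp add: power_mult_distrib)
  also have "... <= csize ^ DIM('a) * (cs ^ DIM('a) * m')"
   unfolding m'_def using measure_simplex_ge[OF T(2)] csize_ge(4) by (intro mult_left_mono) auto
  finally show ?thesis by (simp add: power_mult_distrib)
 qed
 have "(s T')^2 * m' * 1 <= (s T')^2 * m' * (sup_on w T')^2" using b m by (intro mult_left_mono) auto
 also have "... <= (\<Sum>T\<in>\<T>. (s T)^2 * vol T * (sup_on w T)^2)"
  unfolding m'_def by (rule member_le_sum[OF T(2)]) (use finite_\<T> in auto)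
 also have "... <= A * (\<Sum>T\<in>\<T>. (s T)^2 * vol T * (a T)^2)" using st s Fm w Fa unfolding stable_def by blast
 also have "(\<Sum>T\<in>\<T>. (s T)^2 * vol T * (a T)^2) = (\<Sum>S\<in>\<T>. if S = T then (s T)^2 * m * M^2 else 0)"
  by (intro sum.cong) (auto simp: a_def m_def)
 also have "... = (s T)^2 * m * M^2" using finite_\<T> T(1) by simp
 also have "A * ... <= A * ((s T)^2 * ((csize * cs) ^ DIM('a) * m') * M^2)"
  using mm A by (intro mult_left_mono mult_right_mono) auto
 also have "... = (A * M^2 * (csize * cs) ^ DIM('a) * (s T)^2) * m'" by simp
 finally have "(s T')^2 <= A * M^2 * (csize * cs) ^ DIM('a) * (s T)^2" using m by simp
 hence "s T' <= sqrt (A * M^2 * (csize * cs) ^ DIM('a) * (s T)^2)" by (rule real_le_rsqrt)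
 thus ?thesis using s0 by (simp add: ccomp_def M_def real_sqrt_mult)
qed

end

section \<open>Extrapolation from 2 to p by decaying weights\<close>

lemma powr_interpolate:
 assumes "0 <= x" "0 <= y" "0 <= \<theta>" "\<theta> <= (1::real)"
 shows "x powr \<theta> * y powr (1 - \<theta>) <= x + y"
proof -
 define M where "M = max x y"
 have "x powr \<theta> * y powr (1 - \<theta>) <= M powr \<theta> * M powr (1 - \<theta>)"
  using assms by (intro mult_mono powr_mono2) (auto simp: M_def)
 also have "... = M" using assms by (simp add: M_def flip: powr_add)
 finally show ?thesis using assms by (simp add: M_def)
qed

context mesh_shape
begin

lemma mesh_dist_relpow:
 assumes "T \<in> \<T>" "T' \<in> \<T>" shows "(T, T') \<in> R ^^ mesh_dist R T T'"
proof -
 have "(T, T') \<in> R\<^sup>*" using neighbors assms unfolding neighbor_relation_def by blast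
 then obtain N where "(T, T') \<in> R ^^ N" using rtrancl_imp_relpow by blast
 thus ?thesis unfolding mesh_dist_def by (rule LeastI)
qed

end

lemma mesh_dist_self: "mesh_dist R T T = 0" unfolding mesh_dist_def by simp

context mesh_shape
begin

lemma mesh_dist_step:
 assumes "(T, T') \<in> R" "S \<in> \<T>" shows "mesh_dist R T S <= Suc (mesh_dist R T' S)"
proof -
 have "T' \<in> \<T>" using assms neighbors unfolding neighbor_relation_def by blast
 from relpow_Suc_I2[OF assms(1) mesh_dist_relpow[OF this assms(2)]]
 show ?thesis unfolding mesh_dist_def[of R T] by (rule Least_le)
qed

lemma R_sym: "(T, T') \<in> R ==> (T', T) \<in> R" and R_in: "(T, T') \<in> R ==> T \<in> \<T> \<and> T' \<in> \<T>"
 using neighbors unfolding neighbor_relation_def by (auto dest: symD)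

text \<open>A supremal convolution: it dominates \<open>g\<close> and changes by at most the factor
  \<open>1 / \<kappa>\<close> between neighbors. Any nonnegative \<open>g\<close> that is positive
  somewhere thus yields a positive graded weight.\<close>

definition spread :: "real => ('a set => real) => 'a set => real" where
 "spread \<kappa> g T = Max ((%S. \<kappa> ^ mesh_dist R T S * g S) ` \<T>)"

lemma spread_ge: "S \<in> \<T> ==> \<kappa> ^ mesh_dist R T S * g S <= spread \<kappa> g T"
 unfolding spread_def using finite_\<T> by (intro Max_ge) auto

lemma spread_attained: obtains S where "S \<in> \<T>" "spread \<kappa> g T = \<kappa> ^ mesh_dist R T S * g S"
proof -
 have "spread \<kappa> g T \<in> (%S. \<kappa> ^ mesh_dist R T S * g S) ` \<T>" using cover nonempty_Om
  unfolding spread_def using finite_\<T> by (intro Max_in) auto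
 thus ?thesis using that by blast
qed

lemma spread_self: "T \<in> \<T> ==> g T <= spread \<kappa> g T" using spread_ge[of T \<kappa> T g] by (simp add: mesh_dist_self)

lemma spread_pos:
 assumes "0 < \<kappa>" "S \<in> \<T>" "0 < g S" shows "0 < spread \<kappa> g T"
 using spread_ge[of S \<kappa> T g] assms by (meson less_le_trans mult_pos_pos zero_less_power)

lemma spread_step:
 assumes \<kappa>: "0 < \<kappa>" "\<kappa> <= 1" and g: "!!S. S \<in> \<T> ==> 0 <= g S" and TT: "(T, T') \<in> R"
 shows "\<kappa> * spread \<kappa> g T' <= spread \<kappa> g T"
proof -
 obtain S where S: "S \<in> \<T>" "spread \<kappa> g T' = \<kappa> ^ mesh_dist R T' S * g S" by (rule spread_attained)
 have "\<kappa> * spread \<kappa> g T' = \<kappa> ^ Suc (mesh_dist R T' S) * g S" using S(2) by simp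
 also have "... <= \<kappa> ^ mesh_dist R T S * g S"
  by (intro mult_right_mono power_decreasing mesh_dist_step[OF TT S(1)] g S(1)) (use \<kappa> in auto)
 also have "... <= spread \<kappa> g T" by (rule spread_ge[OF S(1)])
 finally show ?thesis .
qed

text \<open>The square root is taken because the L2 sums contain squared weights; it costs the
  factor \<open>1 / sqrt \<kappa>\<close> in the grading. Division costs the same, as
  \<open>R\<close> is symmetric.\<close>

lemma graded_spread:
 assumes \<kappa>: "0 < \<kappa>" "\<kappa> <= 1" and g: "!!S. S \<in> \<T> ==> 0 <= g S" "S \<in> \<T>" "0 < g S"
  and \<tau>: "graded \<gamma> \<tau>" "0 < \<gamma>" and \<gamma>': "\<gamma> / sqrt \<kappa> <= \<gamma>'"
 shows "graded \<gamma>' (%T. \<tau> T * sqrt (spread \<kappa> g T))" "graded \<gamma>' (%T. \<tau> T / sqrt (spread \<kappa> g T))"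
proof -
 note pos = spread_pos[where g = g, OF \<kappa>(1) g(2,3)]
 have tp: "0 < \<tau> T" if "T \<in> \<T>" for T using \<tau>(1) that by (simp add: graded_def)
 have ts: "\<tau> T' <= \<gamma> * \<tau> T" if "(T, T') \<in> R" for T T' using \<tau>(1) that by (auto simp: graded_def)
 have sq: "sqrt (spread \<kappa> g T') <= sqrt (spread \<kappa> g T) / sqrt \<kappa>" if "(T, T') \<in> R" for T T'
 proof -
  have "sqrt (\<kappa> * spread \<kappa> g T') <= sqrt (spread \<kappa> g T)" using spread_step[OF \<kappa> g(1) that] by simp
  thus ?thesis using \<kappa>(1) by (simp add: real_sqrt_mult field_simps)
 qed
 have "\<tau> T' * sqrt (spread \<kappa> g T') <= \<gamma>' * (\<tau> T * sqrt (spread \<kappa> g T))" if R: "(T, T') \<in> R" for T T'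
 proof -
  have "\<tau> T' * sqrt (spread \<kappa> g T') <= (\<gamma> * \<tau> T) * (sqrt (spread \<kappa> g T) / sqrt \<kappa>)"
   using ts[OF R] sq[OF R] tp R_in[OF R] \<tau>(2) pos[of T'] by (intro mult_mono) (auto intro: less_imp_le)
  also have "... = (\<gamma> / sqrt \<kappa>) * (\<tau> T * sqrt (spread \<kappa> g T))" by simp
  also have "... <= \<gamma>' * (\<tau> T * sqrt (spread \<kappa> g T))"
   using \<gamma>' tp[of T] R_in[OF R] pos[of T] by (intro mult_right_mono) auto
  finally show ?thesis .
 qed
 thus "graded \<gamma>' (%T. \<tau> T * sqrt (spread \<kappa> g T))" using pos tp unfolding graded_def by auto
 have "\<tau> T' / sqrt (spread \<kappa> g T') <= \<gamma>' * (\<tau> T / sqrt (spread \<kappa> g T))" if R: "(T, T') \<in> R" for T T'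
 proof -
  have "1 / sqrt (spread \<kappa> g T') <= 1 / sqrt (spread \<kappa> g T) / sqrt \<kappa>"
   using sq[OF R_sym[OF R]] pos[of T] pos[of T'] \<kappa>(1) by (simp add: field_simps)
  hence "\<tau> T' * (1 / sqrt (spread \<kappa> g T')) <= (\<gamma> * \<tau> T) * (1 / sqrt (spread \<kappa> g T) / sqrt \<kappa>)"
   using ts[OF R] tp R_in[OF R] \<tau>(2) pos[of T'] by (intro mult_mono) (auto intro: less_imp_le)
  also have "... = (\<gamma> / sqrt \<kappa>) * (\<tau> T / sqrt (spread \<kappa> g T))" by simp
  also have "... <= \<gamma>' * (\<tau> T / sqrt (spread \<kappa> g T))"
   using \<gamma>' tp[of T] R_in[OF R] pos[of T] by (intro mult_right_mono) (auto)
  finally show ?thesis by simp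
 qed
 thus "graded \<gamma>' (%T. \<tau> T / sqrt (spread \<kappa> g T))" using pos tp unfolding graded_def by auto
qed

text \<open>The maximum is bounded by the sum over all simplices; after exchanging the sums only the
  weighted volumes around each \<open>S\<close> remain.\<close>

lemma spread_powr_sum:
 assumes \<kappa>: "0 < \<kappa>" and g: "!!S. S \<in> \<T> ==> 0 <= g S" and q: "0 < q"
  and vol: "!!S. S \<in> \<T> ==> (\<Sum>T\<in>\<T>. vol T * (\<kappa> powr q) ^ mesh_dist R T S) <= c * vol S"
 shows "(\<Sum>T\<in>\<T>. vol T * spread \<kappa> g T powr q) <= c * (\<Sum>T\<in>\<T>. vol T * g T powr q)"
proof -
 have le: "spread \<kappa> g T powr q <= (\<Sum>S\<in>\<T>. (\<kappa> powr q) ^ mesh_dist R T S * g S powr q)" for T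
 proof -
  obtain S where S: "S \<in> \<T>" "spread \<kappa> g T = \<kappa> ^ mesh_dist R T S * g S" by (rule spread_attained)
  have "spread \<kappa> g T powr q = (\<kappa> powr q) ^ mesh_dist R T S * g S powr q"
   using S \<kappa> by (simp add: powr_mult powr_powr mult.commute flip: powr_realpow)
  also have "... <= (\<Sum>S\<in>\<T>. (\<kappa> powr q) ^ mesh_dist R T S * g S powr q)"
   by (rule member_le_sum[OF S(1)]) (use finite_\<T> in auto)
  finally show ?thesis .
 qed
 have "(\<Sum>T\<in>\<T>. vol T * spread \<kappa> g T powr q) <=
   (\<Sum>T\<in>\<T>. \<Sum>S\<in>\<T>. vol T * ((\<kappa> powr q) ^ mesh_dist R T S * g S powr q))"
  unfolding sum_distrib_left[symmetric] by (intro sum_mono mult_left_mono le) simp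
 also have "... = (\<Sum>S\<in>\<T>. (\<Sum>T\<in>\<T>. vol T * (\<kappa> powr q) ^ mesh_dist R T S) * g S powr q)"
  by (subst sum.swap) (simp add: sum_distrib_left mult_ac)
 also have "... <= (\<Sum>S\<in>\<T>. (c * vol S) * g S powr q)" by (intro sum_mono mult_right_mono vol) auto
 finally show ?thesis by (simp add: sum_distrib_left mult_ac)
qed

text \<open>Extrapolation in the manner of Rubio de Francia, with a weight made from
  \<open>b\<close> itself: \<open>G\<close> dominates \<open>(\<tau> b) powr (p - 2)\<close>, so the
  L2 bound for the weight \<open>\<tau> * sqrt G\<close> controls the p-sum of
  \<open>\<tau> b\<close>. Young's inequality splits its right side into the p-sum of
  \<open>\<tau> a\<close> and a small multiple of the p-sum of \<open>\<tau> b\<close>, which is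
  absorbed.\<close>

lemma extrapolate_above_2:
 assumes H: "!!s. graded \<gamma>' s ==> (\<Sum>T\<in>\<T>. (s T)^2 * vol T * (b T)^2) <= A * (\<Sum>T\<in>\<T>. (s T)^2 * vol T * (a T)^2)"
  and \<tau>: "graded \<gamma> \<tau>" "0 < \<gamma>" and \<gamma>': "\<gamma> / sqrt \<kappa> <= \<gamma>'" and \<kappa>: "0 < \<kappa>" "\<kappa> <= 1"
  and p: "2 < p" and A: "0 <= A" and c: "0 < c"
  and vol: "!!S. S \<in> \<T> ==> (\<Sum>T\<in>\<T>. vol T * (\<kappa> powr (p / (p - 2))) ^ mesh_dist R T S) <= c * vol S"
  and ab: "!!T. T \<in> \<T> ==> 0 <= a T" "!!T. T \<in> \<T> ==> 0 <= b T"
 shows "(\<Sum>T\<in>\<T>. vol T * (\<tau> T * b T) powr p) <=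
   2 * (A * (1 / (2 * (A + 1) * c)) powr - ((p - 2) / 2)) * (\<Sum>T\<in>\<T>. vol T * (\<tau> T * a T) powr p)" proof -
 define X where "X = (\<Sum>T\<in>\<T>. vol T * (\<tau> T * b T) powr p)"
 define Y where "Y = (\<Sum>T\<in>\<T>. vol T * (\<tau> T * a T) powr p)"
 \<comment> \<open>Chosen so that \<open>A * t * c\<close>, the factor of the term to be absorbed,
   is at most 1/2.\<close>
 define t where "t = 1 / (2 * (A + 1) * c)"
 define C where "C = A * t powr - ((p - 2) / 2)"
 define g where "g T = (\<tau> T * b T) powr (p - 2)" for T
 define G where "G = spread \<kappa> g"
 have tp: "0 < \<tau> T" if "T \<in> \<T>" for T using \<tau>(1) that by (simp add: graded_def)
 have t: "0 < t" using A c by (simp add: t_def)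
 have C: "0 <= C" using A by (simp add: C_def)
 have Y: "0 <= Y" unfolding Y_def by (intro sum_nonneg) auto
 have X: "0 <= X" unfolding X_def by (intro sum_nonneg) auto
 have "X <= 2 * C * Y"
 proof (cases "\<exists>S\<in>\<T>. 0 < g S")
  case False
  hence "\<tau> T * b T = 0" if "T \<in> \<T>" for T using that by (auto simp: g_def)
  hence "X = 0" unfolding X_def by (intro sum.neutral) auto
  thus ?thesis using C Y by simp
 next
  case True
  then obtain S where S: "S \<in> \<T>" "0 < g S" by blast
  have g0: "0 <= g T" for T by (simp add: g_def)
  have Gp: "0 < G T" for T unfolding G_def by (rule spread_pos[where S = S and g = g, OF \<kappa>(1) S])
  have "X <= (\<Sum>T\<in>\<T>. (\<tau> T * sqrt (G T))^2 * vol T * (b T)^2)" unfolding X_def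
  proof (rule sum_mono)
   fix T assume T: "T \<in> \<T>"
   have "(\<tau> T * b T) powr p = (\<tau> T * b T) powr (p - 2) * (\<tau> T * b T) powr 2" by (simp flip: powr_add)
   also have "... = g T * (\<tau> T * b T)^2" using tp[OF T] ab(2)[OF T] by (simp add: g_def)
   also have "... <= G T * (\<tau> T * b T)^2" unfolding G_def by (intro mult_right_mono spread_self[OF T]) auto
   finally have "vol T * (\<tau> T * b T) powr p <= vol T * (G T * (\<tau> T * b T)^2)" by (intro mult_left_mono) auto
   thus "vol T * (\<tau> T * b T) powr p <= (\<tau> T * sqrt (G T))^2 * vol T * (b T)^2"
    using Gp[of T] by (simp add: power_mult_distrib mult_ac)
  qed
  also have "... <= A * (\<Sum>T\<in>\<T>. (\<tau> T * sqrt (G T))^2 * vol T * (a T)^2)"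
   unfolding G_def by (intro H graded_spread(1)[where S = S and g = g, OF \<kappa> g0 S \<tau> \<gamma>'])
  also have "... <= A * (\<Sum>T\<in>\<T>. t * (vol T * G T powr (p / (p - 2))) + t powr - ((p - 2) / 2) * (vol T * (\<tau> T * a T) powr p))"
  proof (intro mult_left_mono[OF _ A] sum_mono)
   fix T assume T: "T \<in> \<T>"
   define z where "z = \<tau> T * a T"
   have z: "0 <= z" using tp[OF T] ab(1)[OF T] by (simp add: z_def)
   define x where "x = t powr - ((p - 2) / 2) * z powr p"
   define y where "y = t * G T powr (p / (p - 2))"
   have e: "1 - 2 / p = (p - 2) / p" using p by (simp add: field_simps)
   have e': "- ((p - 2) / 2) * (2 / p) = - ((p - 2) / p)" using p by (simp add: field_simps)
   have "(t powr - ((p - 2) / 2)) powr (2 / p) = t powr - ((p - 2) / p)" by (simp only: powr_powr e')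
   moreover have "(z powr p) powr (2 / p) = z powr 2" using p by (simp add: powr_powr)
   ultimately have "x powr (2 / p) = t powr - ((p - 2) / p) * z powr 2" by (simp add: x_def powr_mult)
   moreover have "y powr (1 - 2 / p) = t powr ((p - 2) / p) * G T" unfolding e using p Gp[of T] by (simp add: y_def powr_mult powr_powr)
   ultimately have "x powr (2 / p) * y powr (1 - 2 / p) = (t powr - ((p - 2) / p) * t powr ((p - 2) / p)) * (z powr 2 * G T)" by simp
   also have "... = z^2 * G T" using t z by (simp flip: powr_add)
   finally have "z^2 * G T <= x + y" using powr_interpolate[of x y "2 / p"] p t by (simp add: x_def y_def)
   hence "vol T * (z^2 * G T) <= vol T * (x + y)" by (intro mult_left_mono) auto
   thus "(\<tau> T * sqrt (G T))^2 * vol T * (a T)^2 <=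
     t * (vol T * G T powr (p / (p - 2))) + t powr - ((p - 2) / 2) * (vol T * (\<tau> T * a T) powr p)"
    using Gp[of T] by (simp add: z_def x_def y_def algebra_simps)
  qed
  also have "... = A * t * (\<Sum>T\<in>\<T>. vol T * G T powr (p / (p - 2))) + C * Y"
   by (simp add: sum.distrib C_def Y_def sum_distrib_left algebra_simps)
  also have "... <= A * t * (c * X) + C * Y"
  proof -
   have "(\<Sum>T\<in>\<T>. vol T * G T powr (p / (p - 2))) <= c * (\<Sum>T\<in>\<T>. vol T * g T powr (p / (p - 2)))"
    unfolding G_def by (rule spread_powr_sum[OF \<kappa>(1) g0 _ vol]) (use p in auto)
   also have "(\<Sum>T\<in>\<T>. vol T * g T powr (p / (p - 2))) = X" unfolding X_def g_def using p by (simp add: powr_powr)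
   finally show ?thesis using A t by (intro add_right_mono mult_left_mono) auto
  qed
  finally
  moreover have "A * t * c <= 1 / 2"
  proof -
   have "A * t * c = A / (A + 1) / 2" using c by (simp add: t_def)
   also have "... <= 1 / 2" using A by simp
   finally show ?thesis .
  qed
  hence "(A * t * c) * X <= 1 / 2 * X" using X by (rule mult_right_mono)
  ultimately show ?thesis by linarith
 qed
 thus ?thesis by (simp add: X_def Y_def C_def t_def)
qed

text \<open>Dual to the case above 2: the weight is made from the data and used as a divisor. Since
  \<open>G\<close> dominates \<open>(\<tau> a) powr (2 - p)\<close>, the weighted L2 sum of
  \<open>a\<close> is at most its p-sum, and Young's inequality recovers the p-sum of
  \<open>b\<close> without any absorption.\<close>

lemma extrapolate_below_2:
 assumes H: "!!s. graded \<gamma>' s ==> (\<Sum>T\<in>\<T>. (s T)^2 * vol T * (b T)^2) <= A * (\<Sum>T\<in>\<T>. (s T)^2 * vol T * (a T)^2)"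
  and \<tau>: "graded \<gamma> \<tau>" "0 < \<gamma>" "\<gamma> <= \<gamma>'" and \<gamma>': "\<gamma> / sqrt \<kappa> <= \<gamma>'" and \<kappa>: "0 < \<kappa>" "\<kappa> <= 1"
  and p: "0 < p" "p < 2" and A: "0 <= A" and c: "0 <= c"
  and vol: "!!S. S \<in> \<T> ==> (\<Sum>T\<in>\<T>. vol T * (\<kappa> powr (p / (2 - p))) ^ mesh_dist R T S) <= c * vol S"
  and ab: "!!T. T \<in> \<T> ==> 0 <= a T" "!!T. T \<in> \<T> ==> 0 <= b T"
 shows "(\<Sum>T\<in>\<T>. vol T * (\<tau> T * b T) powr p) <= (A + c) * (\<Sum>T\<in>\<T>. vol T * (\<tau> T * a T) powr p)"
proof -
 define X where "X = (\<Sum>T\<in>\<T>. vol T * (\<tau> T * b T) powr p)"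
 define Y where "Y = (\<Sum>T\<in>\<T>. vol T * (\<tau> T * a T) powr p)"
 define g where "g T = (\<tau> T * a T) powr (2 - p)" for T
 define G where "G = spread \<kappa> g"
 have tp: "0 < \<tau> T" if "T \<in> \<T>" for T using \<tau>(1) that by (simp add: graded_def)
 have Y: "0 <= Y" unfolding Y_def by (intro sum_nonneg) auto
 have "X <= (A + c) * Y"
 proof (cases "\<exists>S\<in>\<T>. 0 < g S")
  \<comment> \<open>If the data vanish, the spread is 0 and cannot be a divisor; stability with the
    weight \<open>\<tau>\<close> itself then gives \<open>b = 0\<close>.\<close>
  case False
  hence "\<tau> T * a T = 0" if "T \<in> \<T>" for T using that by (auto simp: g_def)
  hence a0: "a T = 0" if "T \<in> \<T>" for T using that tp by fastforce
  have "\<tau> T' <= \<gamma>' * \<tau> T" if R: "(T, T') \<in> R" for T T'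
  proof -
   have "\<tau> T' <= \<gamma> * \<tau> T" using \<tau>(1) R by (auto simp: graded_def)
   also have "... <= \<gamma>' * \<tau> T" using \<tau>(3) tp[of T] R_in[OF R] by simp
   finally show ?thesis .
  qed
  hence "graded \<gamma>' \<tau>" unfolding graded_def using tp by auto
  from H[OF this] have "(\<Sum>T\<in>\<T>. (\<tau> T)^2 * vol T * (b T)^2) <= 0" using a0 by simp
  hence "(\<tau> T)^2 * vol T * (b T)^2 = 0" if "T \<in> \<T>" for T
   using sum_nonneg_eq_0_iff[OF finite_\<T>, of "%T. (\<tau> T)^2 * vol T * (b T)^2"] that
   by (metis (no_types, lifting) antisym measure_nonneg mult_nonneg_nonneg sum_nonneg zero_le_power2)
  hence "b T = 0" if "T \<in> \<T>" for T using that tp[OF that] measure_simplex_pos[OF that] by (metis less_irrefl mult_eq_0_iff power2_eq_square)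
  hence "X = 0" unfolding X_def by simp
  thus ?thesis using A c Y by simp
 next
  case True
  then obtain S where S: "S \<in> \<T>" "0 < g S" by blast
  have g0: "0 <= g T" for T by (simp add: g_def)
  have Gp: "0 < G T" for T unfolding G_def by (rule spread_pos[where S = S and g = g, OF \<kappa>(1) S])
  have "X <= (\<Sum>T\<in>\<T>. (\<tau> T / sqrt (G T))^2 * vol T * (b T)^2 + vol T * G T powr (p / (2 - p)))" unfolding X_def
  proof (rule sum_mono)
   fix T assume T: "T \<in> \<T>"
   define z where "z = \<tau> T * b T"
   have z: "0 <= z" using tp[OF T] ab(2)[OF T] by (simp add: z_def)
   define x where "x = z^2 / G T"
   define y where "y = G T powr (p / (2 - p))"
   have e: "1 - p / 2 = (2 - p) / 2" by simp
   have z2: "z^2 = z powr 2" using z by simp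
   have "(z^2) powr (p / 2) = z powr p" by (simp only: z2 powr_powr) simp
   hence "x powr (p / 2) = z powr p / G T powr (p / 2)" unfolding x_def by (simp add: powr_divide)
   moreover have "y powr (1 - p / 2) = G T powr (p / 2)" unfolding e using p by (simp add: y_def powr_powr)
   ultimately have "z powr p = x powr (p / 2) * y powr (1 - p / 2)" using Gp[of T] by simp
   also have "... <= x + y" using p Gp[of T] by (intro powr_interpolate) (auto simp: x_def y_def)
   finally have "vol T * z powr p <= vol T * (x + y)" by (intro mult_left_mono) auto
   thus "vol T * (\<tau> T * b T) powr p <= (\<tau> T / sqrt (G T))^2 * vol T * (b T)^2 + vol T * G T powr (p / (2 - p))"
    using Gp[of T] by (simp add: z_def x_def y_def power_divide algebra_simps)
  qed
  also have "... <= A * Y + c * Y" unfolding sum.distrib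
  proof (rule add_mono)
   have "(\<Sum>T\<in>\<T>. (\<tau> T / sqrt (G T))^2 * vol T * (b T)^2) <= A * (\<Sum>T\<in>\<T>. (\<tau> T / sqrt (G T))^2 * vol T * (a T)^2)"
    unfolding G_def by (intro H graded_spread(2)[where S = S and g = g, OF \<kappa> g0 S \<tau>(1,2) \<gamma>'])
   also have "... <= A * Y" unfolding Y_def
   proof (intro mult_left_mono[OF _ A] sum_mono)
    fix T assume T: "T \<in> \<T>"
    define z where "z = \<tau> T * a T"
    have z: "0 <= z" using tp[OF T] ab(1)[OF T] by (simp add: z_def)
    have "z^2 = z powr p * z powr (2 - p)" using z by (simp flip: powr_add)
    also have "... <= z powr p * G T" using spread_self[OF T, of g \<kappa>] by (intro mult_left_mono) (auto simp: G_def g_def z_def)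
    finally have "z^2 / G T <= z powr p" using Gp[of T] by (simp add: divide_le_eq)
    hence "vol T * (z^2 / G T) <= vol T * z powr p" by (intro mult_left_mono) auto
    thus "(\<tau> T / sqrt (G T))^2 * vol T * (a T)^2 <= vol T * (\<tau> T * a T) powr p"
     using Gp[of T] by (simp add: z_def power_mult_distrib power_divide mult_ac)
   qed
   finally show "(\<Sum>T\<in>\<T>. (\<tau> T / sqrt (G T))^2 * vol T * (b T)^2) <= A * Y" .
   have "(\<Sum>T\<in>\<T>. vol T * G T powr (p / (2 - p))) <= c * (\<Sum>T\<in>\<T>. vol T * g T powr (p / (2 - p)))"
    unfolding G_def by (rule spread_powr_sum[OF \<kappa>(1) g0 _ vol]) (use p in auto)
   also have "(\<Sum>T\<in>\<T>. vol T * g T powr (p / (2 - p))) = Y" unfolding Y_def g_def using p by (simp add: powr_powr)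
   finally show "(\<Sum>T\<in>\<T>. vol T * G T powr (p / (2 - p))) <= c * Y" .
  qed
  finally show ?thesis by (simp add: algebra_simps)
 qed
 thus ?thesis by (simp add: X_def Y_def)
qed

text \<open>The weight decays away from the single simplex \<open>T0\<close> at which the bound is
  wanted. The summable volumes bound the L2 sum of data that are only uniformly bounded.\<close>

lemma extrapolate_infinity:
 assumes H: "!!s. graded \<gamma>' s ==> (\<Sum>T\<in>\<T>. (s T)^2 * vol T * (b T)^2) <= A * (\<Sum>T\<in>\<T>. (s T)^2 * vol T * (a T)^2)"
  and \<tau>: "graded \<gamma> \<tau>" "0 < \<gamma>" and \<gamma>': "\<gamma> / sqrt \<kappa> <= \<gamma>'" and \<kappa>: "0 < \<kappa>" "\<kappa> <= 1"
  and A: "0 <= A"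
  and vol: "!!S. S \<in> \<T> ==> (\<Sum>T\<in>\<T>. vol T * \<kappa> ^ mesh_dist R T S) <= c * vol S"
  and a: "!!T. T \<in> \<T> ==> 0 <= a T" "!!T. T \<in> \<T> ==> \<tau> T * a T <= N" and T0: "T0 \<in> \<T>" and N: "0 <= N"
 shows "\<tau> T0 * b T0 <= sqrt (A * c) * N"
proof -
 define g where "g T = (if T = T0 then 1 else 0 :: real)" for T
 define G where "G = spread \<kappa> g"
 have tp: "0 < \<tau> T" if "T \<in> \<T>" for T using \<tau>(1) that by (simp add: graded_def)
 have g0: "0 <= g T" "0 < g T0" for T by (simp_all add: g_def)
 have Gp: "0 < G T" for T unfolding G_def by (rule spread_pos[where S = T0 and g = g, OF \<kappa>(1) T0 g0(2)])
 have Gle: "G T <= \<kappa> ^ mesh_dist R T T0" for T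
 proof -
  obtain S where "S \<in> \<T>" "G T = \<kappa> ^ mesh_dist R T S * g S" unfolding G_def by (rule spread_attained)
  thus ?thesis using Gp[of T] by (cases "S = T0") (auto simp: g_def)
 qed
 have "(\<tau> T0 * b T0)^2 * vol T0 <= (\<tau> T0 * sqrt (G T0))^2 * vol T0 * (b T0)^2"
 proof -
  have "1 <= G T0" using spread_self[OF T0, of g \<kappa>] by (simp add: G_def g_def)
  hence "(\<tau> T0 * b T0)^2 * vol T0 * 1 <= (\<tau> T0 * b T0)^2 * vol T0 * G T0" by (intro mult_left_mono) auto
  thus ?thesis using Gp[of T0] by (simp add: power_mult_distrib mult_ac)
 qed
 also have "... <= (\<Sum>T\<in>\<T>. (\<tau> T * sqrt (G T))^2 * vol T * (b T)^2)"
  by (rule member_le_sum[OF T0]) (use finite_\<T> in auto)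
 also have "... <= A * (\<Sum>T\<in>\<T>. (\<tau> T * sqrt (G T))^2 * vol T * (a T)^2)"
  unfolding G_def by (intro H graded_spread(1)[where S = T0 and g = g, OF \<kappa> g0(1) T0 g0(2) \<tau> \<gamma>'])
 also have "... <= A * (\<Sum>T\<in>\<T>. N^2 * (vol T * \<kappa> ^ mesh_dist R T T0))"
 proof (intro mult_left_mono[OF _ A] sum_mono)
  fix T assume T: "T \<in> \<T>"
  have "(\<tau> T * a T)^2 <= N^2" using a(1,2)[OF T] tp[OF T] by (intro power_mono) auto
  hence "(\<tau> T * a T)^2 * (vol T * G T) <= N^2 * (vol T * \<kappa> ^ mesh_dist R T T0)"
   using Gle[of T] Gp[of T] by (intro mult_mono mult_left_mono mult_nonneg_nonneg) auto
  thus "(\<tau> T * sqrt (G T))^2 * vol T * (a T)^2 <= N^2 * (vol T * \<kappa> ^ mesh_dist R T T0)"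
   using Gp[of T] by (simp add: power_mult_distrib mult_ac)
 qed
 also have "... = A * N^2 * (\<Sum>T\<in>\<T>. vol T * \<kappa> ^ mesh_dist R T T0)" by (simp add: sum_distrib_left mult_ac)
 also have "... <= A * N^2 * (c * vol T0)" using A by (intro mult_left_mono vol T0) auto
 finally have "(\<tau> T0 * b T0)^2 * vol T0 <= (A * c * N^2) * vol T0" by (simp add: mult_ac)
 hence "(\<tau> T0 * b T0)^2 <= A * c * N^2" using measure_simplex_pos[OF T0] by simp
 hence "\<tau> T0 * b T0 <= sqrt (A * c * N^2)" by (rule real_le_rsqrt)
 thus ?thesis using N by (simp add: real_sqrt_mult)
qed

end

section \<open>Summability of the weighted volumes\<close>

definition vol_const :: "nat => real => real => real => real" where
 "vol_const d c B \<theta> = (c * B) ^ d * (\<Sum>N. real (N + 1) ^ d * \<theta> ^ N)"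

lemma summable_poly_geometric:
 assumes "0 <= \<theta>" "\<theta> < (1::real)" shows "summable (%N. real (N + 1) ^ d * \<theta> ^ N)"
proof -
 have "(%N. (1 + inverse (real (Suc N))) ^ d * \<theta>) \<longlonglongrightarrow> (1 + 0) ^ d * \<theta>"
  by (intro tendsto_intros LIMSEQ_inverse_real_of_nat)
 hence "\<forall>\<^sub>F N in sequentially. (1 + inverse (real (Suc N))) ^ d * \<theta> < (1 + \<theta>) / 2"
  by (rule order_tendstoD) (use assms in simp)
 then obtain M where M: "!!N. M <= N ==> (1 + inverse (real (Suc N))) ^ d * \<theta> < (1 + \<theta>) / 2"
  unfolding eventually_sequentially by blast
 show ?thesis
 proof (rule summable_ratio_test)
  show "(1 + \<theta>) / 2 < 1" using assms by simp
  fix N assume N: "M <= N"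
  have "real (Suc N + 1) = real (N + 1) * (1 + inverse (real (Suc N)))" by (simp add: field_simps)
  hence "norm (real (Suc N + 1) ^ d * \<theta> ^ Suc N) = ((1 + inverse (real (Suc N))) ^ d * \<theta>) * norm (real (N + 1) ^ d * \<theta> ^ N)"
   using assms by (simp only: power_mult_distrib) (simp)
  also have "... <= (1 + \<theta>) / 2 * norm (real (N + 1) ^ d * \<theta> ^ N)" using M[OF N] by (intro mult_right_mono) auto
  finally show "norm (real (Suc N + 1) ^ d * \<theta> ^ Suc N) <= (1 + \<theta>) / 2 * norm (real (N + 1) ^ d * \<theta> ^ N)" .
 qed
qed

context mesh_shape
begin

text \<open>Consecutive simplices of a chain intersect, so a chain of length N stays in a ball of
  radius at most \<open>N + 1\<close> times the largest diameter bound
  \<open>B * \<gamma> ^ N * diameter T\<close>. By packing, the shell at distance N has volume of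
  order \<open>(N + 1) ^ d * \<gamma> ^ (d N)\<close>, and the factor \<open>\<kappa> ^ N\<close>
  makes the shells summable.\<close>

lemma weighted_volume:
 assumes chain: "!!T T' N. T \<in> \<T> ==> (T, T') \<in> R ^^ N ==> diameter T' <= B * \<gamma> ^ N * diameter T"
  and B: "1 <= B" and \<gamma>: "1 <= \<gamma>" and \<kappa>: "0 <= \<kappa>" "\<kappa> * \<gamma> ^ DIM('a) < 1" and T: "T \<in> \<T>"
 shows "(\<Sum>S\<in>\<T>. vol S * \<kappa> ^ mesh_dist R S T) <= vol_const DIM('a) cs B (\<kappa> * \<gamma> ^ DIM('a)) * vol T"
proof -
 let ?d = "DIM('a)"
 define D where "D = diameter T"
 have D: "0 < D" unfolding D_def by (rule diameter_pos[OF T])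
 have dist: "dist (ctr T) x <= real (N + 1) * (B * \<gamma> ^ N * D)" if "(T, S) \<in> R ^^ N" "x \<in> S" for N S x using that
 proof (induction N arbitrary: S x)
  case 0
  hence "x \<in> T" by simp
  hence "dist (ctr T) x <= D" unfolding D_def dist_norm by (intro dist_le_diameter[OF T ctr_in[OF T]])
  also have "... <= B * D" using B D by simp
  finally show ?case by simp
 next
  case (Suc N)
  then obtain U where U: "(T, U) \<in> R ^^ N" "(U, S) \<in> R" by auto
  hence "U \<inter> S \<noteq> {}" using neighbors unfolding neighbor_relation_def by auto
  then obtain y where y: "y \<in> U" "y \<in> S" by blast
  have "dist (ctr T) x <= dist (ctr T) y + norm (y - x)" by (metis dist_norm dist_triangle)
  also have "... <= real (N + 1) * (B * \<gamma> ^ N * D) + diameter S"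
   by (intro add_mono Suc.IH[OF U(1) y(1)] dist_le_diameter[OF conjunct2[OF R_in[OF U(2)]] y(2) Suc.prems(2)])
  also have "... <= real (N + 1) * (B * \<gamma> ^ Suc N * D) + B * \<gamma> ^ Suc N * D"
  proof (rule add_mono)
   show "real (N + 1) * (B * \<gamma> ^ N * D) <= real (N + 1) * (B * \<gamma> ^ Suc N * D)" using \<gamma>
    using B D by (intro mult_left_mono mult_right_mono) auto
   show "diameter S <= B * \<gamma> ^ Suc N * D" unfolding D_def by (rule chain[OF T Suc.prems(1)])
  qed
  also have "... = real (Suc N + 1) * (B * \<gamma> ^ Suc N * D)" by (simp add: algebra_simps)
  finally show ?case .
 qed
 define L where "L N = {S \<in> \<T>. mesh_dist R S T = N}" for N
 \<comment> \<open>Shells are indexed by the distance from \<open>S\<close> to \<open>T\<close>,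
   whereas the diameter bound runs along chains from \<open>T\<close>; symmetry of \<open>R\<close>
   reverses the chain.\<close>
 have shell_chain: "(T, S) \<in> R ^^ N" if "S \<in> L N" for S N
 proof -
  have "(S, T) \<in> R ^^ N" using mesh_dist_relpow[OF _ T, of S] that by (auto simp: L_def)
  thus ?thesis
  proof (induction N arbitrary: T)
   case (Suc N)
   then obtain U where "(S, U) \<in> R ^^ N" "(U, T) \<in> R" by auto
   thus ?case by (intro relpow_Suc_I2[OF R_sym Suc.IH])
  qed simp
 qed
 have shell: "(\<Sum>S\<in>L N. vol S) <= ((cs * B) ^ ?d * real (N + 1) ^ ?d * (\<gamma> ^ ?d) ^ N) * vol T" for N
 proof -
  define r where "r = real (N + 1) * (B * \<gamma> ^ N * D)"
  have r: "0 <= r" using B \<gamma> D by (simp add: r_def)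
  have "(\<Sum>S\<in>L N. vol S) <= vol (cball (ctr T) r)"
  proof (rule packing)
   show "S \<subseteq> S \<inter> cball (ctr T) r" if "S \<in> L N" for S using dist[OF shell_chain[OF that]] by (auto simp: r_def)
   show "emeasure lborel (cball (ctr T) r) < \<infinity>" by (rule emeasure_compact_finite[OF compact_cball])
  qed (use simplex_measurable in \<open>auto simp: L_def\<close>)
  also have "... = (B ^ ?d * real (N + 1) ^ ?d * (\<gamma> ^ ?d) ^ N) * (\<omega> * D ^ ?d)"
   unfolding measure_cball[OF r] by (simp add: r_def power_mult_distrib power_mult[symmetric] mult_ac)
  also have "... <= (B ^ ?d * real (N + 1) ^ ?d * (\<gamma> ^ ?d) ^ N) * (cs ^ ?d * vol T)"
   unfolding D_def by (intro mult_left_mono measure_simplex_ge[OF T]) (use B \<gamma> in auto)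
  finally show ?thesis by (simp add: power_mult_distrib mult_ac)
 qed
 define M where "M = Suc (Max ((%S. mesh_dist R S T) ` \<T>))"
 have M: "mesh_dist R S T < M" if "S \<in> \<T>" for S unfolding M_def less_Suc_eq_le by (intro Max_ge) (use that finite_\<T> in auto)
 have nn: "0 <= \<kappa> * \<gamma> ^ ?d" using \<kappa> \<gamma> by simp
 have "(\<Sum>S\<in>\<T>. vol S * \<kappa> ^ mesh_dist R S T) = (\<Sum>N\<in>{..<M}. \<Sum>S\<in>L N. vol S * \<kappa> ^ mesh_dist R S T)"
  unfolding L_def by (rule sum.group[symmetric]) (use M finite_\<T> in auto)
 also have "... = (\<Sum>N<M. \<kappa> ^ N * (\<Sum>S\<in>L N. vol S))" by (intro sum.cong refl) (auto simp: sum_distrib_left L_def mult.commute)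
 also have "... <= (\<Sum>N<M. \<kappa> ^ N * (((cs * B) ^ ?d * real (N + 1) ^ ?d * (\<gamma> ^ ?d) ^ N) * vol T))"
  by (intro sum_mono mult_left_mono shell) (use \<kappa> in auto)
 also have "... = (cs * B) ^ ?d * (\<Sum>N<M. real (N + 1) ^ ?d * (\<kappa> * \<gamma> ^ ?d) ^ N) * vol T"
  by (simp add: sum_distrib_left power_mult_distrib mult_ac)
 also have "... <= (cs * B) ^ ?d * (\<Sum>N. real (N + 1) ^ ?d * (\<kappa> * \<gamma> ^ ?d) ^ N) * vol T"
  by (intro mult_right_mono mult_left_mono sum_le_suminf summable_poly_geometric[OF nn \<kappa>(2)])
   (use cs1 B nn in \<open>auto intro!: mult_nonneg_nonneg\<close>)
 finally show ?thesis by (simp add: vol_const_def)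
qed

end

section \<open>From weights and Lebesgue norms to simplexwise quantities\<close>

lemma AE_lebesgue_on:
 assumes "S \<in> sets lborel"
 shows "(AE x in lebesgue_on S. P x) \<longleftrightarrow> (AE x in lborel. x \<in> S --> P x)"
 using assms by (simp add: AE_restrict_space_iff AE_completion_iff)

lemma nn_integral_lebesgue_on:
 assumes "S \<in> sets lborel"
 shows "(\<integral>\<^sup>+x. f x \<partial>lebesgue_on S) = (\<integral>\<^sup>+x. f x * ind S x \<partial>lborel)"
 using assms by (simp add: nn_integral_restrict_space nn_integral_completion)

lemma borel_measurable_lebesgue_on: "f \<in> borel_measurable borel ==> f \<in> borel_measurable (lebesgue_on S)"
 by (intro measurable_restrict_space1 measurable_completion) simp

lemma Lp_exponent: assumes "1 <= p" "p \<noteq> (\<infinity>::ennreal)" shows "1 <= enn2real p"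
proof -
 have "ennreal 1 <= ennreal (enn2real p)" using assms by (simp add: less_top)
 thus ?thesis by simp
qed

lemma Lp_norm_le_iff:
 assumes p: "1 <= p" "p \<noteq> \<infinity>" and B: "0 <= B"
 shows "Lp_norm Om p f <= ennreal B \<longleftrightarrow>
   (\<integral>\<^sup>+x. ennreal (norm (f x) powr enn2real p) \<partial>lebesgue_on Om) <= ennreal (B powr enn2real p)" proof -
 define q where "q = enn2real p"
 have q: "1 <= q" unfolding q_def by (rule Lp_exponent[OF p])
 define I where "I = (\<integral>\<^sup>+x. ennreal (norm (f x) powr enn2real p) \<partial>lebesgue_on Om)"
 have L: "Lp_norm Om p f = (if I = \<infinity> then \<infinity> else ennreal (enn2real I powr (1 / q)))"
  using p(2) by (simp add: Lp_norm_def I_def q_def)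
 have "Lp_norm Om p f <= ennreal B \<longleftrightarrow> I <= ennreal (B powr q)"
 proof (cases "I = \<infinity>")
  case False
  then obtain J where J: "I = ennreal J" "0 <= J" by (cases I) auto
  have "J powr (1 / q) <= B \<longleftrightarrow> J <= B powr q"
  proof
   assume "J powr (1 / q) <= B"
   hence "(J powr (1 / q)) powr q <= B powr q" using q by (intro powr_mono2) auto
   thus "J <= B powr q" using q by (simp add: powr_powr)
  next
   assume "J <= B powr q"
   hence "J powr (1 / q) <= (B powr q) powr (1 / q)" using q J(2) by (intro powr_mono2) auto
   thus "J powr (1 / q) <= B" using B q by (simp add: powr_powr)
  qed
  thus ?thesis using L J B by simp
 qed (simp add: L top_unique)
 thus ?thesis by (simp add: I_def q_def)
qed

context mesh_shape
begin

lemma AE_simplex: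
 assumes "T \<in> \<T>"
 shows "(AE x in lebesgue_on (Om \<inter> T). P x) \<longleftrightarrow> (AE x\<in>interior T in lborel. P x)"
proof -
 have "(AE x in lborel. x \<in> Om \<inter> T --> P x) \<longleftrightarrow> (AE x\<in>interior T in lborel. P x)"
 proof
  assume "AE x in lborel. x \<in> Om \<inter> T --> P x"
  thus "AE x\<in>interior T in lborel. P x" by eventually_elim (use interior_simplex_subset[OF assms] interior_subset in blast)
 next
  assume "AE x\<in>interior T in lborel. P x"
  thus "AE x in lborel. x \<in> Om \<inter> T --> P x" using skeleton_null by eventually_elim (use assms in blast)
 qed
 thus ?thesis using AE_lebesgue_on[of "Om \<inter> T" P] Om_measurable simplex_measurable[OF assms] by simp
qed

lemma AE_simplex_witness:
 assumes T: "T \<in> \<T>" and "AE x\<in>interior T in lborel. P x"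
 obtains x where "x \<in> interior T" "P x"
proof -
 have "\<not> (AE x in lborel. x \<notin> interior T)"
 proof
  assume "AE x in lborel. x \<notin> interior T"
  hence "vol (interior T) = 0" using AE_iff_null_sets[of "interior T" lborel] by (simp add: measure_def null_setsD1)
  thus False using measure_interior_eq[OF T] measure_simplex_pos[OF T] by simp
 qed
 moreover have "AE x in lborel. x \<notin> interior T" if "!!x. x \<in> interior T ==> \<not> P x"
  using assms(2) by eventually_elim (use that in blast)
 ultimately show ?thesis using that by blast
qed

lemma mesh_dist_1_iff: "T \<in> \<T> ==> T' \<in> \<T> ==> mesh_dist R T T' = 1 \<longleftrightarrow> (T, T') \<in> R"
proof
 assume "T \<in> \<T>" "T' \<in> \<T>" "mesh_dist R T T' = 1"
 thus "(T, T') \<in> R" using mesh_dist_relpow[of T T'] by simp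
next
 assume R: "(T, T') \<in> R"
 hence "T \<noteq> T'" using neighbors unfolding neighbor_relation_def by auto
 thus "mesh_dist R T T' = 1" unfolding mesh_dist_def by (intro Least_equality) (use R in \<open>auto simp: Suc_le_eq intro!: gr0I\<close>)
qed

text \<open>The essential infimum serves as the representative. At a point where all almost
  everywhere bounds hold it lies below a real number, and \<open>\<gamma>\<close> times it lies
  above a positive one; so it is finite and positive.\<close>

lemma weight_bounds:
 assumes w: "weight_with_grading Om \<T> R \<gamma> \<rho>"
 obtains \<sigma> where "graded \<gamma> \<sigma>" "!!T. T \<in> \<T> ==> ereal (\<sigma> T) = ess_inf_on Om T \<rho>"
  "!!T. T \<in> \<T> ==> AE x\<in>interior T in lborel. \<sigma> T <= \<rho> x \<and> \<rho> x <= \<gamma> * \<sigma> T"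
proof -
 have \<gamma>: "1 <= \<gamma>" using w by (simp add: weight_with_grading_def)
 define \<sigma> where "\<sigma> T = real_of_ereal (ess_inf_on Om T \<rho>)" for T
 have *: "ereal (\<sigma> T) = ess_inf_on Om T \<rho> \<and> 0 < \<sigma> T \<and> (AE x\<in>interior T in lborel. \<sigma> T <= \<rho> x \<and> \<rho> x <= \<gamma> * \<sigma> T)"
  if T: "T \<in> \<T>" for T
 proof -
  define I where "I = ess_inf_on Om T \<rho>"
  have "AE x in lebesgue_on (Om \<inter> T). - ereal (\<rho> x) <= - I" unfolding I_def ess_inf_on_def ereal_uminus_uminus by (rule esssup_AE)
  hence lo: "AE x\<in>interior T in lborel. I <= ereal (\<rho> x)" unfolding AE_simplex[OF T] ereal_minus_le_minus .
  have "AE x in lebesgue_on (Om \<inter> T). ereal (\<rho> x) <= ess_sup_on Om T \<rho>" unfolding ess_sup_on_def by (rule esssup_AE)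
  moreover have "ess_sup_on Om T \<rho> <= ereal \<gamma> * I" using w T by (simp add: weight_with_grading_def I_def)
  ultimately have hi: "AE x\<in>interior T in lborel. ereal (\<rho> x) <= ereal \<gamma> * I" unfolding AE_simplex[OF T, symmetric] by auto
  have "AE x\<in>Om in lborel. 0 < \<rho> x" using w AE_lebesgue_on[OF Om_measurable] by (simp add: weight_with_grading_def)
  with lo hi have "AE x\<in>interior T in lborel. I <= ereal (\<rho> x) \<and> ereal (\<rho> x) <= ereal \<gamma> * I \<and> 0 < \<rho> x"
   by eventually_elim (use interior_simplex_subset[OF T] in blast)
  then obtain x where x: "I <= ereal (\<rho> x)" "ereal (\<rho> x) <= ereal \<gamma> * I" "0 < \<rho> x" by (rule AE_simplex_witness[OF T]) blast
  then obtain r where r: "I = ereal r" using \<gamma> by (cases I) auto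
  have "\<rho> x <= \<gamma> * r" using x(2) r by simp
  hence "0 < r" using x(3) \<gamma> by (metis zero_less_mult_pos order.strict_trans2 zero_less_one)
  moreover have "\<sigma> T = r" using r by (simp add: \<sigma>_def I_def)
  moreover have "AE x\<in>interior T in lborel. r <= \<rho> x \<and> \<rho> x <= \<gamma> * r" using lo hi by eventually_elim (simp add: r)
  ultimately show ?thesis using r by (simp add: I_def)
 qed
 have "\<sigma> T' <= \<gamma> * \<sigma> T" if R: "(T, T') \<in> R" for T T'
 proof -
  have "T \<in> \<T>" "T' \<in> \<T>" "mesh_dist R T T' = 1" using R_in[OF R] mesh_dist_1_iff R by auto
  hence "ess_inf_on Om T' \<rho> <= ereal \<gamma> * ess_inf_on Om T \<rho>" using w unfolding weight_with_grading_def by blast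
  hence "ereal (\<sigma> T') <= ereal \<gamma> * ereal (\<sigma> T)" using * \<open>T \<in> \<T>\<close> \<open>T' \<in> \<T>\<close> by simp
  thus ?thesis by simp
 qed
 hence "graded \<gamma> \<sigma>" using * by (auto simp: graded_def)
 thus ?thesis using that * by blast
qed

end

context mesh
begin

definition step_weight :: "('a set => real) => 'a => real" where "step_weight s x = (\<Sum>T\<in>\<T>. s T * ind (interior T) x)"

lemma step_weight_eq: "T \<in> \<T> ==> x \<in> interior T ==> step_weight s x = s T"
 unfolding step_weight_def using sum_interior[of T x s] by (simp add: mult.commute)

lemma step_weight_measurable: "step_weight s \<in> borel_measurable borel" unfolding step_weight_def by simp

lemma AE_interior: "AE x\<in>Om in lborel. (\<exists>T\<in>\<T>. x \<in> interior T)"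
 using skeleton_null by eventually_elim (use cover in blast)

end

context mesh_shape
begin

text \<open>On each simplex the step function is almost everywhere constant, so essential supremum
  and infimum coincide and the conditions on weights reduce to \<open>graded\<close>. Its value 0 on
  the skeleton is invisible.\<close>

lemma step_weight_graded:
 assumes s: "graded \<gamma> s" and \<gamma>: "1 <= \<gamma>"
 shows "weight_with_grading Om \<T> R \<gamma> (step_weight s)"
proof -
 have sp: "0 < s T" if "T \<in> \<T>" for T using s that by (simp add: graded_def)
 have ess: "ess_sup_on Om T (step_weight s) = ereal (s T)" "ess_inf_on Om T (step_weight s) = ereal (s T)" if T: "T \<in> \<T>" for T
 proof -
  define M where "M = lebesgue_on (Om \<inter> T)"
  have "AE x\<in>interior T in lborel. step_weight s x = s T" using step_weight_eq[OF T] by simp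
  hence ae: "AE x in M. step_weight s x = s T" unfolding M_def AE_simplex[OF T] .
  have "emeasure M (space M) \<noteq> 0"
  proof
   assume "emeasure M (space M) = 0"
   hence "AE x in M. False" by (simp add: AE_iff_measurable[OF _ refl])
   thus False unfolding M_def AE_simplex[OF T] by (rule AE_simplex_witness[OF T])
  qed
  note const = esssup_const[OF this]
  have m: "step_weight s \<in> borel_measurable M" unfolding M_def by (rule borel_measurable_lebesgue_on[OF step_weight_measurable])
  have "esssup M (%x. ereal (step_weight s x)) = esssup M (%x. ereal (s T))" using ae m by (intro esssup_AE_cong) (auto)
  thus "ess_sup_on Om T (step_weight s) = ereal (s T)" using const by (simp add: ess_sup_on_def M_def)
  have "esssup M (%x. - ereal (step_weight s x)) = esssup M (%x. - ereal (s T))" using ae m by (intro esssup_AE_cong) (auto)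
  thus "ess_inf_on Om T (step_weight s) = ereal (s T)" by (simp only: ess_inf_on_def M_def[symmetric] const ereal_uminus_uminus)
 qed
 have "integrable lborel (%x. s T * ind (interior T) x)" if "T \<in> \<T>" for T
  using finite_measure_simplex[OF that] emeasure_mono[OF interior_subset, of T lborel] simplex_measurable[OF that]
  by (intro integrable_mult_right integrable_real_indicator) (auto)
 hence "integrable lborel (step_weight s)" unfolding step_weight_def[abs_def] by simp
 hence "integrable lebesgue (%x. ind Om x *\<^sub>R step_weight s x)" using integrable_completion[of "step_weight s" lborel]
  using Om_measurable by (intro integrable_mult_indicator) (auto)
 hence i: "integrable (lebesgue_on Om) (step_weight s)" using Om_measurable by (simp add: integrable_restrict_space)
 have pos: "AE x in lebesgue_on Om. 0 < step_weight s x"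
  unfolding AE_lebesgue_on[OF Om_measurable] using AE_interior by eventually_elim (auto simp: step_weight_eq sp)
 show ?thesis unfolding weight_with_grading_def
 proof (intro conjI ballI impI \<gamma> i pos)
  show "ess_sup_on Om T (step_weight s) <= ereal \<gamma> * ess_inf_on Om T (step_weight s)" if "T \<in> \<T>" for T
   using ess[OF that] \<gamma> sp[OF that] by simp
  fix T T' assume T: "T \<in> \<T>" "T' \<in> \<T>" "mesh_dist R T T' = 1"
  hence "s T' <= \<gamma> * s T" using mesh_dist_1_iff using s by (auto simp: graded_def)
  thus "ess_sup_on Om T' (step_weight s) <= ereal \<gamma> * ess_sup_on Om T (step_weight s)"
   "ess_inf_on Om T' (step_weight s) <= ereal \<gamma> * ess_inf_on Om T (step_weight s)" using ess T by simp_all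
 qed
qed

end

context mesh_fem
begin

lemma nn_integral_le_sum:
 assumes "!!T x. T \<in> \<T> ==> 0 <= B T" "!!T. T \<in> \<T> ==> AE x\<in>interior T in lborel. f x <= B T"
 shows "(\<integral>\<^sup>+x. ennreal (f x) \<partial>lebesgue_on Om) <= ennreal (\<Sum>T\<in>\<T>. vol T * B T)"
proof -
 have "AE x in lborel. \<forall>T\<in>\<T>. x \<in> interior T --> f x <= B T" using assms(2) by (intro AE_finite_allI[OF finite_\<T>])
 hence "(\<integral>\<^sup>+x. ennreal (f x) * ind Om x \<partial>lborel) <= (\<integral>\<^sup>+x. (\<Sum>T\<in>\<T>. ennreal (B T) * ind T x) \<partial>lborel)"
  using AE_interior
 proof (intro nn_integral_mono_AE, eventually_elim)
  case (elim x)
  show ?case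
  proof (cases "x \<in> Om")
   case True
   then obtain T where T: "T \<in> \<T>" "x \<in> interior T" using elim by blast
   hence "f x <= B T" "x \<in> T" using elim(3) interior_subset by blast+
   hence "ennreal (f x) <= ennreal (B T) * ind T x" by (simp add: ennreal_leI)
   also have "... <= (\<Sum>T\<in>\<T>. ennreal (B T) * ind T x)" by (rule member_le_sum[OF T(1)]) (use finite_\<T> in auto)
   finally show ?thesis using True by simp
  qed simp
 qed
 also have "... = (\<Sum>T\<in>\<T>. ennreal (B T) * emeasure lborel T)"
  using simplex_measurable by (subst nn_integral_sum) (auto intro!: sum.cong nn_integral_cmult_indicator)
 also have "... = (\<Sum>T\<in>\<T>. ennreal (vol T * B T))"
 proof (intro sum.cong refl)
  fix T assume T: "T \<in> \<T>"
  have "emeasure lborel T = ennreal (vol T)" using finite_measure_simplex[OF T] by (intro emeasure_eq_ennreal_measure) auto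
  thus "ennreal (B T) * emeasure lborel T = ennreal (vol T * B T)" using assms(1)[OF T] by (simp add: ennreal_mult mult.commute)
 qed
 also have "... = ennreal (\<Sum>T\<in>\<T>. vol T * B T)" using assms(1) by (intro sum_ennreal) auto
 finally show ?thesis unfolding nn_integral_lebesgue_on[OF Om_measurable] .
qed

lemma sum_simplex_integrals_le:
 fixes f :: "'a set => 'a => real"
 assumes F: "(\<integral>\<^sup>+x. F x \<partial>lebesgue_on Om) <= ennreal B" "0 <= B"
  and m: "!!T. T \<in> \<T> ==> f T \<in> borel_measurable borel" and nn: "!!T x. T \<in> \<T> ==> 0 <= f T x"
  and le: "!!T. T \<in> \<T> ==> AE x\<in>interior T in lborel. ennreal (f T x) <= F x"
 shows "!!T. T \<in> \<T> ==> integrable lborel (%x. ind T x * f T x)" "(\<Sum>T\<in>\<T>. LBINT x. ind T x * f T x) <= B"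
proof -
 let ?h = "%T x. ind T x * f T x"
 have hm: "?h T \<in> borel_measurable lborel" if "T \<in> \<T>" for T using m[OF that] simplex_measurable[OF that] by simp
 have "AE x in lborel. \<forall>T\<in>\<T>. x \<in> interior T --> ennreal (f T x) <= F x" using le by (intro AE_finite_allI[OF finite_\<T>])
 hence "(\<integral>\<^sup>+x. (\<Sum>T\<in>\<T>. ennreal (?h T x)) \<partial>lborel) <= (\<integral>\<^sup>+x. F x * ind Om x \<partial>lborel)"
  using skeleton_null
 proof (intro nn_integral_mono_AE, eventually_elim)
  case (elim x)
  show ?case
  proof (cases "\<exists>T\<in>\<T>. x \<in> T")
   case True
   then obtain T where T: "T \<in> \<T>" "x \<in> interior T" "x \<in> T" using elim by blast
   have "x \<notin> S" if "S \<in> \<T>" "S \<noteq> T" for S using interior_meets_imp_eq[OF T(1) that(1) T(2)] that(2) by blast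
   hence "(\<Sum>S\<in>\<T>. ennreal (?h S x)) = (\<Sum>S\<in>{T}. ennreal (?h S x))" using T(1) by (intro sum.mono_neutral_right finite_\<T>) auto
   moreover have "x \<in> Om" "ennreal (f T x) <= F x" using elim T interior_simplex_subset[OF T(1)] by blast+
   ultimately show ?thesis using T(3) by simp
  qed simp
 qed
 also have "... <= ennreal B" using F(1) unfolding nn_integral_lebesgue_on[OF Om_measurable] .
 finally have S: "(\<Sum>T\<in>\<T>. \<integral>\<^sup>+x. ennreal (?h T x) \<partial>lborel) <= ennreal B"
  using hm by (subst (asm) nn_integral_sum) auto
 show i: "integrable lborel (?h T)" if T: "T \<in> \<T>" for T
 proof (rule integrableI_nonneg[OF hm[OF T]])
  have "(\<integral>\<^sup>+x. ennreal (?h T x) \<partial>lborel) <= (\<Sum>T\<in>\<T>. \<integral>\<^sup>+x. ennreal (?h T x) \<partial>lborel)"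
   by (rule member_le_sum[OF T]) (simp_all add: finite_\<T>)
  also note S
  finally show "(\<integral>\<^sup>+x. ennreal (?h T x) \<partial>lborel) < \<infinity>" by (rule order.strict_trans1) simp
 qed (use nn[OF T] in simp)
 have "(\<integral>\<^sup>+x. ennreal (?h T x) \<partial>lborel) = ennreal (LBINT x. ?h T x)" if "T \<in> \<T>" for T
  by (rule nn_integral_eq_integral[OF i[OF that]]) (use nn[OF that] in simp)
 hence "(\<Sum>T\<in>\<T>. \<integral>\<^sup>+x. ennreal (?h T x) \<partial>lborel) = ennreal (\<Sum>T\<in>\<T>. LBINT x. ?h T x)"
  using nn by (subst sum_ennreal[symmetric]) (auto intro!: sum.cong integral_nonneg_AE)
 with S F(2) show "(\<Sum>T\<in>\<T>. LBINT x. ?h T x) <= B" by simp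
qed

text \<open>The hypothesis on \<open>\<gamma>max\<close> is used for step functions as weights only.
  The weighted norm of the projection is then a sum over simplices, in which
  \<open>poly_sup_le_L2\<close> bounds the maxima.\<close>

lemma worst_grading_stable:
 assumes wg: "worst_grading Om \<T> R K \<gamma>max C" and \<gamma>: "1 <= \<gamma>" "ereal \<gamma> < \<gamma>max"
 shows "stable (poly_mass DIM('a) K * (C \<gamma>)^2) \<gamma>" unfolding stable_def
proof (intro allI impI)
 fix s F w a
 assume s: "graded \<gamma> s" and Fm: "F \<in> borel_measurable borel" and w: "is_proj F w"
  and Fa: "\<forall>T\<in>\<T>. \<forall>x\<in>interior T. \<bar>F x\<bar> <= a T"
 let ?\<rho> = "step_weight s" and ?Cm = "poly_mass DIM('a) K"
 have a0: "0 <= a T" if "T \<in> \<T>" for T using Fa that simplex_meets_domain(1)[OF that] by (meson abs_ge_zero order.trans)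
 have nnF: "(\<integral>\<^sup>+x. ennreal (norm (r x * F x) powr 2) \<partial>lebesgue_on Om) <= ennreal (\<Sum>T\<in>\<T>. vol T * (t T * a T)^2)"
  if r: "!!T x. T \<in> \<T> ==> x \<in> interior T ==> r x = t T" for r t
 proof (rule nn_integral_le_sum)
  fix T assume T: "T \<in> \<T>"
  have "norm (r x * F x) powr 2 <= (t T * a T)^2" if x: "x \<in> interior T" for x
  proof -
   have "(r x)^2 * (F x)^2 <= (t T)^2 * (a T)^2"
    using Fa T x r[OF T x] power_mono[of "\<bar>F x\<bar>" "a T" 2] by (intro mult_mono) auto
   thus ?thesis by (simp add: power_mult_distrib)
  qed
  thus "AE x\<in>interior T in lborel. norm (r x * F x) powr 2 <= (t T * a T)^2" by simp
 qed simp
 have two: "enn2real 2 = 2" "(1::ennreal) <= 2" "(2::ennreal) \<noteq> \<infinity>" by simp_all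
 have FL: "F \<in> Lp_space Om 2"
 proof -
  have "Lp_norm Om 2 F <= ennreal (sqrt (\<Sum>T\<in>\<T>. vol T * (a T)^2))"
   using nnF[of "%x. 1" "%T. 1"] by (subst Lp_norm_le_iff[OF two(2,3)]) (simp_all add: sum_nonneg)
  thus ?thesis using borel_measurable_lebesgue_on[OF Fm] by (auto simp: Lp_space_def intro: order.strict_trans1)
 qed
 have Fi: "integrable (lebesgue_on Om) F"
 proof (rule integrableI_bounded[OF borel_measurable_lebesgue_on[OF Fm]])
  have "(\<integral>\<^sup>+x. ennreal (norm (F x)) \<partial>lebesgue_on Om) <= ennreal (\<Sum>T\<in>\<T>. vol T * a T)"
   by (rule nn_integral_le_sum) (use Fa a0 in auto)
  thus "(\<integral>\<^sup>+x. ennreal (norm (F x)) \<partial>lebesgue_on Om) < \<infinity>" by (auto intro: order.strict_trans1)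
 qed
 have Qw: "L2_projection Om \<T> K F x = w x" if "x \<in> Om" for x
  by (rule is_proj_unique[OF L2_projection_is_proj[OF Fi Fm] w that]) simp
 define J where "J = (\<Sum>T\<in>\<T>. (s T)^2 * vol T * (a T)^2)"
 have J0: "0 <= J" unfolding J_def by (intro sum_nonneg) auto
 have "Lp_norm Om 2 (%x. ?\<rho> x * F x) <= ennreal (sqrt J)" using nnF[of ?\<rho> s] J0 step_weight_eq
  by (subst Lp_norm_le_iff[OF two(2,3)]) (simp_all add: J_def power_mult_distrib mult_ac)
 \<comment> \<open>\<open>C \<gamma>\<close> may be negative, where \<open>ennreal\<close> truncates
   to 0; the absolute value covers both cases and is squared in the end.\<close>
 hence "ennreal (C \<gamma>) * Lp_norm Om 2 (%x. ?\<rho> x * F x) <= ennreal \<bar>C \<gamma>\<bar> * ennreal (sqrt J)"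
  by (intro mult_mono ennreal_leI) auto
 moreover have "Lp_norm Om 2 (%x. ?\<rho> x * L2_projection Om \<T> K F x) <= ennreal (C \<gamma>) * Lp_norm Om 2 (%x. ?\<rho> x * F x)"
  using wg \<gamma> step_weight_graded[OF s \<gamma>(1)] FL unfolding worst_grading_def by blast
 ultimately have "Lp_norm Om 2 (%x. ?\<rho> x * L2_projection Om \<T> K F x) <= ennreal (\<bar>C \<gamma>\<bar> * sqrt J)"
  using J0 by (simp add: ennreal_mult)
 moreover have "0 <= \<bar>C \<gamma>\<bar> * sqrt J" using J0 by simp
 ultimately have "(\<integral>\<^sup>+x. ennreal (norm (?\<rho> x * L2_projection Om \<T> K F x) powr 2) \<partial>lebesgue_on Om) <= ennreal ((\<bar>C \<gamma>\<bar> * sqrt J) powr 2)"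
  using Lp_norm_le_iff[OF two(2,3), THEN iffD1, unfolded two(1)] by blast
 also have "(\<bar>C \<gamma>\<bar> * sqrt J) powr 2 = (C \<gamma>)^2 * J" using J0 by (simp add: power_mult_distrib)
 finally have nn: "(\<integral>\<^sup>+x. ennreal (norm (?\<rho> x * L2_projection Om \<T> K F x) powr 2) \<partial>lebesgue_on Om) <= ennreal ((C \<gamma>)^2 * J)" .
 have wV: "w \<in> V" using w by (simp add: is_proj_def)
 have "\<exists>q. poly_deg_le K q \<and> (\<forall>x\<in>Om \<inter> T. w x = q x)" if "T \<in> \<T>" for T using V_poly[OF wV that] by metis
 then obtain q where q: "!!T. T \<in> \<T> ==> poly_deg_le K (q T)" "!!T x. T \<in> \<T> ==> x \<in> Om \<inter> T ==> w x = q T x"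
  by metis
 have le: "(\<Sum>T\<in>\<T>. LBINT x. ind T x * ((s T)^2 * (q T x)^2)) <= (C \<gamma>)^2 * J"
 proof (rule sum_simplex_integrals_le(2)[OF nn])
  show "(%x. (s T)^2 * (q T x)^2) \<in> borel_measurable borel" if "T \<in> \<T>" for T
   by (intro borel_measurable_continuous_onI continuous_intros smooth_fun_continuous[OF poly_smooth[OF q(1)[OF that]]])
  show "AE x\<in>interior T in lborel. ennreal ((s T)^2 * (q T x)^2) <= ennreal (norm (?\<rho> x * L2_projection Om \<T> K F x) powr 2)"
   if T: "T \<in> \<T>" for T
  proof (intro AE_I2 impI)
   fix x assume x: "x \<in> interior T"
   hence "x \<in> Om \<inter> T" using interior_simplex_subset[OF T] interior_subset by blast
   thus "ennreal ((s T)^2 * (q T x)^2) <= ennreal (norm (?\<rho> x * L2_projection Om \<T> K F x) powr 2)"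
    using Qw[of x] q(2)[OF T, of x] step_weight_eq[OF T x] by (simp add: power_mult_distrib)
  qed
 qed (use J0 in auto)
 have "(s T)^2 * vol T * (sup_on w T)^2 <= ?Cm * (LBINT x. ind T x * ((s T)^2 * (q T x)^2))"
  if T: "T \<in> \<T>" for T
 proof -
  define I where "I = (LBINT x. ind T x * (q T x)^2)"
  have m: "0 < vol T" by (rule measure_simplex_pos[OF T])
  have I0: "0 <= ?Cm * I" unfolding I_def using poly_mass_pos[of "DIM('a)" K] by (intro mult_nonneg_nonneg integral_nonneg_AE) auto
  have "sup_on w T <= sqrt (?Cm * I / vol T)"
  proof (rule sup_on_least[OF T])
   fix x assume x: "x \<in> Om \<inter> T"
   have "(w x)^2 <= ?Cm * I / vol T"
    using poly_sup_le_L2[OF simplex_\<T>[OF T] q(1)[OF T], of x] q(2)[OF T x] x m by (simp add: I_def le_divide_eq)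
   hence "sqrt ((w x)^2) <= sqrt (?Cm * I / vol T)" by (rule real_sqrt_le_mono)
   thus "\<bar>w x\<bar> <= sqrt (?Cm * I / vol T)" by simp
  qed
  hence "(sup_on w T)^2 <= (sqrt (?Cm * I / vol T))^2" by (rule power_mono) (rule sup_on_nonneg[OF wV T])
  hence "vol T * (sup_on w T)^2 <= ?Cm * I" using m I0 by (simp add: field_simps)
  hence "(s T)^2 * (vol T * (sup_on w T)^2) <= (s T)^2 * (?Cm * I)" by (intro mult_left_mono) auto

  also have "... = ?Cm * (LBINT x. ind T x * ((s T)^2 * (q T x)^2))" unfolding I_def by (subst (2) mult.left_commute) simp
  finally show ?thesis by (simp only: mult_ac)
 qed
 hence "(\<Sum>T\<in>\<T>. (s T)^2 * vol T * (sup_on w T)^2) <= ?Cm * (\<Sum>T\<in>\<T>. LBINT x. ind T x * ((s T)^2 * (q T x)^2))"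
  unfolding sum_distrib_left by (rule sum_mono)
 also have "... <= ?Cm * ((C \<gamma>)^2 * J)" using le poly_mass_pos[of "DIM('a)" K] by (intro mult_left_mono) auto
 finally show "(\<Sum>T\<in>\<T>. (s T)^2 * vol T * (sup_on w T)^2) <=
   ?Cm * (C \<gamma>)^2 * (\<Sum>T\<in>\<T>. (s T)^2 * vol T * (a T)^2)" by (simp only: J_def mult.assoc)
  qed

end

section \<open>Discrete p-norms on the mesh\<close>

context mesh
begin

text \<open>The statement that the p-norm of the step function with values \<open>z T\<close> is at
  most \<open>N\<close>, as a predicate: finite p and infinity can then be treated through the same
  closure rules.\<close>

definition meshbd :: "ennreal => ('a set => real) => real => bool" where
 "meshbd p z N \<longleftrightarrow> 0 <= N \<and> (\<forall>T\<in>\<T>. 0 <= z T) \<and> (if p = \<infinity> then \<forall>T\<in>\<T>. z T <= N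
   else (\<Sum>T\<in>\<T>. vol T * z T powr enn2real p) <= N powr enn2real p)"

lemma meshbd_mono:
 assumes z: "meshbd p z N" and z': "!!T. T \<in> \<T> ==> 0 <= z' T" "!!T. T \<in> \<T> ==> z' T <= z T"
 shows "meshbd p z' N"
proof (cases "p = \<infinity>")
 case False
 have "(\<Sum>T\<in>\<T>. vol T * z' T powr enn2real p) <= (\<Sum>T\<in>\<T>. vol T * z T powr enn2real p)"
  using z' by (intro sum_mono mult_left_mono powr_mono2) auto
 thus ?thesis using z z'(1) False by (simp add: meshbd_def)
qed (use z z' in \<open>force simp: meshbd_def intro: order.trans\<close>)

lemma meshbd_scale:
 assumes z: "meshbd p z N" and c: "0 <= c" shows "meshbd p (%T. c * z T) (c * N)"
proof -
 have "(\<Sum>T\<in>\<T>. vol T * (c * z T) powr q) = c powr q * (\<Sum>T\<in>\<T>. vol T * z T powr q)" for q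
  by (simp add: powr_mult sum_distrib_left mult_ac)
 thus ?thesis using z c unfolding meshbd_def by (auto split: if_splits simp: powr_mult intro!: mult_left_mono)
qed

end

lemma powr_add_le:
 assumes "0 <= x" "0 <= y" "1 <= (q::real)" shows "(x + y) powr q <= 2 powr q * (x powr q + y powr q)"
proof -
 have "(x + y) powr q <= (2 * max x y) powr q" using assms by (intro powr_mono2) auto
 also have "... = 2 powr q * max x y powr q" by (simp add: powr_mult)
 also have "... <= 2 powr q * (x powr q + y powr q)" by (intro mult_left_mono) (auto simp: max_def)
 finally show ?thesis .
qed

lemma le_powr_self: "1 <= x ==> 1 <= q ==> x <= x powr (q::real)" using powr_mono[of 1 q x] by simp

context mesh
begin

text \<open>A triangle inequality with the crude constant 4, which absorbs the factor
  \<open>2 powr q * 2\<close> by \<open>2 <= 2 powr q\<close>.\<close>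

lemma meshbd_add:
 assumes p: "1 <= p" and z: "meshbd p z N" and z': "meshbd p z' N'"
 shows "meshbd p (%T. z T + z' T) (4 * (N + N'))"
proof (cases "p = \<infinity>")
 case True
 thus ?thesis using z z' by (fastforce simp: meshbd_def)
next
 case False
 define q where "q = enn2real p"
 have q: "1 <= q" unfolding q_def by (rule Lp_exponent[OF p False])
 have nn: "!!T. T \<in> \<T> ==> 0 <= z T" "!!T. T \<in> \<T> ==> 0 <= z' T" "0 <= N" "0 <= N'" using z z' by (auto simp: meshbd_def)
 have "(\<Sum>T\<in>\<T>. vol T * (z T + z' T) powr q) <= (\<Sum>T\<in>\<T>. vol T * (2 powr q * (z T powr q + z' T powr q)))"
  using nn q by (intro sum_mono mult_left_mono powr_add_le) auto
 also have "... = 2 powr q * ((\<Sum>T\<in>\<T>. vol T * z T powr q) + (\<Sum>T\<in>\<T>. vol T * z' T powr q))"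
  by (simp add: sum_distrib_left sum.distrib algebra_simps)
 also have "... <= 2 powr q * ((N + N') powr q + (N + N') powr q)"
 proof (intro mult_left_mono add_mono)
  have "N powr q <= (N + N') powr q" "N' powr q <= (N + N') powr q" using nn q by (auto intro!: powr_mono2)
  thus "(\<Sum>T\<in>\<T>. vol T * z T powr q) <= (N + N') powr q" "(\<Sum>T\<in>\<T>. vol T * z' T powr q) <= (N + N') powr q"
   using z z' False by (auto simp: meshbd_def q_def)
 qed simp
 also have "... = 2 powr q * 2 * (N + N') powr q" by simp
 also have "... <= 2 powr q * 2 powr q * (N + N') powr q" using le_powr_self[of 2 q] q by (intro mult_right_mono mult_left_mono) auto
 also have "... = (4 * (N + N')) powr q" by (simp flip: powr_mult)
 finally show ?thesis using nn False by (simp add: meshbd_def q_def)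
qed

end

context mesh_shape
begin

text \<open>The sum over a patch is at most \<open>npatch\<close> times its largest term, and by
  symmetry each simplex lies in at most \<open>npatch\<close> patches. This accounts for the square;
  \<open>cvol\<close> exchanges the volumes.\<close>

lemma meshbd_patch:
 assumes p: "1 <= p" and y: "meshbd p y N"
 shows "meshbd p (%T. \<Sum>S\<in>patch T. y S) (real npatch ^ 2 * cvol * N)"
proof -
 define n where "n = real npatch"
 have n: "1 <= n" unfolding n_def by (rule npatch)
 have nn: "!!T. T \<in> \<T> ==> 0 <= y T" "0 <= N" using y by (auto simp: meshbd_def)
 have s0: "0 <= (\<Sum>S\<in>patch T. y S)" if "T \<in> \<T>" for T using nn patch_in[OF _ that] by (intro sum_nonneg) auto
 have max: "\<exists>S\<in>patch T. (\<Sum>S\<in>patch T. y S) <= n * y S" if T: "T \<in> \<T>" for T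
 proof -
  have "Max (y ` patch T) \<in> y ` patch T" using card_patch(1)[OF T] patch_refl[OF T] by (intro Max_in) auto
  then obtain S where S: "S \<in> patch T" "y S = Max (y ` patch T)" by auto
  have "(\<Sum>S\<in>patch T. y S) <= real (card (patch T)) * y S" using S(2) card_patch(1)[OF T] by (intro sum_bounded_above) auto
  also have "... <= n * y S" using card_patch(2)[OF T] nn(1)[OF patch_in[OF S(1) T]] by (intro mult_right_mono) (auto simp: n_def)
  finally show ?thesis using S(1) by blast
 qed
 have nc: "1 <= n^2 * cvol" using n cvol mult_mono[of 1 "n^2" 1 cvol] by simp
 show ?thesis
 proof (cases "p = \<infinity>")
  case True
  have "(\<Sum>S\<in>patch T. y S) <= n^2 * cvol * N" if T: "T \<in> \<T>" for T
  proof -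
   obtain S where S: "S \<in> patch T" "(\<Sum>S\<in>patch T. y S) <= n * y S" using max[OF T] by blast
   hence "(\<Sum>S\<in>patch T. y S) <= n * N" using y True patch_in[OF S(1) T] n by (auto simp: meshbd_def intro: order.trans)
   also have "n * N <= (n^2 * cvol) * N"
    using n cvol nn(2) mult_mono[of n "n^2" 1 cvol] by (intro mult_right_mono) (auto simp: power2_eq_square)
   finally show ?thesis .
  qed
  thus ?thesis using True s0 nn nc by (simp add: meshbd_def n_def)
 next
  case False
  define q where "q = enn2real p"
  have q: "1 <= q" unfolding q_def by (rule Lp_exponent[OF p False])
  define P where "P T = (if T \<in> \<T> then patch T else {})" for T
  have "(\<Sum>T\<in>\<T>. vol T * (\<Sum>S\<in>patch T. y S) powr q) <=
    (\<Sum>T\<in>\<T>. \<Sum>S\<in>\<T>. if S \<in> patch T then n powr q * (cvol * (vol S * y S powr q)) else 0)" proof (rule sum_mono)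
   fix T assume T: "T \<in> \<T>"
   obtain S where S: "S \<in> patch T" "(\<Sum>S\<in>patch T. y S) <= n * y S" using max[OF T] by blast
   have S\<T>: "S \<in> \<T>" by (rule patch_in[OF S(1) T])
   have "(\<Sum>S\<in>patch T. y S) powr q <= (n * y S) powr q" using S(2) q s0[OF T] by (intro powr_mono2) auto
   hence "vol T * (\<Sum>S\<in>patch T. y S) powr q <= (cvol * vol S) * (n * y S) powr q"
    using patch_measure[OF S\<T> patch_sym[OF S(1) T]] cvol by (intro mult_mono) auto
   also have "... = (if S \<in> patch T then n powr q * (cvol * (vol S * y S powr q)) else 0)" using S(1) by (simp add: powr_mult)
   also have "... <= (\<Sum>S\<in>\<T>. if S \<in> patch T then n powr q * (cvol * (vol S * y S powr q)) else 0)"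
    by (rule member_le_sum[OF S\<T>]) (use finite_\<T> cvol in auto)
   finally show "vol T * (\<Sum>S\<in>patch T. y S) powr q <= ..." .
  qed
  also have "... = (\<Sum>S\<in>\<T>. real (card {T \<in> \<T>. S \<in> patch T}) * (n powr q * (cvol * (vol S * y S powr q))))"
   by (subst sum.swap) (simp add: sum.If_cases finite_\<T> Int_def)
  also have "... <= (\<Sum>S\<in>\<T>. n * (n powr q * (cvol * (vol S * y S powr q))))"
  proof (intro sum_mono mult_right_mono)
   fix S assume S: "S \<in> \<T>"
   have "card {T \<in> \<T>. S \<in> patch T} <= card (patch S)" by (rule card_mono[OF card_patch(1)[OF S]]) (use patch_sym in blast)
   thus "real (card {T \<in> \<T>. S \<in> patch T}) <= n" using card_patch(2)[OF S] by (simp add: n_def)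
  qed (use cvol in auto)
  also have "... = (n * n powr q * cvol) * (\<Sum>S\<in>\<T>. vol S * y S powr q)" by (simp add: sum_distrib_left mult_ac)
  also have "... <= (n powr q * n powr q * cvol powr q) * N powr q" using y False cvol le_powr_self[OF n q] le_powr_self[OF cvol q]
   by (intro mult_mono) (auto simp: meshbd_def q_def intro!: sum_nonneg)
  also have "... = (n^2 * cvol * N) powr q" by (simp add: powr_mult power2_eq_square)
  finally show ?thesis using False s0 nn nc by (simp add: meshbd_def n_def q_def)
 qed
qed

end

context mesh_fem
begin

lemma meshbd_norm_upper:
 assumes p: "1 <= p" and z: "meshbd p z N" and f: "f \<in> borel_measurable (lebesgue_on Om)"
  and le: "!!T. T \<in> \<T> ==> AE x\<in>interior T in lborel. norm (f x) <= z T"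
 shows "Lp_norm Om p f <= ennreal N"
proof -
 have N: "0 <= N" and z0: "!!T. T \<in> \<T> ==> 0 <= z T" using z by (auto simp: meshbd_def)
 show ?thesis
 proof (cases "p = \<infinity>")
  case True
  have "AE x in lborel. \<forall>T\<in>\<T>. x \<in> interior T --> norm (f x) <= z T" using le by (intro AE_finite_allI[OF finite_\<T>])
  hence "AE x\<in>Om in lborel. norm (f x) <= N"
   using AE_interior by eventually_elim (use z True in \<open>fastforce simp: meshbd_def intro: order.trans\<close>)
  hence "AE x in lebesgue_on Om. ennreal (norm (f x)) <= ennreal N"
   unfolding AE_lebesgue_on[OF Om_measurable] by (auto intro: ennreal_leI)
  thus ?thesis using True f by (auto simp: Lp_norm_def)
 next
  case False
  have q: "1 <= enn2real p" by (rule Lp_exponent[OF p False])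
  have "(\<integral>\<^sup>+x. ennreal (norm (f x) powr enn2real p) \<partial>lebesgue_on Om) <= ennreal (\<Sum>T\<in>\<T>. vol T * z T powr enn2real p)"
  proof (rule nn_integral_le_sum)
   show "AE x\<in>interior T in lborel. norm (f x) powr enn2real p <= z T powr enn2real p" if "T \<in> \<T>" for T
    using le[OF that] by eventually_elim (use q in \<open>auto intro: powr_mono2\<close>)
  qed simp
  also have "... <= ennreal (N powr enn2real p)" using z False by (intro ennreal_leI) (simp add: meshbd_def)
  finally show ?thesis using Lp_norm_le_iff[OF p False N] by blast
 qed
qed

end

text \<open>Jensen's inequality up to a factor. With \<open>y\<close> half the mean,
  \<open>k <= y + y powr (1 - q) * k powr q\<close> holds pointwise, and after integration half of
  the left side survives.\<close>

lemma mean_powr_le: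
 fixes k :: "'a::euclidean_space => real"
 assumes q: "1 <= q" and m: "0 < vol T" "T \<in> sets lborel" "emeasure lborel T < \<infinity>" and k: "!!x. 0 <= k x"
  and i: "integrable lborel (%x. ind T x * k x)" "integrable lborel (%x. ind T x * k x powr q)"
 shows "vol T * ((LBINT x. ind T x * k x) / vol T) powr q <= 2 powr q * (LBINT x. ind T x * k x powr q)"
proof -
 define m where "m = vol T"
 define y where "y = (LBINT x. ind T x * k x) / m / 2"
 define J where "J = (LBINT x. ind T x * k x powr q)"
 have m0: "0 < m" using m(1) by (simp add: m_def)
 have y0: "0 <= y" unfolding y_def using m0 k by (intro divide_nonneg_pos integral_nonneg_AE) auto
 have J0: "0 <= J" unfolding J_def by simp
 have "m * y powr q <= J"
 proof (cases "y = 0")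
  case False
  hence yp: "0 < y" using y0 by simp
  have iT: "integrable lborel (%x. ind T x * y)" using m by (intro integrable_mult_left integrable_real_indicator) auto
  have "2 * (m * y) = (LBINT x. ind T x * k x)" using m0 by (simp add: y_def)
  also have "... <= (LBINT x. ind T x * y + y powr (1 - q) * (ind T x * k x powr q))"
  proof (rule integral_mono[OF i(1) Bochner_Integration.integrable_add[OF iT integrable_mult_right[OF i(2)]]])
   fix x
   have "k x <= y + y powr (1 - q) * k x powr q"
   proof (cases "k x <= y")
    case True
    thus ?thesis by (simp add: add_increasing2)
   next
    case False
    hence kx: "0 < k x" using yp by linarith
    have "k x = k x powr (1 - q) * k x powr q" using kx by (simp flip: powr_add)
    also have "... <= y powr (1 - q) * k x powr q" using False yp q by (intro mult_right_mono powr_mono2') auto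
    finally show ?thesis using yp by linarith
   qed
   thus "ind T x * k x <= ind T x * y + y powr (1 - q) * (ind T x * k x powr q)" by (simp add: indicator_def)
  qed
  also have "... = m * y + y powr (1 - q) * J" using iT i(2) by (simp add: m_def J_def)
  finally have "y powr (q - 1) * (m * y) <= y powr (q - 1) * (y powr (1 - q) * J)" by (intro mult_left_mono) auto
  moreover have "y powr (q - 1) * y = y powr q" using powr_mult_base[of y "q - 1"] yp by (simp add: mult.commute)
  moreover have "y powr (q - 1) * y powr (1 - q) = 1" using yp by (simp flip: powr_add)
  ultimately show ?thesis by (simp only: mult.left_commute[of "y powr (q - 1)" m y] mult.assoc[symmetric, of "y powr (q - 1)" "y powr (1 - q)" J])
 qed (use J0 in simp)

 moreover have "(2 * y) powr q = 2 powr q * y powr q" by (simp add: powr_mult)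
 ultimately show ?thesis by (simp add: m_def[symmetric] J_def[symmetric] y_def)
qed

context mesh_sobolev
begin

text \<open>Passes from the continuous norm to mean gradients on simplices. The factor 2 is the one
  lost in \<open>mean_powr_le\<close>.\<close>

lemma meshbd_norm_lower:
 assumes p: "1 <= p" and \<sigma>: "!!T. T \<in> \<T> ==> 0 < \<sigma> T" "!!T. T \<in> \<T> ==> AE x\<in>interior T in lborel. \<sigma> T <= \<rho> x"
  and k: "AE x\<in>Om in lborel. g x = k x" and N: "0 <= N" "Lp_norm Om p (%x. \<rho> x *\<^sub>R k x) <= ennreal N"
 shows "meshbd p (%T. \<sigma> T * (mass g T / vol T)) (2 * N)"
proof -
 have nn: "0 <= \<sigma> T * (mass g T / vol T)" if "T \<in> \<T>" for T using \<sigma>(1)[OF that] mass_nonneg[of g T] by simp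
 have rT: "AE x\<in>interior T in lborel. \<sigma> T * norm (g x) <= norm (\<rho> x *\<^sub>R k x)" if T: "T \<in> \<T>" for T
  using \<sigma>(2)[OF T] k by eventually_elim (use interior_simplex_subset[OF T] in \<open>auto intro!: mult_right_mono\<close>)
 have ig: "integrable lborel (%x. ind T x * norm (g x))" if T: "T \<in> \<T>" for T
  using integrable_mult_indicator[OF _ integrable_norm[OF g_integrable], of T] simplex_measurable[OF T] by simp
 show ?thesis
 proof (cases "p = \<infinity>")
  case True
  have "AE x in lebesgue_on Om. ennreal (norm (\<rho> x *\<^sub>R k x)) <= Lp_norm Om p (%x. \<rho> x *\<^sub>R k x)"
   using True esssup_AE[of "%x. ennreal (norm (\<rho> x *\<^sub>R k x))" "lebesgue_on Om"] by (simp add: Lp_norm_def)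
  hence b: "AE x\<in>Om in lborel. norm (\<rho> x *\<^sub>R k x) <= N"
   unfolding AE_lebesgue_on[OF Om_measurable] using N by (auto elim!: eventually_mono dest: order.trans)
  have "\<sigma> T * (mass g T / vol T) <= 2 * N" if T: "T \<in> \<T>" for T
  proof -
   have m: "0 < vol T" by (rule measure_simplex_pos[OF T])
   have iN: "integrable lborel (%x. ind T x * N)"
    using simplex_measurable[OF T] finite_measure_simplex[OF T] by (intro integrable_mult_left integrable_real_indicator) auto
   have "\<sigma> T * mass g T = (LBINT x. \<sigma> T * (ind T x * norm (g x)))" by (simp add: mass_def)
   also have "... <= (LBINT x. ind T x * N)"
   proof (rule integral_mono_AE[OF integrable_mult_right[OF ig[OF T]] iN])
    show "AE x in lborel. \<sigma> T * (ind T x * norm (g x)) <= ind T x * N" using rT[OF T] b skeleton_null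
    proof eventually_elim
     case (elim x)
     show ?case
     proof (cases "x \<in> T")
      case True
      hence "x \<in> interior T" using elim T by blast
      moreover have "x \<in> Om" using \<open>x \<in> interior T\<close> interior_simplex_subset[OF T] by blast
      ultimately show ?thesis using elim True by auto
     qed simp
    qed
   qed

   finally have "\<sigma> T * (mass g T / vol T) <= N" using m by (simp add: field_simps)
   thus ?thesis using N by simp
  qed
  thus ?thesis using True nn N by (simp add: meshbd_def)
 next
  case False
  define q where "q = enn2real p"
  have q: "1 <= q" unfolding q_def by (rule Lp_exponent[OF p False])
  have nn': "(\<integral>\<^sup>+x. ennreal (norm (\<rho> x *\<^sub>R k x) powr q) \<partial>lebesgue_on Om) <= ennreal (N powr q)"
   unfolding q_def by (rule Lp_norm_le_iff[OF p False N(1), THEN iffD1, OF N(2)])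
  have rq: "AE x\<in>interior T in lborel. ennreal ((\<sigma> T * norm (g x)) powr q) <= ennreal (norm (\<rho> x *\<^sub>R k x) powr q)"
   if T: "T \<in> \<T>" for T using rT[OF T] by eventually_elim (use q \<sigma>(1)[OF T] in \<open>auto intro!: ennreal_leI powr_mono2\<close>)
  have m: "(%x. (\<sigma> T * norm (g x)) powr q) \<in> borel_measurable borel" for T using g_measurable by measurable
  note I = sum_simplex_integrals_le[OF nn' _ m _ rq, simplified]
  have le: "vol T * (\<sigma> T * (mass g T / vol T)) powr q <=
    2 powr q * (LBINT x. ind T x * (\<sigma> T * norm (g x)) powr q)" if T: "T \<in> \<T>" for T proof -
   have i1: "integrable lborel (%x. ind T x * (\<sigma> T * norm (g x)))"
    using integrable_mult_right[OF ig[OF T], of "\<sigma> T"] by (simp add: mult_ac)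
   have "vol T * ((LBINT x. ind T x * (\<sigma> T * norm (g x))) / vol T) powr q <=
     2 powr q * (LBINT x. ind T x * (\<sigma> T * norm (g x)) powr q)"
    by (rule mean_powr_le[OF q measure_simplex_pos[OF T] _ finite_measure_simplex[OF T] _ i1 I(1)[OF T]])
     (use simplex_measurable[OF T] \<sigma>(1)[OF T] in auto)
   also have "(LBINT x. ind T x * (\<sigma> T * norm (g x))) = \<sigma> T * mass g T" by (simp add: mass_def mult.left_commute)
   finally show ?thesis by simp
  qed
  have "(\<Sum>T\<in>\<T>. vol T * (\<sigma> T * (mass g T / vol T)) powr q) <=
    2 powr q * (\<Sum>T\<in>\<T>. LBINT x. ind T x * (\<sigma> T * norm (g x)) powr q)" unfolding sum_distrib_left by (intro sum_mono le)
  also have "... <= 2 powr q * N powr q" using I(2) by (intro mult_left_mono) auto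
  also have "... = (2 * N) powr q" by (simp add: powr_mult)
  finally show ?thesis using False nn N by (simp add: meshbd_def q_def)
 qed
qed

end

section \<open>The gradient of the projection\<close>

lemma vol_const_pos:
 assumes "1 <= c" "1 <= B" "0 <= \<theta>" "\<theta> < 1" shows "0 < vol_const d c B \<theta>"
proof -
 have "(\<Sum>N. real (N + 1) ^ d * \<theta> ^ N) >= (\<Sum>N<1. real (N + 1) ^ d * \<theta> ^ N)"
  by (rule sum_le_suminf[OF summable_poly_geometric[OF assms(3,4)]]) (use assms in auto)
 thus ?thesis using assms by (auto simp: vol_const_def)
qed

context mesh_shape
begin

lemma graded_mono:
 assumes "graded \<gamma> s" "\<gamma> <= \<gamma>'" shows "graded \<gamma>' s"
proof -
 have "s T' <= \<gamma>' * s T" if R: "(T, T') \<in> R" for T T'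
 proof -
  have "s T' <= \<gamma> * s T" "0 < s T" using assms(1) R R_in[OF R] by (auto simp: graded_def)
  thus ?thesis using assms(2) by (meson less_imp_le mult_right_mono order.trans)
 qed
 thus ?thesis using assms(1) by (auto simp: graded_def)
qed

end

text \<open>For finite p the alternatives are the constants \<open>D\<close> of the three regimes
  for p-th powers. Adding 1 gives a constant for the norms, as
  \<open>D <= (1 + D) powr q\<close>.\<close>

definition ext_const :: "ennreal => real => real => real" where "ext_const p A c = (if p = \<infinity> then sqrt (A * c) else let q = enn2real p in
   1 + (if q = 2 then A else if 2 < q then 2 * (A * (1 / (2 * (A + 1) * c)) powr - ((q - 2) / 2)) else A + c))"

text \<open>The exponent that the summability condition imposes on the decay of \<^const>\<open>mesh_shape.spread\<close>.\<close>

definition ext_exponent :: "ennreal => real" where "ext_exponent p = (if p = \<infinity> then 1 else enn2real p / \<bar>enn2real p - 2\<bar>)"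

lemma ext_const_nonneg: "0 <= A ==> 0 < c ==> 0 <= ext_const p A c" by (auto simp: ext_const_def Let_def)

context mesh_fem
begin

lemma extrapolate:
 assumes p: "1 <= p" and st: "stable A \<gamma>'" and A: "0 <= A" and F: "F \<in> borel_measurable borel" "is_proj F e"
  "!!T x. T \<in> \<T> ==> x \<in> interior T ==> \<bar>F x\<bar> <= a T"
  and \<tau>: "graded \<gamma> \<tau>" "0 < \<gamma>" "\<gamma> <= \<gamma>'" and c: "0 < c"
  and vol: "!!S. p \<noteq> 2 ==> S \<in> \<T> ==> (\<Sum>T\<in>\<T>. vol T * ((\<gamma> / \<gamma>')\<^sup>2 powr ext_exponent p) ^ mesh_dist R T S) <= c * vol S"
  and N: "meshbd p (%T. \<tau> T * a T) N"
 shows "meshbd p (%T. \<tau> T * sup_on e T) (ext_const p A c * N)"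
proof -
 \<comment> \<open>The largest decay that the slack permits:
   \<open>\<gamma> / sqrt \<kappa> = \<gamma>'\<close>.\<close>
 define \<kappa> where "\<kappa> = (\<gamma> / \<gamma>')^2"
 have \<kappa>: "0 < \<kappa>" "\<kappa> <= 1" "\<gamma> / sqrt \<kappa> <= \<gamma>'" using \<tau>(2,3) by (simp_all add: \<kappa>_def power_le_one)
 have eV: "e \<in> V" using F(2) by (simp add: is_proj_def)
 have tp: "0 < \<tau> T" if "T \<in> \<T>" for T using \<tau>(1) that by (simp add: graded_def)
 have ab: "0 <= a T" "0 <= sup_on e T" if T: "T \<in> \<T>" for T
  using F(3)[OF T simplex_meets_domain(1)[OF T]] sup_on_nonneg[OF eV T] by linarith+
 have N0: "0 <= N" using N by (simp add: meshbd_def)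
 have H: "(\<Sum>T\<in>\<T>. (s T)^2 * vol T * (sup_on e T)^2) <= A * (\<Sum>T\<in>\<T>. (s T)^2 * vol T * (a T)^2)"
  if "graded \<gamma>' s" for s using st that F unfolding stable_def by blast
 have b0: "0 <= \<tau> T * sup_on e T" if "T \<in> \<T>" for T using tp[OF that] ab[OF that] by simp
 note E0 = ext_const_nonneg[OF A c, of p]
 show ?thesis
 proof (cases "p = \<infinity>")
  case True
  have "\<tau> T * sup_on e T <= sqrt (A * c) * N" if T: "T \<in> \<T>" for T
  proof (rule extrapolate_infinity[OF H \<tau>(1,2) \<kappa>(3,1,2) A _ ab(1) _ T N0])
   show "(\<Sum>T\<in>\<T>. vol T * \<kappa> ^ mesh_dist R T S) <= c * vol S" if "S \<in> \<T>" for S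
    using vol[OF _ that] True \<kappa>(1) by (simp add: ext_exponent_def \<kappa>_def[symmetric])
  qed (use N True in \<open>auto simp: meshbd_def\<close>)
  thus ?thesis using True E0 N0 b0 by (simp add: meshbd_def ext_const_def)
 next
  case False
  define q where "q = enn2real p"
  have q: "1 <= q" unfolding q_def by (rule Lp_exponent[OF p False])
  define D where "D = ext_const p A c - 1"
  have D: "0 <= D" using False A c by (auto simp: D_def ext_const_def Let_def)
  have "(\<Sum>T\<in>\<T>. vol T * (\<tau> T * sup_on e T) powr q) <= D * (\<Sum>T\<in>\<T>. vol T * (\<tau> T * a T) powr q)"
  proof (cases q "2::real" rule: linorder_cases)
   case less
   hence p2: "p \<noteq> 2" by (auto simp: q_def)
   have "(\<Sum>T\<in>\<T>. vol T * (\<tau> T * sup_on e T) powr q) <= (A + c) * (\<Sum>T\<in>\<T>. vol T * (\<tau> T * a T) powr q)"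
   proof (rule extrapolate_below_2[OF H \<tau> \<kappa>(3,1,2) _ less A _ _ ab])
    show "(\<Sum>T\<in>\<T>. vol T * (\<kappa> powr (q / (2 - q))) ^ mesh_dist R T S) <= c * vol S" if "S \<in> \<T>" for S
     using vol[OF p2 that] False less by (simp add: ext_exponent_def \<kappa>_def[symmetric] q_def[symmetric])
   qed (use q c in auto)
   thus ?thesis using False less by (simp add: D_def ext_const_def q_def[symmetric])
  next
   case equal
   have "(\<Sum>T\<in>\<T>. vol T * (\<tau> T * sup_on e T)^2) <= A * (\<Sum>T\<in>\<T>. vol T * (\<tau> T * a T)^2)"
    using H[OF graded_mono[OF \<tau>(1,3)]] by (simp add: power_mult_distrib mult_ac)
   moreover have "(\<tau> T * sup_on e T)^2 = (\<tau> T * sup_on e T) powr 2" "(\<tau> T * a T)^2 = (\<tau> T * a T) powr 2" if "T \<in> \<T>" for T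
    using tp[OF that] ab[OF that] by (simp_all)
   ultimately show ?thesis using False equal by (simp add: D_def ext_const_def q_def[symmetric] del: powr_numeral)
  next
   case greater
   hence p2: "p \<noteq> 2" by (auto simp: q_def)
   have "(\<Sum>T\<in>\<T>. vol T * (\<tau> T * sup_on e T) powr q) <=
     2 * (A * (1 / (2 * (A + 1) * c)) powr - ((q - 2) / 2)) * (\<Sum>T\<in>\<T>. vol T * (\<tau> T * a T) powr q)"
   proof (rule extrapolate_above_2[OF H \<tau>(1,2) \<kappa>(3,1,2) greater A c _ ab])
    show "(\<Sum>T\<in>\<T>. vol T * (\<kappa> powr (q / (q - 2))) ^ mesh_dist R T S) <= c * vol S" if "S \<in> \<T>" for S
     using vol[OF p2 that] False greater by (simp add: ext_exponent_def \<kappa>_def[symmetric] q_def[symmetric])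
   qed
   thus ?thesis using False greater by (simp add: D_def ext_const_def q_def[symmetric])
  qed
  also have "... <= (1 + D) powr q * N powr q"
  proof (intro mult_mono)
   show "D <= (1 + D) powr q" using le_powr_self[of "1 + D" q] D q by linarith
   show "(\<Sum>T\<in>\<T>. vol T * (\<tau> T * a T) powr q) <= N powr q" using N False by (simp add: meshbd_def q_def)
  qed (auto intro!: sum_nonneg)
  also have "... = (ext_const p A c * N) powr q" by (simp add: D_def powr_mult)
  finally show ?thesis using False E0 N0 b0 by (simp add: meshbd_def q_def)
 qed
qed

end

lemma poly_bound_interior:
 assumes T: "full_simplex (T :: 'a::euclidean_space set)" and q: "poly_deg_le K q"
  and M: "!!x. x \<in> interior T ==> \<bar>q x\<bar> <= M" and x: "x \<in> T"
 shows "\<bar>q x\<bar> <= M"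
proof -
 have "closed {x. \<bar>q x\<bar> <= M}" by (intro closed_Collect_le continuous_intros smooth_fun_continuous[OF poly_smooth[OF q]])
 hence "closure (interior T) \<subseteq> {x. \<bar>q x\<bar> <= M}" using M by (intro closure_minimal) auto
 moreover have "closure (interior T) = T"
  using convex_closure_interior[OF full_simplex_convex[OF T] full_simplex_interior[OF T]] full_simplex_closed[OF T] by simp
 ultimately show ?thesis using x by blast
qed

context mesh_fem
begin

definition cgrad :: real where "cgrad = cs * (real (DIM('a) + 1) * cavg + bern_const DIM('a) K * real K)"

lemma cgrad_nonneg: "0 <= cgrad"
 unfolding cgrad_def using cs1 cavg_nonneg bern_const_pos[of "DIM('a)" K] by (intro mult_nonneg_nonneg add_nonneg_nonneg) auto

end

context mesh_sobolev
begin

text \<open>The projection is the interpolant plus the projection \<open>e\<close> of the remainder.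
  The first part varies like differences of averages, the second is bounded by the inverse
  inequality; both cost a division by the diameter.\<close>

lemma projection_lipschitz:
 assumes w: "is_proj v w"
 obtains F e where "F \<in> borel_measurable borel" "is_proj F e"
  "!!T x. T \<in> \<T> ==> x \<in> interior T ==> \<bar>F x\<bar> <= cloc * osc T"
  "!!T x y. T \<in> \<T> ==> x \<in> interior T ==> y \<in> interior T ==>
   \<bar>w x - w y\<bar> <= cgrad * (osc T + sup_on e T) / diameter T * norm (x - y)" proof - let ?\<pi> = "clement (avg v)"
 define e where "e = (%x. w x - ?\<pi> x)"
 obtain F where F: "F \<in> borel_measurable borel" "!!T x. T \<in> \<T> ==> x \<in> interior T ==> \<bar>F x\<bar> <= cloc * osc T" "is_proj F e"
  by (rule piecewise_remainder) (use w in \<open>simp add: e_def\<close>)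
 have eV: "e \<in> V" using F(3) by (simp add: is_proj_def)
 have lip: "\<bar>w x - w y\<bar> <= cgrad * (osc T + sup_on e T) / diameter T * norm (x - y)"
  if T: "T \<in> \<T>" and xy: "x \<in> interior T" "y \<in> interior T" for T x y
 proof -
  note S = simplex_\<T>[OF T]
  have inOm: "z \<in> Om \<inter> T" if "z \<in> interior T" for z using that interior_simplex_subset[OF T] interior_subset by blast
  define b where "b = bern_const DIM('a) K * real K"
  have b: "0 <= b" using bern_const_pos[of "DIM('a)" K] by (simp add: b_def)
  obtain q where q: "poly_deg_le K q" "!!x. x \<in> Om \<inter> T ==> e x = q x" using V_poly[OF eV T] by blast
  have qM: "\<bar>q z\<bar> <= sup_on e T" if "z \<in> T" for z
  proof (rule poly_bound_interior[OF S q(1) _ that])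
   show "\<bar>q x\<bar> <= sup_on e T" if "x \<in> interior T" for x
    using sup_on_upper[OF eV inOm[OF that]] q(2)[OF inOm[OF that]] by simp
  qed
  have "\<bar>q x - q y\<bar> <= b * sup_on e T / rad T * norm (x - y)"
   unfolding b_def by (rule poly_lipschitz[OF S rad_pos[OF T] ball_ctr[OF T] q(1) qM]) (use xy interior_subset in blast)+
  moreover obtain r where r: "!!x. x \<in> Om \<inter> T ==> ?\<pi> x = r x"
   "!!x y. \<bar>r x - r y\<bar> <= real (DIM('a) + 1) * (cavg * osc T) / rad T * norm (x - y)" by (rule clement_bound[OF T]) (rule that)
  moreover have "w x - w y = (r x - r y) + (q x - q y)"
   using r(1)[OF inOm[OF xy(1)]] r(1)[OF inOm[OF xy(2)]] q(2)[OF inOm[OF xy(1)]] q(2)[OF inOm[OF xy(2)]] by (simp add: e_def)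
  ultimately have "\<bar>w x - w y\<bar> <= real (DIM('a) + 1) * (cavg * osc T) / rad T * norm (x - y) + b * sup_on e T / rad T * norm (x - y)"
   using r(2)[of x y] by linarith
  also have "... = (real (DIM('a) + 1) * cavg * osc T + b * sup_on e T) * (1 / rad T) * norm (x - y)"
   by (simp add: algebra_simps add_divide_distrib)
  also have "... <= ((real (DIM('a) + 1) * cavg + b) * (osc T + sup_on e T)) * (cs / diameter T) * norm (x - y)"
  proof (intro mult_right_mono mult_mono)
   show "real (DIM('a) + 1) * cavg * osc T + b * sup_on e T <= (real (DIM('a) + 1) * cavg + b) * (osc T + sup_on e T)"
    using cavg_nonneg b osc_nonneg[OF T] sup_on_nonneg[OF eV T] by (simp add: algebra_simps)
   show "1 / rad T <= cs / diameter T" using diameter_le_rad[OF T] rad_pos[OF T] diameter_pos[OF T] by (simp add: field_simps)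
  qed (use cavg_nonneg b osc_nonneg[OF T] sup_on_nonneg[OF eV T] rad_pos[OF T] in auto)
  also have "... = cgrad * (osc T + sup_on e T) / diameter T * norm (x - y)" by (simp add: cgrad_def b_def)
  finally show ?thesis .
 qed
 show ?thesis by (rule that[OF F(1,3,2) lip])
qed

end

context mesh_fem
begin

text \<open>The gradients of the local polynomials form a weak gradient by
  \<open>is_weak_gradient_lipschitz\<close>, and the chosen one agrees with them almost everywhere.
  Its measurability, not evident from the choice, comes by the same way.\<close>

lemma weak_gradient_bound:
 assumes w: "w \<in> V" and L: "!!T. T \<in> \<T> ==> 0 <= L T"
  "!!T x y. T \<in> \<T> ==> x \<in> interior T ==> y \<in> interior T ==> \<bar>w x - w y\<bar> <= L T * norm (x - y)"
 shows "weak_gradient Om w \<in> borel_measurable (lebesgue_on Om)"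
  "T \<in> \<T> ==> AE x\<in>interior T in lborel. norm (weak_gradient Om w x) <= L T"
proof -
 have pw: "\<exists>q. poly_deg_le K q \<and> (\<forall>x\<in>Om \<inter> T. w x = q x)" if "T \<in> \<T>" for T using w that by (simp add: lagrange_space_def)
 hence "\<forall>T\<in>\<T>. \<exists>q. poly_deg_le K q \<and> (\<forall>x\<in>Om \<inter> T. w x = q x)" by blast
 from bchoice[OF this] obtain q where q: "!!T. T \<in> \<T> ==> poly_deg_le K (q T)" "!!T x. T \<in> \<T> ==> x \<in> Om \<inter> T ==> w x = q T x"
  by auto
 define D where "D T x = (\<Sum>b\<in>Basis. frechet_derivative (q T) (at x) b *\<^sub>R b)" for T x
 define G where "G x = (\<Sum>T\<in>\<T>. ind (interior T) x *\<^sub>R D T x)" for x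
 have Dm: "D T \<in> borel_measurable borel" if "T \<in> \<T>" for T unfolding D_def
  by (intro borel_measurable_sum borel_measurable_scaleR borel_measurable_const borel_measurable_continuous_onI
    smooth_fun_continuous smooth_fun_partial poly_smooth[OF q(1)[OF that]])
 have Gm: "G \<in> borel_measurable borel"
  unfolding G_def using Dm by (intro borel_measurable_sum borel_measurable_scaleR borel_measurable_indicator) auto
 have Geq: "G x = D T x" if "T \<in> \<T>" "x \<in> interior T" for T x unfolding G_def by (rule sum_interior[OF that])
 have der: "(w has_derivative (%h. G x \<bullet> h)) (at x)" if T: "T \<in> \<T>" "x \<in> interior T" for T x
 proof -
  have "D T x \<bullet> h = (\<Sum>b\<in>Basis. (h \<bullet> b) * frechet_derivative (q T) (at x) b)" for h
   unfolding D_def inner_sum_left inner_scaleR_left by (intro sum.cong) (simp_all add: inner_commute)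
  hence "(q T has_derivative (%h. D T x \<bullet> h)) (at x)"
   using smooth_fun_has_derivative[OF poly_smooth[OF q(1)[OF T(1)]], of x] by simp
  hence "(w has_derivative (%h. D T x \<bullet> h)) (at x)"
  proof (rule has_derivative_transform_within_open[OF _ open_interior T(2)])
   fix y assume "y \<in> interior T"
   hence "y \<in> Om \<inter> T" using interior_simplex_subset[OF T(1)] interior_subset by blast
   thus "q T y = w y" using q(2)[OF T(1)] by simp
  qed
  thus ?thesis using Geq[OF T] by simp
 qed
 have GL: "norm (G x) <= L T" if T: "T \<in> \<T>" "x \<in> interior T" for T x
  by (rule gradient_le_lipschitz[OF open_interior T(2) _ der[OF T]]) (use L(2)[OF T(1) _ T(2)] in blast)
 have "norm (G x) <= (\<Sum>T\<in>\<T>. L T)" for x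
 proof (cases "\<exists>T\<in>\<T>. x \<in> interior T")
  case True
  then obtain T where T: "T \<in> \<T>" "x \<in> interior T" by blast
  have "L T <= (\<Sum>T\<in>\<T>. L T)" by (rule member_le_sum[OF T(1)]) (use L(1) finite_\<T> in auto)
  thus ?thesis using GL[OF T] by linarith
 next
  case False
  hence "G x = 0" unfolding G_def by simp
  thus ?thesis using L(1) by (simp add: sum_nonneg)
 qed
 note Gb = this
 obtain L' where L': "0 <= L'" "!!x y. closed_segment x y \<subseteq> Om ==> \<bar>w x - w y\<bar> <= L' * norm (x - y)"
  using piecewise_poly_segment[OF pw] by blast
 have cont: "continuous_on Om w" using w by (simp add: lagrange_space_def)
 have "AE x\<in>Om in lborel. (w has_derivative (%h. G x \<bullet> h)) (at x)" using AE_interior by eventually_elim (use der in blast)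
 from is_weak_gradient_lipschitz[OF open_Om cont L'(2,1) Gm Gb this]
 have wG: "is_weak_gradient Om w G" .
 hence "is_weak_gradient Om w (weak_gradient Om w)" unfolding weak_gradient_def by (rule someI[of "is_weak_gradient Om w"])
 from weak_gradient_AE_unique[OF open_Om wG this]
 have ae: "AE x\<in>Om in lborel. G x = weak_gradient Om w x" unfolding AE_lebesgue_on[OF Om_measurable] .
 thus "AE x\<in>interior T in lborel. norm (weak_gradient Om w x) <= L T" if T: "T \<in> \<T>"
  by eventually_elim (use GL[OF T] interior_simplex_subset[OF T] in force)
 have Oms: "Om \<in> sets lebesgue" using Om_measurable by simp
 have "(%x. ind Om x *\<^sub>R weak_gradient Om w x) \<in> borel_measurable lebesgue"
 proof (rule borel_measurable_AE)
  show "(%x. ind Om x *\<^sub>R G x) \<in> borel_measurable lebesgue"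
   using Gm Om_measurable by (intro measurable_completion) simp
  show "AE x in lebesgue. ind Om x *\<^sub>R G x = ind Om x *\<^sub>R weak_gradient Om w x"
   unfolding AE_completion_iff using ae by eventually_elim (auto)
 qed
 thus "weak_gradient Om w \<in> borel_measurable (lebesgue_on Om)" using Oms by (simp add: borel_measurable_restrict_space_iff)
qed

text \<open>The last two factors pass from mean gradients to \<open>osc\<close> on patches, the
  middle one adds the projected remainder, and \<open>cgrad * c2\<close> returns to
  gradients.\<close>

definition cfinal :: "ennreal => real => real => real => real => real" where
 "cfinal p A c c1 c2 = cgrad * c2 * (4 * (1 + ext_const p A c * cloc) *
   (1 / c1 * (max 1 (ccomp A) ^ (nstar * nstar) * cvol) * (real npatch ^ 2 * cvol * 2)))"

end

context mesh_sobolev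
begin

text \<open>\<open>osc\<close> carries a diameter, so it is measured with the weight
  \<open>\<sigma> / h\<close>, in which the projected remainder is then bounded by
  \<open>extrapolate\<close>. The inverse inequality divides by the diameter again, and the
  equivalence of \<open>h\<close> with the diameter restores \<open>\<sigma>\<close>.\<close>

lemma gradient_stability:
 assumes p: "1 <= p" and st: "stable A \<gamma>'" and A: "0 <= A" and w: "is_proj v w"
  and \<sigma>: "graded \<gamma>r \<sigma>" and h: "graded \<gamma>h h" "!!T. T \<in> \<T> ==> c1 * diameter T <= h T \<and> h T <= c2 * diameter T"
  and c12: "0 < c1" "0 < c2" and \<gamma>: "1 <= \<gamma>r" "1 <= \<gamma>h" "\<gamma>r * \<gamma>h <= \<gamma>'"
  and \<theta>: "\<theta> = (if p = 2 then 0 else (\<gamma>r * \<gamma>h / \<gamma>')\<^sup>2 powr ext_exponent p * \<gamma>h ^ DIM('a))" "\<theta> < 1"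
  and N: "meshbd p (%T. \<sigma> T * (mass g T / vol T)) (2 * N)"
 obtains L where "!!T. T \<in> \<T> ==> 0 <= L T"
  "!!T x y. T \<in> \<T> ==> x \<in> interior T ==> y \<in> interior T ==> \<bar>w x - w y\<bar> <= L T * norm (x - y)"
  "meshbd p (%T. \<sigma> T * L T) (cfinal p A (vol_const DIM('a) cs (max 1 (c2 / c1)) \<theta>) c1 c2 * N)"
proof -
 define B where "B = max 1 (c2 / c1)"
 define c where "c = vol_const DIM('a) cs B \<theta>"

 have \<theta>0: "0 <= \<theta>" unfolding \<theta>(1) using \<gamma> by simp
 have c: "0 < c" unfolding c_def by (rule vol_const_pos[OF cs1 _ \<theta>0 \<theta>(2)]) (simp add: B_def)
 have hp: "0 < h T" and sp: "0 < \<sigma> T" if "T \<in> \<T>" for T using h(1) \<sigma> that by (auto simp: graded_def)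
 obtain F e where F: "F \<in> borel_measurable borel" "is_proj F e"
  "!!T x. T \<in> \<T> ==> x \<in> interior T ==> \<bar>F x\<bar> <= cloc * osc T"
  and lip: "!!T x y. T \<in> \<T> ==> x \<in> interior T ==> y \<in> interior T ==>
   \<bar>w x - w y\<bar> <= cgrad * (osc T + sup_on e T) / diameter T * norm (x - y)" by (rule projection_lipschitz[OF w]) (rule that)
 have eV: "e \<in> V" using F(2) by (simp add: is_proj_def)
 have cl: "0 <= cloc" unfolding cloc_def using poly_mass_pos[of "DIM('a)" K] cavg_nonneg by (intro mult_nonneg_nonneg) auto
 \<comment> \<open>Dividing by \<open>h\<close> multiplies the gradings: one factor
   \<open>\<gamma>h\<close> of the hypothesis is spent here, the others on the volumes.\<close>
 define \<tau> where "\<tau> T = \<sigma> T / h T" for T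
 have tp: "0 < \<tau> T" if "T \<in> \<T>" for T using hp[OF that] sp[OF that] by (simp add: \<tau>_def)
 have \<tau>: "graded (\<gamma>r * \<gamma>h) \<tau>"
 proof -
  have "\<tau> T' <= \<gamma>r * \<gamma>h * \<tau> T" if R: "(T, T') \<in> R" for T T'
  proof -
   note T = R_in[OF R]
   have "\<sigma> T' <= \<gamma>r * \<sigma> T" "h T <= \<gamma>h * h T'" using R R_sym[OF R] \<sigma> h(1) by (auto simp: graded_def)
   hence "\<sigma> T' * h T <= (\<gamma>r * \<sigma> T) * (\<gamma>h * h T')" using sp hp T \<gamma> by (intro mult_mono) (auto intro: less_imp_le)
   thus ?thesis using hp T by (simp add: \<tau>_def field_simps)
  qed
  thus ?thesis using tp by (auto simp: graded_def)
 qed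
 have chain: "diameter T' <= B * \<gamma>h ^ n * diameter T" if T: "T \<in> \<T>" and R: "(T, T') \<in> R ^^ n" for T T' n
 proof -
  have "T' \<in> \<T> \<and> h T' <= \<gamma>h ^ n * h T" using R
  proof (induction n arbitrary: T')
   case (Suc n)
   then obtain U where U: "(T, U) \<in> R ^^ n" "(U, T') \<in> R" by auto
   have "h T' <= \<gamma>h * h U" using h(1) U(2) by (auto simp: graded_def)
   also have "... <= \<gamma>h * (\<gamma>h ^ n * h T)" using Suc.IH[OF U(1)] \<gamma> by (intro mult_left_mono) auto
   finally show ?case using R_in[OF U(2)] by simp
  qed (use T in simp)
  hence "c1 * diameter T' <= \<gamma>h ^ n * h T" using h(2)[of T'] by linarith
  also have "... <= \<gamma>h ^ n * (c2 * diameter T)" using h(2)[OF T] \<gamma> by (intro mult_left_mono) auto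
  finally have "diameter T' <= (c2 / c1) * (\<gamma>h ^ n * diameter T)" using c12 by (simp add: field_simps)
  also have "... <= B * (\<gamma>h ^ n * diameter T)" using diameter_pos[OF T] \<gamma> by (intro mult_right_mono) (auto simp: B_def)
  finally show ?thesis by simp
 qed
 have vol: "(\<Sum>T\<in>\<T>. vol T * ((\<gamma>r * \<gamma>h / \<gamma>')\<^sup>2 powr ext_exponent p) ^ mesh_dist R T S) <= c * vol S"
  if "p \<noteq> 2" "S \<in> \<T>" for S
 proof -
  have \<theta>': "\<theta> = (\<gamma>r * \<gamma>h / \<gamma>')\<^sup>2 powr ext_exponent p * \<gamma>h ^ DIM('a)" using \<theta>(1) that(1) by simp
  show ?thesis unfolding c_def \<theta>' by (rule weighted_volume[OF chain _ \<gamma>(2) _ _ that(2)]) (use \<theta>' \<theta>(2) in \<open>simp_all add: B_def\<close>)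
 qed
 define y where "y S = \<sigma> S * (mass g S / vol S)" for S
 define P where "P = max 1 (ccomp A) ^ (nstar * nstar)"
 have P: "1 <= P" unfolding P_def by simp
 \<comment> \<open>Stability at \<open>\<gamma>'\<close> also applies to \<open>\<sigma>\<close>, so
   its values are comparable on simplices that meet in \<open>Om\<close> even when \<open>R\<close>
   does not relate them. Hence the weight can be moved across a patch.\<close>
 have g'\<sigma>: "graded \<gamma>' \<sigma>"
  by (rule graded_mono[OF \<sigma>]) (use \<gamma> mult_left_mono[of 1 \<gamma>h \<gamma>r] in linarith)
 have sP: "\<sigma> T <= P * \<sigma> S" if T: "T \<in> \<T>" "S \<in> patch T" for T S unfolding P_def
 proof (rule patch_bound[OF _ _ _ patch_in[OF T(2,1)] patch_sym[OF T(2,1)]])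
  show "\<sigma> B' <= max 1 (ccomp A) * \<sigma> A'" if "meets A' B'" for A' B'
  proof -
   have "0 < \<sigma> A'" using sp that by (simp add: meets_def)
   thus ?thesis using graded_comparable[OF st A g'\<sigma> that] by (auto intro: order.trans)
  qed
 qed (use sp[OF patch_in[OF T(2,1)]] in auto)
 \<comment> \<open>The diameter in \<open>osc\<close> cancels the \<open>1 / h\<close> in
   \<open>\<tau>\<close> up to \<open>1 / c1\<close>; \<open>P\<close> moves the weight and
   \<open>cvol\<close> the volume from \<open>T\<close> to a simplex of the patch.\<close>
 have osc: "\<tau> T * osc T <= (1 / c1 * (P * cvol)) * (\<Sum>S\<in>patch T. y S)" if T: "T \<in> \<T>" for T
 proof -
  have m: "0 < vol T" "0 < diameter T" using measure_simplex_pos[OF T] diameter_pos[OF T] by auto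
  have "\<tau> T * diameter T <= 1 / c1 * \<sigma> T" using h(2)[OF T] hp[OF T] sp[OF T] c12 by (simp add: \<tau>_def field_simps)
  hence "\<tau> T * diameter T * (\<Sum>S\<in>patch T. mass g S / vol T) <= 1 / c1 * \<sigma> T * (\<Sum>S\<in>patch T. mass g S / vol T)"
   using m mass_nonneg by (intro mult_right_mono sum_nonneg) (auto intro!: divide_nonneg_pos)
  also have "... = 1 / c1 * (\<Sum>S\<in>patch T. \<sigma> T * (mass g S / vol T))" by (simp add: sum_distrib_left)
  also have "... <= 1 / c1 * (\<Sum>S\<in>patch T. P * cvol * y S)"
  proof (intro mult_left_mono sum_mono)
   fix S assume S: "S \<in> patch T"
   have ms: "0 < vol S" "vol S <= cvol * vol T" and s: "0 < \<sigma> S"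
    using measure_simplex_pos[OF patch_in[OF S T]] patch_measure[OF T S] sp[OF patch_in[OF S T]] by auto
   have "mass g S / vol T <= cvol * (mass g S / vol S)" using ms m mult_left_mono[OF ms(2) mass_nonneg[of g S]] by (simp add: field_simps)
   hence "\<sigma> T * (mass g S / vol T) <= (P * \<sigma> S) * (cvol * (mass g S / vol S))"
    using sP[OF T S] P s mass_nonneg[of g S] by (intro mult_mono) (auto)
   thus "\<sigma> T * (mass g S / vol T) <= P * cvol * y S" by (simp add: y_def mult_ac)
  qed (use c12 in simp)
  also have "... = (1 / c1 * (P * cvol)) * (\<Sum>S\<in>patch T. y S)" by (simp add: sum_distrib_left)
  also have "\<tau> T * diameter T * (\<Sum>S\<in>patch T. mass g S / vol T) = \<tau> T * osc T" by (simp add: osc_def flip: sum_divide_distrib)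
  finally show ?thesis .
 qed
 define M where "M = 1 / c1 * (P * cvol) * (real npatch ^ 2 * cvol * 2)"
 have "meshbd p (%T. (1 / c1 * (P * cvol)) * (\<Sum>S\<in>patch T. y S)) ((1 / c1 * (P * cvol)) * (real npatch ^ 2 * cvol * (2 * N)))"
  by (intro meshbd_scale meshbd_patch p N[folded y_def]) (use c12 P cvol in simp)
 hence "meshbd p (%T. \<tau> T * osc T) ((1 / c1 * (P * cvol)) * (real npatch ^ 2 * cvol * (2 * N)))"
 proof (rule meshbd_mono[OF _ _ osc])
  show "0 <= \<tau> T * osc T" if "T \<in> \<T>" for T using tp[OF that] osc_nonneg[OF that] by simp
 qed
 hence o: "meshbd p (%T. \<tau> T * osc T) (M * N)" by (simp add: M_def mult_ac)
 have "meshbd p (%T. \<tau> T * (cloc * osc T)) (cloc * (M * N))" using meshbd_scale[OF o cl] by (simp add: mult.left_commute)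
 from extrapolate[OF p st A F \<tau> _ \<gamma>(3) c vol this] \<gamma>
 have b: "meshbd p (%T. \<tau> T * sup_on e T) (ext_const p A c * (cloc * (M * N)))" by simp
 define L where "L T = cgrad * (osc T + sup_on e T) / diameter T" for T
 have L0: "0 <= L T" if T: "T \<in> \<T>" for T
  unfolding L_def using cgrad_nonneg osc_nonneg[OF T] sup_on_nonneg[OF eV T] diameter_pos[OF T] by simp
 have "meshbd p (%T. cgrad * c2 * (\<tau> T * osc T + \<tau> T * sup_on e T)) (cgrad * c2 * (4 * (M * N + ext_const p A c * (cloc * (M * N)))))"
  by (intro meshbd_scale meshbd_add p o b) (use cgrad_nonneg c12 in simp)
 hence "meshbd p (%T. \<sigma> T * L T) (cgrad * c2 * (4 * (M * N + ext_const p A c * (cloc * (M * N)))))"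
 proof (rule meshbd_mono)
  fix T assume T: "T \<in> \<T>"
  show "0 <= \<sigma> T * L T" using sp[OF T] L0[OF T] by simp
  have "1 / diameter T <= c2 / h T" using h(2)[OF T] hp[OF T] diameter_pos[OF T] by (simp add: field_simps)
  hence "\<sigma> T * (cgrad * (osc T + sup_on e T)) * (1 / diameter T) <= \<sigma> T * (cgrad * (osc T + sup_on e T)) * (c2 / h T)"
   using sp[OF T] cgrad_nonneg osc_nonneg[OF T] sup_on_nonneg[OF eV T] by (intro mult_left_mono) auto
  thus "\<sigma> T * L T <= cgrad * c2 * (\<tau> T * osc T + \<tau> T * sup_on e T)"
   by (simp add: L_def \<tau>_def algebra_simps add_divide_distrib)
 qed
 moreover have "cgrad * c2 * (4 * (M * N + ext_const p A c * (cloc * (M * N)))) = cfinal p A c c1 c2 * N"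
 proof -
  have "cfinal p A c c1 c2 = cgrad * c2 * (4 * (1 + ext_const p A c * cloc) * M)" by (simp add: cfinal_def M_def P_def)
  thus ?thesis by (simp add: algebra_simps)
 qed
 ultimately show ?thesis using that[of L] L0 lip unfolding c_def B_def L_def by simp
qed

end

section \<open>Constants from the hypotheses and conclusion\<close>

context mesh
begin

text \<open>A ball of more than half the inradius is chosen instead of one attaining the supremum;
  this is the factor 2.\<close>

lemma shape_from_regularity:
 assumes T: "T \<in> \<T>"
 shows "\<exists>b r. 0 < r \<and> cball b r \<subseteq> T \<and> diameter T <= max 1 (2 * shape_regularity \<T>) * r"
proof -
 note S = simplex_\<T>[OF T]
 define I where "I = {r. 0 <= r \<and> (\<exists>x. cball x r \<subseteq> T)}"
 have bT: "bounded T" by (rule compact_imp_bounded[OF full_simplex_compact[OF S]])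
 obtain x where "x \<in> interior T" using full_simplex_interior[OF S] by blast
 then obtain r0 where r0: "0 < r0" "cball x r0 \<subseteq> T" using mem_interior_cball by blast
 have "r <= diameter T" if r: "r \<in> I" for r
 proof -
  obtain y where y: "0 <= r" "cball y r \<subseteq> T" using r unfolding I_def by blast
  obtain i :: 'a where i: "i \<in> Basis" by force
  have "y \<in> T" "y + r *\<^sub>R i \<in> T" using y i by (auto simp: dist_norm)
  hence "dist (y + r *\<^sub>R i) y <= diameter T" by (intro diameter_bounded_bound[OF bT])
  thus ?thesis using i by (simp add: dist_norm)
 qed
 hence bd: "bdd_above I" by force
 have r0I: "r0 \<in> I" using r0 by (auto simp: I_def)
 have inr: "inradius T = Sup I" by (simp add: inradius_def I_def)
 have "r0 <= inradius T" unfolding inr by (rule cSup_upper[OF r0I bd])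
 hence pos: "0 < inradius T" using r0 by linarith
 hence "inradius T / 2 < Sup I" unfolding inr by linarith
 then obtain r where r: "r \<in> I" "inradius T / 2 < r" using less_cSup_iff[OF _ bd] r0I by blast
 have "diameter T / inradius T <= shape_regularity \<T>" unfolding shape_regularity_def using finite_\<T> T by (intro Max_ge) auto
 hence "diameter T <= shape_regularity \<T> * inradius T" using pos by (simp add: divide_le_eq)
 also have "... <= max 1 (2 * shape_regularity \<T>) * r"
 proof -
  have "0 <= diameter T / inradius T" using pos diameter_ge_0[OF bT] by simp
  hence "shape_regularity \<T> * inradius T <= shape_regularity \<T> * (2 * r)" using \<open>diameter T / inradius T <= shape_regularity \<T>\<close> using r(2) by (intro mult_left_mono) auto
  also have "... = (2 * shape_regularity \<T>) * r" by simp
  also have "... <= max 1 (2 * shape_regularity \<T>) * r" using r(2) pos by (intro mult_right_mono) auto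
  finally show ?thesis .
 qed
 finally have "diameter T <= max 1 (2 * shape_regularity \<T>) * r" .
 moreover obtain b where "cball b r \<subseteq> T" using r(1) unfolding I_def by blast
 moreover have "0 < r" using r(2) pos by linarith
 ultimately show ?thesis by blast
qed

end

lemma mesh_dist_neighbor: "(T, T') \<in> R ==> T \<noteq> T' ==> mesh_dist R T T' = 1"
 unfolding mesh_dist_def by (intro Least_equality) (auto simp: Suc_le_eq)

text \<open>The grading of \<open>h\<close> passes between neighbors, and the equivalence constants
  translate it to diameters; hence the ratio \<open>\<gamma>h * c2 / c1\<close>.\<close>

lemma neighbor_size:
 assumes h: "mesh_size_function Om \<T> R c1 c2 \<gamma>h h" and nb: "neighbor_relation \<T> R" and R: "(T, T') \<in> R"
  and c: "0 < c1" "0 < c2" "1 <= \<gamma>h" and d: "0 <= diameter T"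
 shows "diameter T' <= max 1 (\<gamma>h * c2 / c1) * diameter T"
proof -
 have T: "T \<in> \<T>" "T' \<in> \<T>" "T \<noteq> T'" using nb R unfolding neighbor_relation_def by auto
 have "ereal (c1 * diameter T') <= ess_inf_on Om T' h" using h T by (simp add: mesh_size_function_def)
 also have "... <= ereal \<gamma>h * ess_inf_on Om T h"
  using h T mesh_dist_neighbor[OF R T(3)] by (simp add: mesh_size_function_def weight_with_grading_def)
 also have "... <= ereal \<gamma>h * ereal (c2 * diameter T)"
  using h T c by (intro ereal_mult_left_mono) (simp_all add: mesh_size_function_def)
 finally have "diameter T' <= (\<gamma>h * c2 / c1) * diameter T" using c by (simp add: field_simps)
 also have "... <= max 1 (\<gamma>h * c2 / c1) * diameter T" by (intro mult_right_mono d) simp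
 finally show ?thesis .
qed

lemma Lp_space_integrable:
 fixes f :: "'a::euclidean_space => 'b::euclidean_space"
 assumes p: "1 <= p" and f: "f \<in> Lp_space Om p" and Om: "Om \<in> sets lborel" "emeasure lborel Om < \<infinity>"
 shows "integrable (lebesgue_on Om) f"
proof (rule integrableI_bounded)
 show "f \<in> borel_measurable (lebesgue_on Om)" using f by (simp add: Lp_space_def)
 obtain N where N: "0 <= N" "Lp_norm Om p f = ennreal N" using f by (cases "Lp_norm Om p f") (auto simp: Lp_space_def)
 have const: "(\<integral>\<^sup>+x. ennreal c \<partial>lebesgue_on Om) < \<infinity>" for c
  unfolding nn_integral_lebesgue_on[OF Om(1)] using Om by (simp add: nn_integral_cmult_indicator ennreal_mult_less_top)
 show "(\<integral>\<^sup>+x. ennreal (norm (f x)) \<partial>lebesgue_on Om) < \<infinity>"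
 proof (cases "p = \<infinity>")
  case True
  have "AE x in lebesgue_on Om. ennreal (norm (f x)) <= ennreal N"
   using True N(2) esssup_AE[of "%x. ennreal (norm (f x))" "lebesgue_on Om"] by (simp add: Lp_norm_def)
  hence "(\<integral>\<^sup>+x. ennreal (norm (f x)) \<partial>lebesgue_on Om) <= (\<integral>\<^sup>+x. ennreal N \<partial>lebesgue_on Om)" by (rule nn_integral_mono_AE)
  thus ?thesis using const by (rule order.strict_trans1)
 next
  case False
  define q where "q = enn2real p"
  have q: "1 <= q" unfolding q_def by (rule Lp_exponent[OF p False])
  have "(\<integral>\<^sup>+x. ennreal (norm (f x)) \<partial>lebesgue_on Om) <= (\<integral>\<^sup>+x. ennreal 1 + ennreal (norm (f x) powr q) \<partial>lebesgue_on Om)"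
  proof (rule nn_integral_mono)
   fix x
   have "norm (f x) <= 1 + norm (f x) powr q" using le_powr_self[of "norm (f x)" q] q by (cases "1 <= norm (f x)") (auto simp: add_increasing2)
   hence "ennreal (norm (f x)) <= ennreal (1 + norm (f x) powr q)" by (rule ennreal_leI)
   thus "ennreal (norm (f x)) <= ennreal 1 + ennreal (norm (f x) powr q)" by simp
  qed
  also have "... = (\<integral>\<^sup>+x. ennreal 1 \<partial>lebesgue_on Om) + (\<integral>\<^sup>+x. ennreal (norm (f x) powr q) \<partial>lebesgue_on Om)"
   using f by (intro nn_integral_add) (auto simp: Lp_space_def)
  also have "... < \<infinity>"
  proof -
   have "(\<integral>\<^sup>+x. ennreal (norm (f x) powr q) \<partial>lebesgue_on Om) <= ennreal (N powr q)"
    unfolding q_def using Lp_norm_le_iff[OF p False N(1), of Om f] N(2) by simp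
   thus ?thesis using const[of 1] by (auto intro: order.strict_trans1)
  qed
  finally show ?thesis .
 qed
qed

lemma has_wgrad_borel_version:
 fixes u :: "'a::euclidean_space => real"
 assumes Om: "open Om" and wg: "is_weak_gradient Om u G" and i: "integrable (lebesgue_on Om) u" "integrable (lebesgue_on Om) G"
 obtains v g where "has_wgrad Om v g" "AE x\<in>Om in lborel. v x = u x" "AE x\<in>Om in lborel. g x = G x"
proof -
 have Omm: "Om \<in> sets lebesgue" using Om by simp
 obtain v where v: "integrable lborel v" "AE x in lborel. v x = ind Om x *\<^sub>R u x" by (rule borel_version_lebesgue_on[OF Omm i(1)])
 obtain g where g: "integrable lborel g" "AE x in lborel. g x = ind Om x *\<^sub>R G x" by (rule borel_version_lebesgue_on[OF Omm i(2)])
 have "has_wgrad Om v g" unfolding has_wgrad_def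
 proof (intro conjI v(1) g(1) ballI)
  fix \<phi> b assume \<phi>: "\<phi> \<in> bump_on Om" and b: "b \<in> (Basis :: 'a set)"
  have d: "(%x. frechet_derivative \<phi> (at x) b) \<in> borel_measurable borel" by (rule bump_on_measurable[OF bump_on_partial[OF \<phi> b]])
  have "(\<integral>x. u x * frechet_derivative \<phi> (at x) b \<partial>lebesgue_on Om) = - (\<integral>x. (G x \<bullet> b) * \<phi> x \<partial>lebesgue_on Om)"
   using wg bump_on_test_function[OF \<phi> order_refl] b by (simp add: is_weak_gradient_def)
  moreover have "(\<integral>x. u x * frechet_derivative \<phi> (at x) b \<partial>lebesgue_on Om) = (LBINT x. v x * frechet_derivative \<phi> (at x) b)"
   by (rule integral_lebesgue_on_eq[OF Omm]) (use v d in \<open>auto elim!: eventually_mono\<close>)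
  moreover have "(\<integral>x. (G x \<bullet> b) * \<phi> x \<partial>lebesgue_on Om) = (LBINT x. (g x \<bullet> b) * \<phi> x)"
   by (rule integral_lebesgue_on_eq[OF Omm]) (use g bump_on_measurable[OF \<phi>] in \<open>auto elim!: eventually_mono\<close>)
  ultimately show "(LBINT x. v x * frechet_derivative \<phi> (at x) b) = - (LBINT x. (g x \<bullet> b) * \<phi> x)" by simp
 qed
 moreover have "AE x\<in>Om in lborel. v x = u x" using v(2) by eventually_elim simp
 moreover have "AE x\<in>Om in lborel. g x = G x" using g(2) by eventually_elim simp
 ultimately show ?thesis by (rule that)
qed

text \<open>With \<open>r = ext_exponent p\<close> and \<open>s = |1/2 - 1/p|\<close> the identity
  \<open>2 r s = 1\<close> holds, also for p infinite. The claim is the hypothesis divided by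
  \<open>\<gamma>'\<close> and raised to the power \<open>2 r\<close>.\<close>

lemma decay_below_1:
 assumes p: "1 <= p" "p \<noteq> (2::ennreal)" and \<gamma>: "0 < \<gamma>" "1 <= \<gamma>h"
  and less: "\<gamma> * \<gamma>h powr (real d * \<bar>1/2 - enn2real (1 / p)\<bar>) < \<gamma>'"
 shows "(\<gamma> / \<gamma>')\<^sup>2 powr ext_exponent p * \<gamma>h ^ d < 1"
proof -
 define s where "s = \<bar>1/2 - enn2real (1 / p)\<bar>"
 define r where "r = ext_exponent p"
 have rs: "0 < r" "2 * r * s = 1"
 proof -
  have "0 < r \<and> 2 * r * s = 1"
  proof (cases "p = \<infinity>")
   case False
   define q where "q = enn2real p"
   have q: "1 <= q" unfolding q_def by (rule Lp_exponent[OF p(1) False])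
   have pq: "p = ennreal q" using False by (simp add: q_def less_top)
   have "q \<noteq> 2" using p(2) pq by auto
   moreover have "1 / p = ennreal (1 / q)" unfolding pq using q divide_ennreal[of 1 q] by simp
   hence "s = \<bar>1/2 - 1/q\<bar>" using q by (simp add: s_def)
   hence "s = \<bar>q - 2\<bar> / (2 * q)" using q by (simp add: field_simps)
   ultimately show ?thesis using q False by (simp add: r_def ext_exponent_def q_def[symmetric])
  qed (simp add: r_def s_def ext_exponent_def)
  thus "0 < r" "2 * r * s = 1" by auto
 qed
 have g0: "0 < \<gamma>h" using \<gamma> by linarith
 have "1 <= \<gamma>h powr (real d * s)" using \<gamma>(2) by (intro ge_one_powr_ge_zero) (auto simp: s_def)
 hence "\<gamma> * 1 <= \<gamma> * \<gamma>h powr (real d * s)" using \<gamma>(1) by (intro mult_left_mono) auto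
 hence "\<gamma> < \<gamma>'" using less[folded s_def] by linarith
 define x where "x = \<gamma> / \<gamma>'"
 have x: "0 < x" using \<gamma> \<open>\<gamma> < \<gamma>'\<close> by (simp add: x_def)
 have lt: "x * \<gamma>h powr (real d * s) < 1" using less \<gamma> \<open>\<gamma> < \<gamma>'\<close> by (simp add: x_def s_def)
 have x2: "x^2 = x powr 2" using x by simp
 have "x\<^sup>2 powr r = x powr (2 * r)" unfolding x2 powr_powr ..
 moreover have "\<gamma>h ^ d = (\<gamma>h powr (real d * s)) powr (2 * r)"
  using rs g0 by (simp add: powr_powr mult.assoc mult.commute[of s] powr_realpow)
 ultimately have "x\<^sup>2 powr r * \<gamma>h ^ d = (x * \<gamma>h powr (real d * s)) powr (2 * r)" by (simp add: powr_mult)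
 also have "... < 1" using powr_less_mono2[OF _ _ lt, of "2 * r"] rs x by simp
 finally show ?thesis by (simp add: x_def r_def)
qed

context mesh_fem
begin

lemma weighted_gradient_estimate:
 assumes p: "1 <= p" and wg: "worst_grading Om \<T> R K \<gamma>max C" and \<gamma>: "1 <= \<gamma>r" "1 <= \<gamma>h" "\<gamma>r * \<gamma>h <= \<gamma>'" "ereal \<gamma>' < \<gamma>max"
  and \<rho>: "weight_with_grading Om \<T> R \<gamma>r \<rho>" and h: "mesh_size_function Om \<T> R c1 c2 \<gamma>h h" and c12: "0 < c1" "0 < c2"
  and \<theta>: "\<theta> = (if p = 2 then 0 else (\<gamma>r * \<gamma>h / \<gamma>')\<^sup>2 powr ext_exponent p * \<gamma>h ^ DIM('a))" "\<theta> < 1"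
  and u: "u \<in> W1p Om p"
 defines "c == cfinal p (poly_mass DIM('a) K * (C \<gamma>')^2) (vol_const DIM('a) cs (max 1 (c2 / c1)) \<theta>) c1 c2"
 shows "Lp_norm Om p (%x. \<rho> x *\<^sub>R weak_gradient Om (L2_projection Om \<T> K u) x) <=
  ennreal (1 + \<bar>\<gamma>r * c\<bar>) * Lp_norm Om p (%x. \<rho> x *\<^sub>R weak_gradient Om u x)"
proof (cases "Lp_norm Om p (%x. \<rho> x *\<^sub>R weak_gradient Om u x)")
 \<comment> \<open>The constant contains a summand 1, so it is positive and the right side is
   infinite as well.\<close>
 case top
 thus ?thesis by simp
next
 case (real N)
 define A where "A = poly_mass DIM('a) K * (C \<gamma>')^2"
 have A: "0 <= A" using poly_mass_pos[of "DIM('a)" K] by (simp add: A_def)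
 have "1 * 1 <= \<gamma>r * \<gamma>h" using \<gamma> by (intro mult_mono) auto
 hence st: "stable A \<gamma>'" unfolding A_def by (intro worst_grading_stable[OF wg] \<gamma>(4)) (use \<gamma>(3) in linarith)
 obtain G0 where G0: "u \<in> Lp_space Om p" "G0 \<in> Lp_space Om p" "is_weak_gradient Om u G0" using u by (auto simp: W1p_def)
 have ui: "integrable (lebesgue_on Om) u" and Gi: "integrable (lebesgue_on Om) G0"
  using G0 by (auto intro!: Lp_space_integrable[OF p] Om_measurable Om_finite_measure)
 obtain v g where vg: "has_wgrad Om v g" "AE x\<in>Om in lborel. v x = u x" "AE x\<in>Om in lborel. g x = G0 x"
  by (rule has_wgrad_borel_version[OF open_Om G0(3) ui Gi])
 have "is_weak_gradient Om u (weak_gradient Om u)"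
  unfolding weak_gradient_def by (rule someI[of "is_weak_gradient Om u", OF G0(3)])
 from weak_gradient_AE_unique[OF open_Om G0(3) this]
 have gk: "AE x\<in>Om in lborel. g x = weak_gradient Om u x"
  unfolding AE_lebesgue_on[OF Om_measurable] using vg(3) by eventually_elim simp
 interpret sob: mesh_sobolev Om \<T> R cs cr K v g by unfold_locales (rule vg(1))
 define w where "w = L2_projection Om \<T> K u"
 have w: "is_proj v w" unfolding w_def by (rule L2_projection_is_proj[OF ui sob.v_measurable vg(2)])
 have wV: "w \<in> V" using w by (simp add: is_proj_def)
 obtain \<sigma> where \<sigma>: "graded \<gamma>r \<sigma>" "!!T. T \<in> \<T> ==> AE x\<in>interior T in lborel. \<sigma> T <= \<rho> x \<and> \<rho> x <= \<gamma>r * \<sigma> T"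
  by (rule weight_bounds[OF \<rho>]) (rule that)
 have sp: "0 < \<sigma> T" if "T \<in> \<T>" for T using \<sigma>(1) that by (simp add: graded_def)
 have "weight_with_grading Om \<T> R \<gamma>h h" using h by (simp add: mesh_size_function_def)
 then obtain H where H: "graded \<gamma>h H" "!!T. T \<in> \<T> ==> ereal (H T) = ess_inf_on Om T h"
  by (rule weight_bounds) (rule that)
 have Hd: "c1 * diameter T <= H T \<and> H T <= c2 * diameter T" if "T \<in> \<T>" for T
 proof -
  have "ereal (c1 * diameter T) <= ereal (H T)" "ereal (H T) <= ereal (c2 * diameter T)"
   unfolding H(2)[OF that] using h that by (simp_all add: mesh_size_function_def)
  thus ?thesis by simp
 qed
 have N: "meshbd p (%T. \<sigma> T * (mass g T / vol T)) (2 * N)"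
 proof (rule sob.meshbd_norm_lower[OF p sp _ gk])
  show "AE x\<in>interior T in lborel. \<sigma> T <= \<rho> x" if "T \<in> \<T>" for T using \<sigma>(2)[OF that] by eventually_elim simp
 qed (use real in auto)
 obtain L where L: "!!T. T \<in> \<T> ==> 0 <= L T"
  "!!T x y. T \<in> \<T> ==> x \<in> interior T ==> y \<in> interior T ==> \<bar>w x - w y\<bar> <= L T * norm (x - y)"
  "meshbd p (%T. \<sigma> T * L T) (c * N)"
  by (rule sob.gradient_stability[OF p st A w \<sigma>(1) H(1) Hd c12 \<gamma>(1-3) \<theta> N, folded c_def[unfolded A_def[symmetric]]])
   (assumption, rule that)
 have Wm: "weak_gradient Om w \<in> borel_measurable (lebesgue_on Om)" by (rule weak_gradient_bound(1)[OF wV L(1,2)])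
 have WL: "AE x\<in>interior T in lborel. norm (weak_gradient Om w x) <= L T" if "T \<in> \<T>" for T
  by (rule weak_gradient_bound(2)[OF wV L(1,2) that])
 have "\<rho> \<in> borel_measurable (lebesgue_on Om)" using \<rho> by (auto simp: weight_with_grading_def)
 hence m: "(%x. \<rho> x *\<^sub>R weak_gradient Om w x) \<in> borel_measurable (lebesgue_on Om)" by (intro borel_measurable_scaleR Wm)
 have "meshbd p (%T. \<gamma>r * (\<sigma> T * L T)) (\<gamma>r * (c * N))" using meshbd_scale[OF L(3)] \<gamma>(1) by simp
 hence "Lp_norm Om p (%x. \<rho> x *\<^sub>R weak_gradient Om w x) <= ennreal (\<gamma>r * (c * N))"
 proof (rule meshbd_norm_upper[OF p _ m])
  fix T assume T: "T \<in> \<T>"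
  show "AE x\<in>interior T in lborel. norm (\<rho> x *\<^sub>R weak_gradient Om w x) <= \<gamma>r * (\<sigma> T * L T)"
   using \<sigma>(2)[OF T] WL[OF T]
  proof eventually_elim
   case (elim x)
   show ?case
   proof
    assume "x \<in> interior T"
    hence "\<bar>\<rho> x\<bar> * norm (weak_gradient Om w x) <= (\<gamma>r * \<sigma> T) * L T" using elim sp[OF T] by (intro mult_mono) auto
    thus "norm (\<rho> x *\<^sub>R weak_gradient Om w x) <= \<gamma>r * (\<sigma> T * L T)" by simp
   qed
  qed
 qed
 also have "\<gamma>r * (c * N) <= (1 + \<bar>\<gamma>r * c\<bar>) * N"
  using real by (auto simp: mult.assoc[symmetric] intro!: mult_right_mono)
 hence "ennreal (\<gamma>r * (c * N)) <= ennreal (1 + \<bar>\<gamma>r * c\<bar>) * ennreal N"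
  using real(1) by (subst ennreal_mult[symmetric]) (simp_all)
 finally show ?thesis using real by (simp add: w_def)
qed

end

theorem theorem4p13:
  fixes K :: nat and p :: ennreal and \<gamma>\<^sub>\<rho> \<gamma>\<^sub>h \<chi>\<^sub>0 c\<^sub>1 c\<^sub>2 :: real
    and \<gamma>max :: ereal and C :: "real \<Rightarrow> real"
  assumes "1 \<le> K" and "1 \<le> p" and "1 \<le> \<gamma>\<^sub>\<rho>" and "1 \<le> \<gamma>\<^sub>h" and "0 < c\<^sub>1" and "0 < c\<^sub>2"
    and "ereal (\<gamma>\<^sub>\<rho> * \<gamma>\<^sub>h powr (1 + real DIM('a::euclidean_space) * \<bar>1/2 - enn2real (1 / p)\<bar>)) < \<gamma>max"
  shows "\<exists>c::real. \<forall>(\<Omega>::'a set) \<T> R \<rho> h.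
      polyhedral_domain \<Omega> \<and> triangulation_of \<T> \<Omega> \<and> shape_regularity \<T> = \<chi>\<^sub>0 \<and>
      neighbor_relation \<T> R \<and> worst_grading \<Omega> \<T> R K \<gamma>max C \<and>
      weight_with_grading \<Omega> \<T> R \<gamma>\<^sub>\<rho> \<rho> \<and> mesh_size_function \<Omega> \<T> R c\<^sub>1 c\<^sub>2 \<gamma>\<^sub>h h \<longrightarrow>
      (\<forall>u \<in> W1p \<Omega> p.
         Lp_norm \<Omega> p (\<lambda>x. \<rho> x *\<^sub>R weak_gradient \<Omega> (L2_projection \<Omega> \<T> K u) x) \<le>
         ennreal c * Lp_norm \<Omega> p (\<lambda>x. \<rho> x *\<^sub>R weak_gradient \<Omega> u x))"
proof -
 define \<gamma> where "\<gamma> = \<gamma>\<^sub>\<rho> * \<gamma>\<^sub>h"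
 have \<gamma>: "0 < \<gamma>" using assms(3,4) by (simp add: \<gamma>_def)
 define s where "s = real DIM('a) * \<bar>1/2 - enn2real (1 / p)\<bar>"
 have "\<gamma>\<^sub>\<rho> * \<gamma>\<^sub>h powr (1 + s) = \<gamma> * \<gamma>\<^sub>h powr s" using assms(4) by (simp add: \<gamma>_def powr_add)
 hence "ereal (\<gamma> * \<gamma>\<^sub>h powr s) < \<gamma>max" using assms(7) by (simp add: s_def)
 \<comment> \<open>The strict hypothesis leaves room for a number that is admissible for stability
   and still strictly above the required bound; its distance from \<open>\<gamma>\<close> pays for
   the decay.\<close>
 then obtain \<gamma>' where \<gamma>': "\<gamma> * \<gamma>\<^sub>h powr s < \<gamma>'" "ereal \<gamma>' < \<gamma>max"
  using ereal_dense2 by (metis less_ereal.simps(1))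
 have "1 <= \<gamma>\<^sub>h powr s" using assms(4) by (intro ge_one_powr_ge_zero) (auto simp: s_def)
 hence "\<gamma> * 1 <= \<gamma> * \<gamma>\<^sub>h powr s" using \<gamma> by (intro mult_left_mono) auto
 hence "\<gamma> <= \<gamma>'" using \<gamma>'(1) by linarith
 \<comment> \<open>The decay rate of the weighted volumes of successive shells. For
   \<open>p = 2\<close> the L2 bound is used as it stands, and 0 is a placeholder.\<close>
 define \<theta> where "\<theta> = (if p = 2 then 0 else (\<gamma>\<^sub>\<rho> * \<gamma>\<^sub>h / \<gamma>')\<^sup>2 powr ext_exponent p * \<gamma>\<^sub>h ^ DIM('a))"
 have \<theta>1: "\<theta> < 1"
  using decay_below_1[OF assms(2) _ \<gamma> assms(4) \<gamma>'(1)[unfolded s_def]] by (simp add: \<theta>_def \<gamma>_def)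
 \<comment> \<open>Fixed before the domain and the mesh, as the quantifiers demand: outside its
   locale \<open>cfinal\<close> takes only numbers and the type of the space as arguments. The
   maxima with 1 meet the locale's lower bounds.\<close>
 let ?cs = "max 1 (2 * \<chi>\<^sub>0)" and ?cr = "max 1 (\<gamma>\<^sub>h * c\<^sub>2 / c\<^sub>1)"
 let ?c = "mesh_fem.cfinal TYPE('a) ?cs ?cr K p (poly_mass DIM('a) K * (C \<gamma>')^2) (vol_const DIM('a) ?cs (max 1 (c\<^sub>2 / c\<^sub>1)) \<theta>) c\<^sub>1 c\<^sub>2"
 show ?thesis
 proof (rule exI[of _ "1 + \<bar>\<gamma>\<^sub>\<rho> * ?c\<bar>"], intro allI impI ballI, elim conjE)
  fix Om :: "'a set" and \<T> R \<rho> h u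
  assume a: "polyhedral_domain Om" "triangulation_of \<T> Om" "shape_regularity \<T> = \<chi>\<^sub>0" "neighbor_relation \<T> R"
   "worst_grading Om \<T> R K \<gamma>max C" "weight_with_grading Om \<T> R \<gamma>\<^sub>\<rho> \<rho>" "mesh_size_function Om \<T> R c\<^sub>1 c\<^sub>2 \<gamma>\<^sub>h h"
   and u: "u \<in> W1p Om p"
  interpret mesh Om \<T> by unfold_locales (fact a)+
  interpret mesh_fem Om \<T> R ?cs ?cr K
  proof unfold_locales
   show "\<exists>b r. 0 < r \<and> cball b r \<subseteq> T \<and> diameter T <= ?cs * r" if "T \<in> \<T>" for T
    using shape_from_regularity[OF that] a(3) by simp
   show "diameter T' <= ?cr * diameter T" if "(T, T') \<in> R" for T T'
   proof (rule neighbor_size[OF a(7,4) that assms(5,6,4)])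
    have "T \<in> \<T>" using a(4) that by (auto simp: neighbor_relation_def)
    thus "0 <= diameter T" using diameter_ge_0 compact_imp_bounded full_simplex_compact simplex_\<T> by blast
   qed
  qed (use a(4) assms(1) in auto)
  show "Lp_norm Om p (%x. \<rho> x *\<^sub>R weak_gradient Om (L2_projection Om \<T> K u) x) <=
     ennreal (1 + \<bar>\<gamma>\<^sub>\<rho> * ?c\<bar>) * Lp_norm Om p (%x. \<rho> x *\<^sub>R weak_gradient Om u x)"
   by (rule weighted_gradient_estimate[OF assms(2) a(5) assms(3,4) _ \<gamma>'(2) a(6,7) assms(5,6) \<theta>_def \<theta>1 u])
    (use \<open>\<gamma> <= \<gamma>'\<close> in \<open>simp add: \<gamma>_def\<close>)
 qed
qed

end
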